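(* For a solvable topological group $X$ the following conditions are equivalent: (1) $X$ is compact; (2) $X$ is balanced, locally compact, and $\mathsf{h}{:}\mathsf{TG}$-closed; (3) $X$ is balanced, MAP-solvable and $\mathsf{h}{:}\mathsf{TG}$-closed.
   Context: All topological groups are assumed Hausdorff. A topological group $X$ is solvable if $X^{[n]}=\{e\}$ for some $n\in\mathbb N$, where $X^{[0]}=X$ and $X^{[n+1]}=\overline{[X^{[n]},X^{[n]}]}$. $X$ is balanced if for any neighborhood $U\subset X$ of the unit there is a neighborhood $V\subset X$ of the unit with $xV\subset Ux$ for all $x\in X$. $X$ is $\mathsf{h}{:}\mathsf{TG}$-closed if for every continuous homomorphism $f:X\to Y$ to a Hausdorff topological group $Y$ the image $f(X)$ is closed in $Y$. A topological group is MAP (maximally almost periodic) if it admits a continuous injective homomorphism into a compact topological group. $X$ is MAP-solvable if there is an increasing sequence $\{e\}=X_0\subset X_1\subset\dots\subset X_m=X$ of closed normal subgroups of $X$ such that for every $n<m$ the quotient topological group $X_{n+1}/X_n$ is Abelian and MAP. *)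

theory Defs
  imports
    "HOL-Algebra.Generated_Groups"
    "HOL-Analysis.Abstract_Topological_Spaces"
begin

no_notation eq_closure_of (\<open>closure'_of\<index>\<close>)

section \<open>Hausdorff topological groups\<close>

locale topological_group = group G for G (structure) +
  fixes T :: "'a topology"
  assumes topspace_eq: "topspace T = carrier G"
    and continuous_mult: "continuous_map (prod_topology T T) T (\<lambda>(x, y). x \<otimes> y)"
    and continuous_inv: "continuous_map T T (\<lambda>x. inv x)"
    and Hausdorff: "Hausdorff_space T"

definition continuous_hom ::
    "('a, 'm) monoid_scheme \<Rightarrow> 'a topology \<Rightarrow> ('b, 'n) monoid_scheme \<Rightarrow> 'b topology \<Rightarrow> ('a \<Rightarrow> 'b) set"
  where "continuous_hom G T H S = {f \<in> hom G H. continuous_map T S f}"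

text \<open>The commutator subgroup \<open>[A, A]\<close> is \<^const>\<open>derived\<close>, the subgroup generated by all
  \<open>x y x\<inverse> y\<inverse>\<close> with \<open>x, y \<in> A\<close>.  Every term of the series is closed in the whole group, so
  taking closures in the whole group or in the preceding term is the same.\<close>

primrec closed_derived_series ::
    "('a, 'm) monoid_scheme \<Rightarrow> 'a topology \<Rightarrow> nat \<Rightarrow> 'a set" where
  "closed_derived_series G T 0 = carrier G"
| "closed_derived_series G T (Suc n) = T closure_of (derived G (closed_derived_series G T n))"

definition solvable_topological_group :: "('a, 'm) monoid_scheme \<Rightarrow> 'a topology \<Rightarrow> bool" where
  "solvable_topological_group G T \<longleftrightarrow> (\<exists>n. closed_derived_series G T n = {\<one>\<^bsub>G\<^esub>})"

definition unit_neighbourhood ::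
    "('a, 'm) monoid_scheme \<Rightarrow> 'a topology \<Rightarrow> 'a set \<Rightarrow> bool" where
  "unit_neighbourhood G T U \<longleftrightarrow>
     U \<subseteq> carrier G \<and> (\<exists>W. openin T W \<and> \<one>\<^bsub>G\<^esub> \<in> W \<and> W \<subseteq> U)"

definition balanced_group :: "('a, 'm) monoid_scheme \<Rightarrow> 'a topology \<Rightarrow> bool" where
  "balanced_group G T \<longleftrightarrow>
     (\<forall>U. unit_neighbourhood G T U \<longrightarrow>
        (\<exists>V. unit_neighbourhood G T V \<and> (\<forall>x\<in>carrier G. x <#\<^bsub>G\<^esub> V \<subseteq> U #>\<^bsub>G\<^esub> x)))"

text \<open>The next two notions quantify over all Hausdorff topological groups, of any size.  In HOL
  the bound variable must have a fixed type; \<^typ>\<open>'a set set\<close> is large enough, because a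
  Hausdorff space with a dense image of \<^typ>\<open>'a\<close> injects into \<^typ>\<open>'a set set\<close>.
  The lemmas \<open>hTG_closed_any_type\<close> and \<open>MAP_group_any_type\<close> below show that this restriction
  loses nothing.\<close>

definition hTG_closed :: "('a, 'm) monoid_scheme \<Rightarrow> 'a topology \<Rightarrow> bool" where
  "hTG_closed G T \<longleftrightarrow>
     (\<forall>(H :: 'a set set monoid) S f.
        topological_group H S \<and> f \<in> continuous_hom G T H S \<longrightarrow> closedin S (f ` carrier G))"

definition MAP_group :: "('a, 'm) monoid_scheme \<Rightarrow> 'a topology \<Rightarrow> bool" where
  "MAP_group G T \<longleftrightarrow>
     (\<exists>(K :: 'a set set monoid) S f.
        topological_group K S \<and> compact_space S \<and>
        f \<in> continuous_hom G T K S \<and> inj_on f (carrier G))"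

definition quotient_topology :: "'a topology \<Rightarrow> ('a \<Rightarrow> 'b) \<Rightarrow> 'b topology" where
  "quotient_topology T q =
     topology (\<lambda>U. U \<subseteq> q ` topspace T \<and> openin T {x \<in> topspace T. q x \<in> U})"

text \<open>A subgroup \<open>A\<close> of \<open>G\<close>, as a group in its own right, is \<open>G\<lparr>carrier := A\<rparr>\<close>; the quotient
  of \<open>A\<close> by \<open>N\<close> consists of the cosets \<open>N a\<close> with \<open>a \<in> A\<close>.\<close>

definition MAP_solvable :: "('a, 'm) monoid_scheme \<Rightarrow> 'a topology \<Rightarrow> bool" where
  "MAP_solvable G T \<longleftrightarrow>
     (\<exists>m (X :: nat \<Rightarrow> 'a set).
        X 0 = {\<one>\<^bsub>G\<^esub>} \<and> X m = carrier G \<and>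
        (\<forall>n\<le>m. X n \<lhd> G \<and> closedin T (X n)) \<and>
        (\<forall>n<m. X n \<subseteq> X (Suc n) \<and>
           comm_group (G\<lparr>carrier := X (Suc n)\<rparr> Mod X n) \<and>
           MAP_group (G\<lparr>carrier := X (Suc n)\<rparr> Mod X n)
             (quotient_topology (subtopology T (X (Suc n))) (\<lambda>x. X n #>\<^bsub>G\<^esub> x))))"


section \<open>The quotient topology\<close>

lemma openin_quotient_topology:
  "openin (quotient_topology T q) U \<longleftrightarrow>
     U \<subseteq> q ` topspace T \<and> openin T {x \<in> topspace T. q x \<in> U}"
proof -
  have "istopology (\<lambda>U. U \<subseteq> q ` topspace T \<and> openin T {x \<in> topspace T. q x \<in> U})"
    unfolding istopology_def
  proof (intro conjI allI impI)
    fix A B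
    assume A: "A \<subseteq> q ` topspace T \<and> openin T {x \<in> topspace T. q x \<in> A}"
      and B: "B \<subseteq> q ` topspace T \<and> openin T {x \<in> topspace T. q x \<in> B}"
    have "{x \<in> topspace T. q x \<in> A \<inter> B}
        = {x \<in> topspace T. q x \<in> A} \<inter> {x \<in> topspace T. q x \<in> B}"
      by auto
    then show "openin T {x \<in> topspace T. q x \<in> A \<inter> B}"
      using A B by (simp only: openin_Int)
    show "A \<inter> B \<subseteq> q ` topspace T"
      using A by blast
  next
    fix \<K>
    assume K: "\<forall>A\<in>\<K>. A \<subseteq> q ` topspace T \<and> openin T {x \<in> topspace T. q x \<in> A}"
    have "{x \<in> topspace T. q x \<in> \<Union>\<K>} = (\<Union>A\<in>\<K>. {x \<in> topspace T. q x \<in> A})"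
      by auto
    moreover have "openin T (\<Union>A\<in>\<K>. {x \<in> topspace T. q x \<in> A})"
      using K by (intro openin_Union) blast
    ultimately show "openin T {x \<in> topspace T. q x \<in> \<Union>\<K>}"
      by (simp only:)
    show "\<Union>\<K> \<subseteq> q ` topspace T"
      using K by blast
  qed
  then show ?thesis
    by (simp add: quotient_topology_def)
qed

lemma topspace_quotient_topology: "topspace (quotient_topology T q) = q ` topspace T"
proof
  show "topspace (quotient_topology T q) \<subseteq> q ` topspace T"
    using openin_topspace[of "quotient_topology T q"] by (simp only: openin_quotient_topology)
  have "{x \<in> topspace T. q x \<in> q ` topspace T} = topspace T"
    by auto
  then have "openin (quotient_topology T q) (q ` topspace T)"
    by (simp add: openin_quotient_topology)
  then show "q ` topspace T \<subseteq> topspace (quotient_topology T q)"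
    by (rule openin_subset)
qed

lemma quotient_map_quotient_topology: "quotient_map T (quotient_topology T q) q"
  by (auto simp: quotient_map_def topspace_quotient_topology openin_quotient_topology)


section \<open>Independence of the ambient type\<close>

definition transported_group :: "('a, 'm) monoid_scheme \<Rightarrow> ('a \<Rightarrow> 'b) \<Rightarrow> 'b monoid" where
  "transported_group G e =
     \<lparr>carrier = e ` carrier G,
      mult = (\<lambda>a b. e (inv_into (carrier G) e a \<otimes>\<^bsub>G\<^esub> inv_into (carrier G) e b)),
      one = e \<one>\<^bsub>G\<^esub>\<rparr>"

lemma transported_group_iso:
  fixes G (structure)
  assumes "group G" "inj_on e (carrier G)"
  shows "group (transported_group G e)" "e \<in> iso G (transported_group G e)"
proof -
  interpret group G by fact
  let ?H = "transported_group G e"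
  have m: "e x \<otimes>\<^bsub>?H\<^esub> e y = e (x \<otimes> y)" if "x \<in> carrier G" "y \<in> carrier G" for x y
    using that assms(2) by (simp add: transported_group_def)
  have c: "carrier ?H = e ` carrier G" and o: "\<one>\<^bsub>?H\<^esub> = e \<one>"
    by (simp_all add: transported_group_def)
  show "group ?H"
  proof (rule groupI)
    fix a assume "a \<in> carrier ?H"
    then obtain x where x: "x \<in> carrier G" "a = e x"
      by (auto simp: c)
    then have "e (inv x) \<otimes>\<^bsub>?H\<^esub> a = \<one>\<^bsub>?H\<^esub>"
      by (simp add: m o)
    with x show "\<exists>b\<in>carrier ?H. b \<otimes>\<^bsub>?H\<^esub> a = \<one>\<^bsub>?H\<^esub>"
      by (auto simp: c)
  qed (auto simp: c o m m_assoc)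
  show "e \<in> iso G ?H"
    using assms(2) by (auto simp: iso_def hom_def bij_betw_def c m)
qed

lemma transported_topological_group:
  fixes G (structure)
  assumes "topological_group G T" "inj_on e (carrier G)"
  shows "topological_group (transported_group G e) (quotient_topology T e)"
    and "homeomorphic_map T (quotient_topology T e) e"
proof -
  interpret topological_group G T by fact
  let ?H = "transported_group G e" and ?S = "quotient_topology T e"
  define g where "g = inv_into (carrier G) e"
  have ge: "g (e x) = x" if "x \<in> carrier G" for x
    using assms(2) that by (simp add: g_def)
  interpret H: group ?H
    using transported_group_iso(1)[OF is_group assms(2)] .
  have iso: "e \<in> iso G ?H"
    using transported_group_iso(2)[OF is_group assms(2)] .
  have c: "carrier ?H = e ` carrier G"
    by (simp add: transported_group_def)
  have topS: "topspace ?S = carrier ?H"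
    by (simp add: topspace_quotient_topology topspace_eq c)
  show hm: "homeomorphic_map T ?S e"
    using assms(2) quotient_map_quotient_topology by (auto simp: homeomorphic_map_def topspace_eq)
  then have ce: "continuous_map T ?S e"
    by (rule homeomorphic_imp_continuous_map)
  obtain g' where g': "homeomorphic_maps T ?S e g'"
    using hm homeomorphic_map_maps by blast
  have "continuous_map ?S T g'"
    using g' by (simp add: homeomorphic_maps_def)
  moreover have "g' a = g a" if a: "a \<in> topspace ?S" for a
  proof -
    obtain x where x: "x \<in> carrier G" "a = e x"
      using a by (auto simp: topS c)
    moreover have "g' (e x) = x"
      using g' x by (auto simp: homeomorphic_maps_def topspace_eq)
    ultimately show ?thesis
      by (simp add: ge)
  qed
  ultimately have cg: "continuous_map ?S T g"
    by (rule continuous_map_eq)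
  have "Hausdorff_space ?S"
    using Hausdorff hm homeomorphic_Hausdorff_space homeomorphic_map_imp_homeomorphic_space by blast
  moreover have "continuous_map (prod_topology ?S ?S) ?S (\<lambda>(a, b). a \<otimes>\<^bsub>?H\<^esub> b)"
  proof -
    have "continuous_map (prod_topology ?S ?S) (prod_topology T T) (\<lambda>(a, b). (g a, g b))"
      using cg by (simp add: continuous_map_prod_top)
    then have "continuous_map (prod_topology ?S ?S) ?S (e \<circ> ((\<lambda>(x, y). x \<otimes> y) \<circ> (\<lambda>(a, b). (g a, g b))))"
      by (intro continuous_map_compose[OF _ ce] continuous_map_compose[OF _ continuous_mult])
    moreover have "e \<circ> ((\<lambda>(x, y). x \<otimes> y) \<circ> (\<lambda>(a, b). (g a, g b))) = (\<lambda>(a, b). a \<otimes>\<^bsub>?H\<^esub> b)"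
      by (auto simp: transported_group_def g_def)
    ultimately show ?thesis by simp
  qed
  moreover have "continuous_map ?S ?S (\<lambda>a. inv\<^bsub>?H\<^esub> a)"
  proof -
    have "continuous_map ?S ?S (e \<circ> ((\<lambda>x. inv x) \<circ> g))"
      by (intro continuous_map_compose[OF _ ce] continuous_map_compose[OF cg continuous_inv])
    moreover have "(e \<circ> ((\<lambda>x. inv x) \<circ> g)) a = inv\<^bsub>?H\<^esub> a" if a: "a \<in> topspace ?S" for a
    proof -
      obtain x where x: "x \<in> carrier G" "a = e x"
        using a by (auto simp: topS c)
      interpret gh: group_hom G ?H e
        using iso by unfold_locales (auto simp: iso_def)
      show ?thesis
        using x by (simp add: ge)
    qed
    ultimately show ?thesis
      by (rule continuous_map_eq)
  qed
  ultimately show "topological_group ?H ?S"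
    using topS by unfold_locales auto
qed

lemma (in topological_group) closure_of_subgroup:
  assumes "subgroup A G"
  shows "subgroup (T closure_of A) G"
proof (rule subgroupI)
  have A: "A \<subseteq> carrier G"
    using assms by (rule subgroup.subset)
  show "T closure_of A \<subseteq> carrier G"
    using closure_of_subset_topspace[of T A] by (simp add: topspace_eq)
  have "A \<subseteq> T closure_of A"
    using A by (simp add: closure_of_subset topspace_eq)
  then show "T closure_of A \<noteq> {}"
    using subgroup.one_closed[OF assms] by auto
  show "inv a \<in> T closure_of A" if "a \<in> T closure_of A" for a
  proof -
    have "(\<lambda>x. inv x) ` (T closure_of A) \<subseteq> T closure_of ((\<lambda>x. inv x) ` A)"
      using continuous_inv by (rule continuous_map_image_closure_subset)
    also have "\<dots> \<subseteq> T closure_of A"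
      using subgroup.m_inv_closed[OF assms] by (intro closure_of_mono) auto
    finally show ?thesis
      using that by auto
  qed
  show "a \<otimes> b \<in> T closure_of A" if "a \<in> T closure_of A" "b \<in> T closure_of A" for a b
  proof -
    let ?f = "\<lambda>(x, y). x \<otimes> y"
    have "?f ` (prod_topology T T closure_of (A \<times> A)) \<subseteq> T closure_of (?f ` (A \<times> A))"
      using continuous_mult by (rule continuous_map_image_closure_subset)
    also have "\<dots> \<subseteq> T closure_of A"
      using subgroup.m_closed[OF assms] by (intro closure_of_mono) auto
    finally show ?thesis
      using that by (auto simp: closure_of_Times)
  qed
qed

lemma (in topological_group) topological_subgroup:
  assumes "subgroup A G"
  shows "topological_group (G\<lparr>carrier := A\<rparr>) (subtopology T A)"
proof -
  interpret A: subgroup A G by fact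
  interpret GA: group "G\<lparr>carrier := A\<rparr>"
    using A.subgroup_is_group is_group by blast
  have "topspace (subtopology T A) = A"
    using A.subset by (auto simp: topspace_eq)
  moreover have "continuous_map (prod_topology (subtopology T A) (subtopology T A)) (subtopology T A)
      (\<lambda>(x, y). x \<otimes> y)"
    unfolding subtopology_Times[symmetric] continuous_map_in_subtopology
    using continuous_map_from_subtopology[OF continuous_mult] A.m_closed by auto
  moreover have "continuous_map (subtopology T A) (subtopology T A) (\<lambda>x. inv\<^bsub>G\<lparr>carrier := A\<rparr>\<^esub> x)"
  proof (rule continuous_map_eq)
    show "continuous_map (subtopology T A) (subtopology T A) (\<lambda>x. inv x)"
      unfolding continuous_map_in_subtopology
      using continuous_map_from_subtopology[OF continuous_inv] A.m_inv_closed by auto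
    show "inv x = inv\<^bsub>G\<lparr>carrier := A\<rparr>\<^esub> x" if "x \<in> topspace (subtopology T A)" for x
      using that m_inv_consistent[OF assms] by simp
  qed
  moreover have "Hausdorff_space (subtopology T A)"
    using Hausdorff by (rule Hausdorff_space_subtopology)
  ultimately show ?thesis
    by unfold_locales auto
qed

lemma dense_image_injection:
  fixes f :: "'a \<Rightarrow> 'b"
  assumes "Hausdorff_space S" "f ` A \<subseteq> topspace S"
  shows "inj_on (\<lambda>y. {B. B \<subseteq> A \<and> y \<in> S closure_of (f ` B)}) (S closure_of (f ` A))"
proof (rule inj_onI, rule ccontr)
  fix y z
  assume y: "y \<in> S closure_of (f ` A)" and z: "z \<in> S closure_of (f ` A)" and "y \<noteq> z"
    and eq: "{B. B \<subseteq> A \<and> y \<in> S closure_of (f ` B)} = {B. B \<subseteq> A \<and> z \<in> S closure_of (f ` B)}"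
  obtain U V where U: "openin S U" "y \<in> U" and V: "openin S V" "z \<in> V" and "disjnt U V"
    using assms(1) y z \<open>y \<noteq> z\<close> unfolding Hausdorff_space_def in_closure_of
    by metis
  define B where "B = {x \<in> A. f x \<in> U}"
  have "y \<in> S closure_of (f ` B)"
    unfolding in_closure_of
  proof (intro conjI allI impI)
    show "y \<in> topspace S"
      using y by (simp add: in_closure_of)
    fix W assume "y \<in> W \<and> openin S W"
    then have "y \<in> W \<inter> U" "openin S (W \<inter> U)"
      using U by auto
    then obtain x where "x \<in> A" "f x \<in> W \<inter> U"
      using y unfolding in_closure_of by blast
    then show "\<exists>u. u \<in> f ` B \<and> u \<in> W"
      by (auto simp: B_def)
  qed
  moreover have "B \<subseteq> A"
    by (auto simp: B_def)
  ultimately have "z \<in> S closure_of (f ` B)"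
    using eq by blast
  then obtain x where "x \<in> B" "f x \<in> V"
    using V unfolding in_closure_of by blast
  with \<open>disjnt U V\<close> show False
    by (auto simp: B_def disjnt_def)
qed

lemma small_target:
  fixes G :: "('a, 'm) monoid_scheme" and H :: "('b, 'n) monoid_scheme"
  assumes "group G" "topspace T = carrier G"
    and "topological_group H S" "f \<in> continuous_hom G T H S"
  obtains K :: "'a set set monoid" and R e where
    "topological_group K R"
    "homeomorphic_map (subtopology S (S closure_of (f ` carrier G))) R e"
    "e \<circ> f \<in> continuous_hom G T K R"
proof -
  interpret G: group G by fact
  interpret H: topological_group H S by fact
  have f: "f \<in> hom G H" "continuous_map T S f"
    using assms(4) by (auto simp: continuous_hom_def)
  interpret gh: group_hom G H f
    using f(1) by unfold_locales
  let ?C = "S closure_of (f ` carrier G)"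
  let ?HC = "H\<lparr>carrier := ?C\<rparr>" and ?SC = "subtopology S ?C"
  have sub: "f ` carrier G \<subseteq> topspace S"
    by (auto simp: H.topspace_eq)
  have fC: "f ` carrier G \<subseteq> ?C"
    using sub by (rule closure_of_subset)
  define e where "e = (\<lambda>y. {B. B \<subseteq> carrier G \<and> y \<in> S closure_of (f ` B)})"
  have inj: "inj_on e ?C"
    unfolding e_def using H.Hausdorff sub by (rule dense_image_injection)
  have HC: "topological_group ?HC ?SC"
    by (intro H.topological_subgroup H.closure_of_subgroup gh.img_is_subgroup)
  then interpret HC: topological_group ?HC ?SC .
  let ?K = "transported_group ?HC e" and ?R = "quotient_topology ?SC e"
  have 1: "topological_group ?K ?R" and 2: "homeomorphic_map ?SC ?R e"
    using transported_topological_group[OF HC, of e] inj by auto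
  have "e \<in> iso ?HC ?K"
    using transported_group_iso(2)[OF HC.is_group, of e] inj by simp
  moreover have "f \<in> hom G ?HC"
    using f(1) fC by (auto simp: hom_def)
  ultimately have "e \<circ> f \<in> hom G ?K"
    by (auto simp: iso_def hom_compose)
  moreover have "continuous_map T ?R (e \<circ> f)"
  proof (rule continuous_map_compose)
    show "continuous_map T ?SC f"
      using f(2) fC assms(2) by (auto simp: continuous_map_in_subtopology)
    show "continuous_map ?SC ?R e"
      using 2 by (rule homeomorphic_imp_continuous_map)
  qed
  ultimately have "e \<circ> f \<in> continuous_hom G T ?K ?R"
    by (simp add: continuous_hom_def)
  with 1 2 show thesis by (rule that)
qed

lemma hTG_closed_any_type:
  fixes G :: "('a, 'm) monoid_scheme" and H :: "('b, 'n) monoid_scheme"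
  assumes "topological_group G T" "hTG_closed G T"
    and "topological_group H S" "f \<in> continuous_hom G T H S"
  shows "closedin S (f ` carrier G)"
proof -
  interpret G: topological_group G T by fact
  interpret H: topological_group H S by fact
  let ?C = "S closure_of (f ` carrier G)"
  obtain K :: "'a set set monoid" and R e where
    K: "topological_group K R" and e: "homeomorphic_map (subtopology S ?C) R e"
    and ef: "e \<circ> f \<in> continuous_hom G T K R"
    using small_target[OF G.is_group G.topspace_eq assms(3,4)] .
  have "closedin R ((e \<circ> f) ` carrier G)"
    using assms(2) K ef unfolding hTG_closed_def by blast
  then have cl: "closedin R (e ` f ` carrier G)"
    by (simp add: image_comp)
  have "f ` carrier G \<subseteq> topspace S"
    using assms(4) by (auto simp: continuous_hom_def hom_def H.topspace_eq)
  then have "f ` carrier G \<subseteq> topspace (subtopology S ?C)"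
    by (simp add: closure_of_subset)
  then have "closedin (subtopology S ?C) (f ` carrier G)"
    using cl homeomorphic_map_closedness_eq[OF e] by blast
  then show ?thesis
    using closedin_trans_full closedin_closure_of by blast
qed

lemma MAP_group_any_type:
  fixes G :: "('a, 'm) monoid_scheme" and H :: "('b, 'n) monoid_scheme"
  assumes "group G" "topspace T = carrier G"
    and "topological_group H S" "compact_space S"
    and "f \<in> continuous_hom G T H S" "inj_on f (carrier G)"
  shows "MAP_group G T"
proof -
  interpret H: topological_group H S by fact
  let ?C = "S closure_of (f ` carrier G)"
  obtain K :: "'a set set monoid" and R e where
    K: "topological_group K R" and e: "homeomorphic_map (subtopology S ?C) R e"
    and ef: "e \<circ> f \<in> continuous_hom G T K R"
    using small_target[OF assms(1,2,3,5)] .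
  have "compact_space (subtopology S ?C)"
    using assms(4) by (simp add: closedin_compact_space compact_space_subtopology)
  then have "compact_space R"
    using e homeomorphic_compact_space homeomorphic_map_imp_homeomorphic_space by blast
  moreover have "f ` carrier G \<subseteq> topspace S"
    using assms(5) by (auto simp: continuous_hom_def hom_def H.topspace_eq)
  then have "f ` carrier G \<subseteq> topspace (subtopology S ?C)"
    by (simp add: closure_of_subset)
  then have "inj_on (e \<circ> f) (carrier G)"
    using e assms(6) unfolding homeomorphic_map_def
    by (meson comp_inj_on inj_on_subset)
  ultimately show ?thesis
    using K ef unfolding MAP_group_def by blast
qed

end

theory Submission
  imports Defs
begin

text \<open>A compact group is balanced, locally compact and has closed images; along the closed derived series
its subquotients are compact abelian groups, hence maximally almost periodic.  The content is the
converse: a balanced group \<open>X\<close> all of whose continuous homomorphic images are closed is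
compact as soon as it has a finite series \<open>{\<one>} = X\<^sub>0 \<subseteq> \<dots> \<subseteq> X\<^sub>m = X\<close>
of closed normal subgroups with abelian quotients that are maximally almost periodic or, when \<open>X\<close>
is locally compact, arbitrary.

Everything is expressed by continuous pseudonorms that are invariant under conjugation.  A balanced
group has enough of them to define its topology (\<open>balanced_norm\<close>, the Birkhoff--Kakutani
construction).  Closed images mean completeness: \<open>X\<close> maps into the group of Cauchy nets modulo
null nets for any given family of invariant pseudonorms, and closedness of the image says that every
such net converges in \<open>X\<close> (\<open>hTG_closed_complete\<close>).  A pseudonorm on a closed normal
subgroup \<open>H\<close> can be mixed with those of \<open>X\<close> by infimal convolution, and so
\<open>H\<close> is complete for every family of \<open>X\<close>-invariant continuous pseudonorms on it, however
coarse (\<open>closed_normal_complete\<close>).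

The series is descended from the top.  Suppose \<open>N \<subseteq> B\<close> are consecutive terms and
\<open>X/B\<close> is already known to be precompact.  Then \<open>X/N\<close> is precompact provided that
totally bounded \<open>X\<close>-invariant pseudonorms separate the points of \<open>B/N\<close>
(\<open>precompact_if_separated\<close>).  For the proof let \<open>q\<close> be an invariant pseudonorm on
\<open>B\<close> with kernel \<open>N\<close> that is not totally bounded, and choose a \<open>q\<close>-separated sequence.  As
\<open>B/N\<close> is abelian, conjugation on it factors through the precompact group \<open>X/B\<close>, so the
closed normal subgroup \<open>H\<close> generated by \<open>N\<close> and the sequence is separable for every
pseudonorm in question.  On \<open>H\<close> all these pseudonorms are complete, and by the open mapping
theorem (\<open>norm_open_mapping\<close>) comparable ones with the same kernel are equivalent.  Comparing
\<open>q\<close> with \<open>q + r\<close> shows that each totally bounded \<open>r\<close> that vanishes on \<open>N\<close> is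
\<open>q\<close>-continuous; countably many of them then suffice to separate \<open>H/N\<close>, their weighted sum
is totally bounded with kernel \<open>N\<close>, and comparing it with \<open>q\<close> shows that \<open>q\<close> is
totally bounded on \<open>H\<close>, a contradiction.  At the bottom of the series \<open>X\<close> itself is
precompact, and being complete it is compact (\<open>precompact_imp_compact\<close>).

Separating totally bounded pseudonorms come from a compact group in the maximally almost periodic case:
pull back invariant pseudonorms of the compact group and take the supremum over all conjugates, which
remains totally bounded because conjugation acts through a precompact group (\<open>invariant_hull\<close>).
In the locally compact case \<open>B\<close> has an open subgroup \<open>H\<close> generated by \<open>N\<close> and a
compact invariant neighbourhood of the unit.  Characters of the discrete abelian group \<open>B/H\<close> separate
its points, so \<open>X/H\<close> is precompact.  On \<open>H\<close> consider the asymptotic word length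
\<open>p(h) = inf \<ell>(h\<^sup>n) / n\<close>.  By a Hahn--Banach argument, real homomorphisms dominated by
\<open>p\<close>, composed with \<open>t \<mapsto> e\<^sup>i\<^sup>t\<close>, separate \<open>H\<close> modulo the kernel of \<open>p\<close>; hence
\<open>p\<close> is totally bounded, and as \<open>p(h\<^sup>n) = n p(h)\<close> it vanishes.  Vanishing of \<open>p\<close>
forces the word length to be bounded, that is, \<open>H/N\<close> is compact.\<close>

section \<open>Invariant pseudonorms on groups\<close>

lemma (in group) inv_mult_cancel_left:
  assumes "x \<in> carrier G" "y \<in> carrier G"
  shows "inv x \<otimes> (x \<otimes> y) = y" and "x \<otimes> (inv x \<otimes> y) = y"
  using assms by (simp_all flip: m_assoc)

text \<open>Together these rules decide equality of words in group elements and their inverses.\<close>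

lemmas (in group) word_simps = m_assoc inv_mult_group inv_mult_cancel_left

definition pseudonorm :: "('a, 'm) monoid_scheme \<Rightarrow> 'a set \<Rightarrow> ('a \<Rightarrow> real) \<Rightarrow> bool" where
  "pseudonorm G B r \<longleftrightarrow>
     (\<forall>x\<in>B. 0 \<le> r x) \<and> r \<one>\<^bsub>G\<^esub> = 0 \<and> (\<forall>x\<in>B. r (inv\<^bsub>G\<^esub> x) = r x) \<and>
     (\<forall>x\<in>B. \<forall>y\<in>B. r (x \<otimes>\<^bsub>G\<^esub> y) \<le> r x + r y)"

definition conj_invariant :: "('a, 'm) monoid_scheme \<Rightarrow> 'a set \<Rightarrow> ('a \<Rightarrow> real) \<Rightarrow> bool" where
  "conj_invariant G B r \<longleftrightarrow>
     (\<forall>x\<in>carrier G. \<forall>b\<in>B. r (x \<otimes>\<^bsub>G\<^esub> b \<otimes>\<^bsub>G\<^esub> inv\<^bsub>G\<^esub> x) = r b)"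

text \<open>For a pseudonorm this is continuity on \<open>B\<close>, stated without reference to the subspace topology.\<close>

definition small_near_one ::
    "('a, 'm) monoid_scheme \<Rightarrow> 'a topology \<Rightarrow> 'a set \<Rightarrow> ('a \<Rightarrow> real) \<Rightarrow> bool" where
  "small_near_one G T B r \<longleftrightarrow>
     (\<forall>e>0. \<exists>U. openin T U \<and> \<one>\<^bsub>G\<^esub> \<in> U \<and> (\<forall>x\<in>U \<inter> B. r x < e))"

definition norms :: "('a, 'm) monoid_scheme \<Rightarrow> 'a topology \<Rightarrow> 'a set \<Rightarrow> ('a \<Rightarrow> real) set" where
  "norms G T B = {r. pseudonorm G B r \<and> conj_invariant G B r \<and> small_near_one G T B r}"

lemma pseudonormD:
  assumes "pseudonorm G B r"
  shows "x \<in> B \<Longrightarrow> 0 \<le> r x" "r \<one>\<^bsub>G\<^esub> = 0" "x \<in> B \<Longrightarrow> r (inv\<^bsub>G\<^esub> x) = r x"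
    "x \<in> B \<Longrightarrow> y \<in> B \<Longrightarrow> r (x \<otimes>\<^bsub>G\<^esub> y) \<le> r x + r y"
  using assms by (auto simp: pseudonorm_def)

lemma pseudonorm_subset: "pseudonorm G B r \<Longrightarrow> A \<subseteq> B \<Longrightarrow> pseudonorm G A r"
  unfolding pseudonorm_def by blast

lemma conj_invariantD:
  "conj_invariant G B r \<Longrightarrow> x \<in> carrier G \<Longrightarrow> b \<in> B \<Longrightarrow>
    r (x \<otimes>\<^bsub>G\<^esub> b \<otimes>\<^bsub>G\<^esub> inv\<^bsub>G\<^esub> x) = r b"
  by (simp add: conj_invariant_def)

lemma norms_subset: "r \<in> norms G T B \<Longrightarrow> A \<subseteq> B \<Longrightarrow> r \<in> norms G T A"
  unfolding norms_def conj_invariant_def small_near_one_def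
  by (auto intro: pseudonorm_subset) (meson Int_iff subsetD)

lemma normsD:
  assumes "r \<in> norms G T B"
  shows "pseudonorm G B r" "conj_invariant G B r" "small_near_one G T B r"
  using assms by (auto simp: norms_def)

context group
begin

lemma norm_dist_triangle:
  assumes "pseudonorm G B r" "subgroup B G" "x \<in> B" "y \<in> B" "z \<in> B"
  shows "r (inv x \<otimes> z) \<le> r (inv x \<otimes> y) + r (inv y \<otimes> z)"
proof -
  interpret B: subgroup B G by fact
  have "inv x \<otimes> z = (inv x \<otimes> y) \<otimes> (inv y \<otimes> z)"
    using assms by (simp add: word_simps)
  then show ?thesis
    using pseudonormD(4)[OF assms(1), of "inv x \<otimes> y" "inv y \<otimes> z"] assms by simp
qed

lemma norm_dist_sym:
  assumes "pseudonorm G B r" "subgroup B G" "x \<in> B" "y \<in> B"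
  shows "r (inv x \<otimes> y) = r (inv y \<otimes> x)"
proof -
  interpret B: subgroup B G by fact
  have "inv (inv x \<otimes> y) = inv y \<otimes> x"
    using assms by (simp add: word_simps)
  then show ?thesis
    using pseudonormD(3)[OF assms(1), of "inv x \<otimes> y"] assms by simp
qed

lemma norm_le_dist:
  assumes "pseudonorm G B r" "subgroup B G" "x \<in> B" "y \<in> B"
  shows "r y \<le> r x + r (inv x \<otimes> y)"
proof -
  interpret B: subgroup B G by fact
  have "y = x \<otimes> (inv x \<otimes> y)"
    using assms by (simp add: word_simps)
  then show ?thesis
    using pseudonormD(4)[OF assms(1), of x "inv x \<otimes> y"] assms by simp
qed

lemma norm_swap:
  assumes "conj_invariant G B r" "B \<subseteq> carrier G" "x \<in> carrier G" "y \<in> carrier G" "x \<otimes> y \<in> B"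
  shows "r (y \<otimes> x) = r (x \<otimes> y)"
proof -
  have "y \<otimes> (x \<otimes> y) \<otimes> inv y = y \<otimes> x"
    using assms by (simp add: word_simps)
  then show ?thesis
    using conj_invariantD[OF assms(1,4,5)] by simp
qed

text \<open>Multiplication is \<open>1\<close>-Lipschitz in each variable, simultaneously.\<close>

lemma norm_dist_mult:
  assumes "pseudonorm G B r" "conj_invariant G B r" "subgroup B G"
    "x \<in> B" "y \<in> B" "x' \<in> B" "y' \<in> B"
  shows "r (inv (x \<otimes> y) \<otimes> (x' \<otimes> y')) \<le> r (inv x \<otimes> x') + r (inv y \<otimes> y')"
proof -
  interpret B: subgroup B G by fact
  have [simp]: "x \<in> carrier G" "y \<in> carrier G" "x' \<in> carrier G" "y' \<in> carrier G"
    using assms by auto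
  have "r (inv (x \<otimes> y) \<otimes> (x' \<otimes> y')) = r (inv y \<otimes> (inv x \<otimes> x' \<otimes> y'))"
    by (simp add: word_simps)
  also have "\<dots> = r ((inv x \<otimes> x' \<otimes> y') \<otimes> inv y)"
    by (rule norm_swap[OF assms(2) B.subset]) (use assms in auto)
  also have "\<dots> = r ((inv x \<otimes> x') \<otimes> (y' \<otimes> inv y))"
    by (simp add: word_simps)
  also have "\<dots> \<le> r (inv x \<otimes> x') + r (y' \<otimes> inv y)"
    using assms by (intro pseudonormD(4)[OF assms(1)]) auto
  also have "r (y' \<otimes> inv y) = r (inv y \<otimes> y')"
    by (rule norm_swap[OF assms(2) B.subset]) (use assms in auto)
  finally show ?thesis .
qed

lemma norm_dist_inv:
  assumes "pseudonorm G B r" "conj_invariant G B r" "subgroup B G" "x \<in> B" "y \<in> B"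
  shows "r (inv (inv x) \<otimes> inv y) = r (inv x \<otimes> y)"
proof -
  interpret B: subgroup B G by fact
  have "r (inv (inv x) \<otimes> inv y) = r (inv y \<otimes> inv (inv x))"
    by (rule norm_swap[OF assms(2) B.subset]) (use assms in auto)
  then show ?thesis
    using norm_dist_sym[OF assms(1,3,4,5)] assms by simp
qed

end

section \<open>Hausdorff quotients from invariant filter bases\<close>

text \<open>A conjugation invariant filter base that would define a group topology; the topology need not be Hausdorff, and the quotient by the intersection of the base repairs this.\<close>

locale invariant_base = group S for S (structure) +
  fixes \<B> :: "'a set set"
  assumes base_nonempty: "\<B> \<noteq> {}"
    and base_carrier: "U \<in> \<B> \<Longrightarrow> U \<subseteq> carrier S"
    and base_one: "U \<in> \<B> \<Longrightarrow> \<one> \<in> U"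
    and base_Int: "U \<in> \<B> \<Longrightarrow> V \<in> \<B> \<Longrightarrow> \<exists>W\<in>\<B>. W \<subseteq> U \<inter> V"
    and base_mult: "U \<in> \<B> \<Longrightarrow> \<exists>V\<in>\<B>. \<forall>x\<in>V. \<forall>y\<in>V. x \<otimes> y \<in> U"
    and base_inv: "U \<in> \<B> \<Longrightarrow> \<exists>V\<in>\<B>. \<forall>x\<in>V. inv x \<in> U"
    and base_conj: "U \<in> \<B> \<Longrightarrow> x \<in> carrier S \<Longrightarrow> u \<in> U \<Longrightarrow> x \<otimes> u \<otimes> inv x \<in> U"
begin

abbreviation "K \<equiv> \<Inter>\<B>"

lemma K_normal: "K \<lhd> S"
  unfolding normal_inv_iff
proof (intro conjI ballI)
  show "subgroup K S"
  proof
    show "K \<subseteq> carrier S" using base_nonempty base_carrier by blast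
    show "x \<otimes> y \<in> K" if "x \<in> K" "y \<in> K" for x y
      using that base_mult by blast
    show "\<one> \<in> K" using base_one by blast
    show "inv x \<in> K" if "x \<in> K" for x
      using that base_inv by blast
  qed
  show "x \<otimes> h \<otimes> inv x \<in> K" if "x \<in> carrier S" "h \<in> K" for x h
    using that base_conj by blast
qed

sublocale K: normal K S by (rule K_normal)

definition coset_open :: "'a set set \<Rightarrow> bool" where
  "coset_open W \<longleftrightarrow> W \<subseteq> carrier (S Mod K) \<and>
     (\<forall>x\<in>carrier S. K #> x \<in> W \<longrightarrow> (\<exists>U\<in>\<B>. \<forall>u\<in>U. K #> (x \<otimes> u) \<in> W))"

definition coset_topology :: "'a set topology" where
  "coset_topology = topology coset_open"

lemma openin_coset_topology: "openin coset_topology W \<longleftrightarrow> coset_open W"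
proof -
  have "istopology coset_open"
    unfolding istopology_def
  proof (intro conjI allI impI)
    fix A B assume A: "coset_open A" and B: "coset_open B"
    show "coset_open (A \<inter> B)"
      unfolding coset_open_def
    proof (intro conjI ballI impI)
      show "A \<inter> B \<subseteq> carrier (S Mod K)" using A by (auto simp: coset_open_def)
      fix x assume x: "x \<in> carrier S" "K #> x \<in> A \<inter> B"
      obtain U V where "U \<in> \<B>" "V \<in> \<B>" "\<forall>u\<in>U. K #> (x \<otimes> u) \<in> A" "\<forall>u\<in>V. K #> (x \<otimes> u) \<in> B"
        using A B x unfolding coset_open_def by blast
      then show "\<exists>U\<in>\<B>. \<forall>u\<in>U. K #> (x \<otimes> u) \<in> A \<inter> B"
        using base_Int[of U V] by blast
    qed
  next
    fix \<K> assume "\<forall>A\<in>\<K>. coset_open A"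
    then show "coset_open (\<Union>\<K>)"
      unfolding coset_open_def by (meson Union_iff Union_least)
  qed
  then show ?thesis by (simp add: coset_topology_def)
qed

lemma coset_openD:
  assumes "openin coset_topology W" "x \<in> carrier S" "K #> x \<in> W"
  shows "\<exists>U\<in>\<B>. \<forall>u\<in>U. K #> (x \<otimes> u) \<in> W"
  using assms unfolding openin_coset_topology coset_open_def by blast

lemma carrier_coset: "X \<in> carrier (S Mod K) \<longleftrightarrow> (\<exists>x\<in>carrier S. X = K #> x)"
  by (auto simp: FactGroup_def RCOSETS_def)

lemma topspace_coset_topology: "topspace coset_topology = carrier (S Mod K)"
proof
  show "topspace coset_topology \<subseteq> carrier (S Mod K)"
    by (metis openin_topspace openin_coset_topology coset_open_def)
  have "coset_open (carrier (S Mod K))"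
    unfolding coset_open_def using base_nonempty base_carrier
    by (auto simp: carrier_coset) (metis base_carrier equals0I m_closed subsetD)
  then show "carrier (S Mod K) \<subseteq> topspace coset_topology"
    using openin_subset openin_coset_topology by blast
qed

lemma coset_eq_iff: "x \<in> carrier S \<Longrightarrow> y \<in> carrier S \<Longrightarrow> K #> x = K #> y \<longleftrightarrow> inv x \<otimes> y \<in> K"
proof -
  assume x: "x \<in> carrier S" and y: "y \<in> carrier S"
  have "K #> x = K #> y \<longleftrightarrow> y \<in> K #> x"
    using x y by (metis K.subgroup_axioms rcos_self repr_independence)
  also have "\<dots> \<longleftrightarrow> y \<otimes> inv x \<in> K"
    using K.rcos_module[OF is_group x y] .
  also have "\<dots> \<longleftrightarrow> inv x \<otimes> y \<in> K"
  proof
    assume "y \<otimes> inv x \<in> K"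
    then have "inv x \<otimes> (y \<otimes> inv x) \<otimes> x \<in> K"
      using K.inv_op_closed1[OF x] by blast
    then show "inv x \<otimes> y \<in> K" using x y by (simp add: word_simps)
  next
    assume "inv x \<otimes> y \<in> K"
    then have "x \<otimes> (inv x \<otimes> y) \<otimes> inv x \<in> K"
      using K.inv_op_closed2[OF x] by blast
    then show "y \<otimes> inv x \<in> K" using x y by (simp add: word_simps)
  qed
  finally show ?thesis .
qed

text \<open>The interior of the coset neighbourhood \<open>x U\<close> of \<open>x\<close>, as a set of cosets: the points that carry a whole basic neighbourhood into \<open>x U\<close>.\<close>

definition nbhd :: "'a \<Rightarrow> 'a set \<Rightarrow> 'a set set" where
  "nbhd x U = {K #> y | y. y \<in> carrier S \<and> (\<exists>V\<in>\<B>. \<forall>v\<in>V. inv x \<otimes> y \<otimes> v \<in> U)}"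

lemma nbhd:
  assumes x: "x \<in> carrier S" and U: "U \<in> \<B>"
  shows "openin coset_topology (nbhd x U)" "K #> x \<in> nbhd x U"
    "y \<in> carrier S \<Longrightarrow> K #> y \<in> nbhd x U \<Longrightarrow> inv x \<otimes> y \<in> U"
proof -
  have *: "\<exists>V\<in>\<B>. \<forall>v\<in>V. inv x \<otimes> y \<otimes> v \<in> U" if y: "y \<in> carrier S" "K #> y \<in> nbhd x U" for y
  proof -
    obtain z V where z: "z \<in> carrier S" "K #> y = K #> z" and V: "V \<in> \<B>" "\<forall>v\<in>V. inv x \<otimes> z \<otimes> v \<in> U"
      using y unfolding nbhd_def by blast
    obtain V' where V': "V' \<in> \<B>" "\<forall>x\<in>V'. \<forall>y\<in>V'. x \<otimes> y \<in> V"
      using base_mult V by blast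
    have "inv z \<otimes> y \<in> K"
      using coset_eq_iff[OF z(1) y(1)] z(2) by simp
    then have k: "inv z \<otimes> y \<in> V'" using V' by blast
    have "inv x \<otimes> y \<otimes> v \<in> U" if "v \<in> V'" for v
    proof -
      have "v \<in> carrier S" using base_carrier V' that by blast
      then have "inv x \<otimes> y \<otimes> v = inv x \<otimes> z \<otimes> ((inv z \<otimes> y) \<otimes> v)"
        using x y z by (simp add: word_simps)
      then show ?thesis using V V' k that by metis
    qed
    then show ?thesis using V' by blast
  qed
  show "inv x \<otimes> y \<in> U" if "y \<in> carrier S" "K #> y \<in> nbhd x U"
    using *[OF that] base_one x that by (metis inv_closed m_closed r_one)
  have "\<exists>V\<in>\<B>. \<forall>v\<in>V. inv x \<otimes> x \<otimes> v \<in> U"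
    using x U base_carrier by (intro bexI[OF _ U]) (simp add: subset_eq)
  then show "K #> x \<in> nbhd x U"
    unfolding nbhd_def using x by blast
  show "openin coset_topology (nbhd x U)"
    unfolding openin_coset_topology coset_open_def
  proof (intro conjI ballI impI)
    show "nbhd x U \<subseteq> carrier (S Mod K)"
      unfolding nbhd_def by (auto simp: carrier_coset)
    fix y assume y: "y \<in> carrier S" "K #> y \<in> nbhd x U"
    obtain V where V: "V \<in> \<B>" "\<forall>v\<in>V. inv x \<otimes> y \<otimes> v \<in> U"
      using *[OF y] by blast
    obtain V' where V': "V' \<in> \<B>" "\<forall>x\<in>V'. \<forall>y\<in>V'. x \<otimes> y \<in> V"
      using base_mult V by blast
    have c: "u \<in> carrier S" if "u \<in> V'" for u
      using base_carrier V' that by blast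
    have "K #> (y \<otimes> u) \<in> nbhd x U" if u: "u \<in> V'" for u
    proof -
      have "\<forall>v\<in>V'. inv x \<otimes> (y \<otimes> u) \<otimes> v \<in> U"
      proof
        fix v assume v: "v \<in> V'"
        have "inv x \<otimes> (y \<otimes> u) \<otimes> v = inv x \<otimes> y \<otimes> (u \<otimes> v)"
          using x y c u v by (simp add: word_simps)
        then show "inv x \<otimes> (y \<otimes> u) \<otimes> v \<in> U" using V V' u v by metis
      qed
      then show ?thesis
        unfolding nbhd_def using y c u V'(1) by blast
    qed
    then show "\<exists>U'\<in>\<B>. \<forall>u\<in>U'. K #> (y \<otimes> u) \<in> nbhd x U"
      using V' by blast
  qed
qed

lemma coset_mult: "x \<in> carrier S \<Longrightarrow> y \<in> carrier S \<Longrightarrow> (K #> x) \<otimes>\<^bsub>S Mod K\<^esub> (K #> y) = K #> (x \<otimes> y)"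
  by (simp add: FactGroup_def K.rcos_sum)

lemma coset_inv: "x \<in> carrier S \<Longrightarrow> inv\<^bsub>S Mod K\<^esub> (K #> x) = K #> (inv x)"
  by (metis K.inv_FactGroup K.rcos_inv carrier_coset)

lemma topological_group_cosets: "topological_group (S Mod K) coset_topology"
proof -
  interpret Q: group "S Mod K" by (rule K.factorgroup_is_group)
  have "continuous_map (prod_topology coset_topology coset_topology) coset_topology
      (\<lambda>(X, Y). X \<otimes>\<^bsub>S Mod K\<^esub> Y)"
    unfolding continuous_map_def
  proof (intro conjI allI impI)
    show "(\<lambda>(X, Y). X \<otimes>\<^bsub>S Mod K\<^esub> Y) \<in> topspace (prod_topology coset_topology coset_topology)
        \<rightarrow> topspace coset_topology"
      by (auto simp: topspace_coset_topology simp del: mult_FactGroup)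
    fix W assume W: "openin coset_topology W"
    show "openin (prod_topology coset_topology coset_topology)
      {p \<in> topspace (prod_topology coset_topology coset_topology).
        (case p of (X, Y) \<Rightarrow> X \<otimes>\<^bsub>S Mod K\<^esub> Y) \<in> W}"
      unfolding openin_prod_topology_alt
    proof (intro allI impI)
      fix X Y assume "(X, Y) \<in> {p \<in> topspace (prod_topology coset_topology coset_topology).
        (case p of (X, Y) \<Rightarrow> X \<otimes>\<^bsub>S Mod K\<^esub> Y) \<in> W}"
      then obtain x y where x: "x \<in> carrier S" "X = K #> x" and y: "y \<in> carrier S" "Y = K #> y"
        and xy: "K #> (x \<otimes> y) \<in> W"
        by (auto simp: topspace_coset_topology carrier_coset coset_mult simp del: mult_FactGroup)
      obtain U where U: "U \<in> \<B>" "\<forall>u\<in>U. K #> (x \<otimes> y \<otimes> u) \<in> W"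
        using W xy x y unfolding openin_coset_topology coset_open_def by blast
      obtain V where V: "V \<in> \<B>" "\<forall>x\<in>V. \<forall>y\<in>V. x \<otimes> y \<in> U"
        using base_mult U by blast
      have "X' \<otimes>\<^bsub>S Mod K\<^esub> Y' \<in> W" if X': "X' \<in> nbhd x V" and Y': "Y' \<in> nbhd y V" for X' Y'
      proof -
        obtain x' y' where x': "x' \<in> carrier S" "X' = K #> x'" and y': "y' \<in> carrier S" "Y' = K #> y'"
          using X' Y' unfolding nbhd_def by blast
        have a: "inv x \<otimes> x' \<in> V" "inv y \<otimes> y' \<in> V"
          using nbhd(3)[OF x(1) V(1)] nbhd(3)[OF y(1) V(1)] x' y' X' Y' by auto
        have "inv y \<otimes> (inv x \<otimes> x') \<otimes> inv (inv y) \<in> V"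
          using base_conj[OF V(1) _ a(1)] y by blast
        with a(2) have "(inv y \<otimes> (inv x \<otimes> x') \<otimes> inv (inv y)) \<otimes> (inv y \<otimes> y') \<in> U"
          using V(2) by blast
        also have "(inv y \<otimes> (inv x \<otimes> x') \<otimes> inv (inv y)) \<otimes> (inv y \<otimes> y') = inv (x \<otimes> y) \<otimes> (x' \<otimes> y')"
          using x y x' y' by (simp add: word_simps)
        finally have "K #> (x \<otimes> y \<otimes> (inv (x \<otimes> y) \<otimes> (x' \<otimes> y'))) \<in> W"
          using U by blast
        moreover have "x \<otimes> y \<otimes> (inv (x \<otimes> y) \<otimes> (x' \<otimes> y')) = x' \<otimes> y'"
          using x y x' y' by (simp add: word_simps)
        ultimately show ?thesis
          using x' y' by (simp add: coset_mult del: mult_FactGroup)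
      qed
      then show "\<exists>U V. openin coset_topology U \<and> openin coset_topology V \<and> X \<in> U \<and> Y \<in> V \<and>
           U \<times> V \<subseteq> {p \<in> topspace (prod_topology coset_topology coset_topology).
                      (case p of (X, Y) \<Rightarrow> X \<otimes>\<^bsub>S Mod K\<^esub> Y) \<in> W}"
        using nbhd(1,2)[OF x(1) V(1)] nbhd(1,2)[OF y(1) V(1)] x(2) y(2)
          openin_subset[OF nbhd(1)[OF x(1) V(1)]] openin_subset[OF nbhd(1)[OF y(1) V(1)]]
        by (intro exI[of _ "nbhd x V"] exI[of _ "nbhd y V"])
          (auto simp: subset_eq simp del: mult_FactGroup)
    qed
  qed
  moreover have "continuous_map coset_topology coset_topology (\<lambda>X. inv\<^bsub>S Mod K\<^esub> X)"
    unfolding continuous_map_def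
  proof (intro conjI allI impI)
    show "(\<lambda>X. inv\<^bsub>S Mod K\<^esub> X) \<in> topspace coset_topology \<rightarrow> topspace coset_topology"
      by (auto simp: topspace_coset_topology)
    fix W assume W: "openin coset_topology W"
    show "openin coset_topology {X \<in> topspace coset_topology. inv\<^bsub>S Mod K\<^esub> X \<in> W}"
      unfolding openin_coset_topology coset_open_def
    proof (intro conjI ballI impI)
      show "{X \<in> topspace coset_topology. inv\<^bsub>S Mod K\<^esub> X \<in> W} \<subseteq> carrier (S Mod K)"
        by (auto simp: topspace_coset_topology)
      fix x assume x: "x \<in> carrier S"
        and "K #> x \<in> {X \<in> topspace coset_topology. inv\<^bsub>S Mod K\<^esub> X \<in> W}"
      then have "K #> inv x \<in> W" by (simp add: coset_inv)
      then obtain U where U: "U \<in> \<B>" "\<forall>u\<in>U. K #> (inv x \<otimes> u) \<in> W"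
        using W x unfolding openin_coset_topology coset_open_def by (meson inv_closed)
      obtain V where V: "V \<in> \<B>" "\<forall>v\<in>V. inv v \<in> U"
        using base_inv U by blast
      have "K #> (x \<otimes> v) \<in> {X \<in> topspace coset_topology. inv\<^bsub>S Mod K\<^esub> X \<in> W}" if v: "v \<in> V" for v
      proof -
        have vc: "v \<in> carrier S" using base_carrier V v by blast
        have "x \<otimes> inv v \<otimes> inv x \<in> U"
          using base_conj[OF U(1) x] V v by blast
        then have "K #> (inv x \<otimes> (x \<otimes> inv v \<otimes> inv x)) \<in> W" using U by blast
        moreover have "inv x \<otimes> (x \<otimes> inv v \<otimes> inv x) = inv (x \<otimes> v)"
          using x vc by (simp add: word_simps)
        ultimately show ?thesis
          using x vc by (auto simp: coset_inv topspace_coset_topology carrier_coset)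
      qed
      then show "\<exists>U\<in>\<B>. \<forall>u\<in>U. K #> (x \<otimes> u) \<in> {X \<in> topspace coset_topology. inv\<^bsub>S Mod K\<^esub> X \<in> W}"
        using V by blast
    qed
  qed
  moreover have "Hausdorff_space coset_topology"
    unfolding Hausdorff_space_def
  proof (intro allI impI)
    fix X Y assume "X \<in> topspace coset_topology \<and> Y \<in> topspace coset_topology \<and> X \<noteq> Y"
    then obtain x y where x: "x \<in> carrier S" "X = K #> x" and y: "y \<in> carrier S" "Y = K #> y"
      and "K #> x \<noteq> K #> y"
      unfolding topspace_coset_topology carrier_coset by blast
    then have ne: "inv x \<otimes> y \<notin> K"
      using coset_eq_iff by blast
    then obtain U where U: "U \<in> \<B>" "inv x \<otimes> y \<notin> U" by blast
    obtain V where V: "V \<in> \<B>" "\<forall>x\<in>V. \<forall>y\<in>V. x \<otimes> y \<in> U"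
      using base_mult U by blast
    obtain V' where V': "V' \<in> \<B>" "\<forall>v\<in>V'. inv v \<in> V"
      using base_inv V by blast
    have "disjnt (nbhd x V) (nbhd y V')"
      unfolding disjnt_iff
    proof (intro allI notI)
      fix Z assume Z: "Z \<in> nbhd x V \<and> Z \<in> nbhd y V'"
      then obtain z where z: "z \<in> carrier S" "Z = K #> z" unfolding nbhd_def by blast
      have "inv x \<otimes> z \<in> V" "inv y \<otimes> z \<in> V'"
        using nbhd(3)[OF x(1) V(1) z(1)] nbhd(3)[OF y(1) V'(1) z(1)] Z z by auto
      then have "inv x \<otimes> z \<otimes> inv (inv y \<otimes> z) \<in> U"
        using V V' by blast
      moreover have "inv x \<otimes> z \<otimes> inv (inv y \<otimes> z) = inv x \<otimes> y"
        using x y z by (simp add: word_simps)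
      ultimately show False using U by simp
    qed
    then show "\<exists>U V. openin coset_topology U \<and> openin coset_topology V \<and> X \<in> U \<and> Y \<in> V \<and> disjnt U V"
      using nbhd[OF x(1) V(1)] nbhd[OF y(1) V'(1)] x y by blast
  qed
  ultimately show ?thesis
    by unfold_locales (auto simp: topspace_coset_topology)
qed

end

section \<open>Completeness\<close>

definition cauchy_net ::
    "('a, 'm) monoid_scheme \<Rightarrow> ('a \<Rightarrow> real) set \<Rightarrow> 'i filter \<Rightarrow> ('i \<Rightarrow> 'a) \<Rightarrow> bool" where
  "cauchy_net G P F s \<longleftrightarrow>
     (\<forall>q\<in>P. \<forall>e>0. \<exists>A. eventually A F \<and>
        (\<forall>i j. A i \<longrightarrow> A j \<longrightarrow> q (inv\<^bsub>G\<^esub> s i \<otimes>\<^bsub>G\<^esub> s j) < e))"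

lemma cauchy_netD:
  assumes "cauchy_net G P F s" "q \<in> P" "e > 0"
  shows "\<exists>A. eventually A F \<and> (\<forall>i j. A i \<longrightarrow> A j \<longrightarrow> q (inv\<^bsub>G\<^esub> s i \<otimes>\<^bsub>G\<^esub> s j) < e)"
  using assms by (simp add: cauchy_net_def)

text \<open>Modulo null nets these stand for the limits that may be missing: nets over one fixed filter that are Cauchy for every pseudonorm in \<open>P\<close>.  Fixing the filter makes them a group under pointwise multiplication.\<close>

definition cauchy_nets ::
    "('a, 'm) monoid_scheme \<Rightarrow> ('a \<Rightarrow> real) set \<Rightarrow> 'i filter \<Rightarrow> ('i \<Rightarrow> 'a) monoid" where
  "cauchy_nets G P F =
     \<lparr>carrier = {s. (\<forall>i. s i \<in> carrier G) \<and> cauchy_net G P F s},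
      mult = (\<lambda>s t i. s i \<otimes>\<^bsub>G\<^esub> t i), one = (\<lambda>i. \<one>\<^bsub>G\<^esub>)\<rparr>"

text \<open>Neighbourhoods of the unit among Cauchy nets; their intersection, over all finite \<open>Q \<subseteq> P\<close> and \<open>e > 0\<close>, consists of the null nets.\<close>

definition small_nets ::
    "('a, 'm) monoid_scheme \<Rightarrow> ('a \<Rightarrow> real) set \<Rightarrow> 'i filter \<Rightarrow> ('a \<Rightarrow> real) set \<Rightarrow> real \<Rightarrow> ('i \<Rightarrow> 'a) set" where
  "small_nets G P F Q e =
     {s \<in> carrier (cauchy_nets G P F). \<forall>q\<in>Q. eventually (\<lambda>i. q (s i) < e) F}"

context topological_group
begin

lemma group_cauchy_nets:
  assumes P: "P \<subseteq> norms G T (carrier G)"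
  shows "group (cauchy_nets G P F)"
    and "s \<in> carrier (cauchy_nets G P F) \<Longrightarrow> inv\<^bsub>cauchy_nets G P F\<^esub> s = (\<lambda>i. inv s i)"
    and "x \<in> carrier G \<Longrightarrow> (\<lambda>i. x) \<in> carrier (cauchy_nets G P F)"
proof -
  let ?S = "cauchy_nets G P F"
  have pn: "pseudonorm G (carrier G) q" "conj_invariant G (carrier G) q" if "q \<in> P" for q
    using P that by (auto simp: norms_def)
  have const: "(\<lambda>i. x) \<in> carrier ?S" if "x \<in> carrier G" for x
    using that pseudonormD(2)[OF pn(1)] unfolding cauchy_nets_def cauchy_net_def
    by (force intro!: exI[of _ "\<lambda>i. True"])
  have mult: "(\<lambda>i. s i \<otimes> t i) \<in> carrier ?S" if s: "s \<in> carrier ?S" and t: "t \<in> carrier ?S" for s t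
  proof -
    have c: "s i \<in> carrier G" "t i \<in> carrier G" for i
      using s t by (auto simp: cauchy_nets_def)
    have "\<exists>A. eventually A F \<and> (\<forall>i j. A i \<longrightarrow> A j \<longrightarrow> q (inv (s i \<otimes> t i) \<otimes> (s j \<otimes> t j)) < e)"
      if q: "q \<in> P" and e: "e > 0" for q e
    proof -
      obtain A where A: "eventually A F" "\<And>i j. A i \<Longrightarrow> A j \<Longrightarrow> q (inv s i \<otimes> s j) < e / 2"
        using s e cauchy_netD[of G P F s q "e / 2"] q by (auto simp: cauchy_nets_def)
      obtain B where B: "eventually B F" "\<And>i j. B i \<Longrightarrow> B j \<Longrightarrow> q (inv t i \<otimes> t j) < e / 2"
        using t e cauchy_netD[of G P F t q "e / 2"] q by (auto simp: cauchy_nets_def)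
      show ?thesis
      proof (intro exI[of _ "\<lambda>i. A i \<and> B i"] conjI allI impI)
        show "eventually (\<lambda>i. A i \<and> B i) F" using A B by (simp add: eventually_conj)
        fix i j assume ij: "A i \<and> B i" "A j \<and> B j"
        have "q (inv (s i \<otimes> t i) \<otimes> (s j \<otimes> t j)) \<le> q (inv s i \<otimes> s j) + q (inv t i \<otimes> t j)"
          by (rule norm_dist_mult[OF pn(1,2)[OF q] subgroup_self]) (simp_all add: c)
        then show "q (inv (s i \<otimes> t i) \<otimes> (s j \<otimes> t j)) < e"
          using A(2)[of i j] B(2)[of i j] ij by simp
      qed
    qed
    then show ?thesis
      using c by (auto simp: cauchy_nets_def cauchy_net_def)
  qed
  have inv: "(\<lambda>i. inv s i) \<in> carrier ?S" if s: "s \<in> carrier ?S" for s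
  proof -
    have c: "s i \<in> carrier G" for i
      using s by (auto simp: cauchy_nets_def)
    then have eq: "q (inv (inv s i) \<otimes> inv s j) = q (inv s i \<otimes> s j)" if "q \<in> P" for q i j
      using norm_dist_inv[OF pn[OF that] subgroup_self] by blast
    have "\<exists>A. eventually A F \<and> (\<forall>i j. A i \<longrightarrow> A j \<longrightarrow> q (inv (inv s i) \<otimes> inv s j) < e)"
      if "q \<in> P" "e > 0" for q e
      unfolding eq[OF that(1)] using s that by (intro cauchy_netD) (auto simp: cauchy_nets_def)
    then show ?thesis
      using c by (auto simp: cauchy_nets_def cauchy_net_def simp del: inv_inv)
  qed
  show group: "group ?S"
  proof (rule groupI)
    fix s t assume "s \<in> carrier ?S" "t \<in> carrier ?S"
    then show "s \<otimes>\<^bsub>?S\<^esub> t \<in> carrier ?S" using mult by (simp add: cauchy_nets_def)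
  next
    show "\<one>\<^bsub>?S\<^esub> \<in> carrier ?S" using const by (simp add: cauchy_nets_def)
  next
    fix s t u assume "s \<in> carrier ?S" "t \<in> carrier ?S" "u \<in> carrier ?S"
    then show "s \<otimes>\<^bsub>?S\<^esub> t \<otimes>\<^bsub>?S\<^esub> u = s \<otimes>\<^bsub>?S\<^esub> (t \<otimes>\<^bsub>?S\<^esub> u)"
      by (auto simp: cauchy_nets_def m_assoc)
  next
    fix s assume s: "s \<in> carrier ?S"
    then show "\<one>\<^bsub>?S\<^esub> \<otimes>\<^bsub>?S\<^esub> s = s"
      by (auto simp: cauchy_nets_def)
    show "\<exists>t\<in>carrier ?S. t \<otimes>\<^bsub>?S\<^esub> s = \<one>\<^bsub>?S\<^esub>"
      using inv[OF s] s by (intro bexI[of _ "\<lambda>i. inv s i"]) (auto simp: cauchy_nets_def)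
  qed
  show "inv\<^bsub>?S\<^esub> s = (\<lambda>i. inv s i)" if s: "s \<in> carrier ?S"
    by (rule group.inv_equality[OF group _ s inv[OF s]]) (use s in \<open>auto simp: cauchy_nets_def\<close>)
  show "x \<in> carrier G \<Longrightarrow> (\<lambda>i. x) \<in> carrier ?S" by (rule const)
qed

lemma invariant_base_small_nets:
  assumes P: "P \<subseteq> norms G T (carrier G)"
  shows "invariant_base (cauchy_nets G P F)
    {small_nets G P F Q e | Q e. finite Q \<and> Q \<subseteq> P \<and> e > 0}" (is "invariant_base ?S ?B")
proof -
  interpret S: group ?S by (rule group_cauchy_nets[OF P])
  have pn: "pseudonorm G (carrier G) q" "conj_invariant G (carrier G) q" if "q \<in> P" for q
    using P that by (auto simp: norms_def)
  have mult: "s \<otimes>\<^bsub>?S\<^esub> t = (\<lambda>i. s i \<otimes> t i)" for s t by (simp add: cauchy_nets_def)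
  have c: "s i \<in> carrier G" if "s \<in> carrier ?S" for s i
    using that by (auto simp: cauchy_nets_def)
  have one: "\<one>\<^bsub>?S\<^esub> = (\<lambda>i. \<one>)" by (simp add: cauchy_nets_def)
  show ?thesis
  proof
    have "small_nets G P F {} 1 \<in> ?B" by (auto intro!: exI[of _ "{}"] exI[of _ "1::real"])
    then show "?B \<noteq> {}" by blast
    show "U \<subseteq> carrier ?S" if "U \<in> ?B" for U
      using that by (auto simp: small_nets_def)
    show "\<one>\<^bsub>?S\<^esub> \<in> U" if "U \<in> ?B" for U
      using that pseudonormD(2)[OF pn(1)] S.one_closed by (fastforce simp: small_nets_def one)
    show "\<exists>W\<in>?B. W \<subseteq> U \<inter> V" if "U \<in> ?B" "V \<in> ?B" for U V
    proof -
      obtain Q e where U: "U = small_nets G P F Q e" "finite Q" "Q \<subseteq> P" "e > 0"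
        using \<open>U \<in> ?B\<close> by blast
      obtain Q' e' where V: "V = small_nets G P F Q' e'" "finite Q'" "Q' \<subseteq> P" "e' > 0"
        using \<open>V \<in> ?B\<close> by blast
      have "small_nets G P F (Q \<union> Q') (min e e') \<subseteq> U \<inter> V"
        unfolding U(1) V(1) small_nets_def by (auto elim: eventually_mono)
      moreover have "small_nets G P F (Q \<union> Q') (min e e') \<in> ?B"
        using U V by (intro CollectI exI[of _ "Q \<union> Q'"] exI[of _ "min e e'"]) auto
      ultimately show ?thesis by blast
    qed
    show "\<exists>V\<in>?B. \<forall>s\<in>V. \<forall>t\<in>V. s \<otimes>\<^bsub>?S\<^esub> t \<in> U" if "U \<in> ?B" for U
    proof -
      obtain Q e where U: "U = small_nets G P F Q e" "finite Q" "Q \<subseteq> P" "e > 0"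
        using \<open>U \<in> ?B\<close> by blast
      have "s \<otimes>\<^bsub>?S\<^esub> t \<in> U" if s: "s \<in> small_nets G P F Q (e/2)" and t: "t \<in> small_nets G P F Q (e/2)" for s t
      proof -
        have cs: "s \<in> carrier ?S" "t \<in> carrier ?S" using s t by (auto simp: small_nets_def)
        have "eventually (\<lambda>i. q (s i \<otimes> t i) < e) F" if q: "q \<in> Q" for q
        proof -
          have "eventually (\<lambda>i. q (s i) < e/2 \<and> q (t i) < e/2) F"
            using s t q by (auto simp: small_nets_def eventually_conj_iff)
          then show ?thesis
          proof (rule eventually_mono)
            fix i assume "q (s i) < e/2 \<and> q (t i) < e/2"
            moreover have "q (s i \<otimes> t i) \<le> q (s i) + q (t i)"
              using pseudonormD(4)[OF pn(1)] c cs q U by blast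
            ultimately show "q (s i \<otimes> t i) < e" by simp
          qed
        qed
        then show ?thesis using cs S.m_closed[OF cs] unfolding U(1) small_nets_def mult by blast
      qed
      moreover have "small_nets G P F Q (e/2) \<in> ?B"
        using U by (intro CollectI exI[of _ Q] exI[of _ "e/2"]) auto
      ultimately show ?thesis by blast
    qed
    show "\<exists>V\<in>?B. \<forall>s\<in>V. inv\<^bsub>?S\<^esub> s \<in> U" if UB: "U \<in> ?B" for U
    proof -
      obtain Q e where U: "U = small_nets G P F Q e" "finite Q" "Q \<subseteq> P" "e > 0"
        using UB by blast
      have "inv\<^bsub>?S\<^esub> s \<in> U" if s: "s \<in> U" for s
      proof -
        have cs: "s \<in> carrier ?S" using s U by (auto simp: small_nets_def)
        have "eventually (\<lambda>i. q (inv s i) < e) F" if q: "q \<in> Q" for q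
        proof -
          have "q (inv s i) = q (s i)" for i
            using pseudonormD(3)[OF pn(1)] c[OF cs] q U by blast
          then show ?thesis
            using s q unfolding U(1) small_nets_def by simp
        qed
        then show ?thesis
          using S.inv_closed[OF cs] unfolding U(1) small_nets_def group_cauchy_nets(2)[OF P cs]
          by blast
      qed
      then show ?thesis using UB by blast
    qed
    show "s \<otimes>\<^bsub>?S\<^esub> u \<otimes>\<^bsub>?S\<^esub> inv\<^bsub>?S\<^esub> s \<in> U" if UB: "U \<in> ?B" and s: "s \<in> carrier ?S" and u: "u \<in> U" for U s u
    proof -
      obtain Q e where U: "U = small_nets G P F Q e" "finite Q" "Q \<subseteq> P" "e > 0"
        using UB by blast
      have cu: "u \<in> carrier ?S" using u U by (auto simp: small_nets_def)
      have "eventually (\<lambda>i. q (s i \<otimes> u i \<otimes> inv s i) < e) F" if q: "q \<in> Q" for q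
      proof -
        have "q (s i \<otimes> u i \<otimes> inv s i) = q (u i)" for i
          using conj_invariantD[OF pn(2)] c[OF s] c[OF cu] q U by blast
        then show ?thesis
          using u q unfolding U(1) small_nets_def by simp
      qed
      moreover have "(\<lambda>i. s i \<otimes> u i \<otimes> inv s i) \<in> carrier ?S"
        using S.m_closed[OF S.m_closed[OF s cu] S.inv_closed[OF s]]
        unfolding group_cauchy_nets(2)[OF P s] mult .
      ultimately show ?thesis
        unfolding U(1) small_nets_def group_cauchy_nets(2)[OF P s] mult by blast
    qed
  qed
qed

text \<open>The constant nets map the group continuously onto a subgroup of Cauchy nets modulo null nets whose closure contains the class of every Cauchy net: the class of \<open>s\<close> is approximated by the constant nets with values \<open>s j\<close>.  As this subgroup is closed, each Cauchy net differs from a constant one by a null net, which means that it converges.\<close>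

lemma hTG_closed_complete:
  fixes F :: "'i filter"
  assumes h: "hTG_closed G T" and P: "P \<subseteq> norms G T (carrier G)"
    and F: "F \<noteq> bot" and s: "\<And>i. s i \<in> carrier G" "cauchy_net G P F s"
  obtains x where "x \<in> carrier G"
    "\<And>q e. q \<in> P \<Longrightarrow> e > 0 \<Longrightarrow> eventually (\<lambda>i. q (inv s i \<otimes> x) < e) F"
proof -
  let ?S = "cauchy_nets G P F"
  let ?B = "{small_nets G P F Q e | Q e. finite Q \<and> Q \<subseteq> P \<and> e > 0}"
  have pn: "pseudonorm G (carrier G) q" "small_near_one G T (carrier G) q" if "q \<in> P" for q
    using P that by (auto simp: norms_def)
  interpret B: invariant_base ?S ?B by (rule invariant_base_small_nets[OF P])
  let ?H = "?S Mod B.K" and ?R = "B.coset_topology"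
  interpret H: topological_group ?H ?R by (rule B.topological_group_cosets)
  have mult: "s \<otimes>\<^bsub>?S\<^esub> t = (\<lambda>i. s i \<otimes> t i)" for s t by (simp add: cauchy_nets_def)
  note inv = group_cauchy_nets(2)[OF P, where F = F]
  define f where "f = (\<lambda>x. B.K #>\<^bsub>?S\<^esub> (\<lambda>i::'i. x))"
  have const: "(\<lambda>i. x) \<in> carrier ?S" if "x \<in> carrier G" for x
    by (rule group_cauchy_nets(3)[OF P that])
  have fH: "f x \<in> carrier ?H" if "x \<in> carrier G" for x
    using const[OF that] B.carrier_coset unfolding f_def by blast
  have sS: "s \<in> carrier ?S" using s by (simp add: cauchy_nets_def)
  have sx: "inv\<^bsub>?S\<^esub> s \<otimes>\<^bsub>?S\<^esub> (\<lambda>i. x) = (\<lambda>i. inv s i \<otimes> x)" for x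
    using inv[OF sS] by (simp add: mult)
  have "f \<in> hom G ?H"
  proof (rule homI)
    fix x y assume xy: "x \<in> carrier G" "y \<in> carrier G"
    show "f (x \<otimes> y) = f x \<otimes>\<^bsub>?H\<^esub> f y"
      unfolding f_def B.coset_mult[OF const[OF xy(1)] const[OF xy(2)]] mult by simp
  qed (rule fH)
  moreover have "continuous_map T ?R f"
    unfolding continuous_map_def
  proof (intro conjI allI impI)
    show "f \<in> topspace T \<rightarrow> topspace ?R"
      using fH by (auto simp: topspace_eq B.topspace_coset_topology)
    fix W assume W: "openin ?R W"
    show "openin T {x \<in> topspace T. f x \<in> W}"
    proof (subst openin_subopen, intro ballI)
      fix x assume "x \<in> {x \<in> topspace T. f x \<in> W}"
      then have x: "x \<in> carrier G" "f x \<in> W" by (auto simp: topspace_eq)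
      obtain Q e where Q: "finite Q" "Q \<subseteq> P" "e > 0"
        and QW: "\<And>u. u \<in> small_nets G P F Q e \<Longrightarrow> B.K #>\<^bsub>?S\<^esub> ((\<lambda>i. x) \<otimes>\<^bsub>?S\<^esub> u) \<in> W"
        using B.coset_openD[OF W const[OF x(1)]] x(2) unfolding f_def by force
      have "\<forall>q\<in>Q. \<exists>U. openin T U \<and> \<one> \<in> U \<and> (\<forall>x\<in>U \<inter> carrier G. q x < e)"
        using pn(2) Q unfolding small_near_one_def by blast
      from bchoice[OF this] obtain U where
        "\<forall>q\<in>Q. openin T (U q) \<and> \<one> \<in> U q \<and> (\<forall>x\<in>U q \<inter> carrier G. q x < e)" ..
      then have U: "openin T (U q)" "\<one> \<in> U q" "\<forall>x\<in>U q \<inter> carrier G. q x < e" if "q \<in> Q" for q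
        using that by auto
      define V where "V = topspace T \<inter> \<Inter>(U ` Q)"
      have V: "openin T V" "\<one> \<in> V"
      proof -
        show "openin T V"
        proof (cases "Q = {}")
          case False
          then show ?thesis unfolding V_def using Q U by (intro openin_Int openin_Inter) auto
        qed (simp add: V_def)
        show "\<one> \<in> V" using U by (auto simp: V_def topspace_eq)
      qed
      have "continuous_map T T (\<lambda>y. inv x \<otimes> y)"
      proof -
        have "continuous_map T (prod_topology T T) (\<lambda>y. (inv x, y))"
          using x by (auto simp: continuous_map_pairwise o_def topspace_eq)
        from continuous_map_compose[OF this continuous_mult] show ?thesis by (simp add: o_def)
      qed
      then have "openin T {y \<in> topspace T. inv x \<otimes> y \<in> V}"
        using V openin_continuous_map_preimage by blast
      moreover have "x \<in> {y \<in> topspace T. inv x \<otimes> y \<in> V}"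
        using x V by (simp add: topspace_eq)
      moreover have "{y \<in> topspace T. inv x \<otimes> y \<in> V} \<subseteq> {x \<in> topspace T. f x \<in> W}"
      proof clarify
        fix y assume y: "y \<in> topspace T" "inv x \<otimes> y \<in> V"
        have yc: "y \<in> carrier G" using y by (simp add: topspace_eq)
        have "(\<lambda>i. inv x \<otimes> y) \<in> small_nets G P F Q e"
          using y yc x const U unfolding V_def small_nets_def by simp
        from QW[OF this] have "B.K #>\<^bsub>?S\<^esub> (\<lambda>i. x \<otimes> (inv x \<otimes> y)) \<in> W" by (simp add: mult)
        then show "f y \<in> W" using x yc by (simp add: f_def inv_mult_cancel_left)
      qed
      ultimately show "\<exists>Ta. openin T Ta \<and> x \<in> Ta \<and> Ta \<subseteq> {x \<in> topspace T. f x \<in> W}" by blast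
    qed
  qed
  ultimately have "f \<in> continuous_hom G T ?H ?R" by (simp add: continuous_hom_def)
  then have closed: "closedin ?R (f ` carrier G)"
    by (rule hTG_closed_any_type[OF topological_group_axioms h H.topological_group_axioms])
  have "B.K #>\<^bsub>?S\<^esub> s \<in> ?R closure_of (f ` carrier G)"
    unfolding in_closure_of
  proof (intro conjI allI impI)
    show "B.K #>\<^bsub>?S\<^esub> s \<in> topspace ?R"
      using sS B.carrier_coset by (auto simp: B.topspace_coset_topology)
    fix W assume W: "B.K #>\<^bsub>?S\<^esub> s \<in> W \<and> openin ?R W"
    obtain Q e where Q: "finite Q" "Q \<subseteq> P" "e > 0"
      and QW: "\<And>u. u \<in> small_nets G P F Q e \<Longrightarrow> B.K #>\<^bsub>?S\<^esub> (s \<otimes>\<^bsub>?S\<^esub> u) \<in> W"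
      using B.coset_openD[OF conjunct2[OF W] sS conjunct1[OF W]] by force
    have "\<forall>q\<in>Q. \<exists>A. eventually A F \<and> (\<forall>i j. A i \<longrightarrow> A j \<longrightarrow> q (inv s i \<otimes> s j) < e)"
      using s(2) Q unfolding cauchy_net_def by blast
    from bchoice[OF this] obtain A where
      "\<forall>q\<in>Q. eventually (A q) F \<and> (\<forall>i j. A q i \<longrightarrow> A q j \<longrightarrow> q (inv s i \<otimes> s j) < e)" ..
    then have A: "\<And>q. q \<in> Q \<Longrightarrow> eventually (A q) F"
      "\<And>q i j. q \<in> Q \<Longrightarrow> A q i \<Longrightarrow> A q j \<Longrightarrow> q (inv s i \<otimes> s j) < e"
      by auto
    have ev: "eventually (\<lambda>i. \<forall>q\<in>Q. A q i) F"
      using Q(1) A(1) by (simp add: eventually_ball_finite)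
    then obtain j where j: "\<forall>q\<in>Q. A q j"
      using eventually_happens'[OF F ev] by blast
    \<comment> \<open>The constant net with value \<open>s j\<close> is close to \<open>s\<close> when \<open>j\<close> is late.\<close>
    have "inv\<^bsub>?S\<^esub> s \<otimes>\<^bsub>?S\<^esub> (\<lambda>i. s j) \<in> small_nets G P F Q e"
      unfolding small_nets_def
    proof (intro CollectI conjI ballI)
      show "inv\<^bsub>?S\<^esub> s \<otimes>\<^bsub>?S\<^esub> (\<lambda>i. s j) \<in> carrier ?S"
        using const[OF s(1)] sS by simp
      fix q assume "q \<in> Q"
      then show "\<forall>\<^sub>F i in F. q ((inv\<^bsub>?S\<^esub> s \<otimes>\<^bsub>?S\<^esub> (\<lambda>i. s j)) i) < e"
        unfolding sx using j A(2) by (intro eventually_mono[OF A(1)]) auto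
    qed
    from QW[OF this] have "f (s j) \<in> W"
      using B.inv_mult_cancel_left(2)[OF sS const[OF s(1)]] by (simp add: f_def)
    then show "\<exists>y. y \<in> f ` carrier G \<and> y \<in> W" using s(1) by blast
  qed
  then have "B.K #>\<^bsub>?S\<^esub> s \<in> f ` carrier G"
    unfolding closure_of_closedin[OF closed] .
  then obtain x where x: "B.K #>\<^bsub>?S\<^esub> s = f x" "x \<in> carrier G" ..
  have k: "inv\<^bsub>?S\<^esub> s \<otimes>\<^bsub>?S\<^esub> (\<lambda>i. x) \<in> B.K"
    by (rule B.coset_eq_iff[OF sS const[OF x(2)], THEN iffD1, OF x(1)[unfolded f_def]])
  show thesis
  proof (rule that[OF x(2)])
    fix q and e :: real assume "q \<in> P" "e > 0"
    then have "inv\<^bsub>?S\<^esub> s \<otimes>\<^bsub>?S\<^esub> (\<lambda>i. x) \<in> small_nets G P F {q} e"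
      by (intro InterD[OF k] CollectI exI[of _ "{q}"] exI[of _ e]) auto
    then show "eventually (\<lambda>i. q (inv s i \<otimes> x) < e) F"
      unfolding sx small_nets_def by blast
  qed
qed

end

section \<open>Invariant pseudonorms from invariant neighbourhoods\<close>

context topological_group
begin

lemma continuous_map_mult:
  assumes "continuous_map X T f" "continuous_map X T g"
  shows "continuous_map X T (\<lambda>x. f x \<otimes> g x)"
proof -
  have "continuous_map X (prod_topology T T) (\<lambda>x. (f x, g x))"
    using assms by (simp add: continuous_map_pairwise o_def)
  from continuous_map_compose[OF this continuous_mult] show ?thesis
    by (simp add: o_def)
qed

lemma continuous_map_inv:
  assumes "continuous_map X T f"
  shows "continuous_map X T (\<lambda>x. inv f x)"
  using continuous_map_compose[OF assms continuous_inv] by (simp add: o_def)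

lemma continuous_map_const_carrier: "a \<in> carrier G \<Longrightarrow> continuous_map X T (\<lambda>x. a)"
  by (simp add: topspace_eq)

lemmas continuous_group_intros =
  continuous_map_mult continuous_map_inv continuous_map_const_carrier continuous_map_id[unfolded id_def]

lemma openin_carrier: "openin T U \<Longrightarrow> U \<subseteq> carrier G"
  using openin_subset topspace_eq by blast

lemma open_square_root:
  assumes "openin T U" "\<one> \<in> U"
  obtains V where "openin T V" "\<one> \<in> V" "\<And>x y. x \<in> V \<Longrightarrow> y \<in> V \<Longrightarrow> x \<otimes> y \<in> U"
proof -
  let ?M = "{p \<in> topspace (prod_topology T T). (case p of (x, y) \<Rightarrow> x \<otimes> y) \<in> U}"
  have "openin (prod_topology T T) ?M"
    using openin_continuous_map_preimage[OF continuous_mult assms(1)] .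
  moreover have "(\<one>, \<one>) \<in> ?M"
    using assms by (simp add: topspace_eq)
  ultimately have "\<exists>A B. openin T A \<and> openin T B \<and> \<one> \<in> A \<and> \<one> \<in> B \<and> A \<times> B \<subseteq> ?M"
    by (rule openin_prod_topology_alt[THEN iffD1, rule_format])
  then obtain A B where AB: "openin T A" "openin T B" "\<one> \<in> A" "\<one> \<in> B" "A \<times> B \<subseteq> ?M"
    by (elim exE conjE)
  show thesis
  proof (rule that[of "A \<inter> B"])
    show "x \<otimes> y \<in> U" if "x \<in> A \<inter> B" "y \<in> A \<inter> B" for x y
      using subsetD[OF AB(5), of "(x, y)"] that by simp
  qed (use AB in auto)
qed

text \<open>In a balanced group these neighbourhoods form a base at the unit.\<close>

definition invariant_nbhd :: "'a set \<Rightarrow> bool" where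
  "invariant_nbhd A \<longleftrightarrow> A \<subseteq> carrier G \<and> (\<exists>W. openin T W \<and> \<one> \<in> W \<and> W \<subseteq> A) \<and>
     (\<forall>a\<in>A. inv a \<in> A) \<and> (\<forall>x\<in>carrier G. \<forall>a\<in>A. x \<otimes> a \<otimes> inv x \<in> A)"

lemma balanced_invariant_nbhd:
  assumes bal: "balanced_group G T" and U: "openin T U" "\<one> \<in> U"
  obtains A where "invariant_nbhd A" "A \<subseteq> U"
proof -
  define A where "A = {a \<in> carrier G. \<forall>x\<in>carrier G. x \<otimes> a \<otimes> inv x \<in> U \<and> x \<otimes> inv a \<otimes> inv x \<in> U}"
  have "unit_neighbourhood G T U"
    using U openin_carrier by (auto simp: unit_neighbourhood_def)
  then obtain V where V: "unit_neighbourhood G T V" "\<forall>x\<in>carrier G. x <# V \<subseteq> U #> x"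
    using bal unfolding balanced_group_def by blast
  then obtain W where W: "openin T W" "\<one> \<in> W" "W \<subseteq> V"
    unfolding unit_neighbourhood_def by blast
  have conj: "x \<otimes> w \<otimes> inv x \<in> U" if x: "x \<in> carrier G" and w: "w \<in> W" for x w
  proof -
    have "x \<otimes> w \<in> U #> x"
      using V(2) W(3) x w by (auto simp: l_coset_def)
    then obtain u where u: "u \<in> U" "x \<otimes> w = u \<otimes> x"
      by (auto simp: r_coset_def)
    have "u \<in> carrier G" "w \<in> carrier G"
      using u w openin_carrier[OF U(1)] openin_carrier[OF W(1)] by auto
    then have "x \<otimes> w \<otimes> inv x = u"
      unfolding u(2) using x by (simp add: word_simps)
    then show ?thesis using u by simp
  qed
  define W' where "W' = W \<inter> {x \<in> topspace T. inv x \<in> W}"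
  have "openin T W'"
    unfolding W'_def using openin_continuous_map_preimage[OF continuous_inv W(1)] W(1) by blast
  moreover have "\<one> \<in> W'"
    using W by (simp add: W'_def topspace_eq)
  moreover have "W' \<subseteq> A"
    unfolding W'_def A_def using conj openin_carrier[OF W(1)] by auto
  moreover have "inv a \<in> A" if "a \<in> A" for a
    using that by (auto simp: A_def)
  moreover have "x \<otimes> a \<otimes> inv x \<in> A" if x: "x \<in> carrier G" and a: "a \<in> A" for x a
  proof -
    have ac: "a \<in> carrier G" using a by (simp add: A_def)
    have "y \<otimes> (x \<otimes> a \<otimes> inv x) \<otimes> inv y = (y \<otimes> x) \<otimes> a \<otimes> inv (y \<otimes> x)"
      "y \<otimes> inv (x \<otimes> a \<otimes> inv x) \<otimes> inv y = (y \<otimes> x) \<otimes> inv a \<otimes> inv (y \<otimes> x)" if "y \<in> carrier G" for y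
      using that x ac by (simp_all add: word_simps)
    then show ?thesis
      using a x ac by (simp add: A_def)
  qed
  moreover have "A \<subseteq> U"
  proof
    fix a assume "a \<in> A"
    then have "\<one> \<otimes> a \<otimes> inv \<one> \<in> U" "a \<in> carrier G" unfolding A_def by blast+
    then show "a \<in> U" by simp
  qed
  ultimately show thesis
    by (intro that[of A]) (auto simp: invariant_nbhd_def A_def)
qed

end

text \<open>A list of nonnegative weights can be cut at one entry so that what precedes it weighs at most \<open>t\<close> and what follows it at most the rest.\<close>

lemma split_sum_list:
  fixes w :: "'b \<Rightarrow> real"
  assumes "xs \<noteq> []" "0 \<le> t" "t \<le> sum_list (map w xs)" "\<And>x. 0 \<le> w x"
  shows "\<exists>ys x zs. xs = ys @ x # zs \<and> sum_list (map w ys) \<le> t \<and>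
    sum_list (map w zs) \<le> sum_list (map w xs) - t"
  using assms(1-3)
proof (induction xs arbitrary: t)
  case (Cons a xs)
  show ?case
  proof (cases "t \<le> w a")
    case True
    then show ?thesis
      using Cons.prems by (intro exI[of _ "[]"] exI[of _ a] exI[of _ xs]) simp
  next
    case False
    then have "xs \<noteq> []" "0 \<le> t - w a" "t - w a \<le> sum_list (map w xs)"
      using Cons.prems by auto
    from Cons.IH[OF this] obtain ys x zs where "xs = ys @ x # zs" "sum_list (map w ys) \<le> t - w a"
      "sum_list (map w zs) \<le> sum_list (map w xs) - (t - w a)" by blast
    then show ?thesis
      by (intro exI[of _ "a # ys"] exI[of _ x] exI[of _ zs]) simp
  qed
qed simp

text \<open>The hypotheses of the Birkhoff--Kakutani construction in its conjugation invariant form.  The triple product in \<open>chain_mult\<close> fits the cut of a word into prefix, letter and suffix.\<close>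

locale nbhd_chain = group +
  fixes A :: "nat \<Rightarrow> 'a set"
  assumes chain_carrier: "A n \<subseteq> carrier G"
    and chain_one: "\<one> \<in> A n"
    and chain_inv: "a \<in> A n \<Longrightarrow> inv a \<in> A n"
    and chain_conj: "x \<in> carrier G \<Longrightarrow> a \<in> A n \<Longrightarrow> x \<otimes> a \<otimes> inv x \<in> A n"
    and chain_mult: "x \<in> A (Suc n) \<Longrightarrow> y \<in> A (Suc n) \<Longrightarrow> z \<in> A (Suc n) \<Longrightarrow> x \<otimes> y \<otimes> z \<in> A n"
begin

text \<open>Letters carry the index of a set that contains them; the index determines their weight.\<close>

definition words :: "(nat \<times> 'a) list set" where
  "words = {ws. \<forall>(n, a)\<in>set ws. a \<in> A n}"

definition word_prod :: "(nat \<times> 'a) list \<Rightarrow> 'a" where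
  "word_prod ws = foldr (\<otimes>) (map snd ws) \<one>"

definition weight :: "(nat \<times> 'a) list \<Rightarrow> real" where
  "weight ws = sum_list (map (\<lambda>(n, a). (1/2) ^ n) ws)"

text \<open>The infimum of the weights of all words for \<open>x\<close>.  The cap at \<open>1\<close> keeps it meaningful for elements without any such word.\<close>

definition chain_norm :: "'a \<Rightarrow> real" where
  "chain_norm x = Inf (insert 1 {weight ws | ws. ws \<in> words \<and> word_prod ws = x})"

lemma words_simps [simp]: "[] \<in> words" "(n, a) # ws \<in> words \<longleftrightarrow> a \<in> A n \<and> ws \<in> words"
  "us @ vs \<in> words \<longleftrightarrow> us \<in> words \<and> vs \<in> words"
  by (auto simp: words_def)

lemma word_prod_simps [simp]: "word_prod [] = \<one>" "word_prod ((n, a) # ws) = a \<otimes> word_prod ws"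
  by (simp_all add: word_prod_def)

lemma weight_simps [simp]: "weight [] = 0" "weight ((n, a) # ws) = (1/2) ^ n + weight ws"
  "weight (us @ vs) = weight us + weight vs"
  by (simp_all add: weight_def)

lemma weight_nonneg: "0 \<le> weight ws"
  unfolding weight_def by (rule sum_list_nonneg) auto

lemma chain_in_carrier: "a \<in> A n \<Longrightarrow> a \<in> carrier G"
  using chain_carrier by blast

lemma word_prod_carrier: "ws \<in> words \<Longrightarrow> word_prod ws \<in> carrier G"
  by (induction ws) (auto simp: chain_in_carrier)

lemma word_prod_append: "us \<in> words \<Longrightarrow> vs \<in> words \<Longrightarrow> word_prod (us @ vs) = word_prod us \<otimes> word_prod vs"
  by (induction us) (auto simp: chain_in_carrier word_prod_carrier m_assoc)

lemma chain_antimono: "m \<le> n \<Longrightarrow> A n \<subseteq> A m"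
proof (induction rule: dec_induct)
  case (step k)
  have "x \<in> A k" if "x \<in> A (Suc k)" for x
    using chain_mult[OF that chain_one chain_one] that by (simp add: chain_in_carrier)
  with step show ?case by blast
qed simp

text \<open>Cut the word where half of its weight is reached: prefix and suffix both weigh at most half, and the letter in between has weight below \<open>(1/2)^n\<close>.  So all three parts lie in \<open>A (Suc n)\<close>, the outer two by induction.\<close>

lemma short_word:
  assumes "ws \<in> words" "weight ws < (1/2) ^ n"
  shows "word_prod ws \<in> A n"
  using assms
proof (induction "length ws" arbitrary: ws n rule: less_induct)
  case less
  show ?case
  proof (cases "ws = []")
    case True
    then show ?thesis by (simp add: chain_one)
  next
    case False
    let ?w = "\<lambda>(n, a::'a). (1/2::real) ^ n"
    have "\<exists>ys x zs. ws = ys @ x # zs \<and> sum_list (map ?w ys) \<le> weight ws / 2 \<and>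
        sum_list (map ?w zs) \<le> sum_list (map ?w ws) - weight ws / 2"
      by (rule split_sum_list[OF False])
        (use weight_nonneg[of ws] in \<open>simp_all add: weight_def[symmetric] split_beta\<close>)
    then obtain us x vs where split: "ws = us @ x # vs" "weight us \<le> weight ws / 2"
      "weight vs \<le> weight ws / 2"
      by (auto simp: weight_def[symmetric])
    obtain k a where x: "x = (k, a)" by (cases x)
    have ws: "ws = us @ (k, a) # vs"
      and us: "weight us \<le> weight ws / 2" and vs: "weight vs \<le> weight ws / 2"
      using split x by simp_all
    have words: "us \<in> words" "a \<in> A k" "vs \<in> words"
      using less.prems(1) by (auto simp: ws)
    have "weight ws = weight us + (1/2) ^ k + weight vs"
      unfolding ws by simp
    then have "(1/2::real) ^ k < (1/2) ^ n"
      using less.prems(2) weight_nonneg[of us] weight_nonneg[of vs] by linarith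
    then have "Suc n \<le> k"
      using power_strict_decreasing_iff[of "1/2::real" k n] by linarith
    then have "a \<in> A (Suc n)" using chain_antimono words by blast
    have half: "weight ws / 2 < (1/2) ^ Suc n"
      using less.prems(2) unfolding power_Suc by linarith
    have short: "word_prod vs' \<in> A (Suc n)"
      if "length vs' < length ws" "vs' \<in> words" "weight vs' \<le> weight ws / 2" for vs'
      using less.hyps[OF that(1,2)] that(3) half by (meson le_less_trans)
    have "word_prod us \<in> A (Suc n)"
      by (rule short[OF _ words(1) us]) (simp add: ws)
    moreover have "word_prod vs \<in> A (Suc n)"
      by (rule short[OF _ words(3) vs]) (simp add: ws)
    moreover note \<open>a \<in> A (Suc n)\<close>
    ultimately have "word_prod us \<otimes> a \<otimes> word_prod vs \<in> A n"
      by (intro chain_mult)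
    then show ?thesis
      using words by (simp add: ws word_prod_append word_prod_carrier chain_in_carrier m_assoc)
  qed
qed

lemma word_weights_bdd_below: "bdd_below (insert 1 {weight ws | ws. ws \<in> words \<and> word_prod ws = x})"
  by (rule bdd_belowI[of _ 0]) (auto simp: weight_nonneg)

lemma chain_norm_le: "ws \<in> words \<Longrightarrow> chain_norm (word_prod ws) \<le> weight ws" "chain_norm x \<le> 1"
  unfolding chain_norm_def by (rule cInf_lower[OF _ word_weights_bdd_below]; blast)+

lemma chain_norm_less:
  assumes "chain_norm x < e"
  shows "1 < e \<or> (\<exists>ws\<in>words. word_prod ws = x \<and> weight ws < e)"
proof -
  obtain t where "t \<in> insert 1 {weight ws | ws. ws \<in> words \<and> word_prod ws = x}" "t < e"
    using cInf_lessD[OF _ assms[unfolded chain_norm_def]] by blast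
  then show ?thesis by auto
qed

lemma chain_norm_mono:
  assumes "\<And>ws. ws \<in> words \<Longrightarrow> word_prod ws = x \<Longrightarrow>
    \<exists>vs\<in>words. word_prod vs = y \<and> weight vs \<le> weight ws"
  shows "chain_norm y \<le> chain_norm x"
proof (rule ccontr)
  assume "\<not> chain_norm y \<le> chain_norm x"
  then have "chain_norm x < chain_norm y" by simp
  from chain_norm_less[OF this] chain_norm_le(2)[of y]
  obtain ws where "ws \<in> words" "word_prod ws = x" "weight ws < chain_norm y" by auto
  with assms[of ws] obtain vs where "vs \<in> words" "word_prod vs = y" "weight vs < chain_norm y"
    by fastforce
  then show False using chain_norm_le(1)[of vs] by simp
qed

lemma word_inverse:
  "ws \<in> words \<Longrightarrow> \<exists>vs\<in>words. word_prod vs = inv (word_prod ws) \<and> weight vs \<le> weight ws"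
proof (induction ws)
  case (Cons p ws)
  obtain n a where p: "p = (n, a)" by fastforce
  from Cons obtain vs where vs: "vs \<in> words" "word_prod vs = inv (word_prod ws)" "weight vs \<le> weight ws"
    by (auto simp: p)
  show ?case
    using Cons.prems vs chain_inv
    by (intro bexI[of _ "vs @ [(n, inv a)]"])
      (auto simp: p word_prod_append chain_in_carrier word_prod_carrier inv_mult_group)
qed (auto intro: bexI[of _ "[]"])

lemma word_conj:
  assumes x: "x \<in> carrier G"
  shows "ws \<in> words \<Longrightarrow> \<exists>vs\<in>words. word_prod vs = x \<otimes> word_prod ws \<otimes> inv x \<and> weight vs \<le> weight ws"
proof (induction ws)
  case (Cons p ws)
  obtain n a where p: "p = (n, a)" by fastforce
  from Cons obtain vs where vs: "vs \<in> words" "word_prod vs = x \<otimes> word_prod ws \<otimes> inv x"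
    "weight vs \<le> weight ws"
    by (auto simp: p)
  show ?case
    using Cons.prems vs chain_conj[OF x] x
    by (intro bexI[of _ "(n, x \<otimes> a \<otimes> inv x) # vs"])
      (auto simp: p chain_in_carrier word_prod_carrier word_simps)
qed (use x in \<open>auto intro: bexI[of _ "[]"]\<close>)

lemma chain_norm:
  "pseudonorm G (carrier G) chain_norm" "conj_invariant G (carrier G) chain_norm"
  "a \<in> A n \<Longrightarrow> chain_norm a \<le> (1/2) ^ n"
  "chain_norm x < 1 \<Longrightarrow> x \<in> A 0"
proof -
  have nonneg: "0 \<le> chain_norm x" for x
    unfolding chain_norm_def by (rule cInf_greatest) (auto simp: weight_nonneg)
  have one: "chain_norm \<one> = 0"
    using chain_norm_le(1)[of "[]"] nonneg[of \<one>] by simp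
  have inv_le: "chain_norm (inv x) \<le> chain_norm x" for x
    by (rule chain_norm_mono) (use word_inverse in blast)
  have inv: "chain_norm (inv x) = chain_norm x" if "x \<in> carrier G" for x
    using inv_le[of x] inv_le[of "inv x"] that by simp
  have triangle: "chain_norm (x \<otimes> y) \<le> chain_norm x + chain_norm y" for x y
  proof (rule ccontr)
    assume "\<not> chain_norm (x \<otimes> y) \<le> chain_norm x + chain_norm y"
    then obtain e where e: "chain_norm x < e" "chain_norm y < chain_norm (x \<otimes> y) - e"
      by (metis add.commute dense less_diff_eq not_le_imp_less)
    have "e \<le> 1" "chain_norm (x \<otimes> y) - e \<le> 1"
      using chain_norm_le(2)[of "x \<otimes> y"] nonneg[of x] nonneg[of y] e by linarith+
    then obtain us vs where "us \<in> words" "word_prod us = x" "weight us < e"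
      "vs \<in> words" "word_prod vs = y" "weight vs < chain_norm (x \<otimes> y) - e"
      using chain_norm_less[OF e(1)] chain_norm_less[OF e(2)] by auto
    then show False
      using chain_norm_le(1)[of "us @ vs"] by (simp add: word_prod_append)
  qed
  show "pseudonorm G (carrier G) chain_norm"
    using nonneg one inv triangle by (simp add: pseudonorm_def)
  have conj_le: "chain_norm (x \<otimes> a \<otimes> inv x) \<le> chain_norm a" if "x \<in> carrier G" for x a
    by (rule chain_norm_mono) (use word_conj[OF that] in blast)
  show "conj_invariant G (carrier G) chain_norm"
    unfolding conj_invariant_def
  proof (intro ballI antisym)
    fix x a assume xa: "x \<in> carrier G" "a \<in> carrier G"
    have "inv x \<otimes> (x \<otimes> a \<otimes> inv x) \<otimes> inv (inv x) = a"
      using xa by (simp add: word_simps)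
    then show "chain_norm a \<le> chain_norm (x \<otimes> a \<otimes> inv x)"
      using conj_le[of "inv x" "x \<otimes> a \<otimes> inv x"] xa by simp
  qed (rule conj_le)
  show "chain_norm a \<le> (1/2) ^ n" if "a \<in> A n"
    using chain_norm_le(1)[of "[(n, a)]"] that by (simp add: chain_in_carrier)
  show "x \<in> A 0" if "chain_norm x < 1"
    using chain_norm_less[OF that] short_word[of _ 0] by auto
qed

end

text \<open>Invariant pseudonorms define the topology of a balanced group: a chain of invariant neighbourhoods below \<open>U\<close> gives one whose open unit ball lies in \<open>U\<close>.\<close>

lemma (in topological_group) balanced_norm:
  assumes bal: "balanced_group G T" and U: "openin T U" "\<one> \<in> U"
  obtains q where "q \<in> norms G T (carrier G)" "\<And>x. q x < 1 \<Longrightarrow> x \<in> U"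
proof -
  have step: "\<exists>B. invariant_nbhd B \<and> (\<forall>x\<in>B. \<forall>y\<in>B. \<forall>z\<in>B. x \<otimes> y \<otimes> z \<in> A)" if A: "invariant_nbhd A" for A
  proof -
    obtain W where W: "openin T W" "\<one> \<in> W" "W \<subseteq> A" using A unfolding invariant_nbhd_def by blast
    obtain V where V: "openin T V" "\<one> \<in> V" "\<And>x y. x \<in> V \<Longrightarrow> y \<in> V \<Longrightarrow> x \<otimes> y \<in> W"
      using open_square_root[OF W(1,2)] by blast
    obtain V' where V': "openin T V'" "\<one> \<in> V'" "\<And>x y. x \<in> V' \<Longrightarrow> y \<in> V' \<Longrightarrow> x \<otimes> y \<in> V"
      using open_square_root[OF V(1,2)] by blast
    obtain B where B: "invariant_nbhd B" "B \<subseteq> V'"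
      using balanced_invariant_nbhd[OF bal V'(1,2)] by blast
    have "x \<otimes> y \<otimes> z \<in> A" if "x \<in> B" "y \<in> B" "z \<in> B" for x y z
    proof -
      have z: "z \<in> carrier G" "z \<in> V'" using that B openin_carrier[OF V'(1)] by auto
      then have "z \<in> V" using V'(3)[OF z(2) V'(2)] by simp
      moreover have "x \<otimes> y \<in> V" using V'(3) that B by blast
      ultimately show ?thesis using V(3) W(3) by blast
    qed
    then show ?thesis using B by blast
  qed
  obtain A0 where A0: "invariant_nbhd A0" "A0 \<subseteq> U"
    using balanced_invariant_nbhd[OF bal U] by blast
  have "\<exists>A. A 0 = A0 \<and> (\<forall>n. invariant_nbhd (A n) \<and> (\<forall>x\<in>A (Suc n). \<forall>y\<in>A (Suc n). \<forall>z\<in>A (Suc n). x \<otimes> y \<otimes> z \<in> A n))"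
  proof -
    define A where "A = rec_nat A0 (\<lambda>_ A. SOME B. invariant_nbhd B \<and> (\<forall>x\<in>B. \<forall>y\<in>B. \<forall>z\<in>B. x \<otimes> y \<otimes> z \<in> A))"
    have S: "invariant_nbhd (A (Suc n)) \<and> (\<forall>x\<in>A (Suc n). \<forall>y\<in>A (Suc n). \<forall>z\<in>A (Suc n). x \<otimes> y \<otimes> z \<in> A n)"
      if "invariant_nbhd (A n)" for n
      using someI_ex[OF step[OF that]] by (simp add: A_def)
    have "invariant_nbhd (A n)" for n
      by (induction n) (use S A0 in \<open>auto simp: A_def\<close>)
    then show ?thesis using S by (intro exI[of _ A]) (auto simp: A_def)
  qed
  then obtain A where A: "A 0 = A0" "\<And>n. invariant_nbhd (A n)"
    "\<And>n x y z. x \<in> A (Suc n) \<Longrightarrow> y \<in> A (Suc n) \<Longrightarrow> z \<in> A (Suc n) \<Longrightarrow> x \<otimes> y \<otimes> z \<in> A n"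
    by blast
  have A': "A n \<subseteq> carrier G" "\<one> \<in> A n" "a \<in> A n \<Longrightarrow> inv a \<in> A n"
    "x \<in> carrier G \<Longrightarrow> a \<in> A n \<Longrightarrow> x \<otimes> a \<otimes> inv x \<in> A n" for n a x
    using A(2)[of n] by (auto simp: invariant_nbhd_def)
  have "nbhd_chain_axioms G A"
    unfolding nbhd_chain_axioms_def
  proof (intro conjI allI impI)
    fix n a x y z
    show "A n \<subseteq> carrier G" "\<one> \<in> A n" by (rule A')+
    show "a \<in> A n \<Longrightarrow> inv a \<in> A n" by (rule A'(3))
    show "x \<in> carrier G \<Longrightarrow> a \<in> A n \<Longrightarrow> x \<otimes> a \<otimes> inv x \<in> A n" by (rule A'(4))
    show "x \<in> A (Suc n) \<Longrightarrow> y \<in> A (Suc n) \<Longrightarrow> z \<in> A (Suc n) \<Longrightarrow> x \<otimes> y \<otimes> z \<in> A n"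
      by (rule A(3))
  qed
  then interpret chain: nbhd_chain G A
    using is_group by (simp add: nbhd_chain_def)
  have "small_near_one G T (carrier G) chain.chain_norm"
    unfolding small_near_one_def
  proof (intro allI impI)
    fix e :: real assume "e > 0"
    then obtain n where n: "(1/2::real) ^ n < e"
      using real_arch_pow_inv[of e "1/2"] by auto
    obtain W where "openin T W" "\<one> \<in> W" "W \<subseteq> A n"
      using A(2)[of n] unfolding invariant_nbhd_def by blast
    then show "\<exists>U. openin T U \<and> \<one> \<in> U \<and> (\<forall>x\<in>U \<inter> carrier G. chain.chain_norm x < e)"
      using chain.chain_norm(3)[of _ n] n by (intro exI[of _ W]) fastforce
  qed
  then have "chain.chain_norm \<in> norms G T (carrier G)"
    using chain.chain_norm by (simp add: norms_def)
  moreover have "x \<in> U" if "chain.chain_norm x < 1" for x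
    using chain.chain_norm(4)[OF that] A(1) A0(2) by blast
  ultimately show thesis by (rule that)
qed

section \<open>Completeness of closed normal subgroups\<close>

text \<open>The largest pseudonorm that is at most \<open>r\<close> on \<open>H\<close> and at most \<open>q\<close>; for \<open>r = 0\<close> it is the \<open>q\<close>-distance from \<open>H\<close>.\<close>

definition inf_conv ::
    "('a, 'm) monoid_scheme \<Rightarrow> 'a set \<Rightarrow> ('a \<Rightarrow> real) \<Rightarrow> ('a \<Rightarrow> real) \<Rightarrow> 'a \<Rightarrow> real" where
  "inf_conv G H r q x = (INF h\<in>H. r h + q (inv\<^bsub>G\<^esub> h \<otimes>\<^bsub>G\<^esub> x))"

context topological_group
begin

lemma
  assumes H: "H \<lhd> G" and B: "B \<lhd> G" and HB: "H \<subseteq> B"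
    and r: "r \<in> norms G T H" and q: "q \<in> norms G T B"
  shows inf_conv_norm: "inf_conv G H r q \<in> norms G T B"
    and inf_conv_le: "x \<in> B \<Longrightarrow> inf_conv G H r q x \<le> q x"
      "x \<in> H \<Longrightarrow> inf_conv G H r q x \<le> r x"
    and inf_conv_less: "inf_conv G H r q x < e \<Longrightarrow> \<exists>h\<in>H. r h + q (inv h \<otimes> x) < e"
proof -
  interpret H: normal H G by fact
  interpret B: normal B G by fact
  note rn = normsD[OF r] and qn = normsD[OF q]
  note Hc = H.subset[THEN subsetD] and Bc = B.subset[THEN subsetD]
  let ?c = "inf_conv G H r q"
  have term_nonneg: "0 \<le> r h + q (inv h \<otimes> x)" if "h \<in> H" "x \<in> B" for h x
    using pseudonormD(1)[OF rn(1), of h] pseudonormD(1)[OF qn(1), of "inv h \<otimes> x"] that HB by auto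
  have le: "?c x \<le> r h + q (inv h \<otimes> x)" if "h \<in> H" "x \<in> B" for h x
    unfolding inf_conv_def using that term_nonneg
    by (intro cINF_lower bdd_belowI2[of _ 0]) auto
  show less: "\<exists>h\<in>H. r h + q (inv h \<otimes> x) < e" if "?c x < e" for x e
  proof -
    have "H \<noteq> {}" using H.one_closed by blast
    then have "\<exists>y\<in>(\<lambda>h. r h + q (inv h \<otimes> x)) ` H. y < e"
      using that unfolding inf_conv_def by (intro cInf_lessD) auto
    then show ?thesis by blast
  qed
  have mono: "?c y \<le> ?c x"
    if step: "\<And>h. h \<in> H \<Longrightarrow> \<exists>k\<in>H. r k + q (inv k \<otimes> y) \<le> r h + q (inv h \<otimes> x)" and y: "y \<in> B" for x y
  proof (rule ccontr)
    assume "\<not> ?c y \<le> ?c x"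
    then obtain h where h: "h \<in> H" "r h + q (inv h \<otimes> x) < ?c y"
      using less[of x "?c y"] by auto
    then obtain k where "k \<in> H" "r k + q (inv k \<otimes> y) < ?c y"
      using step[of h] by force
    then show False using le[OF _ y, of k] by simp
  qed
  show le_q: "?c x \<le> q x" if "x \<in> B" for x
    using le[OF H.one_closed that] pseudonormD(2)[OF rn(1)] Bc[OF that] by simp
  show "?c x \<le> r x" if "x \<in> H" for x
    using le[OF that, of x] pseudonormD(2)[OF qn(1)] Hc[OF that] that HB by auto
  have nonneg: "0 \<le> ?c x" if "x \<in> B" for x
  proof -
    have "H \<noteq> {}" using H.one_closed by blast
    then show ?thesis
      unfolding inf_conv_def using term_nonneg[OF _ that] by (intro cINF_greatest) auto
  qed
  have "pseudonorm G B ?c"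
    unfolding pseudonorm_def
  proof (intro conjI ballI)
    show "?c \<one> = 0"
      using le_q[OF B.one_closed] nonneg[OF B.one_closed] pseudonormD(2)[OF qn(1)] by simp
    have inv_le: "?c (inv x) \<le> ?c x" if x: "x \<in> B" for x
    proof (rule mono)
      fix h assume h: "h \<in> H"
      have hB: "h \<in> B" using h HB by blast
      have "q (inv (inv h) \<otimes> inv x) = q (inv h \<otimes> x)"
        by (rule norm_dist_inv[OF qn(1,2) B.subgroup_axioms hB x])
      then show "\<exists>k\<in>H. r k + q (inv k \<otimes> inv x) \<le> r h + q (inv h \<otimes> x)"
        using h pseudonormD(3)[OF rn(1) h] by (intro bexI[of _ "inv h"]) auto
    qed (use x in auto)
    show "?c (inv x) = ?c x" if x: "x \<in> B" for x
      using inv_le[OF x] inv_le[of "inv x"] x Bc[OF x] by simp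
    show "?c (x \<otimes> y) \<le> ?c x + ?c y" if x: "x \<in> B" and y: "y \<in> B" for x y
    proof (rule ccontr)
      assume "\<not> ?c (x \<otimes> y) \<le> ?c x + ?c y"
      then have "?c x < ?c (x \<otimes> y) - ?c y" by linarith
      then obtain h where h: "h \<in> H" "r h + q (inv h \<otimes> x) < ?c (x \<otimes> y) - ?c y"
        using less by blast
      then have "?c y < ?c (x \<otimes> y) - (r h + q (inv h \<otimes> x))" by linarith
      then obtain k where k: "k \<in> H" "r k + q (inv k \<otimes> y) < ?c (x \<otimes> y) - (r h + q (inv h \<otimes> x))"
        using less by blast
      have "q (inv (h \<otimes> k) \<otimes> (x \<otimes> y)) \<le> q (inv h \<otimes> x) + q (inv k \<otimes> y)"
        using h k HB x y by (intro norm_dist_mult[OF qn(1,2) B.subgroup_axioms]) auto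
      moreover have "r (h \<otimes> k) \<le> r h + r k"
        using pseudonormD(4)[OF rn(1)] h k by blast
      moreover have "?c (x \<otimes> y) \<le> r (h \<otimes> k) + q (inv (h \<otimes> k) \<otimes> (x \<otimes> y))"
        using h k x y by (intro le) auto
      ultimately show False using k(2) by linarith
    qed
  qed (rule nonneg)
  moreover have "conj_invariant G B ?c"
  proof -
    have conj_le: "?c (y \<otimes> x \<otimes> inv y) \<le> ?c x" if y: "y \<in> carrier G" and x: "x \<in> B" for x y
    proof (rule mono)
      fix h assume h: "h \<in> H"
      have "inv (y \<otimes> h \<otimes> inv y) \<otimes> (y \<otimes> x \<otimes> inv y) = y \<otimes> (inv h \<otimes> x) \<otimes> inv y"
        using Hc[OF h] Bc[OF x] y by (simp add: word_simps)
      moreover have "inv h \<otimes> x \<in> B" using h x HB by auto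
      ultimately have "q (inv (y \<otimes> h \<otimes> inv y) \<otimes> (y \<otimes> x \<otimes> inv y)) = q (inv h \<otimes> x)"
        using conj_invariantD[OF qn(2) y] by simp
      then show "\<exists>k\<in>H. r k + q (inv k \<otimes> (y \<otimes> x \<otimes> inv y)) \<le> r h + q (inv h \<otimes> x)"
        using conj_invariantD[OF rn(2) y h] H.inv_op_closed2[OF y h]
        by (intro bexI[of _ "y \<otimes> h \<otimes> inv y"]) auto
    qed (use B.inv_op_closed2[OF y x] in auto)
    show ?thesis
      unfolding conj_invariant_def
    proof (intro ballI antisym conj_le)
      fix y x assume y: "y \<in> carrier G" and x: "x \<in> B"
      have "inv y \<otimes> (y \<otimes> x \<otimes> inv y) \<otimes> inv (inv y) = x"
        using Bc[OF x] y by (simp add: word_simps)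
      then show "?c x \<le> ?c (y \<otimes> x \<otimes> inv y)"
        using conj_le[of "inv y" "y \<otimes> x \<otimes> inv y"] y B.inv_op_closed2[OF y x] by simp
    qed
  qed
  moreover have "small_near_one G T B ?c"
    using qn(3) le_q unfolding small_near_one_def by (meson Int_iff le_less_trans)
  ultimately show "?c \<in> norms G T B" by (simp add: norms_def)
qed

lemma balanced_norm_at:
  assumes bal: "balanced_group G T" and W: "openin T W" "x \<in> W"
  obtains q where "q \<in> norms G T (carrier G)"
    "\<And>y. y \<in> carrier G \<Longrightarrow> q (inv y \<otimes> x) < 1 \<Longrightarrow> y \<in> W"
proof -
  have x: "x \<in> carrier G" using W openin_carrier by blast
  have "continuous_map T T (\<lambda>u. x \<otimes> inv u)"
    using x by (intro continuous_group_intros)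
  then have "openin T {u \<in> topspace T. x \<otimes> inv u \<in> W}"
    using W(1) by (rule openin_continuous_map_preimage)
  moreover have "\<one> \<in> {u \<in> topspace T. x \<otimes> inv u \<in> W}"
    using x W by (simp add: topspace_eq)
  ultimately obtain q where q: "q \<in> norms G T (carrier G)"
    "\<And>u. q u < 1 \<Longrightarrow> u \<in> {u \<in> topspace T. x \<otimes> inv u \<in> W}"
    using balanced_norm[OF bal] by blast
  show thesis
  proof (rule that[OF q(1)])
    fix y assume y: "y \<in> carrier G" and "q (inv y \<otimes> x) < 1"
    then have "x \<otimes> inv (inv y \<otimes> x) \<in> W" using q(2) by blast
    then show "y \<in> W" using x y by (simp add: word_simps)
  qed
qed

text \<open>The family \<open>R\<close> can be much coarser than the topology of \<open>H\<close>.  A net in \<open>H\<close> that is Cauchy for \<open>R\<close> is Cauchy for all convolutions of members of \<open>R\<close> with invariant pseudonorms of the group, so it converges for these to some \<open>x\<close> of the group.  A small convolution means that \<open>x\<close> is close, in the original topology, to a product of a term of the net and an element of \<open>H\<close> that is small for \<open>R\<close>.  The first fact puts \<open>x\<close> into \<open>H\<close>, the second makes it the limit.\<close>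

lemma closed_normal_complete:
  fixes F :: "'i filter"
  assumes bal: "balanced_group G T" and h: "hTG_closed G T"
    and H: "H \<lhd> G" "closedin T H" and R: "R \<subseteq> norms G T H"
    and F: "F \<noteq> bot" and s: "\<And>i. s i \<in> H" "cauchy_net G R F s"
  obtains x where "x \<in> H"
    "\<And>r e. r \<in> R \<Longrightarrow> e > 0 \<Longrightarrow> eventually (\<lambda>i. r (inv s i \<otimes> x) < e) F"
proof (cases "R = {}")
  case True
  then show thesis using that s(1) by blast
next
  case False
  then obtain r0 where r0: "r0 \<in> R" by blast
  interpret H: normal H G by fact
  note Hc = H.subset[THEN subsetD]
  have G: "carrier G \<lhd> G"
    by (simp add: normal_inv_iff subgroup_self)
  note conv = H(1) G H.subset
  let ?Q = "norms G T (carrier G)"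
  define P where "P = {inf_conv G H r q | r q. r \<in> R \<and> q \<in> ?Q}"
  have P: "P \<subseteq> ?Q"
    unfolding P_def using inf_conv_norm[OF conv] R by blast
  have cauchy: "cauchy_net G P F s"
    unfolding cauchy_net_def
  proof (intro ballI allI impI)
    fix p and e :: real assume "p \<in> P" "e > 0"
    then obtain r q where p: "p = inf_conv G H r q" "r \<in> R" "q \<in> ?Q"
      unfolding P_def by blast
    obtain A where A: "eventually A F" "\<And>i j. A i \<Longrightarrow> A j \<Longrightarrow> r (inv s i \<otimes> s j) < e"
      using cauchy_netD[OF s(2) p(2) \<open>e > 0\<close>] by blast
    have "p (inv s i \<otimes> s j) \<le> r (inv s i \<otimes> s j)" for i j
      unfolding p(1) using R p s(1) by (intro inf_conv_le(2)[OF conv]) auto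
    then show "\<exists>A. eventually A F \<and> (\<forall>i j. A i \<longrightarrow> A j \<longrightarrow> p (inv s i \<otimes> s j) < e)"
      using A by (meson le_less_trans)
  qed
  have sc: "s i \<in> carrier G" for i using s(1) Hc by blast
  obtain x where x: "x \<in> carrier G"
    "\<And>p e. p \<in> P \<Longrightarrow> e > 0 \<Longrightarrow> eventually (\<lambda>i. p (inv s i \<otimes> x) < e) F"
    by (rule hTG_closed_complete[OF h P F sc cauchy]) blast+
  \<comment> \<open>Convergence for the convolution of \<open>r\<close> and \<open>q\<close>, unravelled.\<close>
  have near: "eventually (\<lambda>i. \<exists>h\<in>H. r h < e \<and> q (inv h \<otimes> (inv s i \<otimes> x)) < e) F"
    if r: "r \<in> R" and q: "q \<in> ?Q" and e: "e > 0" for r q and e :: real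
  proof -
    have rq: "r \<in> norms G T H" "inf_conv G H r q \<in> P" using r q R by (auto simp: P_def)
    from x(2)[OF rq(2) e] show ?thesis
    proof (rule eventually_mono)
      fix i assume "inf_conv G H r q (inv s i \<otimes> x) < e"
      then obtain h where h: "h \<in> H" "r h + q (inv h \<otimes> (inv s i \<otimes> x)) < e"
        using inf_conv_less[OF conv rq(1) q] by blast
      have "0 \<le> r h" "0 \<le> q (inv h \<otimes> (inv s i \<otimes> x))"
        using pseudonormD(1)[OF normsD(1)[OF rq(1)] h(1)]
          pseudonormD(1)[OF normsD(1)[OF q], of "inv h \<otimes> (inv s i \<otimes> x)"] Hc[OF h(1)] sc x(1) by auto
      then show "\<exists>h\<in>H. r h < e \<and> q (inv h \<otimes> (inv s i \<otimes> x)) < e"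
        using h by (intro bexI[of _ h]) auto
    qed
  qed
  have "x \<in> T closure_of H"
    unfolding in_closure_of
  proof (intro conjI allI impI)
    show "x \<in> topspace T" using x by (simp add: topspace_eq)
    fix W assume "x \<in> W \<and> openin T W"
    then obtain q where q: "q \<in> ?Q" "\<And>y. y \<in> carrier G \<Longrightarrow> q (inv y \<otimes> x) < 1 \<Longrightarrow> y \<in> W"
      using balanced_norm_at[OF bal] by blast
    obtain i h where h: "h \<in> H" "q (inv h \<otimes> (inv s i \<otimes> x)) < 1"
      using eventually_happens'[OF F near[OF r0 q(1), of 1]] by auto
    have "inv h \<otimes> (inv s i \<otimes> x) = inv (s i \<otimes> h) \<otimes> x"
      using Hc[OF h(1)] sc x(1) by (simp add: word_simps)
    then have "s i \<otimes> h \<in> W"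
      using q(2)[of "s i \<otimes> h"] h Hc[OF h(1)] sc by simp
    then show "\<exists>y. y \<in> H \<and> y \<in> W" using h s(1) by blast
  qed
  then have xH: "x \<in> H" using closure_of_closedin[OF H(2)] by simp
  show thesis
  proof (rule that[OF xH])
    fix r and e :: real assume r: "r \<in> R" "e > 0"
    then have rn: "pseudonorm G H r" "small_near_one G T H r" using R by (auto simp: norms_def)
    obtain U where U: "openin T U" "\<one> \<in> U" "\<forall>x\<in>U \<inter> H. r x < e / 2"
      using rn(2) r(2) unfolding small_near_one_def by (meson half_gt_zero)
    obtain q where q: "q \<in> ?Q" "\<And>x. q x < 1 \<Longrightarrow> x \<in> U"
      using balanced_norm[OF bal U(1,2)] by blast
    have "eventually (\<lambda>i. \<exists>h\<in>H. r h < min 1 (e/2) \<and> q (inv h \<otimes> (inv s i \<otimes> x)) < min 1 (e/2)) F"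
      by (rule near[OF r(1) q(1)]) (use r(2) in simp)
    then show "eventually (\<lambda>i. r (inv s i \<otimes> x) < e) F"
    proof (rule eventually_mono)
      fix i assume "\<exists>h\<in>H. r h < min 1 (e/2) \<and> q (inv h \<otimes> (inv s i \<otimes> x)) < min 1 (e/2)"
      then obtain h where h: "h \<in> H" "r h < e/2" "q (inv h \<otimes> (inv s i \<otimes> x)) < 1" by auto
      have "inv h \<otimes> (inv s i \<otimes> x) \<in> U \<inter> H"
        using q(2)[OF h(3)] h s(1) xH by auto
      then have "r (inv h \<otimes> (inv s i \<otimes> x)) < e / 2" using U(3) by blast
      moreover have "r (inv s i \<otimes> x) \<le> r h + r (inv h \<otimes> (inv s i \<otimes> x))"
        using h s(1) xH by (intro norm_le_dist[OF rn(1) H.subgroup_axioms]) auto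
      ultimately show "r (inv s i \<otimes> x) < e" using h(2) by linarith
    qed
  qed
qed

end

section \<open>Precompactness and compactness\<close>

text \<open>Precompactness of the quotient by \<open>N\<close>, expressed by invariant pseudonorms of the group itself.\<close>

definition precompact_modulo ::
    "('a, 'm) monoid_scheme \<Rightarrow> 'a topology \<Rightarrow> 'a set \<Rightarrow> bool" where
  "precompact_modulo G T N \<longleftrightarrow>
     (\<forall>q\<in>norms G T (carrier G). \<forall>e>0. \<exists>F. finite F \<and> F \<subseteq> carrier G \<and>
        (\<forall>x\<in>carrier G. \<exists>f\<in>F. \<exists>n\<in>N. q (inv\<^bsub>G\<^esub> f \<otimes>\<^bsub>G\<^esub> x \<otimes>\<^bsub>G\<^esub> n) < e))"

text \<open>A minimal proper filter, which exists because the infimum of a chain of proper filters is proper.\<close>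

lemma ultrafilter_below:
  fixes F0 :: "'i filter"
  assumes "F0 \<noteq> bot"
  obtains F where "F \<le> F0" "F \<noteq> bot" "\<forall>P. eventually P F \<or> eventually (\<lambda>x. \<not> P x) F"
proof -
  have "\<exists>F\<in>{F. F \<le> F0 \<and> F \<noteq> bot}. \<forall>F'\<in>{F. F \<le> F0 \<and> F \<noteq> bot}. F' \<le> F \<longrightarrow> F' = F"
  proof (rule predicate_Zorn)
    show "partial_order_on {F. F \<le> F0 \<and> F \<noteq> bot} (relation_of (\<lambda>F F'. F' \<le> F) {F. F \<le> F0 \<and> F \<noteq> bot})"
      by (rule partial_order_on_relation_ofI) auto
    fix C assume C: "C \<in> Chains (relation_of (\<lambda>F F'. F' \<le> F) {F. F \<le> F0 \<and> F \<noteq> bot})"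
    then have sub: "C \<subseteq> {F. F \<le> F0 \<and> F \<noteq> bot}" and lin: "\<And>F F'. F \<in> C \<Longrightarrow> F' \<in> C \<Longrightarrow> F \<le> F' \<or> F' \<le> F"
      by (auto simp: Chains_def relation_of_def)
    show "\<exists>u\<in>{F. F \<le> F0 \<and> F \<noteq> bot}. \<forall>a\<in>C. u \<le> a"
    proof (cases "C = {}")
      case True
      then show ?thesis using assms by auto
    next
      case False
      have "eventually P (Inf C) \<longleftrightarrow> (\<exists>b\<in>C. eventually P b)" for P
        using lin by (intro eventually_Inf_base[OF False]) (metis inf.absorb1 inf.absorb2 order_refl)
      from this[of "\<lambda>x. False"] have "Inf C \<noteq> bot"
        using sub by (auto simp: trivial_limit_def)
      moreover obtain F where "F \<in> C" using False by blast
      then have "Inf C \<le> F" "F \<le> F0" using sub by (auto intro: Inf_lower)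
      then have "Inf C \<le> F0" by (rule order_trans)
      ultimately show ?thesis by (auto intro: Inf_lower)
    qed
  qed
  then obtain F where F: "F \<le> F0" "F \<noteq> bot" and max: "\<And>F'. F' \<le> F0 \<Longrightarrow> F' \<noteq> bot \<Longrightarrow> F' \<le> F \<Longrightarrow> F' = F"
    by blast
  have "eventually P F \<or> eventually (\<lambda>x. \<not> P x) F" for P
  proof (rule disjCI)
    assume "\<not> eventually (\<lambda>x. \<not> P x) F"
    then have "inf F (principal {x. P x}) \<noteq> bot"
      by (simp add: trivial_limit_def eventually_inf_principal)
    then have "inf F (principal {x. P x}) = F"
      using F by (intro max) (auto intro: le_infI1)
    then have "F \<le> principal {x. P x}" by (metis inf.cobounded2)
    then show "eventually P F" by (simp add: le_principal)
  qed
  with F show thesis by (intro that allI)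
qed

lemma ultrafilter_finite:
  assumes "\<forall>P. eventually P F \<or> eventually (\<lambda>x. \<not> P x) F" "F \<noteq> bot" "finite A"
    "eventually (\<lambda>x. \<exists>a\<in>A. Q a x) F"
  shows "\<exists>a\<in>A. eventually (Q a) F"
proof (rule ccontr)
  assume "\<not> (\<exists>a\<in>A. eventually (Q a) F)"
  then have "\<forall>a\<in>A. eventually (\<lambda>x. \<not> Q a x) F" using assms(1) by blast
  then have "eventually (\<lambda>x. \<forall>a\<in>A. \<not> Q a x) F" using assms(3) by (simp add: eventually_ball_finite)
  then have "eventually (\<lambda>x. False) F" using assms(4) by eventually_elim blast
  then show False using assms(2) by (simp add: trivial_limit_def)
qed

text \<open>An ultrafilter on a precompact group is Cauchy for every invariant pseudonorm, so by completeness it converges.  Applied to an ultrafilter that contains a family of closed sets with the finite intersection property this gives a common point.\<close>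

lemma (in topological_group) precompact_imp_compact:
  assumes bal: "balanced_group G T" and h: "hTG_closed G T" and pc: "precompact_modulo G T {\<one>}"
  shows "compact_space T"
  unfolding compact_space_fip
proof (intro allI impI)
  fix \<U> assume U: "Ball \<U> (closedin T) \<and> (\<forall>\<F>. finite \<F> \<and> \<F> \<subseteq> \<U> \<longrightarrow> \<Inter> \<F> \<noteq> {})"
  show "\<Inter>\<U> \<noteq> {}"
  proof (cases "\<U> = {}")
    case False
    then obtain C0 where C0: "C0 \<in> \<U>" by blast
    let ?B = "{principal (\<Inter>\<F>) | \<F>. finite \<F> \<and> \<F> \<subseteq> \<U> \<and> \<F> \<noteq> {}}"
    have "principal (\<Inter>{C0}) \<in> ?B" using C0 by blast
    then have ne: "?B \<noteq> {}" by blast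
    have base: "eventually P (Inf ?B) \<longleftrightarrow> (\<exists>b\<in>?B. eventually P b)" for P
    proof (rule eventually_Inf_base[OF ne])
      fix F F' assume "F \<in> ?B" "F' \<in> ?B"
      then obtain A A' where A: "F = principal (\<Inter>A)" "finite A" "A \<subseteq> \<U>" "A \<noteq> {}"
        and A': "F' = principal (\<Inter>A')" "finite A'" "A' \<subseteq> \<U>" "A' \<noteq> {}" by blast
      have "principal (\<Inter>(A \<union> A')) \<in> ?B" using A A' by blast
      moreover have "principal (\<Inter>(A \<union> A')) \<le> inf F F'" by (auto simp: A A')
      ultimately show "\<exists>x\<in>?B. x \<le> inf F F'" by blast
    qed
    have "Inf ?B \<noteq> bot"
      unfolding trivial_limit_def base
    proof
      assume "\<exists>b\<in>?B. eventually (\<lambda>x. False) b"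
      then obtain A where A: "finite A" "A \<subseteq> \<U>" "eventually (\<lambda>x. False) (principal (\<Inter>A))" by blast
      then have "\<Inter>A = {}" unfolding eventually_principal by blast
      then show False using U A by blast
    qed
    then obtain F where F: "F \<le> Inf ?B" "F \<noteq> bot" "\<forall>P. eventually P F \<or> eventually (\<lambda>x. \<not> P x) F"
      by (rule ultrafilter_below)
    have inC: "eventually (\<lambda>x. x \<in> C) F" if "C \<in> \<U>" for C
    proof -
      have "principal (\<Inter>{C}) \<in> ?B" using that by blast
      then have "Inf ?B \<le> principal C" by (intro Inf_lower) simp
      then have "F \<le> principal C" using F(1) by (rule order_trans[rotated])
      then show ?thesis by (simp add: le_principal)
    qed
    have inG: "eventually (\<lambda>x. x \<in> carrier G) F"
    proof (rule eventually_mono[OF inC[OF C0]])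
      have "C0 \<subseteq> carrier G" using U C0 closedin_subset[of T C0] by (auto simp: topspace_eq)
      then show "x \<in> carrier G" if "x \<in> C0" for x using that by blast
    qed
    define s where "s = (\<lambda>x. if x \<in> carrier G then x else \<one>)"
    have s: "s x \<in> carrier G" for x by (simp add: s_def)
    have cauchy: "cauchy_net G (norms G T (carrier G)) F s"
      unfolding cauchy_net_def
    proof (intro ballI allI impI)
      fix q and e :: real assume q: "q \<in> norms G T (carrier G)" and e: "e > 0"
      obtain A where A: "finite A" "A \<subseteq> carrier G"
        "\<forall>x\<in>carrier G. \<exists>f\<in>A. \<exists>n\<in>{\<one>}. q (inv f \<otimes> x \<otimes> n) < e / 2"
        using pc q e unfolding precompact_modulo_def by (meson half_gt_zero)
      have "eventually (\<lambda>x. \<exists>f\<in>A. x \<in> carrier G \<and> q (inv f \<otimes> x) < e / 2) F"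
        using inG
      proof (rule eventually_mono)
        fix x assume x: "x \<in> carrier G"
        then obtain f where "f \<in> A" "q (inv f \<otimes> x \<otimes> \<one>) < e / 2" using A(3) by blast
        moreover have "inv f \<otimes> x \<otimes> \<one> = inv f \<otimes> x" using x \<open>f \<in> A\<close> A(2) by auto
        ultimately show "\<exists>f\<in>A. x \<in> carrier G \<and> q (inv f \<otimes> x) < e / 2" using x by auto
      qed
      then obtain f where f: "f \<in> A" "eventually (\<lambda>x. x \<in> carrier G \<and> q (inv f \<otimes> x) < e / 2) F"
        using ultrafilter_finite[OF F(3,2) A(1), of "\<lambda>f x. x \<in> carrier G \<and> q (inv f \<otimes> x) < e / 2"]
        by blast
      have "q (inv s x \<otimes> s y) < e" if "x \<in> carrier G \<and> q (inv f \<otimes> x) < e / 2"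
        "y \<in> carrier G \<and> q (inv f \<otimes> y) < e / 2" for x y
      proof -
        have fc: "f \<in> carrier G" using f A by blast
        have "q (inv x \<otimes> y) \<le> q (inv x \<otimes> f) + q (inv f \<otimes> y)"
          using that fc by (intro norm_dist_triangle[OF normsD(1)[OF q] subgroup_self]) auto
        also have "q (inv x \<otimes> f) = q (inv f \<otimes> x)"
          using that fc by (intro norm_dist_sym[OF normsD(1)[OF q] subgroup_self]) auto
        finally show ?thesis using that by (simp add: s_def)
      qed
      then show "\<exists>A. eventually A F \<and> (\<forall>i j. A i \<longrightarrow> A j \<longrightarrow> q (inv s i \<otimes> s j) < e)"
        using f(2) by blast
    qed
    obtain x where x: "x \<in> carrier G"
      "\<And>q e. q \<in> norms G T (carrier G) \<Longrightarrow> e > 0 \<Longrightarrow> eventually (\<lambda>i. q (inv s i \<otimes> x) < e) F"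
      by (rule hTG_closed_complete[OF h _ F(2) s cauchy]) blast+
    have "x \<in> C" if C: "C \<in> \<U>" for C
    proof -
      have "x \<in> T closure_of C"
        unfolding in_closure_of
      proof (intro conjI allI impI)
        show "x \<in> topspace T" using x by (simp add: topspace_eq)
        fix W assume "x \<in> W \<and> openin T W"
        then obtain q where q: "q \<in> norms G T (carrier G)"
          "\<And>y. y \<in> carrier G \<Longrightarrow> q (inv y \<otimes> x) < 1 \<Longrightarrow> y \<in> W"
          using balanced_norm_at[OF bal] by blast
        have "eventually (\<lambda>i. q (inv s i \<otimes> x) < 1 \<and> i \<in> carrier G \<and> i \<in> C) F"
          using x(2)[OF q(1), of 1] inG inC[OF C] by (simp add: eventually_conj_iff)
        then obtain i where "q (inv s i \<otimes> x) < 1" "i \<in> carrier G" "i \<in> C"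
          using eventually_happens'[OF F(2)] by blast
        then show "\<exists>y. y \<in> C \<and> y \<in> W" using q(2)[of i] by (auto simp: s_def)
      qed
      then show ?thesis using U C closure_of_closedin by blast
    qed
    then show ?thesis by blast
  qed simp
qed

section \<open>An open mapping theorem for pseudonorms\<close>

definition complete_norm :: "('a, 'm) monoid_scheme \<Rightarrow> 'a set \<Rightarrow> ('a \<Rightarrow> real) \<Rightarrow> bool" where
  "complete_norm G H r \<longleftrightarrow>
     (\<forall>s. (\<forall>n. s n \<in> H) \<longrightarrow> cauchy_net G {r} sequentially s \<longrightarrow>
        (\<exists>x\<in>H. \<forall>e>0. eventually (\<lambda>n. r (inv\<^bsub>G\<^esub> s n \<otimes>\<^bsub>G\<^esub> x) < e) sequentially))"

lemma (in group) complete_norm_limit: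
  assumes r: "pseudonorm G H r" "subgroup H G" and c: "complete_norm G H r"
    and s: "\<And>n. s n \<in> H" "\<And>m n. n \<le> m \<Longrightarrow> r (inv s n \<otimes> s m) \<le> b n" and b: "b \<longlonglongrightarrow> 0"
  obtains x where "x \<in> H" "\<And>n. r (inv s n \<otimes> x) \<le> b n"
proof -
  interpret H: subgroup H G by fact
  have "cauchy_net G {r} sequentially s"
    unfolding cauchy_net_def
  proof (intro ballI allI impI)
    fix q and e :: real assume q: "q \<in> {r}" and e: "e > 0"
    have "eventually (\<lambda>n. b n < e / 2) sequentially"
      using b e by (intro order_tendstoD) auto
    then obtain N where N: "b N < e / 2"
      using eventually_happens'[OF sequentially_bot] by blast
    show "\<exists>A. eventually A sequentially \<and> (\<forall>i j. A i \<longrightarrow> A j \<longrightarrow> q (inv s i \<otimes> s j) < e)"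
    proof (intro exI[of _ "\<lambda>n. n \<ge> N"] conjI allI impI)
      fix i j assume ij: "i \<ge> N" "j \<ge> N"
      have "r (inv s i \<otimes> s j) \<le> r (inv s i \<otimes> s N) + r (inv s N \<otimes> s j)"
        by (rule norm_dist_triangle[OF r s(1) s(1) s(1)])
      also have "r (inv s i \<otimes> s N) = r (inv s N \<otimes> s i)"
        by (rule norm_dist_sym[OF r s(1) s(1)])
      also have "\<dots> + r (inv s N \<otimes> s j) \<le> b N + b N"
        using s(2)[OF ij(1)] s(2)[OF ij(2)] by (rule add_mono)
      finally show "q (inv s i \<otimes> s j) < e" using N q by simp
    qed (rule eventually_ge_at_top)
  qed
  then obtain x where x: "x \<in> H" "\<And>e. e > 0 \<Longrightarrow> eventually (\<lambda>n. r (inv s n \<otimes> x) < e) sequentially"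
    using c s(1) unfolding complete_norm_def by blast
  have "r (inv s n \<otimes> x) \<le> b n" for n
  proof (rule field_le_epsilon)
    fix e :: real assume "e > 0"
    have "eventually (\<lambda>m. r (inv s m \<otimes> x) < e \<and> n \<le> m) sequentially"
      using x(2)[OF \<open>e > 0\<close>] eventually_ge_at_top by (rule eventually_conj)
    then obtain m where m: "r (inv s m \<otimes> x) < e" "n \<le> m"
      using eventually_happens'[OF sequentially_bot] by blast
    have "r (inv s n \<otimes> x) \<le> r (inv s n \<otimes> s m) + r (inv s m \<otimes> x)"
      by (rule norm_dist_triangle[OF r s(1) s(1) x(1)])
    then show "r (inv s n \<otimes> x) \<le> b n + e"
      using s(2)[OF m(2)] m(1) by linarith
  qed
  with x(1) show thesis by (rule that)
qed

text \<open>The Baire category theorem for a complete pseudonorm: if countably many sets cover \<open>H\<close>, one of them is dense in some ball.  Otherwise shrinking balls avoid the sets one after the other and close down on a point outside all of them.\<close>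

lemma (in group) norm_Baire:
  assumes r: "pseudonorm G H r" "subgroup H G" and c: "complete_norm G H r"
    and cover: "H \<subseteq> (\<Union>n::nat. S n)"
  obtains n x d where "x \<in> H" "d > 0"
    "\<And>y e. y \<in> H \<Longrightarrow> r (inv x \<otimes> y) < d \<Longrightarrow> e > 0 \<Longrightarrow> \<exists>s\<in>S n. r (inv y \<otimes> s) < e"
proof (rule ccontr)
  note found = that
  assume "\<not> thesis"
  then have no: "\<exists>y e. y \<in> H \<and> r (inv x \<otimes> y) < d \<and> e > 0 \<and> (\<forall>s\<in>S n. \<not> r (inv y \<otimes> s) < e)"
    if "x \<in> H" "d > 0" for n x d
    using found[OF that, of n] by blast
  interpret H: subgroup H G by fact
  let ?P = "\<lambda>n (x, d). x \<in> H \<and> d > (0::real)"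
  let ?Q = "\<lambda>n (x, d) (y, d'). r (inv x \<otimes> y) \<le> d / 2 \<and> d' \<le> d / 2 \<and> (\<forall>s\<in>S n. d' < r (inv y \<otimes> s))"
  have "\<exists>f. \<forall>n. ?P n (f n) \<and> ?Q n (f n) (f (Suc n))"
  proof (rule dependent_nat_choice)
    show "\<exists>p. ?P 0 p" using H.one_closed by (intro exI[of _ "(\<one>, 1)"]) simp
    fix p n assume "?P n p"
    then obtain x d where p: "p = (x, d)" "x \<in> H" "d / 2 > 0" by (cases p) auto
    obtain y e where y: "y \<in> H" "r (inv x \<otimes> y) < d / 2" "e > 0" "\<forall>s\<in>S n. \<not> r (inv y \<otimes> s) < e"
      using no[OF p(2,3)] by blast
    have "min (d / 2) (e / 2) < r (inv y \<otimes> s)" if "s \<in> S n" for s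
      using y(3) y(4)[rule_format, OF that] by linarith
    then have "?P (Suc n) (y, min (d / 2) (e / 2)) \<and> ?Q n p (y, min (d / 2) (e / 2))"
      using y p by simp
    then show "\<exists>p'. ?P (Suc n) p' \<and> ?Q n p p'" by (rule exI)
  qed
  then obtain f where f: "\<And>n. ?P n (f n) \<and> ?Q n (f n) (f (Suc n))" by blast
  define x d where "x n = fst (f n)" and "d n = snd (f n)" for n
  have x: "x n \<in> H" "d n > 0" "r (inv x n \<otimes> x (Suc n)) \<le> d n / 2" "d (Suc n) \<le> d n / 2"
    "\<And>s. s \<in> S n \<Longrightarrow> d (Suc n) < r (inv x (Suc n) \<otimes> s)" for n
    using f[of n] by (auto simp: x_def d_def split_beta)
  have step: "r (inv x n \<otimes> x m) \<le> d n - d m" if "n \<le> m" for n m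
    using that
  proof (induction rule: dec_induct)
    case base
    then show ?case using pseudonormD(2)[OF r(1)] x(1)[THEN H.mem_carrier] by simp
  next
    case (step m)
    have "r (inv x n \<otimes> x (Suc m)) \<le> r (inv x n \<otimes> x m) + r (inv x m \<otimes> x (Suc m))"
      by (rule norm_dist_triangle[OF r x(1) x(1) x(1)])
    then show ?case using step.IH x(3)[of m] x(4)[of m] by linarith
  qed
  have bound: "r (inv x n \<otimes> x m) \<le> d n" if "n \<le> m" for n m
    using step[OF that] x(2)[of m] by linarith
  have le: "d n \<le> d 0 * (1/2) ^ n" for n
  proof (induction n)
    case (Suc n)
    then show ?case using x(4)[of n] by simp
  qed simp
  have "(\<lambda>n. d 0 * (1/2) ^ n) \<longlonglongrightarrow> 0"
    by (intro tendsto_mult_right_zero LIMSEQ_realpow_zero) auto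
  then have lim: "d \<longlonglongrightarrow> 0"
  proof (rule real_tendsto_sandwich[rotated 3])
    show "(\<lambda>n. 0::real) \<longlonglongrightarrow> 0" by simp
    show "eventually (\<lambda>n. 0 \<le> d n) sequentially" using x(2) by (simp add: less_imp_le)
    show "eventually (\<lambda>n. d n \<le> d 0 * (1/2) ^ n) sequentially" using le by simp
  qed
  obtain y where y: "y \<in> H" "\<And>n. r (inv x n \<otimes> y) \<le> d n"
    by (rule complete_norm_limit[OF r c x(1) bound lim]) blast+
  then obtain n where "y \<in> S n" using cover by blast
  then show False using x(5)[of y n] y(2)[of "Suc n"] by simp
qed

text \<open>The open mapping theorem, applied to the identity from \<open>p\<close> to the coarser \<open>r\<close>.  Separability covers \<open>H\<close> by countably many \<open>p\<close>-small pieces, so by Baire the \<open>p\<close>-balls are \<open>r\<close>-dense in \<open>r\<close>-balls.  An \<open>r\<close>-small element \<open>h\<close> is then approximated by a product of \<open>p\<close>-small factors; the product converges for \<open>p\<close>, its limit is \<open>p\<close>-small, and it differs from \<open>h\<close> by an element of the kernel of \<open>r\<close>.\<close>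

lemma (in group) norm_open_mapping:
  assumes H: "subgroup H G"
    and p: "pseudonorm G H p" "conj_invariant G H p" "complete_norm G H p"
    and r: "pseudonorm G H r" "conj_invariant G H r" "complete_norm G H r"
    and C: "countable C" "C \<subseteq> H" "\<And>h e. h \<in> H \<Longrightarrow> e > 0 \<Longrightarrow> \<exists>c\<in>C. p (inv c \<otimes> h) < e"
    and cont: "\<And>e. e > 0 \<Longrightarrow> \<exists>d>0. \<forall>h\<in>H. p h < d \<longrightarrow> r h < e"
    and ker: "\<And>h. h \<in> H \<Longrightarrow> r h = 0 \<Longrightarrow> p h = 0"
    and e: "e > 0"
  shows "\<exists>d>0. \<forall>h\<in>H. r h < d \<longrightarrow> p h < e"
proof -
  interpret H: subgroup H G by fact
  note Hc = H.subset[THEN subsetD]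
  \<comment> \<open>Near continuity: \<open>r\<close>-small elements are \<open>r\<close>-limits of \<open>p\<close>-small ones.\<close>
  have near: "\<exists>d>0. \<forall>h\<in>H. r h < d \<longrightarrow> (\<forall>\<eta>>0. \<exists>u\<in>H. p u < \<epsilon> \<and> r (inv h \<otimes> u) < \<eta>)"
    if \<epsilon>: "\<epsilon> > 0" for \<epsilon> :: real
  proof -
    define c where "c = from_nat_into C"
    have "C \<noteq> {}" using C(3)[OF H.one_closed, of 1] by auto
    then have c: "range c = C" unfolding c_def using C(1) by (rule range_from_nat_into)
    have cH: "c n \<in> H" for n using c C(2) by auto
    define S where "S n = {c n \<otimes> u | u. u \<in> H \<and> p u < \<epsilon> / 2}" for n
    have cover: "H \<subseteq> (\<Union>n. S n)"
    proof
      fix h assume h: "h \<in> H"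
      obtain n where n: "p (inv c n \<otimes> h) < \<epsilon> / 2"
        using C(3)[OF h, of "\<epsilon> / 2"] \<epsilon> c by auto
      have "h = c n \<otimes> (inv c n \<otimes> h)"
        using Hc[OF h] Hc[OF cH[of n]] by (simp add: word_simps)
      moreover have "inv c n \<otimes> h \<in> H" using h cH by simp
      ultimately have "h \<in> S n" unfolding S_def using n by blast
      then show "h \<in> (\<Union>n. S n)" by blast
    qed
    obtain n x d where x: "x \<in> H" "d > 0"
      "\<And>y e. y \<in> H \<Longrightarrow> r (inv x \<otimes> y) < d \<Longrightarrow> e > 0 \<Longrightarrow> \<exists>s\<in>S n. r (inv y \<otimes> s) < e"
      by (rule norm_Baire[OF r(1) H r(3) cover]) (rule that)
    have "\<exists>u\<in>H. p u < \<epsilon> \<and> r (inv h \<otimes> u) < \<eta>" if h: "h \<in> H" "r h < d" and \<eta>: "\<eta> > 0" for h \<eta>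
    proof -
      have xx: "inv x \<otimes> x = \<one>" "inv x \<otimes> (x \<otimes> h) = h"
        using Hc[OF x(1)] Hc[OF h(1)] by (simp_all add: word_simps)
      have "r (inv x \<otimes> x) < d" unfolding xx using x(2) pseudonormD(2)[OF r(1)] by simp
      then obtain s where s: "s \<in> S n" "r (inv x \<otimes> s) < \<eta> / 2"
        using x(3)[OF x(1), of "\<eta> / 2"] \<eta> by auto
      have "r (inv x \<otimes> (x \<otimes> h)) < d" unfolding xx by (rule h)
      then obtain t where t: "t \<in> S n" "r (inv (x \<otimes> h) \<otimes> t) < \<eta> / 2"
        using x(3)[of "x \<otimes> h" "\<eta> / 2"] x(1) h(1) \<eta> by auto
      obtain u where u: "u \<in> H" "p u < \<epsilon> / 2" "s = c n \<otimes> u" using s(1) unfolding S_def by blast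
      obtain v where v: "v \<in> H" "p v < \<epsilon> / 2" "t = c n \<otimes> v" using t(1) unfolding S_def by blast
      have st: "s \<in> H" "t \<in> H" using u v cH by auto
      have "inv s \<otimes> t = inv u \<otimes> v"
        using Hc[OF u(1)] Hc[OF v(1)] Hc[OF cH[of n]] by (simp add: u(3) v(3) word_simps)
      moreover have "p (inv u \<otimes> v) < \<epsilon>"
        using pseudonormD(4)[OF p(1), of "inv u" v] pseudonormD(3)[OF p(1) u(1)] u v by simp
      ultimately have "p (inv s \<otimes> t) < \<epsilon>" by simp
      moreover have "r (inv h \<otimes> (inv s \<otimes> t)) < \<eta>"
      proof -
        have "r (inv (inv x \<otimes> (x \<otimes> h)) \<otimes> (inv s \<otimes> t)) \<le> r (inv (inv x) \<otimes> inv s) + r (inv (x \<otimes> h) \<otimes> t)"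
          using x(1) h(1) st by (intro norm_dist_mult[OF r(1,2) H]) auto
        also have "r (inv (inv x) \<otimes> inv s) = r (inv x \<otimes> s)"
          by (rule norm_dist_inv[OF r(1,2) H x(1) st(1)])
        finally show ?thesis using s t unfolding xx by linarith
      qed
      moreover have "inv s \<otimes> t \<in> H" using st by simp
      ultimately show ?thesis by blast
    qed
    then show ?thesis using x(2) by blast
  qed
  \<comment> \<open>The factor \<open>e/4\<close> makes the sum of all \<open>\<epsilon> k\<close> equal to \<open>e/2\<close>.\<close>
  define \<epsilon> where "\<epsilon> k = e / 4 * (1/2) ^ k" for k :: nat
  have \<epsilon>: "\<epsilon> k > 0" "\<epsilon> (Suc k) = \<epsilon> k / 2" for k using e by (simp_all add: \<epsilon>_def)
  have "\<forall>k. \<exists>d>0. \<forall>h\<in>H. r h < d \<longrightarrow> (\<forall>\<eta>>0. \<exists>u\<in>H. p u < \<epsilon> k \<and> r (inv h \<otimes> u) < \<eta>)"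
    using near \<epsilon>(1) by blast
  from choice[OF this] obtain d0 where d0:
    "\<forall>k. d0 k > 0 \<and> (\<forall>h\<in>H. r h < d0 k \<longrightarrow> (\<forall>\<eta>>0. \<exists>u\<in>H. p u < \<epsilon> k \<and> r (inv h \<otimes> u) < \<eta>))" ..
  define d where "d k = min (d0 k) ((1/2) ^ k)" for k
  have d: "d k > 0" "d k \<le> (1/2) ^ k"
    "\<And>h \<eta>. h \<in> H \<Longrightarrow> r h < d k \<Longrightarrow> \<eta> > 0 \<Longrightarrow> \<exists>u\<in>H. p u < \<epsilon> k \<and> r (inv h \<otimes> u) < \<eta>" for k
    using d0 by (auto simp: d_def)
  have "p h < e" if h: "h \<in> H" "r h < d 0" for h
  proof -
    have "\<exists>y. \<forall>n. (y n \<in> H \<and> r (inv y n \<otimes> h) < d n \<and> (n = 0 \<longrightarrow> y n = \<one>)) \<and> p (inv y n \<otimes> y (Suc n)) < \<epsilon> n"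
    proof (rule dependent_nat_choice)
      show "\<exists>y. y \<in> H \<and> r (inv y \<otimes> h) < d 0 \<and> (0 = (0::nat) \<longrightarrow> y = \<one>)"
        using h Hc[OF h(1)] by (intro exI[of _ \<one>]) simp
      fix y n assume "y \<in> H \<and> r (inv y \<otimes> h) < d n \<and> (n = 0 \<longrightarrow> y = \<one>)"
      then have y: "y \<in> H" "r (inv y \<otimes> h) < d n" by auto
      obtain u where u: "u \<in> H" "p u < \<epsilon> n" "r (inv (inv y \<otimes> h) \<otimes> u) < d (Suc n)"
        using d(3)[of "inv y \<otimes> h" n "d (Suc n)"] d(1)[of "Suc n"] y h by auto
      have "r (inv (y \<otimes> u) \<otimes> h) = r (inv u \<otimes> (inv y \<otimes> h))"
        using u(1) y h(1) by (simp add: word_simps)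
      also have "\<dots> = r (inv (inv y \<otimes> h) \<otimes> u)"
        using u(1) y h(1) by (intro norm_dist_sym[OF r(1) H]) auto
      finally have "r (inv (y \<otimes> u) \<otimes> h) < d (Suc n)" using u(3) by simp
      moreover have "inv y \<otimes> (y \<otimes> u) = u" using u(1) y by (simp add: word_simps)
      ultimately show "\<exists>z. (z \<in> H \<and> r (inv z \<otimes> h) < d (Suc n) \<and> (Suc n = 0 \<longrightarrow> z = \<one>)) \<and>
          p (inv y \<otimes> z) < \<epsilon> n"
        using u y by (intro exI[of _ "y \<otimes> u"]) simp
    qed
    then obtain y where y: "\<And>n. y n \<in> H" "\<And>n. r (inv y n \<otimes> h) < d n"
      "\<And>n. p (inv y n \<otimes> y (Suc n)) < \<epsilon> n" and y0: "y 0 = \<one>"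
      by blast
    have step: "p (inv y n \<otimes> y m) \<le> 2 * \<epsilon> n - 2 * \<epsilon> m" if "n \<le> m" for n m
      using that
    proof (induction rule: dec_induct)
      case base
      then show ?case using pseudonormD(2)[OF p(1)] Hc[OF y(1)] by simp
    next
      case (step m)
      have "p (inv y n \<otimes> y (Suc m)) \<le> p (inv y n \<otimes> y m) + p (inv y m \<otimes> y (Suc m))"
        by (rule norm_dist_triangle[OF p(1) H y(1) y(1) y(1)])
      then show ?case using step.IH y(3)[of m] \<epsilon>(2)[of m] by linarith
    qed
    have bound: "p (inv y n \<otimes> y m) \<le> 2 * \<epsilon> n" if "n \<le> m" for n m
      using step[OF that] \<epsilon>(1)[of m] by linarith
    have lim: "(\<lambda>n. 2 * \<epsilon> n) \<longlonglongrightarrow> 0"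
      unfolding \<epsilon>_def by (intro tendsto_mult_right_zero LIMSEQ_realpow_zero) auto
    obtain z where z: "z \<in> H" "\<And>n. p (inv y n \<otimes> z) \<le> 2 * \<epsilon> n"
      by (rule complete_norm_limit[OF p(1) H p(3) y(1) bound lim]) blast+
    have "r (inv z \<otimes> h) \<le> 0"
    proof (rule field_le_epsilon)
      fix \<eta> :: real assume \<eta>: "\<eta> > 0"
      obtain \<delta> where \<delta>: "\<delta> > 0" "\<forall>h\<in>H. p h < \<delta> \<longrightarrow> r h < \<eta> / 2"
        using cont[of "\<eta> / 2"] \<eta> by auto
      have "eventually (\<lambda>n. 2 * \<epsilon> n < \<delta>) sequentially"
        using lim \<delta>(1) by (rule order_tendstoD)
      moreover have "(\<lambda>n. (1/2::real) ^ n) \<longlonglongrightarrow> 0" by (intro LIMSEQ_realpow_zero) auto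
      then have "eventually (\<lambda>n. (1/2::real) ^ n < \<eta> / 2) sequentially"
        using \<eta> by (intro order_tendstoD) auto
      ultimately have "eventually (\<lambda>n. 2 * \<epsilon> n < \<delta> \<and> (1/2) ^ n < \<eta> / 2) sequentially"
        by (rule eventually_conj)
      then obtain n where n: "2 * \<epsilon> n < \<delta>" "(1/2) ^ n < \<eta> / 2"
        using eventually_happens'[OF sequentially_bot] by blast
      have "r (inv y n \<otimes> z) < \<eta> / 2"
        using \<delta>(2) z(2)[of n] n(1) y(1) z(1) by fastforce
      moreover have "r (inv z \<otimes> h) \<le> r (inv z \<otimes> y n) + r (inv y n \<otimes> h)"
        by (rule norm_dist_triangle[OF r(1) H z(1) y(1) h(1)])
      moreover have "r (inv z \<otimes> y n) = r (inv y n \<otimes> z)"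
        by (rule norm_dist_sym[OF r(1) H z(1) y(1)])
      ultimately show "r (inv z \<otimes> h) \<le> 0 + \<eta>"
        using y(2)[of n] d(2)[of n] n(2) by linarith
    qed
    then have "r (inv z \<otimes> h) = 0"
      using pseudonormD(1)[OF r(1), of "inv z \<otimes> h"] z(1) h(1) by auto
    then have "p (inv z \<otimes> h) = 0" using ker[of "inv z \<otimes> h"] z(1) h(1) by auto
    moreover have "p h \<le> p z + p (inv z \<otimes> h)"
      by (rule norm_le_dist[OF p(1) H z(1) h(1)])
    moreover have "p z \<le> p (y 0) + p (inv y 0 \<otimes> z)"
      by (rule norm_le_dist[OF p(1) H y(1) z(1)])
    moreover have "p (y 0) = 0" using pseudonormD(2)[OF p(1)] by (simp add: y0)
    moreover have "2 * \<epsilon> 0 < e" using e by (simp add: \<epsilon>_def)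
    ultimately show ?thesis using z(2)[of 0] by linarith
  qed
  then show ?thesis using d(1) by blast
qed

section \<open>Totally bounded pseudonorms\<close>

text \<open>Finite colourings with small colour classes replace finite nets: they restrict to subsets, pull back along maps and combine for several pseudonorms at once.\<close>

definition totally_bounded_norm :: "('a, 'm) monoid_scheme \<Rightarrow> 'a set \<Rightarrow> ('a \<Rightarrow> real) \<Rightarrow> bool" where
  "totally_bounded_norm G B r \<longleftrightarrow>
     (\<forall>e>0. \<exists>\<phi> :: 'a \<Rightarrow> nat. finite (\<phi> ` B) \<and>
        (\<forall>x\<in>B. \<forall>y\<in>B. \<phi> x = \<phi> y \<longrightarrow> r (inv\<^bsub>G\<^esub> x \<otimes>\<^bsub>G\<^esub> y) < e))"

lemma totally_boundedI:
  fixes G :: "('a, 'm) monoid_scheme"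
  assumes "\<And>e. e > 0 \<Longrightarrow> \<exists>\<phi> :: 'a \<Rightarrow> 'k. finite (\<phi> ` B) \<and>
    (\<forall>x\<in>B. \<forall>y\<in>B. \<phi> x = \<phi> y \<longrightarrow> r (inv\<^bsub>G\<^esub> x \<otimes>\<^bsub>G\<^esub> y) < e)"
  shows "totally_bounded_norm G B r"
  unfolding totally_bounded_norm_def
proof (intro allI impI)
  fix e :: real assume "e > 0"
  then obtain \<phi> :: "'a \<Rightarrow> 'k" where fin: "finite (\<phi> ` B)"
    and \<phi>: "\<forall>x\<in>B. \<forall>y\<in>B. \<phi> x = \<phi> y \<longrightarrow> r (inv\<^bsub>G\<^esub> x \<otimes>\<^bsub>G\<^esub> y) < e"
    using assms by blast
  obtain g :: "'k \<Rightarrow> nat" where g: "inj_on g (\<phi> ` B)"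
    using finite_imp_inj_to_nat_seg[OF fin] by blast
  have "finite ((g \<circ> \<phi>) ` B)"
    unfolding image_comp[symmetric] using fin by (rule finite_imageI)
  moreover have "r (inv\<^bsub>G\<^esub> x \<otimes>\<^bsub>G\<^esub> y) < e" if "x \<in> B" "y \<in> B" "(g \<circ> \<phi>) x = (g \<circ> \<phi>) y" for x y
    using \<phi> that g by (auto simp: inj_on_def)
  ultimately show "\<exists>\<phi> :: 'a \<Rightarrow> nat. finite (\<phi> ` B) \<and>
        (\<forall>x\<in>B. \<forall>y\<in>B. \<phi> x = \<phi> y \<longrightarrow> r (inv\<^bsub>G\<^esub> x \<otimes>\<^bsub>G\<^esub> y) < e)"
    by blast
qed

lemma totally_boundedE:
  fixes G :: "('a, 'm) monoid_scheme"
  assumes "totally_bounded_norm G B r" "e > 0"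
  obtains \<phi> :: "'a \<Rightarrow> nat" where "finite (\<phi> ` B)"
    "\<And>x y. x \<in> B \<Longrightarrow> y \<in> B \<Longrightarrow> \<phi> x = \<phi> y \<Longrightarrow> r (inv\<^bsub>G\<^esub> x \<otimes>\<^bsub>G\<^esub> y) < e"
proof -
  have "\<exists>\<phi> :: 'a \<Rightarrow> nat. finite (\<phi> ` B) \<and>
      (\<forall>x\<in>B. \<forall>y\<in>B. \<phi> x = \<phi> y \<longrightarrow> r (inv\<^bsub>G\<^esub> x \<otimes>\<^bsub>G\<^esub> y) < e)"
    using assms by (simp add: totally_bounded_norm_def)
  then obtain \<phi> :: "'a \<Rightarrow> nat" where \<phi>: "finite (\<phi> ` B) \<and>
      (\<forall>x\<in>B. \<forall>y\<in>B. \<phi> x = \<phi> y \<longrightarrow> r (inv\<^bsub>G\<^esub> x \<otimes>\<^bsub>G\<^esub> y) < e)" ..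
  show thesis by (rule that[of \<phi>]) (use \<phi> in auto)
qed

lemma totally_bounded_net:
  fixes G :: "('a, 'm) monoid_scheme"
  assumes "totally_bounded_norm G B r" "e > 0"
  obtains F where "finite F" "F \<subseteq> B" "\<And>b. b \<in> B \<Longrightarrow> \<exists>f\<in>F. r (inv\<^bsub>G\<^esub> f \<otimes>\<^bsub>G\<^esub> b) < e"
proof -
  obtain \<phi> :: "'a \<Rightarrow> nat" where \<phi>: "finite (\<phi> ` B)"
    "\<And>x y. x \<in> B \<Longrightarrow> y \<in> B \<Longrightarrow> \<phi> x = \<phi> y \<Longrightarrow> r (inv\<^bsub>G\<^esub> x \<otimes>\<^bsub>G\<^esub> y) < e"
    by (rule totally_boundedE[OF assms]) (rule that)
  show thesis
  proof (rule that[of "inv_into B \<phi> ` (\<phi> ` B)"])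
    show "finite (inv_into B \<phi> ` (\<phi> ` B))" using \<phi>(1) by (rule finite_imageI)
    show "inv_into B \<phi> ` (\<phi> ` B) \<subseteq> B" by (auto intro: inv_into_into)
    fix b assume b: "b \<in> B"
    then have "inv_into B \<phi> (\<phi> b) \<in> B" "\<phi> (inv_into B \<phi> (\<phi> b)) = \<phi> b"
      by (auto intro: inv_into_into f_inv_into_f)
    then show "\<exists>f\<in>inv_into B \<phi> ` (\<phi> ` B). r (inv\<^bsub>G\<^esub> f \<otimes>\<^bsub>G\<^esub> b) < e"
      using \<phi>(2)[OF _ b] b by blast
  qed
qed

lemma (in group) totally_bounded_if_net:
  assumes B: "subgroup B G" and r: "pseudonorm G B r"
    and net: "\<And>e. e > 0 \<Longrightarrow> \<exists>F. finite F \<and> F \<subseteq> B \<and> (\<forall>b\<in>B. \<exists>f\<in>F. r (inv f \<otimes> b) < e)"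
  shows "totally_bounded_norm G B r"
proof (rule totally_boundedI)
  fix e :: real assume e: "e > 0"
  then obtain F where F: "finite F" "F \<subseteq> B" "\<forall>b\<in>B. \<exists>f\<in>F. r (inv f \<otimes> b) < e / 2"
    using net[of "e / 2"] by auto
  from bchoice[OF F(3)[unfolded Bex_def]] obtain \<phi> where
    "\<forall>b\<in>B. \<phi> b \<in> F \<and> r (inv (\<phi> b) \<otimes> b) < e / 2" ..
  then have \<phi>: "\<phi> b \<in> F" "r (inv (\<phi> b) \<otimes> b) < e / 2" if "b \<in> B" for b using that by auto
  have "finite (\<phi> ` B)" by (rule finite_subset[OF _ F(1)]) (use \<phi> in auto)
  moreover have "r (inv x \<otimes> y) < e" if xy: "x \<in> B" "y \<in> B" "\<phi> x = \<phi> y" for x y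
  proof -
    have f: "\<phi> x \<in> B" using \<phi> F xy by blast
    have "r (inv x \<otimes> y) \<le> r (inv x \<otimes> \<phi> x) + r (inv (\<phi> x) \<otimes> y)"
      by (rule norm_dist_triangle[OF r B xy(1) f xy(2)])
    also have "r (inv x \<otimes> \<phi> x) = r (inv (\<phi> x) \<otimes> x)"
      by (rule norm_dist_sym[OF r B xy(1) f])
    finally show ?thesis using \<phi>(2)[OF xy(1)] \<phi>(2)[OF xy(2)] xy(3) by simp
  qed
  ultimately show "\<exists>\<phi> :: 'a \<Rightarrow> 'a. finite (\<phi> ` B) \<and>
    (\<forall>x\<in>B. \<forall>y\<in>B. \<phi> x = \<phi> y \<longrightarrow> r (inv x \<otimes> y) < e)" by blast
qed

lemma (in group) not_totally_bounded_sequence: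
  assumes B: "subgroup B G" and r: "pseudonorm G B r" and n: "\<not> totally_bounded_norm G B r"
  obtains e a where "e > 0" "\<And>n::nat. a n \<in> B" "\<And>m n. m < n \<Longrightarrow> e \<le> r (inv (a m) \<otimes> a n)"
proof -
  obtain e where e: "e > 0" "\<And>F. finite F \<Longrightarrow> F \<subseteq> B \<Longrightarrow> \<exists>b\<in>B. \<forall>f\<in>F. e \<le> r (inv f \<otimes> b)"
    using totally_bounded_if_net[OF B r] n by (meson not_le)
  have "\<exists>f. \<forall>n::nat. set (f n) \<subseteq> B \<and>
      (\<exists>x\<in>B. f (Suc n) = x # f n \<and> (\<forall>y\<in>set (f n). e \<le> r (inv y \<otimes> x)))"
  proof (rule dependent_nat_choice)
    show "\<exists>xs. set xs \<subseteq> B" by (intro exI[of _ "[]"]) simp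
    fix xs :: "'a list" and n :: nat assume xs: "set xs \<subseteq> B"
    then obtain b where "b \<in> B" "\<forall>f\<in>set xs. e \<le> r (inv f \<otimes> b)"
      using e(2)[of "set xs"] by auto
    then show "\<exists>ys. set ys \<subseteq> B \<and> (\<exists>x\<in>B. ys = x # xs \<and> (\<forall>y\<in>set xs. e \<le> r (inv y \<otimes> x)))"
      using xs by (intro exI[of _ "b # xs"]) auto
  qed
  then obtain f where f: "\<And>n::nat. \<exists>x\<in>B. f (Suc n) = x # f n \<and> (\<forall>y\<in>set (f n). e \<le> r (inv y \<otimes> x))"
    by blast
  define a where "a n = hd (f (Suc n))" for n
  have a: "a n \<in> B" "f (Suc n) = a n # f n" "\<And>y. y \<in> set (f n) \<Longrightarrow> e \<le> r (inv y \<otimes> a n)" for n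
    using f[of n] by (auto simp: a_def)
  have "a m \<in> set (f n)" if "Suc m \<le> n" for m n
    using that by (induction rule: dec_induct) (auto simp: a(2))
  then have "e \<le> r (inv (a m) \<otimes> a n)" if "m < n" for m n
    using a(3)[of "a m" n] that by simp
  with e(1) a(1) show thesis by (rule that)
qed

lemma totally_bounded_le:
  fixes G :: "('a, 'm) monoid_scheme"
  assumes "totally_bounded_norm G B r" "\<And>x y. x \<in> B \<Longrightarrow> y \<in> B \<Longrightarrow> r' (inv\<^bsub>G\<^esub> x \<otimes>\<^bsub>G\<^esub> y) \<le> r (inv\<^bsub>G\<^esub> x \<otimes>\<^bsub>G\<^esub> y)"
  shows "totally_bounded_norm G B r'"
  unfolding totally_bounded_norm_def
proof (intro allI impI)
  fix e :: real assume "e > 0"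
  obtain \<phi> :: "'a \<Rightarrow> nat" where \<phi>: "finite (\<phi> ` B)"
    "\<And>x y. x \<in> B \<Longrightarrow> y \<in> B \<Longrightarrow> \<phi> x = \<phi> y \<Longrightarrow> r (inv\<^bsub>G\<^esub> x \<otimes>\<^bsub>G\<^esub> y) < e"
    by (rule totally_boundedE[OF assms(1) \<open>e > 0\<close>]) (rule that)
  then show "\<exists>\<phi> :: 'a \<Rightarrow> nat. finite (\<phi> ` B) \<and>
        (\<forall>x\<in>B. \<forall>y\<in>B. \<phi> x = \<phi> y \<longrightarrow> r' (inv\<^bsub>G\<^esub> x \<otimes>\<^bsub>G\<^esub> y) < e)"
    using assms(2) by (meson le_less_trans)
qed

lemma totally_bounded_sum:
  fixes G :: "('a, 'm) monoid_scheme" and r :: "'k \<Rightarrow> 'a \<Rightarrow> real"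
  assumes A: "finite A" and tb: "\<And>a. a \<in> A \<Longrightarrow> totally_bounded_norm G B (r a)"
  shows "totally_bounded_norm G B (\<lambda>x. \<Sum>a\<in>A. r a x)"
proof (rule totally_boundedI)
  fix e :: real assume e: "e > 0"
  define d where "d = e / (real (card A) + 1)"
  have d: "d > 0" using e by (simp add: d_def)
  have "\<forall>a\<in>A. \<exists>\<phi> :: 'a \<Rightarrow> nat. finite (\<phi> ` B) \<and>
      (\<forall>x\<in>B. \<forall>y\<in>B. \<phi> x = \<phi> y \<longrightarrow> r a (inv\<^bsub>G\<^esub> x \<otimes>\<^bsub>G\<^esub> y) < d)"
    using tb d unfolding totally_bounded_norm_def by blast
  from bchoice[OF this] obtain \<phi> :: "'k \<Rightarrow> 'a \<Rightarrow> nat" where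
    "\<forall>a\<in>A. finite (\<phi> a ` B) \<and> (\<forall>x\<in>B. \<forall>y\<in>B. \<phi> a x = \<phi> a y \<longrightarrow> r a (inv\<^bsub>G\<^esub> x \<otimes>\<^bsub>G\<^esub> y) < d)" ..
  then have \<phi>: "\<And>a. a \<in> A \<Longrightarrow> finite (\<phi> a ` B)"
    "\<And>a x y. a \<in> A \<Longrightarrow> x \<in> B \<Longrightarrow> y \<in> B \<Longrightarrow> \<phi> a x = \<phi> a y \<Longrightarrow> r a (inv\<^bsub>G\<^esub> x \<otimes>\<^bsub>G\<^esub> y) < d" by auto
  let ?\<psi> = "\<lambda>x. \<lambda>a\<in>A. \<phi> a x"
  have "finite (PiE A (\<lambda>a. \<phi> a ` B))" using A \<phi>(1) by (intro finite_PiE)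
  then have "finite (?\<psi> ` B)" by (rule finite_subset[rotated]) auto
  moreover have "(\<Sum>a\<in>A. r a (inv\<^bsub>G\<^esub> x \<otimes>\<^bsub>G\<^esub> y)) < e" if xy: "x \<in> B" "y \<in> B" "?\<psi> x = ?\<psi> y" for x y
  proof -
    have "r a (inv\<^bsub>G\<^esub> x \<otimes>\<^bsub>G\<^esub> y) \<le> d" if a: "a \<in> A" for a
    proof -
      have "\<phi> a x = \<phi> a y" using fun_cong[OF xy(3), of a] a by simp
      then show ?thesis using \<phi>(2)[OF a xy(1,2)] by simp
    qed
    then have "(\<Sum>a\<in>A. r a (inv\<^bsub>G\<^esub> x \<otimes>\<^bsub>G\<^esub> y)) \<le> real (card A) * d"
      by (rule sum_bounded_above)
    also have "\<dots> < e" using e by (simp add: d_def field_simps)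
    finally show ?thesis .
  qed
  ultimately show "\<exists>\<psi> :: 'a \<Rightarrow> 'k \<Rightarrow> nat. finite (\<psi> ` B) \<and>
    (\<forall>x\<in>B. \<forall>y\<in>B. \<psi> x = \<psi> y \<longrightarrow> (\<Sum>a\<in>A. r a (inv\<^bsub>G\<^esub> x \<otimes>\<^bsub>G\<^esub> y)) < e)" by blast
qed

lemma small_near_one_approx:
  assumes "\<And>e. e > 0 \<Longrightarrow> \<exists>r'. small_near_one G T B r' \<and> (\<forall>x\<in>B. r x \<le> r' x + e)"
  shows "small_near_one G T B r"
  unfolding small_near_one_def
proof (intro allI impI)
  fix e :: real assume e: "e > 0"
  then obtain r' where r': "small_near_one G T B r'" "\<forall>x\<in>B. r x \<le> r' x + e / 2"
    using assms[of "e / 2"] by auto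
  obtain U where U: "openin T U" "\<one>\<^bsub>G\<^esub> \<in> U" "\<forall>x\<in>U \<inter> B. r' x < e / 2"
    using r'(1) e unfolding small_near_one_def by (meson half_gt_zero)
  have "r x < e" if "x \<in> U \<inter> B" for x
  proof -
    have "r' x < e / 2" "r x \<le> r' x + e / 2" using U(3) r'(2) that by auto
    then show ?thesis by linarith
  qed
  then show "\<exists>U. openin T U \<and> \<one>\<^bsub>G\<^esub> \<in> U \<and> (\<forall>x\<in>U \<inter> B. r x < e)" using U by blast
qed

lemma totally_bounded_approx:
  fixes G :: "('a, 'm) monoid_scheme"
  assumes "\<And>e. e > 0 \<Longrightarrow> \<exists>r'. totally_bounded_norm G B r' \<and>
    (\<forall>x\<in>B. \<forall>y\<in>B. r (inv\<^bsub>G\<^esub> x \<otimes>\<^bsub>G\<^esub> y) \<le> r' (inv\<^bsub>G\<^esub> x \<otimes>\<^bsub>G\<^esub> y) + e)"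
  shows "totally_bounded_norm G B r"
  unfolding totally_bounded_norm_def
proof (intro allI impI)
  fix e :: real assume e: "e > 0"
  then obtain r' where r': "totally_bounded_norm G B r'"
    "\<forall>x\<in>B. \<forall>y\<in>B. r (inv\<^bsub>G\<^esub> x \<otimes>\<^bsub>G\<^esub> y) \<le> r' (inv\<^bsub>G\<^esub> x \<otimes>\<^bsub>G\<^esub> y) + e / 2"
    using assms[of "e / 2"] by auto
  obtain \<phi> :: "'a \<Rightarrow> nat" where \<phi>: "finite (\<phi> ` B)"
    "\<And>x y. x \<in> B \<Longrightarrow> y \<in> B \<Longrightarrow> \<phi> x = \<phi> y \<Longrightarrow> r' (inv\<^bsub>G\<^esub> x \<otimes>\<^bsub>G\<^esub> y) < e / 2"
    by (rule totally_boundedE[OF r'(1), of "e / 2"]) (use e in auto)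
  have "r (inv\<^bsub>G\<^esub> x \<otimes>\<^bsub>G\<^esub> y) < e" if "x \<in> B" "y \<in> B" "\<phi> x = \<phi> y" for x y
  proof -
    have "r (inv\<^bsub>G\<^esub> x \<otimes>\<^bsub>G\<^esub> y) \<le> r' (inv\<^bsub>G\<^esub> x \<otimes>\<^bsub>G\<^esub> y) + e / 2" using r'(2) that by blast
    then show ?thesis using \<phi>(2)[OF that] by linarith
  qed
  then show "\<exists>\<phi> :: 'a \<Rightarrow> nat. finite (\<phi> ` B) \<and>
        (\<forall>x\<in>B. \<forall>y\<in>B. \<phi> x = \<phi> y \<longrightarrow> r (inv\<^bsub>G\<^esub> x \<otimes>\<^bsub>G\<^esub> y) < e)"
    using \<phi>(1) by blast
qed

lemma norms_zero: "topological_group G T \<Longrightarrow> (\<lambda>x. 0) \<in> norms G T B"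
proof -
  assume "topological_group G T"
  then interpret topological_group G T .
  have "openin T (topspace T)" "\<one>\<^bsub>G\<^esub> \<in> topspace T"
    by (rule openin_topspace, simp add: topspace_eq)
  then show ?thesis
    unfolding norms_def pseudonorm_def conj_invariant_def small_near_one_def by auto
qed

lemma norms_add:
  assumes r: "r \<in> norms G T B" and s: "s \<in> norms G T B"
  shows "(\<lambda>x. r x + s x) \<in> norms G T B"
proof -
  note rn = normsD[OF r] and sn = normsD[OF s]
  have "pseudonorm G B (\<lambda>x. r x + s x)"
    unfolding pseudonorm_def
  proof (intro conjI ballI)
    fix x y assume x: "x \<in> B" and y: "y \<in> B"
    show "0 \<le> r x + s x"
      by (intro add_nonneg_nonneg pseudonormD(1)[OF rn(1) x] pseudonormD(1)[OF sn(1) x])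
    show "r (inv\<^bsub>G\<^esub> x) + s (inv\<^bsub>G\<^esub> x) = r x + s x"
      by (simp only: pseudonormD(3)[OF rn(1) x] pseudonormD(3)[OF sn(1) x])
    show "r (x \<otimes>\<^bsub>G\<^esub> y) + s (x \<otimes>\<^bsub>G\<^esub> y) \<le> r x + s x + (r y + s y)"
      using pseudonormD(4)[OF rn(1) x y] pseudonormD(4)[OF sn(1) x y] by linarith
  next
    show "r \<one>\<^bsub>G\<^esub> + s \<one>\<^bsub>G\<^esub> = 0"
      using pseudonormD(2)[OF rn(1)] pseudonormD(2)[OF sn(1)] by simp
  qed
  moreover have "conj_invariant G B (\<lambda>x. r x + s x)"
    using rn(2) sn(2) unfolding conj_invariant_def by simp
  moreover have "small_near_one G T B (\<lambda>x. r x + s x)"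
    unfolding small_near_one_def
  proof (intro allI impI)
    fix e :: real assume e: "e > 0"
    obtain U where U: "openin T U" "\<one>\<^bsub>G\<^esub> \<in> U" "\<forall>x\<in>U \<inter> B. r x < e / 2"
      using rn(3) e unfolding small_near_one_def by (meson half_gt_zero)
    obtain V where V: "openin T V" "\<one>\<^bsub>G\<^esub> \<in> V" "\<forall>x\<in>V \<inter> B. s x < e / 2"
      using sn(3) e unfolding small_near_one_def by (meson half_gt_zero)
    have "r x + s x < e" if "x \<in> (U \<inter> V) \<inter> B" for x
    proof -
      have "r x < e / 2" "s x < e / 2" using U(3) V(3) that by auto
      then show ?thesis by linarith
    qed
    then show "\<exists>U. openin T U \<and> \<one>\<^bsub>G\<^esub> \<in> U \<and> (\<forall>x\<in>U \<inter> B. r x + s x < e)"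
      using U V by (intro exI[of _ "U \<inter> V"]) auto
  qed
  ultimately show ?thesis by (simp add: norms_def)
qed

lemma norms_sum:
  assumes "topological_group G T" "finite A" "\<And>a. a \<in> A \<Longrightarrow> r a \<in> norms G T B"
  shows "(\<lambda>x. \<Sum>a\<in>A. r a x) \<in> norms G T B"
  using assms(2,3)
proof (induction A rule: finite_induct)
  case empty
  then show ?case using norms_zero[OF assms(1)] by simp
next
  case (insert a A)
  then show ?case using norms_add[of "r a" G T B "\<lambda>x. \<Sum>a\<in>A. r a x"] by simp
qed

text \<open>A single pseudonorm whose kernel is the intersection of the kernels of countably many.  By \<open>norm_series_tail\<close> it is approximated uniformly by finite sums, so it inherits continuity and total boundedness.\<close>

definition norm_series :: "(nat \<Rightarrow> 'a \<Rightarrow> real) \<Rightarrow> 'a \<Rightarrow> real" where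
  "norm_series r x = (\<Sum>n. (1/2) ^ n * min 1 (r n x))"

lemma
  assumes nonneg: "\<And>n. 0 \<le> r n x"
  shows norm_series_summable: "summable (\<lambda>n. (1/2::real) ^ n * min 1 (r n x))"
    and norm_series_tail: "norm_series r x \<le> (\<Sum>n<k. r n x) + 2 * (1/2) ^ k"
    and norm_series_eq_0: "norm_series r x = 0 \<longleftrightarrow> (\<forall>n. r n x = 0)"
    and norm_series_nonneg: "0 \<le> norm_series r x"
proof -
  let ?f = "\<lambda>n. (1/2::real) ^ n * min 1 (r n x)"
  have f: "0 \<le> ?f n" "?f n \<le> (1/2) ^ n" "?f n \<le> r n x" for n
  proof -
    show "0 \<le> ?f n" using nonneg[of n] by simp
    show "?f n \<le> (1/2) ^ n" by (simp add: mult_left_le)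
    have "?f n \<le> 1 * min 1 (r n x)"
      using nonneg[of n] by (intro mult_right_mono power_le_one) auto
    then show "?f n \<le> r n x" by simp
  qed
  have geo: "summable (\<lambda>n. (1/2::real) ^ n)" by (simp add: summable_geometric)
  show sm: "summable ?f"
    by (rule summable_comparison_test'[OF geo]) (use f in auto)
  show "0 \<le> norm_series r x"
    unfolding norm_series_def by (rule suminf_nonneg[OF sm f(1)])
  have "norm_series r x = (\<Sum>n. ?f (n + k)) + (\<Sum>n<k. ?f n)"
    unfolding norm_series_def by (rule suminf_split_initial_segment[OF sm])
  also have "(\<Sum>n. ?f (n + k)) \<le> (\<Sum>n. (1/2) ^ (n + k))"
    using sm geo f(2) by (intro suminf_le summable_ignore_initial_segment) auto
  also have "(\<Sum>n. (1/2::real) ^ (n + k)) = 2 * (1/2) ^ k"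
    by (simp add: power_add suminf_mult2[symmetric] suminf_geometric geo mult.commute)
  also have "(\<Sum>n<k. ?f n) \<le> (\<Sum>n<k. r n x)" by (intro sum_mono f)
  finally show "norm_series r x \<le> (\<Sum>n<k. r n x) + 2 * (1/2) ^ k" by simp
  have "norm_series r x = 0 \<longleftrightarrow> (\<forall>n. ?f n = 0)"
    unfolding norm_series_def by (rule suminf_eq_zero_iff[OF sm f(1)])
  also have "\<dots> \<longleftrightarrow> (\<forall>n. r n x = 0)"
  proof (intro iff_allI)
    fix n show "?f n = 0 \<longleftrightarrow> r n x = 0" using nonneg[of n] by (auto simp: min_def)
  qed
  finally show "norm_series r x = 0 \<longleftrightarrow> (\<forall>n. r n x = 0)" .
qed

lemma half_power_small: "e > 0 \<Longrightarrow> \<exists>k. 2 * (1/2::real) ^ k \<le> e"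
  using real_arch_pow_inv[of "e / 2" "1/2"] by (auto simp: field_simps intro: less_imp_le)

lemma norm_series_norm:
  assumes G: "topological_group G T" and B: "B \<lhd> G" and r: "\<And>n. r n \<in> norms G T B"
  shows "norm_series r \<in> norms G T B"
proof -
  interpret topological_group G T by fact
  interpret B: normal B G by fact
  have rn: "pseudonorm G B (r n)" "conj_invariant G B (r n)" for n using normsD[OF r[of n]] by auto
  have nn: "0 \<le> r n x" if "x \<in> B" for n x using pseudonormD(1)[OF rn(1) that] .
  have "pseudonorm G B (norm_series r)"
    unfolding pseudonorm_def
  proof (intro conjI ballI)
    fix x y assume x: "x \<in> B" and y: "y \<in> B"
    show "0 \<le> norm_series r x" by (rule norm_series_nonneg) (rule nn[OF x])
    show "norm_series r (inv\<^bsub>G\<^esub> x) = norm_series r x"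
      unfolding norm_series_def using pseudonormD(3)[OF rn(1) x] by simp
    have "norm_series r (x \<otimes>\<^bsub>G\<^esub> y) \<le> (\<Sum>n. (1/2) ^ n * min 1 (r n x) + (1/2) ^ n * min 1 (r n y))"
      unfolding norm_series_def
    proof (rule suminf_le)
      fix n
      have "r n (x \<otimes>\<^bsub>G\<^esub> y) \<le> r n x + r n y" by (rule pseudonormD(4)[OF rn(1) x y])
      then have "min 1 (r n (x \<otimes>\<^bsub>G\<^esub> y)) \<le> min 1 (r n x) + min 1 (r n y)"
        using nn[OF x, of n] nn[OF y, of n] by (auto simp: min_def)
      then have "(1/2) ^ n * min 1 (r n (x \<otimes>\<^bsub>G\<^esub> y)) \<le> (1/2) ^ n * (min 1 (r n x) + min 1 (r n y))"
        by (intro mult_left_mono) auto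
      then show "(1/2) ^ n * min 1 (r n (x \<otimes>\<^bsub>G\<^esub> y)) \<le> (1/2) ^ n * min 1 (r n x) + (1/2) ^ n * min 1 (r n y)"
        by (simp add: distrib_left)
    next
      show "summable (\<lambda>n. (1/2) ^ n * min 1 (r n (x \<otimes>\<^bsub>G\<^esub> y)))"
        using nn x y by (intro norm_series_summable) auto
      show "summable (\<lambda>n. (1/2) ^ n * min 1 (r n x) + (1/2) ^ n * min 1 (r n y))"
        using nn x y by (intro summable_add norm_series_summable) auto
    qed
    also have "\<dots> = norm_series r x + norm_series r y"
      unfolding norm_series_def using nn x y
      by (intro suminf_add[symmetric] norm_series_summable) auto
    finally show "norm_series r (x \<otimes>\<^bsub>G\<^esub> y) \<le> norm_series r x + norm_series r y" .
  next
    show "norm_series r \<one>\<^bsub>G\<^esub> = 0"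
      unfolding norm_series_def using pseudonormD(2)[OF rn(1)] by simp
  qed
  moreover have "conj_invariant G B (norm_series r)"
    unfolding conj_invariant_def norm_series_def using conj_invariantD[OF rn(2)] by simp
  moreover have "small_near_one G T B (norm_series r)"
  proof (rule small_near_one_approx)
    fix e :: real assume "e > 0"
    then obtain k where k: "2 * (1/2::real) ^ k \<le> e" using half_power_small by blast
    have "(\<lambda>x. \<Sum>n<k. r n x) \<in> norms G T B" using r by (intro norms_sum[OF G]) auto
    moreover have "norm_series r x \<le> (\<Sum>n<k. r n x) + e" if "x \<in> B" for x
      using norm_series_tail[of r x k] nn[OF that] k by force
    ultimately show "\<exists>r'. small_near_one G T B r' \<and> (\<forall>x\<in>B. norm_series r x \<le> r' x + e)"
      using normsD(3) by blast
  qed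
  ultimately show ?thesis by (simp add: norms_def)
qed

lemma norm_series_totally_bounded:
  assumes B: "subgroup B G" "group G" and r: "\<And>n. pseudonorm G B (r n)" "\<And>n. totally_bounded_norm G B (r n)"
  shows "totally_bounded_norm G B (norm_series r)"
proof (rule totally_bounded_approx)
  interpret group G by fact
  interpret B: subgroup B G by fact
  fix e :: real assume "e > 0"
  then obtain k where k: "2 * (1/2::real) ^ k \<le> e" using half_power_small by blast
  have "totally_bounded_norm G B (\<lambda>x. \<Sum>n<k. r n x)" using r by (intro totally_bounded_sum) auto
  moreover have "norm_series r (inv\<^bsub>G\<^esub> x \<otimes>\<^bsub>G\<^esub> y) \<le> (\<Sum>n<k. r n (inv\<^bsub>G\<^esub> x \<otimes>\<^bsub>G\<^esub> y)) + e"
    if "x \<in> B" "y \<in> B" for x y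
    using norm_series_tail[of r "inv\<^bsub>G\<^esub> x \<otimes>\<^bsub>G\<^esub> y" k] pseudonormD(1)[OF r(1), of "inv\<^bsub>G\<^esub> x \<otimes>\<^bsub>G\<^esub> y"] that k
    by force
  ultimately show "\<exists>r'. totally_bounded_norm G B r' \<and>
      (\<forall>x\<in>B. \<forall>y\<in>B. norm_series r (inv\<^bsub>G\<^esub> x \<otimes>\<^bsub>G\<^esub> y) \<le> r' (inv\<^bsub>G\<^esub> x \<otimes>\<^bsub>G\<^esub> y) + e)"
    by blast
qed

section \<open>Separable closed normal subgroups\<close>

lemma (in group) countable_generate:
  assumes "countable C" "C \<subseteq> carrier G"
  shows "countable (generate G C)"
proof -
  define D where "D = C \<union> (\<lambda>x. inv x) ` C"
  let ?prod = "\<lambda>xs. foldr (\<otimes>) xs \<one>"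
  have D: "D \<subseteq> carrier G" using assms by (auto simp: D_def)
  have closed: "?prod xs \<in> carrier G" if "xs \<in> lists D" for xs
    using that D by (induction xs) auto
  have app: "?prod (xs @ ys) = ?prod xs \<otimes> ?prod ys" if "xs \<in> lists D" "ys \<in> lists D" for xs ys
    using that(1)
  proof (induction xs)
    case Nil
    then show ?case using closed[OF that(2)] by simp
  next
    case (Cons x xs)
    then show ?case using closed[OF that(2)] closed[of xs] D by (auto simp: m_assoc)
  qed
  have "h \<in> ?prod ` lists D" if "h \<in> generate G C" for h
    using that
  proof induction
    case one
    then show ?case by (intro image_eqI[of _ _ "[]"]) auto
  next
    case (incl h)
    then show ?case using assms(2) by (intro image_eqI[of _ _ "[h]"]) (auto simp: D_def)
  next
    case (inv h)
    then show ?case using assms(2) by (intro image_eqI[of _ _ "[inv h]"]) (auto simp: D_def)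
  next
    case (eng h1 h2)
    then obtain xs ys where "xs \<in> lists D" "h1 = ?prod xs" "ys \<in> lists D" "h2 = ?prod ys" by blast
    then show ?case using app[of xs ys] by (intro image_eqI[of _ _ "xs @ ys"]) auto
  qed
  moreover have "countable D" using assms(1) by (simp add: D_def)
  ultimately show ?thesis
    by (meson countable_image countable_lists countable_subset subsetI)
qed

context topological_group
begin

lemma closure_near:
  assumes x: "x \<in> T closure_of S" and S: "S \<subseteq> carrier G" and U: "openin T U" "\<one> \<in> U"
  obtains s where "s \<in> S" "inv s \<otimes> x \<in> U"
proof -
  have xc: "x \<in> carrier G" using x closure_of_subset_topspace[of T S] topspace_eq by blast
  have "continuous_map T T (\<lambda>y. inv y \<otimes> x)"
    using xc by (intro continuous_group_intros)
  then have op: "openin T {y \<in> topspace T. inv y \<otimes> x \<in> U}"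
    using U(1) by (rule openin_continuous_map_preimage)
  have "x \<in> {y \<in> topspace T. inv y \<otimes> x \<in> U}"
    using xc U by (simp add: topspace_eq)
  with x op have "\<exists>y. y \<in> S \<and> y \<in> {y \<in> topspace T. inv y \<otimes> x \<in> U}"
    unfolding in_closure_of by (elim conjE allE impE) (rule conjI, assumption+)
  then obtain s where "s \<in> S" "inv s \<otimes> x \<in> U" by auto
  then show thesis by (rule that)
qed

lemma normal_closure_of:
  assumes "N \<lhd> G"
  shows "T closure_of N \<lhd> G"
  unfolding normal_inv_iff
proof (intro conjI ballI)
  interpret N: normal N G by fact
  show "subgroup (T closure_of N) G" by (rule closure_of_subgroup[OF N.subgroup_axioms])
  fix x h assume x: "x \<in> carrier G" and h: "h \<in> T closure_of N"
  let ?c = "\<lambda>y. x \<otimes> y \<otimes> inv x"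
  have "continuous_map T T ?c"
    using x by (intro continuous_group_intros) auto
  then have "?c ` (T closure_of N) \<subseteq> T closure_of (?c ` N)"
    by (rule continuous_map_image_closure_subset)
  also have "\<dots> \<subseteq> T closure_of N"
    using N.inv_op_closed2[OF x] by (intro closure_of_mono) auto
  finally show "x \<otimes> h \<otimes> inv x \<in> T closure_of N" using h by blast
qed

text \<open>Modulo \<open>N\<close>, conjugation by \<open>B\<close> is trivial on \<open>B\<close>, and conjugation by an element close to the unit is close to the identity, uniformly on the group, because pseudonorms are invariant.  Precompactness modulo \<open>B\<close> therefore approximates each conjugacy class in \<open>B\<close> by finitely many conjugates, and the closed normal subgroup generated by \<open>N\<close> and a sequence is separable for all pseudonorms that vanish on \<open>N\<close>.\<close>

lemma separable_normal_hull:
  assumes bal: "balanced_group G T"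
    and N: "N \<lhd> G" and B: "B \<lhd> G" "closedin T B" and NB: "N \<subseteq> B"
    and comm: "\<And>a b. a \<in> B \<Longrightarrow> b \<in> B \<Longrightarrow> a \<otimes> b \<otimes> inv a \<otimes> inv b \<in> N"
    and pc: "precompact_modulo G T B"
    and a: "\<And>n::nat. a n \<in> B"
  obtains H where "H \<lhd> G" "closedin T H" "N \<subseteq> H" "H \<subseteq> B" "range a \<subseteq> H"
    "\<And>r. r \<in> norms G T B \<Longrightarrow> (\<forall>n\<in>N. r n = 0) \<Longrightarrow>
       \<exists>C. countable C \<and> C \<subseteq> H \<and> (\<forall>h\<in>H. \<forall>e>0. \<exists>c\<in>C. r (inv c \<otimes> h) < e)"
proof -
  interpret N: normal N G by fact
  interpret B: normal B G by fact
  note Nc = N.subset[THEN subsetD] and Bc = B.subset[THEN subsetD]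
  define E where "E = N \<union> {x \<otimes> a n \<otimes> inv x | x n. x \<in> carrier G}"
  have EB: "E \<subseteq> B" using NB a B.inv_op_closed2 by (auto simp: E_def)
  then have Ec: "E \<subseteq> carrier G" using B.subset by blast
  define D where "D = generate G E"
  have D: "D \<lhd> G"
    unfolding D_def
  proof (rule normal_generateI[OF Ec])
    fix h g assume h: "h \<in> E" and g: "g \<in> carrier G"
    from h consider "h \<in> N" | x n where "x \<in> carrier G" "h = x \<otimes> a n \<otimes> inv x" unfolding E_def by blast
    then show "g \<otimes> h \<otimes> inv g \<in> E"
    proof cases
      case 1
      then show ?thesis using N.inv_op_closed2[OF g] by (simp add: E_def)
    next
      case 2
      have "g \<otimes> h \<otimes> inv g = (g \<otimes> x) \<otimes> a n \<otimes> inv (g \<otimes> x)"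
        using 2 g Bc[OF a] by (simp add: word_simps)
      then show ?thesis using 2 g unfolding E_def by blast
    qed
  qed
  have ED: "E \<subseteq> D" unfolding D_def by (auto intro: generate.incl)
  have DB: "D \<subseteq> B" unfolding D_def by (rule generate_subgroup_incl[OF EB B.subgroup_axioms])
  define H where "H = T closure_of D"
  have Dc: "D \<subseteq> topspace T" using DB B.subset topspace_eq by blast
  have DH: "D \<subseteq> H" unfolding H_def by (rule closure_of_subset[OF Dc])
  show thesis
  proof (rule that[of H])
    show "H \<lhd> G" unfolding H_def by (rule normal_closure_of[OF D])
    show "closedin T H" unfolding H_def by simp
    show "N \<subseteq> H" using ED DH by (auto simp: E_def)
    show "H \<subseteq> B" unfolding H_def using closure_of_minimal[OF DB B(2)] .
    show "range a \<subseteq> H"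
    proof -
      have "a n \<in> E" for n
        unfolding E_def using Bc[OF a[of n]] by (intro UnI2 CollectI exI[of _ \<one>] exI[of _ n]) simp
      then show ?thesis using ED DH by blast
    qed
    fix r assume r: "r \<in> norms G T B" and r0: "\<forall>n\<in>N. r n = 0"
    note rn = normsD[OF r]
    have orbit: "\<exists>F. finite F \<and> F \<subseteq> carrier G \<and>
        (\<forall>x\<in>carrier G. \<forall>b\<in>B. \<exists>f\<in>F. r (inv (f \<otimes> b \<otimes> inv f) \<otimes> (x \<otimes> b \<otimes> inv x)) < e)" if e: "e > 0" for e
    proof -
      obtain U where U: "openin T U" "\<one> \<in> U" "\<forall>x\<in>U \<inter> B. r x < e"
        using rn(3) e unfolding small_near_one_def by blast
      obtain q where q: "q \<in> norms G T (carrier G)" "\<And>x. q x < 1 \<Longrightarrow> x \<in> U"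
        using balanced_norm[OF bal U(1,2)] by blast
      note qn = normsD[OF q(1)]
      have half: "(1/2::real) > 0" by simp
      obtain F where F: "finite F" "F \<subseteq> carrier G"
        "\<forall>x\<in>carrier G. \<exists>f\<in>F. \<exists>n\<in>B. q (inv f \<otimes> x \<otimes> n) < 1/2"
        using pc[unfolded precompact_modulo_def, rule_format, OF q(1) half] by blast
      have near: "\<exists>f\<in>F. r (inv (f \<otimes> b \<otimes> inv f) \<otimes> (x \<otimes> b \<otimes> inv x)) < e"
        if x: "x \<in> carrier G" and b: "b \<in> B" for x b
      proof -
        obtain f c where f: "f \<in> F" "c \<in> B" "q (inv f \<otimes> x \<otimes> c) < 1/2" using F(3) x by blast
        have fc: "f \<in> carrier G" using f F by blast
        note cl = fc Bc[OF f(2)] x Bc[OF b]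
        define u where "u = inv f \<otimes> x \<otimes> c"
        have u: "u \<in> carrier G" using cl by (simp add: u_def)
        define k where "k = inv b \<otimes> inv c \<otimes> b \<otimes> c"
        have k: "k \<in> N"
          using comm[of "inv b" "inv c"] b f(2) Bc[OF b] Bc[OF f(2)] by (simp add: k_def)
        have kc: "k \<in> carrier G" using Nc[OF k] .
        have "x = f \<otimes> u \<otimes> inv c" using cl by (simp add: u_def word_simps)
        then have "x \<otimes> b \<otimes> inv x = f \<otimes> u \<otimes> (b \<otimes> k) \<otimes> inv u \<otimes> inv f"
          using cl u by (simp add: k_def word_simps)
        \<comment> \<open>A conjugate of a commutator of \<open>b\<close> and the small \<open>u\<close>, times an element of \<open>N\<close>.\<close>
        then have eq: "inv (f \<otimes> b \<otimes> inv f) \<otimes> (x \<otimes> b \<otimes> inv x)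
            = (f \<otimes> (inv b \<otimes> u \<otimes> b \<otimes> inv u) \<otimes> inv f) \<otimes> ((f \<otimes> u) \<otimes> k \<otimes> inv (f \<otimes> u))"
          using cl u kc by (simp add: word_simps)
        have split: "r ((f \<otimes> (inv b \<otimes> u \<otimes> b \<otimes> inv u) \<otimes> inv f) \<otimes> ((f \<otimes> u) \<otimes> k \<otimes> inv (f \<otimes> u)))
            \<le> r (f \<otimes> (inv b \<otimes> u \<otimes> b \<otimes> inv u) \<otimes> inv f) + r ((f \<otimes> u) \<otimes> k \<otimes> inv (f \<otimes> u))"
        proof (rule pseudonormD(4)[OF rn(1)])
          have "u \<otimes> b \<otimes> inv u \<in> B" by (rule B.inv_op_closed2[OF u b])
          then have "inv b \<otimes> (u \<otimes> b \<otimes> inv u) \<in> B" using b by simp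
          then have "inv b \<otimes> u \<otimes> b \<otimes> inv u \<in> B" using cl u by (simp add: m_assoc)
          then show "f \<otimes> (inv b \<otimes> u \<otimes> b \<otimes> inv u) \<otimes> inv f \<in> B" by (rule B.inv_op_closed2[OF fc])
          show "(f \<otimes> u) \<otimes> k \<otimes> inv (f \<otimes> u) \<in> B"
            using k NB fc u by (intro B.inv_op_closed2) auto
        qed
        have zero: "r ((f \<otimes> u) \<otimes> k \<otimes> inv (f \<otimes> u)) = 0"
          by (rule r0[rule_format, OF N.inv_op_closed2[OF _ k]]) (use fc u in simp)
        have conj: "r (f \<otimes> (inv b \<otimes> u \<otimes> b \<otimes> inv u) \<otimes> inv f) = r (inv b \<otimes> u \<otimes> b \<otimes> inv u)"
        proof (rule conj_invariantD[OF rn(2) fc])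
          have "inv b \<otimes> (u \<otimes> b \<otimes> inv u) \<in> B" using B.inv_op_closed2[OF u b] b by simp
          then show "inv b \<otimes> u \<otimes> b \<otimes> inv u \<in> B" using cl u by (simp add: m_assoc)
        qed
        have small: "r (inv b \<otimes> u \<otimes> b \<otimes> inv u) < e"
        proof -
          have "q (inv b \<otimes> u \<otimes> b \<otimes> inv u) \<le> q (inv b \<otimes> u \<otimes> b) + q (inv u)"
            using cl u by (intro pseudonormD(4)[OF qn(1)]) auto
          also have "q (inv b \<otimes> u \<otimes> b) = q u"
            using conj_invariantD[OF qn(2), of "inv b" u] cl u by simp
          also have "q (inv u) = q u" by (rule pseudonormD(3)[OF qn(1) u])
          finally have "q (inv b \<otimes> u \<otimes> b \<otimes> inv u) < 1" using f(3) by (simp add: u_def)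
          then have "inv b \<otimes> u \<otimes> b \<otimes> inv u \<in> U" by (rule q(2))
          moreover have "inv b \<otimes> (u \<otimes> b \<otimes> inv u) \<in> B" using B.inv_op_closed2[OF u b] b by simp
          then have "inv b \<otimes> u \<otimes> b \<otimes> inv u \<in> B" using cl u by (simp add: m_assoc)
          ultimately show ?thesis using U(3) by blast
        qed
        have "r (inv (f \<otimes> b \<otimes> inv f) \<otimes> (x \<otimes> b \<otimes> inv x)) < e"
          unfolding eq using split zero conj small by linarith
        with f(1) show ?thesis by blast
      qed
      show ?thesis by (intro exI[of _ F] conjI ballI F near)
    qed
    have "\<forall>k::nat. \<exists>F. finite F \<and> F \<subseteq> carrier G \<and>
        (\<forall>x\<in>carrier G. \<forall>b\<in>B. \<exists>f\<in>F. r (inv (f \<otimes> b \<otimes> inv f) \<otimes> (x \<otimes> b \<otimes> inv x)) < 1 / Suc k)"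
      using orbit by simp
    from choice[OF this] obtain F where "\<forall>k::nat. finite (F k) \<and> F k \<subseteq> carrier G \<and>
        (\<forall>x\<in>carrier G. \<forall>b\<in>B. \<exists>f\<in>F k. r (inv (f \<otimes> b \<otimes> inv f) \<otimes> (x \<otimes> b \<otimes> inv x)) < 1 / Suc k)" ..
    then have F: "finite (F k)" "F k \<subseteq> carrier G"
      "\<And>x b. x \<in> carrier G \<Longrightarrow> b \<in> B \<Longrightarrow> \<exists>f\<in>F k. r (inv (f \<otimes> b \<otimes> inv f) \<otimes> (x \<otimes> b \<otimes> inv x)) < 1 / Suc k"
      for k by auto
    define C0 where "C0 = insert \<one> (\<Union>k n. (\<lambda>f. f \<otimes> a n \<otimes> inv f) ` F k)"
    have C0E: "C0 \<subseteq> E"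
      unfolding C0_def E_def using F(2) by auto
    have C0c: "countable C0"
      unfolding C0_def using F(1) by (intro countable_insert countable_UN countable_image) (auto intro: countable_finite)
    define C where "C = generate G C0"
    have Cg: "subgroup C G" unfolding C_def using C0E Ec by (intro generate_is_subgroup) blast
    interpret C: subgroup C G by (rule Cg)
    have CD: "C \<subseteq> D" unfolding C_def D_def by (rule mono_generate[OF C0E])
    \<comment> \<open>The \<open>r\<close>-closure of \<open>C\<close> is a closed subgroup that contains the generators of \<open>D\<close>.\<close>
    define M where "M = {h \<in> B. \<forall>e>0. \<exists>c\<in>C. r (inv c \<otimes> h) < e}"
    have CB: "c \<in> B" if "c \<in> C" for c using that CD DB by blast
    have "subgroup M G"
    proof
      show "M \<subseteq> carrier G" using B.subset by (auto simp: M_def)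
      show "\<one> \<in> M" using C.one_closed pseudonormD(2)[OF rn(1)] by (auto simp: M_def intro!: bexI[of _ \<one>])
      show "inv x \<in> M" if x: "x \<in> M" for x
        unfolding M_def
      proof (intro CollectI conjI allI impI)
        show "inv x \<in> B" using x by (simp add: M_def)
        fix e :: real assume "e > 0"
        then obtain c where c: "c \<in> C" "r (inv c \<otimes> x) < e" using x by (auto simp: M_def)
        have "r (inv (inv c) \<otimes> inv x) = r (inv c \<otimes> x)"
          using x by (intro norm_dist_inv[OF rn(1,2) B.subgroup_axioms CB[OF c(1)]]) (simp add: M_def)
        then show "\<exists>c\<in>C. r (inv c \<otimes> inv x) < e" using c by (intro bexI[of _ "inv c"]) auto
      qed
      show "x \<otimes> y \<in> M" if x: "x \<in> M" and y: "y \<in> M" for x y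
        unfolding M_def
      proof (intro CollectI conjI allI impI)
        show "x \<otimes> y \<in> B" using x y by (simp add: M_def)
        fix e :: real assume "e > 0"
        then have e2: "e / 2 > 0" by simp
        obtain c where c: "c \<in> C" "r (inv c \<otimes> x) < e / 2" using x e2 unfolding M_def by blast
        obtain d where d: "d \<in> C" "r (inv d \<otimes> y) < e / 2" using y e2 unfolding M_def by blast
        have "r (inv (c \<otimes> d) \<otimes> (x \<otimes> y)) \<le> r (inv c \<otimes> x) + r (inv d \<otimes> y)"
          using x y CB c d by (intro norm_dist_mult[OF rn(1,2) B.subgroup_axioms]) (auto simp: M_def)
        then have "r (inv (c \<otimes> d) \<otimes> (x \<otimes> y)) < e" using c d by linarith
        then show "\<exists>c\<in>C. r (inv c \<otimes> (x \<otimes> y)) < e" using c d by (intro bexI[of _ "c \<otimes> d"]) auto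
      qed
    qed
    moreover have "E \<subseteq> M"
    proof
      fix h assume h: "h \<in> E"
      show "h \<in> M"
        unfolding M_def
      proof (intro CollectI conjI allI impI)
        show "h \<in> B" using h EB by blast
        fix e :: real assume e: "e > 0"
        from h consider "h \<in> N" | x n where "x \<in> carrier G" "h = x \<otimes> a n \<otimes> inv x" unfolding E_def by blast
        then show "\<exists>c\<in>C. r (inv c \<otimes> h) < e"
        proof cases
          case 1
          then have "inv \<one> \<otimes> h = h" "r h = 0" using r0 Nc by (simp, blast)
          then have "r (inv \<one> \<otimes> h) < e" using e by simp
          then show ?thesis using C.one_closed by blast
        next
          case 2
          obtain k where k: "1 / Suc k < e" using nat_approx_posE[OF e] by blast
          obtain f where f: "f \<in> F k" "r (inv (f \<otimes> a n \<otimes> inv f) \<otimes> (x \<otimes> a n \<otimes> inv x)) < 1 / Suc k"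
            using F(3)[OF 2(1) a] by blast
          have "f \<otimes> a n \<otimes> inv f \<in> C0" unfolding C0_def using f(1) by blast
          then have "f \<otimes> a n \<otimes> inv f \<in> C" unfolding C_def by (rule generate.incl)
          moreover have "r (inv (f \<otimes> a n \<otimes> inv f) \<otimes> h) < e"
            unfolding 2(2) using f(2) k by (rule less_trans)
          ultimately show ?thesis by blast
        qed
      qed
    qed
    ultimately have DM: "D \<subseteq> M" unfolding D_def using generate_subgroup_incl by blast
    have "\<exists>c\<in>C. r (inv c \<otimes> h) < e" if h: "h \<in> H" and e: "e > 0" for h e
    proof -
      have hB: "h \<in> B" using h \<open>H \<subseteq> B\<close> by blast
      have e2: "e / 2 > 0" using e by simp
      obtain U where U: "openin T U" "\<one> \<in> U" "\<forall>x\<in>U \<inter> B. r x < e / 2"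
        using rn(3) e2 unfolding small_near_one_def by blast
      obtain d where d: "d \<in> D" "inv d \<otimes> h \<in> U"
        using closure_near[OF h[unfolded H_def] _ U(1,2)] Dc topspace_eq by blast
      have dB: "d \<in> B" using d DB by blast
      obtain c where c: "c \<in> C" "r (inv c \<otimes> d) < e / 2"
        using d(1) DM e2 unfolding M_def by blast
      have "inv d \<otimes> h \<in> B" using dB hB by simp
      then have "r (inv d \<otimes> h) < e / 2" using U(3) d(2) by blast
      moreover have "r (inv c \<otimes> h) \<le> r (inv c \<otimes> d) + r (inv d \<otimes> h)"
        by (rule norm_dist_triangle[OF rn(1) B.subgroup_axioms CB[OF c(1)] dB hB])
      ultimately show ?thesis using c by (intro bexI[of _ c]) auto
    qed
    moreover have "countable C"
      unfolding C_def using C0c C0E Ec by (intro countable_generate) auto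
    ultimately show "\<exists>C. countable C \<and> C \<subseteq> H \<and> (\<forall>h\<in>H. \<forall>e>0. \<exists>c\<in>C. r (inv c \<otimes> h) < e)"
      using CD DH by (intro exI[of _ C]) auto
  qed
qed

end

section \<open>Kernels of pseudonorms\<close>

context topological_group
begin

lemma norm_kernel_normal:
  assumes B: "B \<lhd> G" and q: "q \<in> norms G T B"
  shows "{b \<in> B. q b = 0} \<lhd> G"
  unfolding normal_inv_iff
proof (intro conjI ballI)
  interpret B: normal B G by fact
  note qn = normsD[OF q]
  let ?M = "{b \<in> B. q b = 0}"
  show "subgroup ?M G"
  proof
    show "?M \<subseteq> carrier G" using B.subset by auto
    show "\<one> \<in> ?M" using pseudonormD(2)[OF qn(1)] by simp
    show "inv x \<in> ?M" if "x \<in> ?M" for x using that pseudonormD(3)[OF qn(1), of x] by simp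
    show "x \<otimes> y \<in> ?M" if "x \<in> ?M" "y \<in> ?M" for x y
      using that pseudonormD(4)[OF qn(1), of x y] pseudonormD(1)[OF qn(1), of "x \<otimes> y"] by simp
  qed
  show "x \<otimes> h \<otimes> inv x \<in> ?M" if "x \<in> carrier G" "h \<in> ?M" for x h
    using that conj_invariantD[OF qn(2), of x h] B.inv_op_closed2[of x h] by simp
qed

lemma closedin_norm_le:
  assumes B: "B \<lhd> G" "closedin T B" and q: "q \<in> norms G T B"
  shows "closedin T {b \<in> B. q b \<le> c}"
proof -
  interpret B: normal B G by fact
  note qn = normsD[OF q]
  let ?M = "{b \<in> B. q b \<le> c}"
  have "T closure_of ?M \<subseteq> ?M"
  proof
    fix x assume x: "x \<in> T closure_of ?M"
    have xB: "x \<in> B" using x closure_of_minimal[of ?M B T] B(2) by blast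
    have "q x \<le> c"
    proof (rule field_le_epsilon)
      fix e :: real assume "e > 0"
      then obtain U where U: "openin T U" "\<one> \<in> U" "\<forall>x\<in>U \<inter> B. q x < e"
        using qn(3) unfolding small_near_one_def by blast
      have Mc: "?M \<subseteq> carrier G" using B.subset by blast
      obtain m where m: "m \<in> ?M" "inv m \<otimes> x \<in> U"
        by (rule closure_near[OF x Mc U(1,2)])
      then have mB: "m \<in> B" by blast
      have "q (inv m \<otimes> x) < e" using U(3) m(2) mB xB by simp
      moreover have "q x \<le> q m + q (inv m \<otimes> x)"
        by (rule norm_le_dist[OF qn(1) B.subgroup_axioms mB xB])
      ultimately show "q x \<le> c + e" using m(1) by simp
    qed
    then show "x \<in> ?M" using xB by simp
  qed
  moreover have "?M \<subseteq> topspace T" using B.subset by (auto simp: topspace_eq)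
  ultimately show ?thesis using closure_of_subset_eq by blast
qed

lemma norm_kernel_closed:
  assumes B: "B \<lhd> G" "closedin T B" and q: "q \<in> norms G T B"
  shows "closedin T {b \<in> B. q b = 0}"
proof -
  have "{b \<in> B. q b = 0} = {b \<in> B. q b \<le> 0}"
    using pseudonormD(1)[OF normsD(1)[OF q]] by (auto intro: antisym)
  then show ?thesis using closedin_norm_le[OF B q, of 0] by simp
qed

end

section \<open>Abelian sections with enough totally bounded pseudonorms\<close>

text \<open>One step of the descent: an abelian quotient \<open>B/N\<close> of closed normal subgroups above which the group is already precompact.\<close>

locale abelian_section = topological_group +
  fixes N B
  assumes balanced: "balanced_group G T" and hTG: "hTG_closed G T"
    and N: "N \<lhd> G" "closedin T N" and B: "B \<lhd> G" "closedin T B" and NB: "N \<subseteq> B"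
    and commutator: "\<And>a b. a \<in> B \<Longrightarrow> b \<in> B \<Longrightarrow> a \<otimes> b \<otimes> inv a \<otimes> inv b \<in> N"
    and precompact: "precompact_modulo G T B"
begin

sublocale N: normal N G by (rule N)
sublocale B: normal B G by (rule B)

definition tb_norms :: "('a \<Rightarrow> real) set" where
  "tb_norms = {r \<in> norms G T B. totally_bounded_norm G B r \<and> (\<forall>n\<in>N. r n = 0)}"

lemma tb_normsD:
  assumes "r \<in> tb_norms"
  shows "r \<in> norms G T B" "totally_bounded_norm G B r" "n \<in> N \<Longrightarrow> r n = 0"
  using assms by (auto simp: tb_norms_def)

lemma tb_norms_zero: "(\<lambda>x. 0) \<in> tb_norms"
proof -
  have "finite ((\<lambda>x. 0::nat) ` B)" by (rule finite_subset[of _ "{0}"]) auto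
  then have "totally_bounded_norm G B (\<lambda>x. 0)"
    unfolding totally_bounded_norm_def by (intro allI impI exI[of _ "\<lambda>x. 0"]) simp
  then show ?thesis
    using norms_zero[OF topological_group_axioms, of B] by (simp add: tb_norms_def)
qed

lemma tb_norms_add:
  assumes r: "r \<in> tb_norms" and s: "s \<in> tb_norms"
  shows "(\<lambda>x. r x + s x) \<in> tb_norms"
proof -
  have "totally_bounded_norm G B (\<lambda>x. \<Sum>b\<in>UNIV. (if b then r else s) x)"
    using tb_normsD(2)[OF r] tb_normsD(2)[OF s] by (intro totally_bounded_sum) auto
  moreover have "(\<Sum>b\<in>UNIV. (if b then r else s) x) = r x + s x" for x
    by (simp add: UNIV_bool add.commute)
  ultimately have "totally_bounded_norm G B (\<lambda>x. r x + s x)" by simp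
  then show ?thesis
    using norms_add[OF tb_normsD(1)[OF r] tb_normsD(1)[OF s]] tb_normsD(3)[OF r] tb_normsD(3)[OF s]
    by (simp add: tb_norms_def)
qed

lemma norm_complete_on_closed_normal:
  assumes H: "H \<lhd> G" "closedin T H" "H \<subseteq> B" and r: "r \<in> norms G T B"
  shows "complete_norm G H r"
  unfolding complete_norm_def
proof (intro allI impI)
  fix s :: "nat \<Rightarrow> 'a" assume s: "\<forall>n. s n \<in> H" "cauchy_net G {r} sequentially s"
  have "{r} \<subseteq> norms G T H" using norms_subset[OF r H(3)] by simp
  then obtain x where "x \<in> H"
    "\<And>q e. q \<in> {r} \<Longrightarrow> e > 0 \<Longrightarrow> eventually (\<lambda>i. q (inv s i \<otimes> x) < e) sequentially"
    using closed_normal_complete[OF balanced hTG H(1,2) _ sequentially_bot s(1)[rule_format] s(2)]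
    by blast
  then show "\<exists>x\<in>H. \<forall>e>0. eventually (\<lambda>n. r (inv s n \<otimes> x) < e) sequentially" by blast
qed

text \<open>Separation passes from \<open>N\<close> to larger closed normal subgroups \<open>M\<close>.  If the distances from \<open>M\<close> for all pseudonorms in \<open>tb_norms\<close> vanish at \<open>b\<close>, then the points of \<open>M\<close> close to \<open>b\<close> generate a Cauchy filter.  Its limit lies in \<open>M\<close> by completeness and agrees with \<open>b\<close> modulo \<open>N\<close>.\<close>

lemma separates_larger:
  assumes sep: "\<And>b. b \<in> B \<Longrightarrow> (\<And>r. r \<in> tb_norms \<Longrightarrow> r b = 0) \<Longrightarrow> b \<in> N"
    and M: "M \<lhd> G" "closedin T M" "N \<subseteq> M" "M \<subseteq> B"
    and b: "b \<in> B" "b \<notin> M"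
  obtains r where "r \<in> tb_norms" "\<And>x. x \<in> M \<Longrightarrow> r x = 0" "r b \<noteq> 0"
proof (rule ccontr)
  note found = that
  assume no: "\<not> thesis"
  interpret M: normal M G by fact
  let ?d = "inf_conv G M (\<lambda>x. 0)"
  have zero: "(\<lambda>x. 0) \<in> norms G T M" by (rule norms_zero[OF topological_group_axioms])
  note conv = M(1) B(1) M(4) zero
  have close: "\<exists>m\<in>M. r (inv m \<otimes> b) < e" if r: "r \<in> tb_norms" and e: "e > 0" for r e
  proof -
    note rB = tb_normsD(1)[OF r]
    note dn = inf_conv_norm[OF conv rB]
    have dM: "?d r x = 0" if "x \<in> M" for x
    proof (rule antisym)
      show "?d r x \<le> 0" by (rule inf_conv_le(2)[OF conv rB that])
      show "0 \<le> ?d r x" by (rule pseudonormD(1)[OF normsD(1)[OF dn] subsetD[OF M(4) that]])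
    qed
    have "totally_bounded_norm G B (?d r)"
      by (rule totally_bounded_le[OF tb_normsD(2)[OF r]]) (use inf_conv_le(1)[OF conv rB] in auto)
    then have "?d r \<in> tb_norms" using dn dM M(3) by (auto simp: tb_norms_def)
    then have "?d r b = 0" using found dM no by blast
    then show ?thesis using inf_conv_less[OF conv rB, of b e] e by simp
  qed
  let ?S = "\<lambda>(r, e). {m \<in> M. r (inv m \<otimes> b) < e}"
  let ?I = "tb_norms \<times> {e::real. e > 0}"
  let ?F = "\<lambda>i. principal (?S i)"
  define F where "F = (INF i\<in>?I. ?F i)"
  have ne: "?I \<noteq> {}" using tb_norms_zero by (auto intro: exI[of _ 1])
  have base: "eventually P F \<longleftrightarrow> (\<exists>i\<in>?I. eventually P (?F i))" for P
    unfolding F_def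
  proof (rule eventually_INF_base[OF ne])
    fix i j assume i: "i \<in> ?I" and j: "j \<in> ?I"
    obtain r e s d where ij: "i = (r, e)" "j = (s, d)" by (cases i, cases j)
    have rs: "r \<in> tb_norms" "s \<in> tb_norms" "e > 0" "d > 0" using i j by (auto simp: ij)
    have "0 \<le> r (inv m \<otimes> b)" "0 \<le> s (inv m \<otimes> b)" if "m \<in> M" for m
    proof -
      have "inv m \<otimes> b \<in> B" using that M(4) b(1) by auto
      then show "0 \<le> r (inv m \<otimes> b)" "0 \<le> s (inv m \<otimes> b)"
        using pseudonormD(1)[OF normsD(1)[OF tb_normsD(1)]] rs by blast+
    qed
    then have sub: "?S (\<lambda>x. r x + s x, min e d) \<subseteq> ?S i \<inter> ?S j" by (force simp: ij)
    have mem: "(\<lambda>x. r x + s x, min e d) \<in> ?I" using tb_norms_add[OF rs(1,2)] rs by simp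
    show "\<exists>k\<in>?I. ?F k \<le> inf (?F i) (?F j)"
      using sub unfolding inf_principal principal_le_iff by (intro bexI[OF _ mem])
  qed
  have S_ne: "?S i \<noteq> {}" if "i \<in> ?I" for i
    using that close by (cases i) auto
  have "F \<noteq> bot"
    unfolding trivial_limit_def base
  proof
    assume "\<exists>i\<in>?I. eventually (\<lambda>x. False) (?F i)"
    then obtain i where "i \<in> ?I" "eventually (\<lambda>x. False) (principal (?S i))" by blast
    then have "?S i = {}" unfolding eventually_principal by blast
    then show False using S_ne \<open>i \<in> ?I\<close> by blast
  qed
  have near: "eventually (\<lambda>m. m \<in> M \<and> r (inv m \<otimes> b) < e) F" if "r \<in> tb_norms" "e > 0" for r e
    unfolding base using that by (intro bexI[of _ "(r, e)"]) (auto simp: eventually_principal)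
  define s where "s m = (if m \<in> M then m else \<one>)" for m
  have s: "s m \<in> M" for m by (simp add: s_def)
  have cauchy: "cauchy_net G tb_norms F s"
    unfolding cauchy_net_def
  proof (intro ballI allI impI)
    fix r and e :: real assume r: "r \<in> tb_norms" and e: "e > 0"
    note rn = normsD(1)[OF tb_normsD(1)[OF r]]
    show "\<exists>A. eventually A F \<and> (\<forall>i j. A i \<longrightarrow> A j \<longrightarrow> r (inv s i \<otimes> s j) < e)"
    proof (intro exI[of _ "\<lambda>m. m \<in> M \<and> r (inv m \<otimes> b) < e / 2"] conjI allI impI)
      show "eventually (\<lambda>m. m \<in> M \<and> r (inv m \<otimes> b) < e / 2) F" using near[OF r, of "e / 2"] e by simp
      fix i j assume i: "i \<in> M \<and> r (inv i \<otimes> b) < e / 2" and j: "j \<in> M \<and> r (inv j \<otimes> b) < e / 2"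
      then have ij: "i \<in> B" "j \<in> B" using M(4) by auto
      have "r (inv i \<otimes> j) \<le> r (inv i \<otimes> b) + r (inv b \<otimes> j)"
        by (rule norm_dist_triangle[OF rn B.subgroup_axioms ij(1) b(1) ij(2)])
      moreover have "r (inv b \<otimes> j) = r (inv j \<otimes> b)"
        by (rule norm_dist_sym[OF rn B.subgroup_axioms b(1) ij(2)])
      ultimately show "r (inv s i \<otimes> s j) < e" using i j by (simp add: s_def)
    qed
  qed
  have sub: "tb_norms \<subseteq> norms G T M"
    using norms_subset[OF tb_normsD(1) M(4)] by blast
  obtain x where x: "x \<in> M"
    "\<And>r e. r \<in> tb_norms \<Longrightarrow> e > 0 \<Longrightarrow> eventually (\<lambda>i. r (inv s i \<otimes> x) < e) F"
    by (rule closed_normal_complete[OF balanced hTG M(1,2) sub \<open>F \<noteq> bot\<close> s cauchy]) blast+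
  have xB: "x \<in> B" using x M(4) by blast
  have "r (inv x \<otimes> b) = 0" if r: "r \<in> tb_norms" for r
  proof -
    note rn = normsD(1)[OF tb_normsD(1)[OF r]]
    have "r (inv x \<otimes> b) \<le> 0"
    proof (rule field_le_epsilon)
      fix e :: real assume "e > 0"
      then have e: "e / 2 > 0" by simp
      have "eventually (\<lambda>m. r (inv s m \<otimes> x) < e / 2 \<and> m \<in> M \<and> r (inv m \<otimes> b) < e / 2) F"
        using x(2)[OF r e] near[OF r e] by (rule eventually_conj)
      then obtain m where m: "r (inv s m \<otimes> x) < e / 2" "m \<in> M" "r (inv m \<otimes> b) < e / 2"
        using eventually_happens'[OF \<open>F \<noteq> bot\<close>] by blast
      have mB: "m \<in> B" using m M(4) by blast
      have "r (inv x \<otimes> b) \<le> r (inv x \<otimes> m) + r (inv m \<otimes> b)"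
        by (rule norm_dist_triangle[OF rn B.subgroup_axioms xB mB b(1)])
      moreover have "r (inv x \<otimes> m) = r (inv m \<otimes> x)"
        by (rule norm_dist_sym[OF rn B.subgroup_axioms xB mB])
      ultimately show "r (inv x \<otimes> b) \<le> 0 + e" using m by (simp add: s_def)
    qed
    moreover have "inv x \<otimes> b \<in> B" using xB b(1) by simp
    ultimately show ?thesis using pseudonormD(1)[OF rn] by force
  qed
  then have "inv x \<otimes> b \<in> N" using sep xB b(1) by simp
  then have "x \<otimes> (inv x \<otimes> b) \<in> M" using x(1) M(3) by blast
  moreover have "x \<otimes> (inv x \<otimes> b) = b" using xB b(1) by (simp add: word_simps)
  ultimately show False using b(2) by simp
qed

text \<open>The heart of the proof.  On the separable subgroup \<open>H\<close> the open mapping theorem is used twice: from \<open>q + r\<close> down to \<open>q\<close>, to make each \<open>r\<close> in \<open>tb_norms\<close> continuous for \<open>q\<close>, and from \<open>q\<close> down to a suitable series of such \<open>r\<close>, to bound \<open>q\<close> by a totally bounded pseudonorm.\<close>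

lemma norm_totally_bounded_if_kernel:
  assumes sep: "\<And>b. b \<in> B \<Longrightarrow> (\<And>r. r \<in> tb_norms \<Longrightarrow> r b = 0) \<Longrightarrow> b \<in> N"
    and q: "q \<in> norms G T B" and ker: "\<And>b. b \<in> B \<Longrightarrow> q b = 0 \<longleftrightarrow> b \<in> N"
  shows "totally_bounded_norm G B q"
proof (rule ccontr)
  note qn = normsD[OF q]
  assume not_tb: "\<not> totally_bounded_norm G B q"
  obtain e a where e: "e > 0" and a: "\<And>n::nat. a n \<in> B"
    "\<And>m n. m < n \<Longrightarrow> e \<le> q (inv (a m) \<otimes> a n)"
    by (rule not_totally_bounded_sequence[OF B.subgroup_axioms qn(1) not_tb]) blast+
  obtain H where H: "H \<lhd> G" "closedin T H" "N \<subseteq> H" "H \<subseteq> B" "range a \<subseteq> H"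
    and separable: "\<And>r. r \<in> norms G T B \<Longrightarrow> (\<forall>n\<in>N. r n = 0) \<Longrightarrow>
       \<exists>C. countable C \<and> C \<subseteq> H \<and> (\<forall>h\<in>H. \<forall>e>0. \<exists>c\<in>C. r (inv c \<otimes> h) < e)"
    by (rule separable_normal_hull[OF balanced N(1) B NB _ precompact, of a],
        erule (1) commutator, rule a(1), rule that)
  interpret H: normal H G by fact
  have qN: "\<forall>n\<in>N. q n = 0" using ker NB by blast
  have HB: "h \<in> B" if "h \<in> H" for h using H(4) that by blast
  have H_norm: "pseudonorm G H r" "conj_invariant G H r" "complete_norm G H r" if "r \<in> norms G T B" for r
    using norms_subset[OF that H(4)] norm_complete_on_closed_normal[OF H(1,2,4) that] by (auto simp: norms_def)
  \<comment> \<open>Both \<open>q\<close> and \<open>q + r\<close> have kernel \<open>N\<close>, so on \<open>H\<close> they are equivalent.\<close>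
  have cont: "\<exists>d>0. \<forall>h\<in>H. q h < d \<longrightarrow> r h < \<epsilon>" if r: "r \<in> tb_norms" and \<epsilon>: "\<epsilon> > 0" for r \<epsilon>
  proof -
    let ?p = "\<lambda>x. q x + r x"
    note rn = tb_normsD(1)[OF r]
    have p: "?p \<in> norms G T B" by (rule norms_add[OF q rn])
    have nn: "0 \<le> q h" "0 \<le> r h" if "h \<in> H" for h
      using pseudonormD(1)[OF qn(1) HB[OF that]] pseudonormD(1)[OF normsD(1)[OF rn] HB[OF that]] by auto
    have "\<forall>n\<in>N. ?p n = 0" using qN tb_normsD(3)[OF r] by simp
    from separable[OF p this] obtain C where C: "countable C" "C \<subseteq> H"
      "\<forall>h\<in>H. \<forall>e>0. \<exists>c\<in>C. ?p (inv c \<otimes> h) < e" by blast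
    have "\<exists>d>0. \<forall>h\<in>H. q h < d \<longrightarrow> ?p h < \<epsilon>"
    proof (rule norm_open_mapping[OF H.subgroup_axioms H_norm[OF p] H_norm[OF q] C(1,2) C(3)[rule_format] _ _ \<epsilon>])
      show "\<exists>d>0. \<forall>h\<in>H. ?p h < d \<longrightarrow> q h < e" if "e > 0" for e
      proof (intro exI[of _ e] conjI ballI impI that)
        fix h assume "h \<in> H" "?p h < e"
        then show "q h < e" using nn(2)[of h] by linarith
      qed
      show "?p h = 0" if "h \<in> H" "q h = 0" for h
        using that ker[OF HB[OF that(1)]] tb_normsD(3)[OF r, of h] by simp
    qed
    then obtain d where d: "d > 0" "\<forall>h\<in>H. q h < d \<longrightarrow> ?p h < \<epsilon>" by blast
    have "r h < \<epsilon>" if "h \<in> H" "q h < d" for h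
    proof -
      have "q h + r h < \<epsilon>" using d(2) that by blast
      then show ?thesis using nn(1)[OF that(1)] by linarith
    qed
    then show ?thesis using d(1) by blast
  qed
  obtain C where C: "countable C" "C \<subseteq> H" "\<forall>h\<in>H. \<forall>e>0. \<exists>c\<in>C. q (inv c \<otimes> h) < e"
    using separable[OF q qN] by blast
  have "C \<noteq> {}" using C(3)[rule_format, OF H.one_closed, of 1] by auto
  \<comment> \<open>Lindelof: \<open>good c k r\<close> says that \<open>r\<close> is positive on the ball of radius \<open>1/(k+1)\<close> about \<open>c\<close>.  There are countably many such balls; those that admit some such \<open>r\<close> cover \<open>H - N\<close>, and one \<open>r\<close> is chosen for each of them.\<close>
  define good where "good c k r \<longleftrightarrow> r \<in> tb_norms \<and>
      (\<forall>h\<in>H. q (inv c \<otimes> h) < 1 / Suc k \<longrightarrow> 0 < r h)" for c and k :: nat and r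
  define R where "R = (\<lambda>(c, k). if \<exists>r. good c k r then SOME r. good c k r else (\<lambda>x. 0))"
  have R_good: "good c k (R (c, k))" if "good c k r" for c k r
    unfolding R_def using someI[of "good c k", OF that] that by auto
  have R: "R i \<in> tb_norms" for i
  proof (cases i)
    case (Pair c k)
    show ?thesis
    proof (cases "\<exists>r. good c k r")
      case True
      then show ?thesis using R_good Pair unfolding good_def by blast
    next
      case False
      then have "R (c, k) = (\<lambda>x. 0)" unfolding R_def prod.case by (rule if_not_P)
      then show ?thesis using tb_norms_zero Pair by simp
    qed
  qed
  have R_pos: "\<exists>i\<in>C \<times> UNIV. R i h > 0" if h: "h \<in> H" "h \<notin> N" for h
  proof -
    obtain r where r: "r \<in> tb_norms" "r h \<noteq> 0"
      using sep[OF HB[OF h(1)]] h(2) by blast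
    note rn = normsD[OF tb_normsD(1)[OF r(1)]]
    have pos: "r h > 0" using pseudonormD(1)[OF rn(1) HB[OF h(1)]] r(2) by simp
    obtain d where d: "d > 0" "\<forall>x\<in>H. q x < d \<longrightarrow> r x < r h" using cont[OF r(1) pos] by blast
    obtain k where k: "1 / Suc k < d / 2" using nat_approx_posE[of "d / 2"] d(1) by auto
    obtain c where c: "c \<in> C" "q (inv c \<otimes> h) < 1 / Suc k"
      using C(3)[rule_format, OF h(1), of "1 / Suc k"] by auto
    have cH: "c \<in> H" using c C(2) by blast
    have "good c k r"
      unfolding good_def
    proof (intro conjI ballI impI r(1))
      fix x assume x: "x \<in> H" "q (inv c \<otimes> x) < 1 / Suc k"
      have "q (inv x \<otimes> h) \<le> q (inv x \<otimes> c) + q (inv c \<otimes> h)"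
        by (rule norm_dist_triangle[OF qn(1) B.subgroup_axioms HB[OF x(1)] HB[OF cH] HB[OF h(1)]])
      moreover have "q (inv x \<otimes> c) = q (inv c \<otimes> x)"
        by (rule norm_dist_sym[OF qn(1) B.subgroup_axioms HB[OF x(1)] HB[OF cH]])
      ultimately have "q (inv x \<otimes> h) < d" using x(2) c(2) k by linarith
      then have "r (inv x \<otimes> h) < r h" using d(2) x(1) h(1) by simp
      moreover have "r h \<le> r x + r (inv x \<otimes> h)"
        by (rule norm_le_dist[OF rn(1) B.subgroup_axioms HB[OF x(1)] HB[OF h(1)]])
      ultimately show "0 < r x" by linarith
    qed
    from R_good[OF this] have "R (c, k) h > 0" unfolding good_def using h(1) c(2) by blast
    then show ?thesis using c(1) by blast
  qed
  define f where "f = from_nat_into (C \<times> (UNIV :: nat set))"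
  have f: "range f = C \<times> UNIV"
    unfolding f_def using C(1) \<open>C \<noteq> {}\<close> by (intro range_from_nat_into) auto
  define r where "r = norm_series (\<lambda>n. R (f n))"
  have Rn: "R (f n) \<in> norms G T B" "totally_bounded_norm G B (R (f n))" "\<And>x. x \<in> N \<Longrightarrow> R (f n) x = 0" for n
    using tb_normsD[OF R] by auto
  have R_nn: "0 \<le> R (f n) x" if "x \<in> B" for n x
    by (rule pseudonormD(1)[OF normsD(1)[OF Rn(1)] that])
  have r: "r \<in> tb_norms"
    unfolding tb_norms_def
  proof (intro CollectI conjI ballI)
    show "r \<in> norms G T B" unfolding r_def by (rule norm_series_norm[OF topological_group_axioms B(1) Rn(1)])
    show "totally_bounded_norm G B r" unfolding r_def
      by (rule norm_series_totally_bounded[OF B.subgroup_axioms is_group normsD(1)[OF Rn(1)] Rn(2)])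
    fix n assume "n \<in> N"
    then show "r n = 0" unfolding r_def norm_series_def using Rn(3) by simp
  qed
  have "\<exists>d>0. \<forall>h\<in>H. r h < d \<longrightarrow> q h < e"
  proof (rule norm_open_mapping[OF H.subgroup_axioms H_norm[OF q] H_norm[OF tb_normsD(1)[OF r]]
        C(1,2) C(3)[rule_format] cont[OF r] _ e])
    fix h assume h: "h \<in> H" "r h = 0"
    then have "\<forall>n. R (f n) h = 0"
      using norm_series_eq_0[of "\<lambda>n. R (f n)" h] R_nn[OF HB[OF h(1)]] by (simp add: r_def)
    then have "\<not> (\<exists>i\<in>range f. R i h > 0)" by auto
    then have "h \<in> N" using R_pos[OF h(1)] unfolding f by blast
    then show "q h = 0" using qN by blast
  qed
  then obtain d where d: "d > 0" "\<forall>h\<in>H. r h < d \<longrightarrow> q h < e" by blast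
  \<comment> \<open>Two members of the separated sequence are close for \<open>r\<close>, hence for \<open>q\<close>.\<close>
  obtain \<phi> :: "'a \<Rightarrow> nat" where \<phi>: "finite (\<phi> ` B)"
    "\<And>x y. x \<in> B \<Longrightarrow> y \<in> B \<Longrightarrow> \<phi> x = \<phi> y \<Longrightarrow> r (inv x \<otimes> y) < d"
    by (rule totally_boundedE[OF tb_normsD(2)[OF r] d(1)]) (rule that)
  have "finite (range (\<lambda>n. \<phi> (a n)))"
    by (rule finite_subset[OF _ \<phi>(1)]) (use a(1) in auto)
  then have "\<not> inj (\<lambda>n. \<phi> (a n))" using finite_imageD[of "\<lambda>n. \<phi> (a n)" UNIV] by auto
  then obtain m n where mn: "m < n" "\<phi> (a m) = \<phi> (a n)"
    by (metis injI linorder_neqE_nat)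
  have "r (inv (a m) \<otimes> a n) < d" by (rule \<phi>(2)[OF a(1) a(1) mn(2)])
  moreover have "a k \<in> H" for k using H(5) by blast
  then have "inv (a m) \<otimes> a n \<in> H" by (intro H.m_closed H.m_inv_closed)
  ultimately have "q (inv (a m) \<otimes> a n) < e" using d(2) by blast
  then show False using a(2)[OF mn(1)] by linarith
qed

text \<open>Replacing \<open>N\<close> by the kernel of \<open>q\<close> reduces the claim to the preceding lemma, since separation passes to the kernel.\<close>

theorem norms_totally_bounded:
  assumes sep: "\<And>b. b \<in> B \<Longrightarrow> (\<And>r. r \<in> tb_norms \<Longrightarrow> r b = 0) \<Longrightarrow> b \<in> N"
    and q: "q \<in> norms G T B" "\<And>n. n \<in> N \<Longrightarrow> q n = 0"
  shows "totally_bounded_norm G B q"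
proof -
  define M where "M = {b \<in> B. q b = 0}"
  have M: "M \<lhd> G" and M_closed: "closedin T M"
    unfolding M_def by (rule norm_kernel_normal[OF B(1) q(1)], rule norm_kernel_closed[OF B q(1)])
  have NM: "N \<subseteq> M" "M \<subseteq> B" using q(2) NB by (auto simp: M_def)
  interpret M: abelian_section G T M B
  proof (intro abelian_section.intro topological_group_axioms abelian_section_axioms.intro
      balanced hTG M M_closed B NM(2) precompact)
    show "a \<otimes> b \<otimes> inv a \<otimes> inv b \<in> M" if "a \<in> B" "b \<in> B" for a b
      using commutator[OF that] NM(1) by blast
  qed
  show ?thesis
  proof (rule M.norm_totally_bounded_if_kernel[OF _ q(1)])
    fix b assume b: "b \<in> B" and zero: "\<And>r. r \<in> M.tb_norms \<Longrightarrow> r b = 0"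
    show "b \<in> M"
    proof (rule ccontr)
      assume bM: "b \<notin> M"
      obtain r where r: "r \<in> tb_norms" "\<And>x. x \<in> M \<Longrightarrow> r x = 0" "r b \<noteq> 0"
        by (rule separates_larger[OF sep M M_closed NM b bM]) blast+
      then have "r \<in> M.tb_norms" by (auto simp: M.tb_norms_def tb_norms_def)
      then show False using zero r(3) by blast
    qed
  qed (simp add: M_def)
qed

text \<open>The distance from \<open>N\<close> for an invariant pseudonorm of the group vanishes on \<open>N\<close> and so is totally bounded on \<open>B\<close>; combine a finite net for it with one modulo \<open>B\<close>.\<close>

theorem precompact_if_separated:
  assumes sep: "\<And>b. b \<in> B \<Longrightarrow> (\<And>r. r \<in> tb_norms \<Longrightarrow> r b = 0) \<Longrightarrow> b \<in> N"
  shows "precompact_modulo G T N"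
  unfolding precompact_modulo_def
proof (intro ballI allI impI)
  fix q and e :: real assume q: "q \<in> norms G T (carrier G)" and e: "e > 0"
  then have e2: "e / 2 > 0" by simp
  note qn = normsD[OF q]
  have zero: "(\<lambda>x. 0) \<in> norms G T N" by (rule norms_zero[OF topological_group_axioms])
  have qB: "q \<in> norms G T B" by (rule norms_subset[OF q B.subset])
  note conv = N(1) B(1) NB zero qB
  let ?d = "inf_conv G N (\<lambda>x. 0) q"
  have dn: "?d \<in> norms G T B" by (rule inf_conv_norm[OF conv])
  have dN: "?d x = 0" if "x \<in> N" for x
  proof (rule antisym)
    show "?d x \<le> 0" by (rule inf_conv_le(2)[OF conv that])
    show "0 \<le> ?d x" by (rule pseudonormD(1)[OF normsD(1)[OF dn] subsetD[OF NB that]])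
  qed
  have tb: "totally_bounded_norm G B ?d" by (rule norms_totally_bounded[OF sep dn dN])
  obtain F' where F': "finite F'" "F' \<subseteq> B" "\<And>b. b \<in> B \<Longrightarrow> \<exists>f\<in>F'. ?d (inv f \<otimes> b) < e / 2"
    by (rule totally_bounded_net[OF tb e2]) (rule that)
  obtain F where F: "finite F" "F \<subseteq> carrier G"
    "\<forall>x\<in>carrier G. \<exists>f\<in>F. \<exists>n\<in>B. q (inv f \<otimes> x \<otimes> n) < e / 2"
    using precompact[unfolded precompact_modulo_def, rule_format, OF q e2] by blast
  show "\<exists>F. finite F \<and> F \<subseteq> carrier G \<and> (\<forall>x\<in>carrier G. \<exists>f\<in>F. \<exists>n\<in>N. q (inv f \<otimes> x \<otimes> n) < e)"
  proof (intro exI[of _ "(\<lambda>(f, g). f \<otimes> g) ` (F \<times> F')"] conjI ballI)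
    show "finite ((\<lambda>(f, g). f \<otimes> g) ` (F \<times> F'))" using F(1) F'(1) by simp
    show "(\<lambda>(f, g). f \<otimes> g) ` (F \<times> F') \<subseteq> carrier G" using F(2) F'(2) B.subset by auto
    fix x assume x: "x \<in> carrier G"
    obtain f b where f: "f \<in> F" "b \<in> B" "q (inv f \<otimes> x \<otimes> b) < e / 2" using F(3) x by blast
    obtain g where g: "g \<in> F'" "?d (inv g \<otimes> inv b) < e / 2" using F'(3)[of "inv b"] f(2) by auto
    from inf_conv_less[OF conv g(2)] obtain n where n: "n \<in> N" "q (inv n \<otimes> (inv g \<otimes> inv b)) < e / 2" by auto
    have cl: "f \<in> carrier G" "b \<in> carrier G" "g \<in> carrier G" "n \<in> carrier G"
      using f g n F(2) F'(2) B.subset N.subset by auto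
    let ?u = "inv f \<otimes> x \<otimes> b" and ?w = "inv n \<otimes> (inv g \<otimes> inv b)"
    \<comment> \<open>Both factors are conjugates of small elements; \<open>n\<close> is moved to the right end.\<close>
    have eq: "inv (f \<otimes> g) \<otimes> x \<otimes> inv n = (inv g \<otimes> ?u \<otimes> inv (inv g)) \<otimes> (n \<otimes> ?w \<otimes> inv n)"
      using cl x by (simp add: word_simps)
    have "q (inv (f \<otimes> g) \<otimes> x \<otimes> inv n) \<le> q (inv g \<otimes> ?u \<otimes> inv (inv g)) + q (n \<otimes> ?w \<otimes> inv n)"
      unfolding eq using cl x by (intro pseudonormD(4)[OF qn(1)]) auto
    moreover have "q (inv g \<otimes> ?u \<otimes> inv (inv g)) = q ?u"
      using cl x by (intro conj_invariantD[OF qn(2)]) auto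
    moreover have "q (n \<otimes> ?w \<otimes> inv n) = q ?w"
      using cl x by (intro conj_invariantD[OF qn(2)]) auto
    ultimately have "q (inv (f \<otimes> g) \<otimes> x \<otimes> inv n) < e" using f(3) n(2) by linarith
    moreover have "inv n \<in> N" using n(1) by simp
    moreover have "f \<otimes> g \<in> (\<lambda>(f, g). f \<otimes> g) ` (F \<times> F')" using f(1) g(1) by auto
    ultimately show "\<exists>f\<in>(\<lambda>(f, g). f \<otimes> g) ` (F \<times> F'). \<exists>n\<in>N. q (inv f \<otimes> x \<otimes> n) < e" by blast
  qed
qed

end

section \<open>Compact groups\<close>

context topological_group
begin

lemma compactin_net:
  assumes C: "compactin T C" and U: "openin T U" "\<one> \<in> U"
  obtains F where "finite F" "F \<subseteq> C" "\<And>x. x \<in> C \<Longrightarrow> \<exists>f\<in>F. inv f \<otimes> x \<in> U"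
proof -
  let ?O = "\<lambda>f. {x \<in> topspace T. inv f \<otimes> x \<in> U}"
  have Cc: "C \<subseteq> carrier G" using compactin_subset_topspace[OF C] topspace_eq by simp
  have "openin T V" if V: "V \<in> ?O ` C" for V
  proof -
    obtain f where f: "f \<in> C" "V = ?O f" using V by blast
    have "continuous_map T T (\<lambda>x. inv f \<otimes> x)"
      using f(1) Cc by (intro continuous_group_intros) auto
    then show ?thesis unfolding f(2) using U(1) by (rule openin_continuous_map_preimage)
  qed
  moreover have "C \<subseteq> \<Union>(?O ` C)"
  proof
    fix x assume x: "x \<in> C"
    then have "x \<in> ?O x" using Cc U(2) by (auto simp: topspace_eq)
    then show "x \<in> \<Union>(?O ` C)" using x by blast
  qed
  ultimately obtain \<F> where \<F>: "finite \<F>" "\<F> \<subseteq> ?O ` C" "C \<subseteq> \<Union>\<F>"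
    using compactinD[OF C, of "?O ` C"] by auto
  obtain F where F: "F \<subseteq> C" "finite F" "\<F> = ?O ` F"
    using finite_subset_image[OF \<F>(1,2)] by auto
  show thesis
  proof (rule that[OF F(2,1)])
    fix x assume "x \<in> C"
    then show "\<exists>f\<in>F. inv f \<otimes> x \<in> U" using \<F>(3) unfolding F(3) by auto
  qed
qed

lemma compact_imp_totally_bounded:
  assumes "compact_space T" and q: "q \<in> norms G T (carrier G)"
  shows "totally_bounded_norm G (carrier G) q"
proof (rule totally_bounded_if_net[OF subgroup_self normsD(1)[OF q]])
  fix e :: real assume "e > 0"
  then obtain U where U: "openin T U" "\<one> \<in> U" "\<forall>x\<in>U \<inter> carrier G. q x < e"
    using normsD(3)[OF q] unfolding small_near_one_def by blast
  have "compactin T (carrier G)" using assms(1) by (simp add: compact_space_def topspace_eq)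
  then obtain F where F: "finite F" "F \<subseteq> carrier G" "\<And>x. x \<in> carrier G \<Longrightarrow> \<exists>f\<in>F. inv f \<otimes> x \<in> U"
    by (rule compactin_net[OF _ U(1,2)]) (rule that)
  have "\<exists>f\<in>F. q (inv f \<otimes> b) < e" if b: "b \<in> carrier G" for b
  proof -
    obtain f where "f \<in> F" "inv f \<otimes> b \<in> U" using F(3)[OF b] by blast
    then have "q (inv f \<otimes> b) < e" using U(3) openin_carrier[OF U(1)] by blast
    then show ?thesis using \<open>f \<in> F\<close> by blast
  qed
  then show "\<exists>F. finite F \<and> F \<subseteq> carrier G \<and> (\<forall>b\<in>carrier G. \<exists>f\<in>F. q (inv f \<otimes> b) < e)"
    using F(1,2) by blast
qed

text \<open>The tube lemma for the continuous map \<open>(x, v) \<mapsto> x v x\<inverse>\<close> near the compact set of all \<open>(x, \<one>)\<close>.\<close>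

lemma compact_imp_balanced:
  assumes "compact_space T"
  shows "balanced_group G T"
  unfolding balanced_group_def
proof (intro allI impI)
  fix U assume "unit_neighbourhood G T U"
  then obtain W where W: "openin T W" "\<one> \<in> W" "W \<subseteq> U" and Uc: "U \<subseteq> carrier G"
    unfolding unit_neighbourhood_def by blast
  let ?P = "prod_topology T T"
  let ?M = "{p \<in> topspace ?P. fst p \<otimes> snd p \<otimes> inv (fst p) \<in> W}"
  have "continuous_map ?P T (\<lambda>p. fst p \<otimes> snd p \<otimes> inv (fst p))"
    by (intro continuous_group_intros continuous_map_fst continuous_map_snd)
  then have "openin ?P ?M" using W(1) by (rule openin_continuous_map_preimage)
  moreover have "compactin T (topspace T)" using assms by (simp add: compact_space_def)
  moreover have "\<one> \<in> topspace T" by (simp add: topspace_eq)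
  moreover have "topspace T \<times> {\<one>} \<subseteq> ?M" using W(2) by (auto simp: topspace_eq)
  ultimately have "\<exists>A V. openin T A \<and> openin T V \<and> topspace T \<subseteq> A \<and> \<one> \<in> V \<and> A \<times> V \<subseteq> ?M"
    by (rule tube_lemma_left)
  then obtain A V where V: "openin T V" "topspace T \<subseteq> A" "\<one> \<in> V" "A \<times> V \<subseteq> ?M" by blast
  have Vc: "V \<subseteq> carrier G" by (rule openin_carrier[OF V(1)])
  have "x <# V \<subseteq> U #> x" if x: "x \<in> carrier G" for x
  proof
    fix y assume "y \<in> x <# V"
    then obtain v where v: "v \<in> V" "y = x \<otimes> v" by (auto simp: l_coset_def)
    have "(x, v) \<in> ?M" using V(2,4) x v(1) topspace_eq by blast
    then have "x \<otimes> v \<otimes> inv x \<in> U" using W(3) by auto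
    moreover have "y = (x \<otimes> v \<otimes> inv x) \<otimes> x" using v Vc x by (auto simp: m_assoc)
    ultimately show "y \<in> U #> x" unfolding r_coset_def by blast
  qed
  moreover have "unit_neighbourhood G T V" using V Vc by (auto simp: unit_neighbourhood_def)
  ultimately show "\<exists>V. unit_neighbourhood G T V \<and> (\<forall>x\<in>carrier G. x <# V \<subseteq> U #> x)" by blast
qed

lemma compact_imp_hTG_closed:
  assumes "compact_space T"
  shows "hTG_closed G T"
  unfolding hTG_closed_def
proof (intro allI impI, elim conjE)
  fix H :: "'a set set monoid" and S f
  assume H: "topological_group H S" and f: "f \<in> continuous_hom G T H S"
  interpret H: topological_group H S by fact
  have "compactin S (f ` topspace T)"
    using assms f by (intro image_compactin[of T]) (auto simp: compact_space_def continuous_hom_def)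
  then show "closedin S (f ` carrier G)"
    using compactin_imp_closedin[OF H.Hausdorff] by (simp add: topspace_eq)
qed

end

section \<open>Averaging a pseudonorm over conjugation\<close>

context abelian_section
begin

text \<open>The supremum of \<open>s\<close> over all conjugates is invariant.  It stays continuous because the group is balanced, and totally bounded because up to a small error finitely many conjugates account for all of them: modulo \<open>B\<close> finitely many are enough, \<open>B\<close> itself acts trivially modulo \<open>N\<close>, and an element \<open>u\<close> near the unit changes \<open>s\<close> by at most its value at a commutator with \<open>u\<close>.\<close>

lemma invariant_hull:
  assumes s: "pseudonorm G B s" "small_near_one G T B s" "totally_bounded_norm G B s"
    and s1: "\<And>b. b \<in> B \<Longrightarrow> s b \<le> c" and s0: "\<And>n. n \<in> N \<Longrightarrow> s n = 0"
  obtains r where "r \<in> tb_norms" "\<And>b. b \<in> B \<Longrightarrow> s b \<le> r b"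
proof -
  note Bc = B.subset[THEN subsetD]
  define r where "r b = (SUP x\<in>carrier G. s (x \<otimes> b \<otimes> inv x))" for b
  have conjB: "x \<otimes> b \<otimes> inv x \<in> B" if "x \<in> carrier G" "b \<in> B" for x b
    by (rule B.inv_op_closed2[OF that])
  have le: "s (x \<otimes> b \<otimes> inv x) \<le> r b" if "x \<in> carrier G" "b \<in> B" for x b
    unfolding r_def using s1 conjB that by (intro cSUP_upper bdd_aboveI2[of _ _ c]) auto
  have ne: "carrier G \<noteq> {}" using one_closed by blast
  have least: "r b \<le> t" if "\<And>x. x \<in> carrier G \<Longrightarrow> s (x \<otimes> b \<otimes> inv x) \<le> t" for b t
    unfolding r_def by (rule cSUP_least[OF ne that])
  have s_le: "s b \<le> r b" if "b \<in> B" for b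
    using le[OF one_closed that] Bc[OF that] by simp
  have "pseudonorm G B r"
    unfolding pseudonorm_def
  proof (intro conjI ballI)
    show "0 \<le> r b" if "b \<in> B" for b
      using pseudonormD(1)[OF s(1) that] s_le[OF that] by linarith
    show "r \<one> = 0"
    proof (rule antisym)
      show "r \<one> \<le> 0" by (rule least) (simp add: pseudonormD(2)[OF s(1)])
      show "0 \<le> r \<one>" using s_le[OF B.one_closed] pseudonormD(2)[OF s(1)] by simp
    qed
    show "r (inv b) = r b" if b: "b \<in> B" for b
    proof -
      have "s (x \<otimes> inv b \<otimes> inv x) = s (x \<otimes> b \<otimes> inv x)" if x: "x \<in> carrier G" for x
      proof -
        have "x \<otimes> inv b \<otimes> inv x = inv (x \<otimes> b \<otimes> inv x)" using x Bc[OF b] by (simp add: word_simps)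
        then show ?thesis using pseudonormD(3)[OF s(1) conjB[OF x b]] by simp
      qed
      then show ?thesis unfolding r_def by (intro SUP_cong) auto
    qed
    show "r (a \<otimes> b) \<le> r a + r b" if ab: "a \<in> B" "b \<in> B" for a b
    proof (rule least)
      fix x assume x: "x \<in> carrier G"
      have eq: "x \<otimes> (a \<otimes> b) \<otimes> inv x = (x \<otimes> a \<otimes> inv x) \<otimes> (x \<otimes> b \<otimes> inv x)"
        using x Bc[OF ab(1)] Bc[OF ab(2)] by (simp add: word_simps)
      have "s (x \<otimes> (a \<otimes> b) \<otimes> inv x) \<le> s (x \<otimes> a \<otimes> inv x) + s (x \<otimes> b \<otimes> inv x)"
        unfolding eq by (rule pseudonormD(4)[OF s(1) conjB[OF x ab(1)] conjB[OF x ab(2)]])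
      also have "\<dots> \<le> r a + r b" by (intro add_mono le x ab)
      finally show "s (x \<otimes> (a \<otimes> b) \<otimes> inv x) \<le> r a + r b" .
    qed
  qed
  moreover have "conj_invariant G B r"
  proof -
    have conj_le: "r (y \<otimes> b \<otimes> inv y) \<le> r b" if y: "y \<in> carrier G" and b: "b \<in> B" for y b
    proof (rule least)
      fix x assume x: "x \<in> carrier G"
      have "x \<otimes> (y \<otimes> b \<otimes> inv y) \<otimes> inv x = (x \<otimes> y) \<otimes> b \<otimes> inv (x \<otimes> y)"
        using x y Bc[OF b] by (simp add: word_simps)
      then show "s (x \<otimes> (y \<otimes> b \<otimes> inv y) \<otimes> inv x) \<le> r b"
        using le[of "x \<otimes> y" b] x y b by simp
    qed
    show ?thesis
      unfolding conj_invariant_def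
    proof (intro ballI antisym conj_le)
      fix y b assume y: "y \<in> carrier G" and b: "b \<in> B"
      have "inv y \<otimes> (y \<otimes> b \<otimes> inv y) \<otimes> inv (inv y) = b" using y Bc[OF b] by (simp add: word_simps)
      then show "r b \<le> r (y \<otimes> b \<otimes> inv y)"
        using conj_le[of "inv y" "y \<otimes> b \<otimes> inv y"] y conjB[OF y b] by simp
    qed
  qed
  moreover have gauge: "\<exists>q\<in>norms G T (carrier G). \<forall>b\<in>B. q b < 1 \<longrightarrow> s b < e" if e: "e > 0" for e
  proof -
    obtain U where U: "openin T U" "\<one> \<in> U" "\<forall>x\<in>U \<inter> B. s x < e"
      using s(2) e unfolding small_near_one_def by blast
    obtain q where "q \<in> norms G T (carrier G)" "\<And>x. q x < 1 \<Longrightarrow> x \<in> U"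
      using balanced_norm[OF balanced U(1,2)] by blast
    then show ?thesis using U(3) by (intro bexI[of _ q]) auto
  qed
  have "small_near_one G T B r"
    unfolding small_near_one_def
  proof (intro allI impI)
    fix e :: real assume "e > 0"
    then have e2: "e / 2 > 0" by simp
    obtain q where q: "q \<in> norms G T (carrier G)" "\<forall>b\<in>B. q b < 1 \<longrightarrow> s b < e / 2"
      using gauge[OF e2] by blast
    have one: "(1::real) > 0" by simp
    obtain U where U: "openin T U" "\<one> \<in> U" "\<forall>x\<in>U \<inter> carrier G. q x < 1"
      using normsD(3)[OF q(1)] one unfolding small_near_one_def by blast
    have "r b < e" if b: "b \<in> U \<inter> B" for b
    proof -
      have "r b \<le> e / 2"
      proof (rule least)
        fix x assume x: "x \<in> carrier G"
        have "q (x \<otimes> b \<otimes> inv x) = q b"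
          using b Bc by (intro conj_invariantD[OF normsD(2)[OF q(1)] x]) auto
        also have "\<dots> < 1" using U(3) b Bc by blast
        finally show "s (x \<otimes> b \<otimes> inv x) \<le> e / 2"
          using q(2) conjB[OF x] b by (simp add: less_imp_le)
      qed
      then show ?thesis using \<open>e > 0\<close> by linarith
    qed
    then show "\<exists>U. openin T U \<and> \<one> \<in> U \<and> (\<forall>x\<in>U \<inter> B. r x < e)" using U(1,2) by blast
  qed
  moreover have "totally_bounded_norm G B r"
  proof (rule totally_bounded_approx)
    fix e :: real assume e: "e > 0"
    obtain q where q: "q \<in> norms G T (carrier G)" "\<forall>b\<in>B. q b < 1 \<longrightarrow> s b < e"
      using gauge[OF e] by blast
    note qn = normsD[OF q(1)]
    have half: "(1/2::real) > 0" by simp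
    obtain F where F: "finite F" "F \<subseteq> carrier G"
      "\<forall>x\<in>carrier G. \<exists>f\<in>F. \<exists>n\<in>B. q (inv f \<otimes> x \<otimes> n) < 1/2"
      using precompact[unfolded precompact_modulo_def, rule_format, OF q(1) half] by blast
    let ?r = "\<lambda>b. \<Sum>f\<in>F. s (f \<otimes> b \<otimes> inv f)"
    have "totally_bounded_norm G B (\<lambda>b. s (f \<otimes> b \<otimes> inv f))" if f: "f \<in> F" for f
    proof (rule totally_boundedI)
      fix e :: real assume e: "e > 0"
      have fc: "f \<in> carrier G" using f F by blast
      obtain \<phi> :: "'a \<Rightarrow> nat" where \<phi>: "finite (\<phi> ` B)"
        "\<And>x y. x \<in> B \<Longrightarrow> y \<in> B \<Longrightarrow> \<phi> x = \<phi> y \<Longrightarrow> s (inv x \<otimes> y) < e"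
        by (rule totally_boundedE[OF s(3) e]) (rule that)
      have "finite ((\<lambda>b. \<phi> (f \<otimes> b \<otimes> inv f)) ` B)"
        by (rule finite_subset[OF _ \<phi>(1)]) (use conjB[OF fc] in auto)
      moreover have "s (f \<otimes> (inv x \<otimes> y) \<otimes> inv f) < e"
        if xy: "x \<in> B" "y \<in> B" "\<phi> (f \<otimes> x \<otimes> inv f) = \<phi> (f \<otimes> y \<otimes> inv f)" for x y
      proof -
        have "f \<otimes> (inv x \<otimes> y) \<otimes> inv f = inv (f \<otimes> x \<otimes> inv f) \<otimes> (f \<otimes> y \<otimes> inv f)"
          using fc Bc[OF xy(1)] Bc[OF xy(2)] by (simp add: word_simps)
        then show ?thesis using \<phi>(2)[OF conjB[OF fc xy(1)] conjB[OF fc xy(2)] xy(3)] by simp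
      qed
      ultimately show "\<exists>\<phi> :: 'a \<Rightarrow> nat. finite (\<phi> ` B) \<and>
          (\<forall>x\<in>B. \<forall>y\<in>B. \<phi> x = \<phi> y \<longrightarrow> s (f \<otimes> (inv x \<otimes> y) \<otimes> inv f) < e)" by blast
    qed
    then have "totally_bounded_norm G B ?r" using F(1) by (intro totally_bounded_sum)
    moreover have "r b \<le> ?r b + e" if b: "b \<in> B" for b
    proof (rule least)
      fix x assume x: "x \<in> carrier G"
      obtain f c where f: "f \<in> F" "c \<in> B" "q (inv f \<otimes> x \<otimes> c) < 1/2" using F(3) x by blast
      have fc: "f \<in> carrier G" using f F by blast
      note cl = fc Bc[OF f(2)] x Bc[OF b]
      define u where "u = inv f \<otimes> x \<otimes> c"
      have u: "u \<in> carrier G" using cl by (simp add: u_def)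
      define k where "k = inv b \<otimes> inv c \<otimes> b \<otimes> c"
      have k: "k \<in> N"
        using commutator[of "inv b" "inv c"] b f(2) Bc[OF b] Bc[OF f(2)] by (simp add: k_def)
      have kc: "k \<in> carrier G" using k N.subset by blast
      let ?w = "u \<otimes> (b \<otimes> inv u \<otimes> inv b)"
      have wB: "?w \<in> B"
      proof -
        have "(u \<otimes> b \<otimes> inv u) \<otimes> inv b \<in> B" using B.inv_op_closed2[OF u b] b by simp
        then show ?thesis using cl u by (simp add: m_assoc)
      qed
      have "x = f \<otimes> u \<otimes> inv c" using cl by (simp add: u_def word_simps)
      then have "x \<otimes> b \<otimes> inv x = f \<otimes> u \<otimes> (b \<otimes> k) \<otimes> inv u \<otimes> inv f"
        using cl u by (simp add: k_def word_simps)
      \<comment> \<open>A conjugate of the commutator of \<open>u\<close> and \<open>b\<close>, times the conjugate of \<open>b\<close> by \<open>f\<close>, times an element of \<open>N\<close>.\<close>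
      then have eq: "x \<otimes> b \<otimes> inv x
          = (f \<otimes> ?w \<otimes> inv f) \<otimes> ((f \<otimes> b \<otimes> inv f) \<otimes> ((f \<otimes> u) \<otimes> k \<otimes> inv (f \<otimes> u)))"
        using cl u kc by (simp add: word_simps)
      have kN: "(f \<otimes> u) \<otimes> k \<otimes> inv (f \<otimes> u) \<in> N"
        using fc u by (intro N.inv_op_closed2[OF _ k]) auto
      have "s (x \<otimes> b \<otimes> inv x) \<le> s (f \<otimes> ?w \<otimes> inv f) + s ((f \<otimes> b \<otimes> inv f) \<otimes> ((f \<otimes> u) \<otimes> k \<otimes> inv (f \<otimes> u)))"
        unfolding eq using conjB[OF fc wB] conjB[OF fc b] kN NB by (intro pseudonormD(4)[OF s(1)]) auto
      moreover have "s ((f \<otimes> b \<otimes> inv f) \<otimes> ((f \<otimes> u) \<otimes> k \<otimes> inv (f \<otimes> u))) \<le> s (f \<otimes> b \<otimes> inv f) + s ((f \<otimes> u) \<otimes> k \<otimes> inv (f \<otimes> u))"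
        using conjB[OF fc b] kN NB by (intro pseudonormD(4)[OF s(1)]) auto
      moreover have "s ((f \<otimes> u) \<otimes> k \<otimes> inv (f \<otimes> u)) = 0" by (rule s0[OF kN])
      moreover have "s (f \<otimes> ?w \<otimes> inv f) < e"
      proof -
        have "q (f \<otimes> ?w \<otimes> inv f) = q ?w"
          using cl u by (intro conj_invariantD[OF qn(2)]) auto
        moreover have "q ?w \<le> q u + q (b \<otimes> inv u \<otimes> inv b)"
          using cl u by (intro pseudonormD(4)[OF qn(1)]) auto
        moreover have "q (b \<otimes> inv u \<otimes> inv b) = q (inv u)"
          using cl u by (intro conj_invariantD[OF qn(2)]) auto
        moreover have "q (inv u) = q u" by (rule pseudonormD(3)[OF qn(1) u])
        ultimately have "q (f \<otimes> ?w \<otimes> inv f) < 1" using f(3) unfolding u_def by linarith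
        then show ?thesis using q(2) conjB[OF fc wB] by blast
      qed
      moreover have "s (f \<otimes> b \<otimes> inv f) \<le> ?r b"
        using F f(1) conjB b pseudonormD(1)[OF s(1)]
        by (intro member_le_sum) (auto simp del: B.inv_op_closed2)
      ultimately show "s (x \<otimes> b \<otimes> inv x) \<le> ?r b + e" by linarith
    qed
    then have "\<forall>x\<in>B. \<forall>y\<in>B. r (inv x \<otimes> y) \<le> ?r (inv x \<otimes> y) + e" by simp
    ultimately show "\<exists>r'. totally_bounded_norm G B r' \<and>
        (\<forall>x\<in>B. \<forall>y\<in>B. r (inv x \<otimes> y) \<le> r' (inv x \<otimes> y) + e)" by blast
  qed
  moreover have "r n = 0" if n: "n \<in> N" for n
  proof (rule antisym)
    show "r n \<le> 0"
    proof (rule least)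
      fix x assume "x \<in> carrier G"
      then show "s (x \<otimes> n \<otimes> inv x) \<le> 0" using s0[OF N.inv_op_closed2[OF _ n]] by simp
    qed
    show "0 \<le> r n" using s_le[of n] s0[OF n] n NB by auto
  qed
  ultimately have "r \<in> tb_norms" by (simp add: tb_norms_def norms_def)
  then show thesis using s_le by (rule that)
qed

end

section \<open>Maximally almost periodic sections\<close>

text \<open>A compact group has separating totally bounded invariant pseudonorms.  Their pullbacks to \<open>B\<close> are turned into members of \<open>tb_norms\<close> by averaging over conjugation.\<close>

lemma (in abelian_section) precompact_if_MAP:
  assumes MAP: "MAP_group (G\<lparr>carrier := B\<rparr> Mod N)
    (quotient_topology (subtopology T B) (\<lambda>x. N #> x))"
  shows "precompact_modulo G T N"
proof (rule precompact_if_separated)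
  let ?Q = "G\<lparr>carrier := B\<rparr> Mod N" and ?TB = "subtopology T B"
  let ?TQ = "quotient_topology ?TB (\<lambda>x. N #> x)"
  note Bc = B.subset[THEN subsetD]
  obtain K :: "'a set set set monoid" and S f where K: "topological_group K S" "compact_space S"
    and f: "f \<in> continuous_hom ?Q ?TQ K S" "inj_on f (carrier ?Q)"
    using MAP unfolding MAP_group_def by blast
  interpret K: topological_group K S by fact
  have cQ: "N #> b \<in> carrier ?Q" if "b \<in> B" for b
    using that by (auto simp: carrier_FactGroup)
  define g where "g b = f (N #> b)" for b
  have gK: "g b \<in> carrier K" if "b \<in> B" for b
    using f(1) cQ[OF that] by (auto simp: g_def continuous_hom_def hom_def)
  have mult: "g (a \<otimes> b) = g a \<otimes>\<^bsub>K\<^esub> g b" if "a \<in> B" "b \<in> B" for a b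
  proof -
    have "f ((N #> a) \<otimes>\<^bsub>?Q\<^esub> (N #> b)) = g a \<otimes>\<^bsub>K\<^esub> g b"
      unfolding g_def using f(1) cQ[OF that(1)] cQ[OF that(2)]
      by (intro hom_mult) (auto simp: continuous_hom_def)
    moreover have "(N #> a) \<otimes>\<^bsub>?Q\<^esub> (N #> b) = N #> (a \<otimes> b)"
      using N.rcos_sum[of a b] that Bc by simp
    ultimately show ?thesis by (simp add: g_def)
  qed
  have g1: "g \<one> = \<one>\<^bsub>K\<^esub>"
    using mult[OF B.one_closed B.one_closed] gK[OF B.one_closed] by (metis K.l_cancel_one' one_closed r_one)
  have ginv: "g (inv b) = inv\<^bsub>K\<^esub> g b" if b: "b \<in> B" for b
  proof (rule K.inv_equality[symmetric])
    show "g (inv b) \<otimes>\<^bsub>K\<^esub> g b = \<one>\<^bsub>K\<^esub>"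
      using mult[of "inv b" b] b Bc[OF b] g1 by simp
  qed (use b gK in auto)
  have gN: "g n = \<one>\<^bsub>K\<^esub>" if n: "n \<in> N" for n
  proof -
    have "N #> n = N #> \<one>" using n N.rcos_const by (simp add: coset_join2 N.subgroup_axioms N.subset)
    then show ?thesis using g1 by (simp add: g_def)
  qed
  have gcont: "continuous_map ?TB S g"
    unfolding g_def
    using continuous_map_compose[OF quotient_imp_continuous_map[OF quotient_map_quotient_topology]] f(1)
    by (auto simp: continuous_hom_def o_def)
  fix b assume b: "b \<in> B" and zero: "\<And>r. r \<in> tb_norms \<Longrightarrow> r b = 0"
  show "b \<in> N"
  proof (rule ccontr)
    assume bN: "b \<notin> N"
    have "g b \<noteq> \<one>\<^bsub>K\<^esub>"
    proof
      assume "g b = \<one>\<^bsub>K\<^esub>"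
      then have "f (N #> b) = f (N #> \<one>)" using g1 by (simp add: g_def)
      then have "N #> b = N #> \<one>" using inj_onD[OF f(2)] cQ[OF b] cQ[OF B.one_closed] by blast
      then show False using bN rcos_self[OF Bc[OF b] N.subgroup_axioms] N.subset by auto
    qed
    then obtain V where V: "openin S V" "\<one>\<^bsub>K\<^esub> \<in> V" "g b \<notin> V"
      using K.Hausdorff gK[OF b] K.topspace_eq K.one_closed
      unfolding Hausdorff_space_def disjnt_iff by metis
    obtain \<rho> where \<rho>: "\<rho> \<in> norms K S (carrier K)" "\<And>x. \<rho> x < 1 \<Longrightarrow> x \<in> V"
      using K.balanced_norm[OF K.compact_imp_balanced[OF K(2)] V(1,2)] by blast
    note \<rho>n = normsD[OF \<rho>(1)]
    \<comment> \<open>The cap at \<open>1\<close> provides the bound that the supremum over all conjugates requires.\<close>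
    define s where "s x = min 1 (\<rho> (g x))" for x
    have "pseudonorm G B s"
      unfolding pseudonorm_def
    proof (intro conjI ballI)
      show "0 \<le> s x" if "x \<in> B" for x using pseudonormD(1)[OF \<rho>n(1) gK[OF that]] by (simp add: s_def)
      show "s \<one> = 0" using pseudonormD(2)[OF \<rho>n(1)] by (simp add: s_def g1)
      show "s (inv x) = s x" if "x \<in> B" for x
        using pseudonormD(3)[OF \<rho>n(1) gK[OF that]] by (simp add: s_def ginv[OF that])
      show "s (x \<otimes> y) \<le> s x + s y" if "x \<in> B" "y \<in> B" for x y
        using pseudonormD(4)[OF \<rho>n(1) gK[OF that(1)] gK[OF that(2)]]
          pseudonormD(1)[OF \<rho>n(1) gK[OF that(1)]] pseudonormD(1)[OF \<rho>n(1) gK[OF that(2)]]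
        by (simp add: s_def mult[OF that] min_def)
    qed
    moreover have "small_near_one G T B s"
      unfolding small_near_one_def
    proof (intro allI impI)
      fix e :: real assume "e > 0"
      then obtain O' where O': "openin S O'" "\<one>\<^bsub>K\<^esub> \<in> O'" "\<forall>x\<in>O' \<inter> carrier K. \<rho> x < e"
        using \<rho>n(3) unfolding small_near_one_def by blast
      have "openin ?TB {x \<in> topspace ?TB. g x \<in> O'}"
        by (rule openin_continuous_map_preimage[OF gcont O'(1)])
      then obtain U where U: "openin T U" "{x \<in> topspace ?TB. g x \<in> O'} = U \<inter> B"
        unfolding openin_subtopology by blast
      have "\<one> \<in> {x \<in> topspace ?TB. g x \<in> O'}" using O'(2) g1 by (simp add: topspace_eq)
      then have "\<one> \<in> U" using U(2) by blast
      moreover have "s x < e" if "x \<in> U \<inter> B" for x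
      proof -
        have "x \<in> {x \<in> topspace ?TB. g x \<in> O'}" using that U(2) by blast
        then have "\<rho> (g x) < e" using O'(3) gK that by blast
        then show ?thesis by (simp add: s_def min_less_iff_disj)
      qed
      ultimately show "\<exists>U. openin T U \<and> \<one> \<in> U \<and> (\<forall>x\<in>U \<inter> B. s x < e)" using U(1) by blast
    qed
    moreover have "totally_bounded_norm G B s"
    proof (rule totally_boundedI)
      fix e :: real assume e: "e > 0"
      obtain \<phi> :: "_ \<Rightarrow> nat" where \<phi>: "finite (\<phi> ` carrier K)"
        "\<And>x y. x \<in> carrier K \<Longrightarrow> y \<in> carrier K \<Longrightarrow> \<phi> x = \<phi> y \<Longrightarrow> \<rho> (inv\<^bsub>K\<^esub> x \<otimes>\<^bsub>K\<^esub> y) < e"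
        by (rule totally_boundedE[OF K.compact_imp_totally_bounded[OF K(2) \<rho>(1)] e]) (rule that)
      have "finite ((\<lambda>x. \<phi> (g x)) ` B)"
        by (rule finite_subset[OF _ \<phi>(1)]) (use gK in auto)
      moreover have "s (inv x \<otimes> y) < e" if xy: "x \<in> B" "y \<in> B" "\<phi> (g x) = \<phi> (g y)" for x y
        using \<phi>(2)[OF gK[OF xy(1)] gK[OF xy(2)] xy(3)] xy
        by (simp add: s_def mult ginv min_less_iff_disj)
      ultimately show "\<exists>\<phi> :: 'a \<Rightarrow> nat. finite (\<phi> ` B) \<and>
          (\<forall>x\<in>B. \<forall>y\<in>B. \<phi> x = \<phi> y \<longrightarrow> s (inv x \<otimes> y) < e)" by blast
    qed
    moreover have "s x \<le> 1" for x by (simp add: s_def)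
    moreover have "s n = 0" if "n \<in> N" for n
      using pseudonormD(2)[OF \<rho>n(1)] by (simp add: s_def gN[OF that])
    ultimately obtain r where r: "r \<in> tb_norms" "\<And>b. b \<in> B \<Longrightarrow> s b \<le> r b"
      by (rule invariant_hull[of s 1]) blast+
    have "s b = 1" using \<rho>(2)[of "g b"] V(3) by (force simp: s_def)
    then show False using r(2)[OF b] zero[OF r(1)] by simp
  qed
qed

section \<open>Characters and real homomorphisms of abelian groups\<close>

context comm_group
begin

text \<open>Graphs of unimodular homomorphisms defined on subgroups.  As relations they are ordered by inclusion, and unions of chains are again of this kind.\<close>

definition partial_character :: "('a \<times> complex) set \<Rightarrow> bool" where
  "partial_character R \<longleftrightarrow> (\<one>, 1) \<in> R \<and>
     (\<forall>x u. (x, u) \<in> R \<longrightarrow> x \<in> carrier G \<and> norm u = 1 \<and> (inv x, inverse u) \<in> R) \<and>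
     (\<forall>x u y v. (x, u) \<in> R \<longrightarrow> (y, v) \<in> R \<longrightarrow> (x \<otimes> y, u * v) \<in> R) \<and>
     (\<forall>u. (\<one>, u) \<in> R \<longrightarrow> u = 1)"

lemma partial_characterD:
  assumes "partial_character R"
  shows "(\<one>, 1) \<in> R" "(x, u) \<in> R \<Longrightarrow> x \<in> carrier G" "(x, u) \<in> R \<Longrightarrow> norm u = 1"
    "(x, u) \<in> R \<Longrightarrow> (inv x, inverse u) \<in> R"
    "(x, u) \<in> R \<Longrightarrow> (y, v) \<in> R \<Longrightarrow> (x \<otimes> y, u * v) \<in> R"
    "(\<one>, u) \<in> R \<Longrightarrow> u = 1"
  using assms unfolding partial_character_def by blast+

lemma partial_character_unique:
  assumes R: "partial_character R" and "(x, u) \<in> R" "(x, v) \<in> R"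
  shows "u = v"
proof -
  have "(inv x \<otimes> x, inverse u * v) \<in> R"
    using assms by (intro partial_characterD(5)[OF R] partial_characterD(4)[OF R])
  then have "inverse u * v = 1"
    using partial_characterD(2)[OF R assms(2)] by (intro partial_characterD(6)[OF R]) simp
  moreover have "u \<noteq> 0" using partial_characterD(3)[OF R assms(2)] by auto
  ultimately show ?thesis by (simp add: field_simps)
qed

lemma partial_character_power:
  assumes R: "partial_character R" and x: "(x, u) \<in> R"
  shows "(x [^] (k::int), u powi k) \<in> R"
proof -
  have nat: "(x [^] n, u ^ n) \<in> R" for n :: nat
  proof (induction n)
    case 0
    then show ?case using partial_characterD(1)[OF R] by simp
  next
    case (Suc n)
    then show ?case using partial_characterD(5)[OF R Suc x] by (simp add: mult.commute)
  qed
  show ?thesis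
  proof (cases k rule: int_cases2)
    case (nonneg n)
    then show ?thesis using nat[of n] by (simp add: int_pow_int)
  next
    case (nonpos n)
    have "x \<in> carrier G" by (rule partial_characterD(2)[OF R x])
    then show ?thesis using partial_characterD(4)[OF R nat[of n]] nonpos
      by (simp add: int_pow_neg int_pow_int power_int_minus)
  qed
qed

text \<open>The value \<open>t\<close> at a new element \<open>x\<close> is admissible if it agrees with the old values at the powers of \<open>x\<close> that lie in the domain.\<close>

lemma adjoin_to_partial_character:
  assumes R: "partial_character R" and x: "x \<in> carrier G" and t: "norm t = 1"
    and compatible: "\<And>j w. (x [^] (j::int), w) \<in> R \<Longrightarrow> w = t powi j"
  obtains R' where "partial_character R'" "R \<subseteq> R'" "(x, t) \<in> R'"
proof -
  define R' where "R' = {(y \<otimes> x [^] (k::int), v * t powi k) | y v k. (y, v) \<in> R}"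
  have t0: "t \<noteq> 0" using t by auto
  have mem: "(y \<otimes> x [^] (k::int), v * t powi k) \<in> R'" if "(y, v) \<in> R" for y v k
    using that unfolding R'_def by blast
  note Rc = partial_characterD(2)[OF R]
  have "partial_character R'"
    unfolding partial_character_def
  proof (intro conjI allI impI)
    show "(\<one>, 1) \<in> R'" using mem[OF partial_characterD(1)[OF R], of 0] by simp
    fix z w assume "(z, w) \<in> R'"
    then obtain y v and k :: int where z: "z = y \<otimes> x [^] k" "w = v * t powi k" "(y, v) \<in> R"
      unfolding R'_def by blast
    show "z \<in> carrier G" using z x Rc by simp
    show "norm w = 1" using partial_characterD(3)[OF R z(3)] t by (simp add: z norm_mult norm_power_int)
    have "inv z = inv y \<otimes> x [^] (- k)"
      using z x Rc[OF z(3)] by (simp add: inv_mult int_pow_neg)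
    moreover have "inverse w = inverse v * t powi (- k)" by (simp add: z power_int_minus)
    ultimately show "(inv z, inverse w) \<in> R'" using mem[OF partial_characterD(4)[OF R z(3)]] by simp
  next
    fix z w z' w' assume "(z, w) \<in> R'" "(z', w') \<in> R'"
    then obtain y v y' v' and k k' :: int where z: "z = y \<otimes> x [^] k" "w = v * t powi k" "(y, v) \<in> R"
      and z': "z' = y' \<otimes> x [^] k'" "w' = v' * t powi k'" "(y', v') \<in> R"
      unfolding R'_def by blast
    have "z \<otimes> z' = (y \<otimes> y') \<otimes> x [^] (k + k')"
      using x Rc[OF z(3)] Rc[OF z'(3)] by (simp add: z z' int_pow_mult m_ac)
    moreover have "w * w' = (v * v') * t powi (k + k')"
      using t0 by (simp add: z z' power_int_add)
    ultimately show "(z \<otimes> z', w * w') \<in> R'" using mem[OF partial_characterD(5)[OF R z(3) z'(3)]] by simp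
  next
    fix w assume "(\<one>, w) \<in> R'"
    then obtain y v and k :: int where z: "\<one> = y \<otimes> x [^] k" "w = v * t powi k" "(y, v) \<in> R"
      unfolding R'_def by blast
    have "y = inv (x [^] k)"
      using z(1) x Rc[OF z(3)] by (metis inv_equality int_pow_closed inv_inv inv_closed)
    then have "y = x [^] (- k)" using x by (simp add: int_pow_neg)
    then have "v = t powi (- k)" using compatible z(3) by blast
    then show "w = 1" using t0 by (simp add: z(2) power_int_minus)
  qed
  moreover have "R \<subseteq> R'"
  proof
    fix p assume p: "p \<in> R"
    obtain y v where yv: "p = (y, v)" by fastforce
    then show "p \<in> R'" using mem[of y v 0] p Rc by simp
  qed
  moreover have "(x, t) \<in> R'" using mem[OF partial_characterD(1)[OF R], of 1] x by simp
  ultimately show thesis by (rule that)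
qed

text \<open>There are \<open>n \<ge> 2\<close> roots to choose from, and at most one of them is \<open>1\<close>.\<close>

lemma nontrivial_root:
  assumes "norm (w::complex) = 1" "n \<ge> 2"
  obtains t where "norm t = 1" "t \<noteq> 1" "t ^ n = w"
proof -
  have "w \<noteq> 0" using assms by auto
  then have "card {z. z ^ n = w} = n" using assms by (intro card_nth_roots) auto
  then have "\<not> {z. z ^ n = w} \<subseteq> {1}"
    using assms(2) card_mono[of "{1::complex}" "{z. z ^ n = w}"] by auto
  then obtain t where t: "t ^ n = w" "t \<noteq> 1" by blast
  have "norm t ^ n = 1" using t(1) assms(1) by (metis norm_power)
  then have "norm t = 1" using assms(2) power_eq_imp_eq_base[of "norm t" n 1] by simp
  then show thesis using t by (intro that)
qed

text \<open>If no positive power of \<open>x\<close> lies in the domain, every value is admissible.  Otherwise the exponents in question are the multiples of the least positive one, \<open>n\<close>, and an \<open>n\<close>-th root of the value there is admissible; \<open>n \<ge> 2\<close> leaves room for a root other than \<open>1\<close>.\<close>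

lemma extend_partial_character:
  assumes R: "partial_character R" and x: "x \<in> carrier G" "x \<notin> Domain R"
  obtains R' t where "partial_character R'" "R \<subseteq> R'" "(x, t) \<in> R'" "t \<noteq> 1"
proof (cases "\<exists>n::nat. n > 0 \<and> x [^] n \<in> Domain R")
  case False
  have "w = (-1) powi j" if "(x [^] (j::int), w) \<in> R" for j w
  proof -
    have dom: "x [^] nat \<bar>j\<bar> \<in> Domain R"
    proof (cases j rule: int_cases2)
      case (nonneg n)
      then show ?thesis using that by (simp add: int_pow_int Domain.DomainI)
    next
      case (nonpos n)
      then have "(inv (x [^] n), w) \<in> R" using that x(1) by (simp add: int_pow_neg int_pow_int)
      then have "(inv (inv (x [^] n)), inverse w) \<in> R" by (rule partial_characterD(4)[OF R])
      then show ?thesis using nonpos x(1) by (simp add: Domain.DomainI)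
    qed
    have "\<not> nat \<bar>j\<bar> > 0"
    proof
      assume "nat \<bar>j\<bar> > 0"
      then have "\<exists>n::nat. n > 0 \<and> x [^] n \<in> Domain R" using dom by (intro exI conjI)
      then show False using False by (rule notE[rotated])
    qed
    then have "j = 0" by simp
    then show ?thesis using that partial_characterD(6)[OF R, of w] by simp
  qed
  then obtain R' where "partial_character R'" "R \<subseteq> R'" "(x, -1) \<in> R'"
    by (rule adjoin_to_partial_character[OF R x(1), of "-1", rotated]) auto
  then show thesis by (intro that[of R' "-1"]) auto
next
  case True
  define n where "n = (LEAST n::nat. n > 0 \<and> x [^] n \<in> Domain R)"
  have n: "n > 0" "x [^] n \<in> Domain R"
    using LeastI_ex[OF True] by (auto simp: n_def)
  have min: "n \<le> m" if "m > 0" "x [^] m \<in> Domain R" for m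
    unfolding n_def using that by (intro Least_le) auto
  have "n \<noteq> 1" using n(2) x by auto
  then have n2: "n \<ge> 2" using n(1) by simp
  obtain w0 where w0: "(x [^] n, w0) \<in> R" using n(2) by blast
  obtain t where t: "norm t = 1" "t \<noteq> 1" "t ^ n = w0"
    using nontrivial_root[OF partial_characterD(3)[OF R w0] n2] by blast
  have "w = t powi j" if j: "(x [^] (j::int), w) \<in> R" for j w
  proof -
    have xn: "x [^] int n = x [^] n" by (simp add: int_pow_int)
    have pow: "((x [^] n) [^] (j div int n), w0 powi (j div int n)) \<in> R"
      by (rule partial_character_power[OF R w0])
    have eq: "(x [^] n) [^] (j div int n) = x [^] (int n * (j div int n))"
      using x(1) by (simp add: int_pow_pow xn[symmetric])
    have "(x [^] j \<otimes> inv (x [^] (int n * (j div int n))), w * inverse (w0 powi (j div int n))) \<in> R"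
      using pow unfolding eq by (intro partial_characterD(5)[OF R j] partial_characterD(4)[OF R])
    moreover have "x [^] j \<otimes> inv (x [^] (int n * (j div int n))) = x [^] (j mod int n)"
      using x(1) by (simp add: int_pow_neg[symmetric] int_pow_mult[symmetric] minus_mult_div_eq_mod)
    ultimately have r: "(x [^] (j mod int n), w * inverse (w0 powi (j div int n))) \<in> R" by simp
    have "j mod int n = 0"
    proof (rule ccontr)
      assume "j mod int n \<noteq> 0"
      then have pos: "nat (j mod int n) > 0" "nat (j mod int n) < n" using n(1)
        by (auto simp: nat_less_iff) (metis order_le_less pos_mod_sign of_nat_0_less_iff)
      have "x [^] nat (j mod int n) = x [^] (j mod int n)"
      proof -
        have "int (nat (j mod int n)) = j mod int n" using pos by simp
        then show ?thesis using int_pow_int[of G x "nat (j mod int n)"] by simp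
      qed
      then have "x [^] nat (j mod int n) \<in> Domain R" using r by auto
      then show False using min[OF pos(1)] pos(2) by simp
    qed
    then have j_eq: "j = int n * (j div int n)" by (metis add.right_neutral mult_div_mod_eq)
    have "(x [^] j, w0 powi (j div int n)) \<in> R" using pow unfolding eq using j_eq by simp
    then have "w = w0 powi (j div int n)" using partial_character_unique[OF R j] by blast
    also have "\<dots> = t powi (int n * (j div int n))" by (simp add: t(3)[symmetric] power_int_mult)
    finally show ?thesis using j_eq by simp
  qed
  then obtain R' where "partial_character R'" "R \<subseteq> R'" "(x, t) \<in> R'"
    by (rule adjoin_to_partial_character[OF R x(1) t(1)]) blast+
  then show thesis using t(2) by (intro that[of R' t]) auto
qed

text \<open>First give \<open>b\<close> a nontrivial value, then extend to a maximal partial character; by the preceding lemma it is defined everywhere.\<close>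

lemma character_separates:
  assumes b: "b \<in> carrier G" "b \<noteq> \<one>"
  obtains \<psi> :: "'a \<Rightarrow> complex" where
    "\<And>x y. x \<in> carrier G \<Longrightarrow> y \<in> carrier G \<Longrightarrow> \<psi> (x \<otimes> y) = \<psi> x * \<psi> y"
    "\<And>x. x \<in> carrier G \<Longrightarrow> norm (\<psi> x) = 1" "\<psi> b \<noteq> 1"
proof -
  have "partial_character {(\<one>, 1)}" by (auto simp: partial_character_def)
  then obtain R1 t where R1: "partial_character R1" "(b, t) \<in> R1" "t \<noteq> 1"
    by (rule extend_partial_character[of "{(\<one>, 1)}" b]) (use b in auto)
  have "\<exists>R\<in>{R. partial_character R \<and> R1 \<subseteq> R}. \<forall>R'\<in>{R. partial_character R \<and> R1 \<subseteq> R}. R \<subseteq> R' \<longrightarrow> R' = R"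
  proof (rule subset_Zorn_nonempty)
    show "{R. partial_character R \<and> R1 \<subseteq> R} \<noteq> {}" using R1(1) by blast
    fix \<C> assume ne: "\<C> \<noteq> {}" and "subset.chain {R. partial_character R \<and> R1 \<subseteq> R} \<C>"
    then have C: "\<And>R. R \<in> \<C> \<Longrightarrow> partial_character R" "\<And>R. R \<in> \<C> \<Longrightarrow> R1 \<subseteq> R"
      and lin: "\<And>R R'. R \<in> \<C> \<Longrightarrow> R' \<in> \<C> \<Longrightarrow> R \<subseteq> R' \<or> R' \<subseteq> R"
      unfolding subset.chain_def by blast+
    have "partial_character (\<Union>\<C>)"
      unfolding partial_character_def
    proof (intro conjI allI impI)
      show "(\<one>, 1) \<in> \<Union>\<C>" using ne C(1) partial_characterD(1) by blast
      show "x \<in> carrier G" "norm u = 1" "(inv x, inverse u) \<in> \<Union>\<C>" if "(x, u) \<in> \<Union>\<C>" for x u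
        using that C(1) partial_characterD(2,3,4) by blast+
      show "u = 1" if "(\<one>, u) \<in> \<Union>\<C>" for u
        using that C(1) partial_characterD(6) by blast
      fix x u y v assume "(x, u) \<in> \<Union>\<C>" "(y, v) \<in> \<Union>\<C>"
      then obtain R where "R \<in> \<C>" "(x, u) \<in> R" "(y, v) \<in> R" using lin by blast
      then show "(x \<otimes> y, u * v) \<in> \<Union>\<C>" using C(1) partial_characterD(5) by blast
    qed
    then show "\<Union>\<C> \<in> {R. partial_character R \<and> R1 \<subseteq> R}" using ne C(2) by blast
  qed
  then obtain R where RA: "R \<in> {R. partial_character R \<and> R1 \<subseteq> R}"
    and max': "\<forall>R'\<in>{R. partial_character R \<and> R1 \<subseteq> R}. R \<subseteq> R' \<longrightarrow> R' = R" ..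
  then have R: "partial_character R" "R1 \<subseteq> R" by auto
  have max: "R' = R" if "partial_character R'" "R \<subseteq> R'" for R'
    using max'[rule_format, of R'] that R(2) by simp
  have dom: "\<exists>u. (x, u) \<in> R" if x: "x \<in> carrier G" for x
  proof (rule ccontr)
    assume "\<nexists>u. (x, u) \<in> R"
    then have "x \<notin> Domain R" by blast
    then obtain R' t where R': "partial_character R'" "R \<subseteq> R'" "(x, t) \<in> R'"
      by (rule extend_partial_character[OF R(1) x])
    have "R' = R" by (rule max[OF R'(1,2)])
    then show False using R'(3) \<open>x \<notin> Domain R\<close> by blast
  qed
  define \<psi> where "\<psi> x = (SOME u. (x, u) \<in> R)" for x
  have \<psi>: "(x, \<psi> x) \<in> R" if "x \<in> carrier G" for x
    unfolding \<psi>_def by (rule someI_ex[OF dom[OF that]])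
  show thesis
  proof (rule that[of \<psi>])
    show "\<psi> (x \<otimes> y) = \<psi> x * \<psi> y" if "x \<in> carrier G" "y \<in> carrier G" for x y
      using partial_character_unique[OF R(1) \<psi>] partial_characterD(5)[OF R(1) \<psi> \<psi>] that by blast
    show "norm (\<psi> x) = 1" if "x \<in> carrier G" for x
      by (rule partial_characterD(3)[OF R(1) \<psi>[OF that]])
    have "\<psi> b = t" using partial_character_unique[OF R(1) \<psi>[OF b(1)]] R1(2) R(2) by blast
    then show "\<psi> b \<noteq> 1" using R1(3) by simp
  qed
qed

definition sublinear :: "('a \<Rightarrow> real) \<Rightarrow> bool" where
  "sublinear f \<longleftrightarrow> (\<forall>x\<in>carrier G. \<forall>y\<in>carrier G. f (x \<otimes> y) \<le> f x + f y) \<and>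
     (\<forall>x\<in>carrier G. \<forall>n::nat. f (x [^] (n::nat)) = real n * f x)"

lemma sublinearD:
  assumes "sublinear f"
  shows "x \<in> carrier G \<Longrightarrow> y \<in> carrier G \<Longrightarrow> f (x \<otimes> y) \<le> f x + f y"
    "x \<in> carrier G \<Longrightarrow> f (x [^] (n::nat)) = real n * f x"
  using assms by (auto simp: sublinear_def)

lemma sublinear_one: "sublinear f \<Longrightarrow> f \<one> = 0"
  using sublinearD(2)[of f \<one> 0] by simp

lemma sublinear_inv: "sublinear f \<Longrightarrow> x \<in> carrier G \<Longrightarrow> - f (inv x) \<le> f x"
  using sublinearD(1)[of f x "inv x"] sublinear_one[of f] by simp

text \<open>The Busemann function of \<open>f\<close> along the ray of powers of \<open>a\<close>.\<close>

definition asymptote :: "('a \<Rightarrow> real) \<Rightarrow> 'a \<Rightarrow> 'a \<Rightarrow> real" where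
  "asymptote f a x = (INF n::nat. f (x \<otimes> a [^] (n::nat)) - real n * f a)"

lemma
  assumes f: "sublinear f" and a: "a \<in> carrier G"
  shows asymptote_le: "x \<in> carrier G \<Longrightarrow> asymptote f a x \<le> f (x \<otimes> a [^] (n::nat)) - real n * f a"
    and sublinear_asymptote: "sublinear (asymptote f a)"
proof -
  let ?g = "\<lambda>x n. f (x \<otimes> a [^] (n::nat)) - real n * f a"
  have below: "- f (inv x) \<le> ?g x n" if x: "x \<in> carrier G" for x n
  proof -
    have "real n * f a = f (inv x \<otimes> (x \<otimes> a [^] n))"
      using x a by (simp add: inv_mult_cancel_left sublinearD(2)[OF f])
    also have "\<dots> \<le> f (inv x) + f (x \<otimes> a [^] n)" using x a by (intro sublinearD(1)[OF f]) auto
    finally show ?thesis by linarith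
  qed
  show le: "asymptote f a x \<le> ?g x n" if "x \<in> carrier G" for x n
    unfolding asymptote_def using below[OF that] by (intro cINF_lower bdd_belowI2) auto
  have least: "t \<le> asymptote f a x" if "\<And>n. t \<le> ?g x n" for t x
    unfolding asymptote_def by (rule cINF_greatest) (use that in auto)
  have dec: "?g x m \<le> ?g x n" if "n \<le> m" "x \<in> carrier G" for x n m
  proof -
    have "x \<otimes> a [^] m = (x \<otimes> a [^] n) \<otimes> a [^] (m - n)"
      using that a by (simp add: m_assoc nat_pow_mult)
    then have "f (x \<otimes> a [^] m) \<le> f (x \<otimes> a [^] n) + f (a [^] (m - n))"
      using sublinearD(1)[OF f, of "x \<otimes> a [^] n" "a [^] (m - n)"] that a by simp
    also have "f (a [^] (m - n)) = real (m - n) * f a" by (rule sublinearD(2)[OF f a])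
    finally show ?thesis using that(1) by (simp add: of_nat_diff left_diff_distrib)
  qed
  show "sublinear (asymptote f a)"
    unfolding sublinear_def
  proof (intro conjI ballI allI)
    fix x y assume x: "x \<in> carrier G" and y: "y \<in> carrier G"
    have "asymptote f a (x \<otimes> y) - ?g x m \<le> ?g y n" for m n
    proof -
      have "asymptote f a (x \<otimes> y) \<le> ?g (x \<otimes> y) (m + n)" by (rule le) (use x y in simp)
      moreover have "(x \<otimes> y) \<otimes> a [^] (m + n) = (x \<otimes> a [^] m) \<otimes> (y \<otimes> a [^] n)"
        using x y a by (simp add: nat_pow_mult[symmetric] m_ac)
      moreover have "f ((x \<otimes> a [^] m) \<otimes> (y \<otimes> a [^] n)) \<le> f (x \<otimes> a [^] m) + f (y \<otimes> a [^] n)"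
        using x y a by (intro sublinearD(1)[OF f]) auto
      ultimately show ?thesis by (simp add: distrib_right)
    qed
    then have "asymptote f a (x \<otimes> y) - ?g x m \<le> asymptote f a y" for m by (rule least)
    then have "asymptote f a (x \<otimes> y) - asymptote f a y \<le> ?g x m" for m
      by (simp add: algebra_simps)
    then have "asymptote f a (x \<otimes> y) - asymptote f a y \<le> asymptote f a x" by (rule least)
    then show "asymptote f a (x \<otimes> y) \<le> asymptote f a x + asymptote f a y" by linarith
  next
    fix x and k :: nat assume x: "x \<in> carrier G"
    have pow: "?g (x [^] k) (k * n) = real k * ?g x n" for n
    proof -
      have "x [^] k \<otimes> a [^] (k * n) = (x \<otimes> a [^] n) [^] k"
        using x a by (simp add: pow_mult_distrib m_comm nat_pow_pow mult.commute)
      then show ?thesis using sublinearD(2)[OF f, of "x \<otimes> a [^] n" k] x a by (simp add: algebra_simps)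
    qed
    show "asymptote f a (x [^] k) = real k * asymptote f a x"
    proof (cases "k = 0")
      case True
      have "?g \<one> n = 0" for n using a sublinearD(2)[OF f a] by simp
      then have "asymptote f a \<one> = 0" unfolding asymptote_def by simp
      then show ?thesis using True by simp
    next
      case False
      show ?thesis
      proof (rule antisym)
        have "asymptote f a (x [^] k) / real k \<le> ?g x n" for n
          using le[of "x [^] k" "k * n"] x False unfolding pow by (simp add: field_simps)
        then have "asymptote f a (x [^] k) / real k \<le> asymptote f a x" by (rule least)
        then show "asymptote f a (x [^] k) \<le> real k * asymptote f a x" using False by (simp add: field_simps)
        show "real k * asymptote f a x \<le> asymptote f a (x [^] k)"
        proof (rule least)
          fix n
          have "real k * asymptote f a x \<le> real k * ?g x n" using le[OF x] by (intro mult_left_mono) auto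
          also have "\<dots> = ?g (x [^] k) (k * n)" by (rule pow[symmetric])
          also have "\<dots> \<le> ?g (x [^] k) n" using False x by (intro dec) auto
          finally show "real k * asymptote f a x \<le> ?g (x [^] k) n" .
        qed
      qed
    qed
  qed
qed

text \<open>Below each sublinear function there is a minimal one, since the pointwise infimum of a chain is sublinear; it is finite because \<open>f x \<ge> - f (x\<inverse>)\<close>.\<close>

lemma minimal_sublinear:
  assumes p: "sublinear p"
  obtains f where "sublinear f" "\<And>x. x \<in> carrier G \<Longrightarrow> f x \<le> p x"
    "\<And>g. sublinear g \<Longrightarrow> (\<And>x. x \<in> carrier G \<Longrightarrow> g x \<le> f x) \<Longrightarrow> (\<And>x. x \<in> carrier G \<Longrightarrow> g x = f x)"
proof -
  define A where "A = {f. sublinear f \<and> (\<forall>x\<in>carrier G. f x \<le> p x) \<and> (\<forall>x. x \<notin> carrier G \<longrightarrow> f x = 0)}"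
  have cut: "(\<lambda>x. if x \<in> carrier G then g x else 0) \<in> A"
    if "sublinear g" "\<And>x. x \<in> carrier G \<Longrightarrow> g x \<le> p x" for g
    using that by (auto simp: A_def sublinear_def)
  have "\<exists>f\<in>A. \<forall>g\<in>A. g \<le> f \<longrightarrow> g = f"
  proof (rule predicate_Zorn)
    show "partial_order_on A (relation_of (\<lambda>f g. g \<le> f) A)"
      by (rule partial_order_on_relation_ofI) auto
    fix C assume C: "C \<in> Chains (relation_of (\<lambda>f g. g \<le> f) A)"
    then have sub: "C \<subseteq> A" and lin: "\<And>f g. f \<in> C \<Longrightarrow> g \<in> C \<Longrightarrow> f \<le> g \<or> g \<le> f"
      by (auto simp: Chains_def relation_of_def)
    show "\<exists>u\<in>A. \<forall>a\<in>C. u \<le> a"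
    proof (cases "C = {}")
      case True
      then show ?thesis using cut[OF p] by auto
    next
      case False
      have CS: "sublinear f" "\<And>x. x \<in> carrier G \<Longrightarrow> f x \<le> p x" "\<And>x. x \<notin> carrier G \<Longrightarrow> f x = 0" if "f \<in> C" for f
        using that sub by (auto simp: A_def)
      define u where "u x = (INF f\<in>C. f x)" for x
      have below: "- p (inv x) \<le> f x" if "f \<in> C" "x \<in> carrier G" for f x
        using sublinear_inv[OF CS(1)[OF that(1)] that(2)] CS(2)[OF that(1), of "inv x"] that(2) by simp
      have u_le: "u x \<le> f x" if "f \<in> C" for f x
      proof (cases "x \<in> carrier G")
        case True
        then show ?thesis unfolding u_def using below that by (intro cINF_lower bdd_belowI2) auto
      next
        case False
        have "bdd_below ((\<lambda>f. f x) ` C)"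
          by (rule bdd_belowI2[of _ 0]) (simp add: CS(3)[OF _ False])
        then show ?thesis unfolding u_def using that by (intro cINF_lower)
      qed
      have least: "t \<le> u x" if "\<And>f. f \<in> C \<Longrightarrow> t \<le> f x" for t x
        unfolding u_def by (rule cINF_greatest[OF False that])
      have "sublinear u"
        unfolding sublinear_def
      proof (intro conjI ballI allI)
        fix x y assume x: "x \<in> carrier G" and y: "y \<in> carrier G"
        have "u (x \<otimes> y) \<le> f x + g y" if fg: "f \<in> C" "g \<in> C" for f g
        proof -
          obtain h where h: "h \<in> C" "h \<le> f" "h \<le> g" using lin[OF fg] fg by blast
          have "u (x \<otimes> y) \<le> h (x \<otimes> y)" by (rule u_le[OF h(1)])
          also have "\<dots> \<le> h x + h y" by (rule sublinearD(1)[OF CS(1)[OF h(1)] x y])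
          also have "\<dots> \<le> f x + g y" using h(2,3) by (intro add_mono) (auto simp: le_fun_def)
          finally show ?thesis .
        qed
        then have "u (x \<otimes> y) - f x \<le> g y" if "f \<in> C" "g \<in> C" for f g using that by (simp add: algebra_simps)
        then have "u (x \<otimes> y) - f x \<le> u y" if "f \<in> C" for f using that by (intro least)
        then have "u (x \<otimes> y) - u y \<le> f x" if "f \<in> C" for f using that by (simp add: algebra_simps)
        then have "u (x \<otimes> y) - u y \<le> u x" by (rule least)
        then show "u (x \<otimes> y) \<le> u x + u y" by linarith
      next
        fix x and n :: nat assume x: "x \<in> carrier G"
        show "u (x [^] n) = real n * u x"
        proof (cases "n = 0")
          case True
          have "f \<one> = 0" if "f \<in> C" for f using sublinear_one[OF CS(1)[OF that]] .
          then have "(\<lambda>f. f \<one>) ` C = (\<lambda>f. 0) ` C" by (intro image_cong) auto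
          then have "u \<one> = 0" unfolding u_def using False by simp
          then show ?thesis using True by simp
        next
          case n: False
          show ?thesis
          proof (rule antisym)
            have "u (x [^] n) / real n \<le> f x" if "f \<in> C" for f
              using u_le[OF that, of "x [^] n"] sublinearD(2)[OF CS(1)[OF that] x, of n] n
              by (simp add: field_simps)
            then have "u (x [^] n) / real n \<le> u x" by (rule least)
            then show "u (x [^] n) \<le> real n * u x" using n by (simp add: field_simps)
            show "real n * u x \<le> u (x [^] n)"
            proof (rule least)
              fix f assume f: "f \<in> C"
              have "real n * u x \<le> real n * f x" using u_le[OF f] by (intro mult_left_mono) auto
              then show "real n * u x \<le> f (x [^] n)" using sublinearD(2)[OF CS(1)[OF f] x, of n] by simp
            qed
          qed
        qed
      qed
      moreover have "u x \<le> p x" if "x \<in> carrier G" for x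
      proof -
        obtain f where "f \<in> C" using False by blast
        then show ?thesis using u_le[of f x] CS(2)[of f x] that by linarith
      qed
      moreover have "u x = 0" if "x \<notin> carrier G" for x
      proof -
        have "(\<lambda>f. f x) ` C = (\<lambda>f. 0) ` C" using CS(3)[OF _ that] by (intro image_cong) auto
        then show ?thesis unfolding u_def using False by simp
      qed
      ultimately have "u \<in> A" by (simp add: A_def)
      then show ?thesis using u_le by (intro bexI[of _ u]) (auto simp: le_fun_def)
    qed
  qed
  then obtain f where f: "f \<in> A" and min: "\<And>g. g \<in> A \<Longrightarrow> g \<le> f \<Longrightarrow> g = f" by blast
  show thesis
  proof (rule that[of f])
    show "sublinear f" "\<And>x. x \<in> carrier G \<Longrightarrow> f x \<le> p x" using f by (auto simp: A_def)
    fix g x assume g: "sublinear g" "\<And>x. x \<in> carrier G \<Longrightarrow> g x \<le> f x" and x: "x \<in> carrier G"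
    let ?g = "\<lambda>x. if x \<in> carrier G then g x else 0"
    have "g x \<le> p x" if "x \<in> carrier G" for x
      using g(2)[OF that] f that by (force simp: A_def)
    then have "?g \<in> A" by (rule cut[OF g(1)])
    moreover have "?g \<le> f" using g(2) f by (auto simp: le_fun_def A_def)
    ultimately have "?g = f" by (rule min)
    from fun_cong[OF this, of x] show "g x = f x" using x by simp
  qed
qed

text \<open>A minimal sublinear function \<open>f\<close> is additive: its asymptote along \<open>y\<close> is sublinear and below \<open>f\<close>, hence equal to \<open>f\<close>, and so \<open>f x \<le> f (x y) - f y\<close>.  Starting from the asymptote of \<open>p\<close> along \<open>a\<close> forces \<open>f (a\<inverse>) \<le> - p a\<close>, that is, \<open>f a = p a\<close>.\<close>

lemma Hahn_Banach:
  assumes p: "sublinear p" and a: "a \<in> carrier G"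
  obtains f where "\<And>x y. x \<in> carrier G \<Longrightarrow> y \<in> carrier G \<Longrightarrow> f (x \<otimes> y) = f x + f y"
    "\<And>x. x \<in> carrier G \<Longrightarrow> f x \<le> p x" "f a = p a"
proof -
  obtain f where f: "sublinear f" "\<And>x. x \<in> carrier G \<Longrightarrow> f x \<le> asymptote p a x"
    and min: "\<And>g x. sublinear g \<Longrightarrow> (\<And>x. x \<in> carrier G \<Longrightarrow> g x \<le> f x) \<Longrightarrow> x \<in> carrier G \<Longrightarrow> g x = f x"
    by (rule minimal_sublinear[OF sublinear_asymptote[OF p a]]) blast
  have add: "f (x \<otimes> y) = f x + f y" if x: "x \<in> carrier G" and y: "y \<in> carrier G" for x y
  proof (rule antisym)
    show "f (x \<otimes> y) \<le> f x + f y" by (rule sublinearD(1)[OF f(1) x y])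
    have "asymptote f y z \<le> f z" if "z \<in> carrier G" for z
      using asymptote_le[OF f(1) y that, of 0] that by simp
    then have "asymptote f y x = f x" by (rule min[OF sublinear_asymptote[OF f(1) y] _ x])
    then show "f x + f y \<le> f (x \<otimes> y)" using asymptote_le[OF f(1) y x, of 1] y by simp
  qed
  have le: "f x \<le> p x" if "x \<in> carrier G" for x
    using f(2)[OF that] asymptote_le[OF p a that, of 0] that by simp
  have "f (inv a) \<le> - p a"
    using f(2)[of "inv a"] asymptote_le[OF p a, of "inv a" 1] a sublinear_one[OF p] by simp
  moreover have "f (inv a) + f a = 0" using add[of "inv a" a] a sublinear_one[OF f(1)] by simp
  ultimately have "f a = p a" using le[OF a] by linarith
  with add le show thesis by (rule that)
qed

end

section \<open>Asymptotic word length in abelian groups\<close>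

context comm_group
begin

text \<open>The stable length of \<open>x\<close> for a length function \<open>l\<close>; for subadditive \<open>l\<close> it is the limit of \<open>l (x\<^sup>n) / n\<close>.\<close>

definition growth :: "('a \<Rightarrow> nat) \<Rightarrow> 'a \<Rightarrow> real" where
  "growth l x = (INF n::nat. real (l (x [^] Suc n)) / real (Suc n))"

lemma growth_le: "n > 0 \<Longrightarrow> growth l x \<le> real (l (x [^] (n::nat))) / real n"
proof -
  assume "n > 0"
  then obtain m where n: "n = Suc m" using gr0_implies_Suc by blast
  have "bdd_below (range (\<lambda>n. real (l (x [^] Suc n)) / real (Suc n)))"
    by (rule bdd_belowI2[of _ 0]) simp
  then show ?thesis
    unfolding growth_def n by (rule cINF_lower) simp
qed

lemma growth_greatest:
  assumes "\<And>n::nat. n > 0 \<Longrightarrow> t \<le> real (l (x [^] n)) / real n"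
  shows "t \<le> growth l x"
  unfolding growth_def by (rule cINF_greatest) (use assms in blast)+

lemma growth_nonneg: "0 \<le> growth l x"
  by (rule growth_greatest) simp

lemma length_pow_le:
  assumes "\<And>x y. x \<in> carrier G \<Longrightarrow> y \<in> carrier G \<Longrightarrow> l (x \<otimes> y) \<le> l x + (l y :: nat)" "l \<one> = 0"
    and "x \<in> carrier G"
  shows "l (x [^] (n::nat)) \<le> n * l x"
proof (induction n)
  case (Suc n)
  have "l (x [^] Suc n) \<le> l (x [^] n) + l x" using assms by simp
  then show ?case using Suc by simp
qed (simp add: assms(2))

lemma sublinear_growth:
  assumes l: "\<And>x y. x \<in> carrier G \<Longrightarrow> y \<in> carrier G \<Longrightarrow> l (x \<otimes> y) \<le> l x + (l y :: nat)" "l \<one> = 0"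
  shows "sublinear (growth l)"
  unfolding sublinear_def
proof (intro conjI ballI allI)
  fix x y assume x: "x \<in> carrier G" and y: "y \<in> carrier G"
  have bound: "growth l (x \<otimes> y) \<le> real (l (x [^] m)) / real m + real (l (y [^] n)) / real n"
    if mn: "m > 0" "n > 0" for m n :: nat
  proof -
    have "(x \<otimes> y) [^] (m * n) = (x [^] m) [^] n \<otimes> (y [^] n) [^] m"
      using x y by (simp add: nat_pow_distrib nat_pow_pow mult.commute)
    then have "l ((x \<otimes> y) [^] (m * n)) \<le> l ((x [^] m) [^] n) + l ((y [^] n) [^] m)"
      using l(1) x y by simp
    also have "\<dots> \<le> n * l (x [^] m) + m * l (y [^] n)"
      using x y by (intro add_mono length_pow_le l) auto
    finally have "real (l ((x \<otimes> y) [^] (m * n))) \<le> real n * real (l (x [^] m)) + real m * real (l (y [^] n))"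
      by (metis of_nat_add of_nat_mono of_nat_mult)
    then have "real (l ((x \<otimes> y) [^] (m * n))) / real (m * n) \<le>
        (real n * real (l (x [^] m)) + real m * real (l (y [^] n))) / real (m * n)"
      by (intro divide_right_mono) auto
    also have "\<dots> = real (l (x [^] m)) / real m + real (l (y [^] n)) / real n"
      using mn by (simp add: field_simps)
    finally show ?thesis using growth_le[of "m * n" l "x \<otimes> y"] mn by simp
  qed
  have "growth l (x \<otimes> y) - real (l (x [^] m)) / real m \<le> growth l y" if "m > 0" for m :: nat
    by (rule growth_greatest) (use bound[OF that] in \<open>simp add: algebra_simps\<close>)
  then have "growth l (x \<otimes> y) - growth l y \<le> growth l x"
    by (intro growth_greatest) (simp add: algebra_simps)
  then show "growth l (x \<otimes> y) \<le> growth l x + growth l y" by linarith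
next
  fix x and k :: nat assume x: "x \<in> carrier G"
  show "growth l (x [^] k) = real k * growth l x"
  proof (cases "k = 0")
    case True
    have "growth l \<one> \<le> 0" using growth_le[of 1 l \<one>] l(2) by simp
    then show ?thesis using True growth_nonneg[of l \<one>] by simp
  next
    case False
    show ?thesis
    proof (rule antisym)
      have "growth l (x [^] k) / real k \<le> growth l x"
      proof (rule growth_greatest)
        fix n :: nat assume n: "n > 0"
        have "(x [^] k) [^] n = (x [^] n) [^] k" using x by (simp add: nat_pow_pow mult.commute)
        then have "l ((x [^] k) [^] n) \<le> k * l (x [^] n)"
          using length_pow_le[of l "x [^] n" k] l x by simp
        then have "real (l ((x [^] k) [^] n)) \<le> real k * real (l (x [^] n))"
          by (metis of_nat_mono of_nat_mult)
        then have "real (l ((x [^] k) [^] n)) / real n \<le> real k * real (l (x [^] n)) / real n"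
          by (intro divide_right_mono) auto
        then have "growth l (x [^] k) \<le> real k * (real (l (x [^] n)) / real n)"
          using growth_le[OF n, of l "x [^] k"] by simp
        then show "growth l (x [^] k) / real k \<le> real (l (x [^] n)) / real n"
          using False by (simp add: pos_divide_le_eq mult.commute)
      qed
      then show "growth l (x [^] k) \<le> real k * growth l x"
        using False by (simp add: pos_divide_le_eq mult.commute)
      show "real k * growth l x \<le> growth l (x [^] k)"
      proof (rule growth_greatest)
        fix n :: nat assume n: "n > 0"
        have "real k * growth l x \<le> real k * (real (l (x [^] (k * n))) / real (k * n))"
          using growth_le[of "k * n" l x] n False by (intro mult_left_mono) auto
        also have "\<dots> = real (l ((x [^] k) [^] n)) / real n"
          using x False by (simp add: nat_pow_pow)
        finally show "real k * growth l x \<le> real (l ((x [^] k) [^] n)) / real n" .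
      qed
    qed
  qed
qed

lemma slow_growth_pow:
  assumes l: "\<And>x y. x \<in> carrier G \<Longrightarrow> y \<in> carrier G \<Longrightarrow> l (x \<otimes> y) \<le> l x + (l y :: nat)" "l \<one> = 0"
    and x: "x \<in> carrier G" and g: "growth l x = 0"
  obtains M :: real where "\<And>k::nat. real (l (x [^] k)) \<le> real k / 2 + M"
proof -
  have "\<exists>n::nat. n > 0 \<and> real (l (x [^] n)) / real n < 1/2"
    using growth_greatest[of "1/2" l x] g by (force simp: not_less)
  then obtain m :: nat where m: "m > 0" "real (l (x [^] m)) / real m < 1/2" by blast
  have "real (l (x [^] k)) \<le> real k / 2 + real (m * l x)" for k :: nat
  proof -
    have "x [^] k = (x [^] m) [^] (k div m) \<otimes> x [^] (k mod m)"
      using x by (simp add: nat_pow_pow nat_pow_mult)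
    then have "l (x [^] k) \<le> l ((x [^] m) [^] (k div m)) + l (x [^] (k mod m))"
      using l(1) x by simp
    also have "\<dots> \<le> (k div m) * l (x [^] m) + (k mod m) * l x"
      using x by (intro add_mono length_pow_le l) auto
    also have "\<dots> \<le> (k div m) * l (x [^] m) + m * l x"
      using m(1) by (simp add: less_imp_le)
    finally have "real (l (x [^] k)) \<le> real ((k div m) * l (x [^] m) + m * l x)"
      by (rule of_nat_mono)
    then have "real (l (x [^] k)) \<le> real (k div m) * real (l (x [^] m)) + real (m * l x)" by simp
    also have "real (k div m) * real (l (x [^] m)) \<le> real (k div m) * (real m / 2)"
      using m by (intro mult_left_mono) (auto simp: field_simps)
    also have "\<dots> = real (k div m * m) / 2" by simp
    also have "\<dots> \<le> real k / 2" by (intro divide_right_mono of_nat_mono) auto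
    finally show ?thesis by simp
  qed
  then show thesis by (rule that)
qed

definition list_prod :: "'a list \<Rightarrow> 'a" where
  "list_prod xs = foldr (\<otimes>) xs \<one>"

lemma list_prod_simps [simp]: "list_prod [] = \<one>" "list_prod (x # xs) = x \<otimes> list_prod xs"
  by (simp_all add: list_prod_def)

lemma list_prod_closed: "set xs \<subseteq> carrier G \<Longrightarrow> list_prod xs \<in> carrier G"
  by (induction xs) auto

text \<open>Collecting equal factors, a product of \<open>n\<close> elements of \<open>F\<close> is a product of powers, one for each element of \<open>F\<close>.  Each power has length at most half its exponent, up to a constant.\<close>

lemma slow_growth_products:
  assumes l: "\<And>x y. x \<in> carrier G \<Longrightarrow> y \<in> carrier G \<Longrightarrow> l (x \<otimes> y) \<le> l x + (l y :: nat)" "l \<one> = 0"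
    and F: "finite F" "F \<subseteq> carrier G" "\<And>f. f \<in> F \<Longrightarrow> growth l f = 0"
  shows "\<exists>M::real. \<forall>xs. set xs \<subseteq> F \<longrightarrow> real (l (list_prod xs)) \<le> real (length xs) / 2 + M"
  using F
proof (induction F rule: finite_induct)
  case empty
  then show ?case using l(2) by (intro exI[of _ 0]) simp
next
  case (insert f F)
  obtain M where M: "\<And>xs. set xs \<subseteq> F \<Longrightarrow> real (l (list_prod xs)) \<le> real (length xs) / 2 + M"
    using insert.IH insert.prems by blast
  have f: "f \<in> carrier G" "growth l f = 0" using insert.prems by auto
  obtain M' where M': "\<And>k::nat. real (l (f [^] k)) \<le> real k / 2 + M'"
    using slow_growth_pow[OF l f] by blast
  have split: "\<exists>k ys. set ys \<subseteq> F \<and> k + length ys = length xs \<and> list_prod xs = f [^] (k::nat) \<otimes> list_prod ys"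
    if "set xs \<subseteq> insert f F" for xs
    using that
  proof (induction xs)
    case Nil
    show ?case by (intro exI[of _ 0] exI[of _ "[]"]) simp
  next
    case (Cons x xs)
    then obtain k ys where ys: "set ys \<subseteq> F" "k + length ys = length xs"
      "list_prod xs = f [^] (k::nat) \<otimes> list_prod ys" by auto
    have yc: "list_prod ys \<in> carrier G" using ys(1) insert.prems by (intro list_prod_closed) auto
    show ?case
    proof (cases "x = f")
      case True
      have "f \<otimes> (f [^] k \<otimes> list_prod ys) = f [^] Suc k \<otimes> list_prod ys"
        using f(1) yc by (simp add: m_ac)
      then show ?thesis using ys True by (intro exI[of _ "Suc k"] exI[of _ ys]) simp
    next
      case False
      then have x: "x \<in> F" "x \<in> carrier G" using Cons.prems insert.prems by auto
      have "x \<otimes> (f [^] k \<otimes> list_prod ys) = f [^] k \<otimes> (x \<otimes> list_prod ys)"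
        using f(1) yc x by (simp add: m_ac)
      then show ?thesis using ys x by (intro exI[of _ k] exI[of _ "x # ys"]) simp
    qed
  qed
  show ?case
  proof (intro exI[of _ "M + M'"] allI impI)
    fix xs assume "set xs \<subseteq> insert f F"
    then obtain k ys where ys: "set ys \<subseteq> F" "k + length ys = length xs"
      "list_prod xs = f [^] (k::nat) \<otimes> list_prod ys" using split by blast
    have yc: "list_prod ys \<in> carrier G" using ys(1) insert.prems by (intro list_prod_closed) auto
    have "l (list_prod xs) \<le> l (f [^] k) + l (list_prod ys)"
      unfolding ys(3) using f(1) yc by (intro l) auto
    then have "real (l (list_prod xs)) \<le> real (l (f [^] k)) + real (l (list_prod ys))"
      by (metis of_nat_add of_nat_mono)
    also have "\<dots> \<le> (real k / 2 + M') + (real (length ys) / 2 + M)"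
      by (intro add_mono M M' ys(1))
    also have "\<dots> = real (length xs) / 2 + (M + M')" by (simp add: ys(2)[symmetric] add_divide_distrib)
    finally show "real (l (list_prod xs)) \<le> real (length xs) / 2 + (M + M')" .
  qed
qed

end

section \<open>Abelian quotients of subgroups\<close>

context group
begin

lemma
  assumes N: "N \<lhd> G" and B: "subgroup B G" and NB: "N \<subseteq> B"
  shows subquotient_group: "group (G\<lparr>carrier := B\<rparr> Mod N)"
    and subquotient_carrier: "X \<in> carrier (G\<lparr>carrier := B\<rparr> Mod N) \<longleftrightarrow> (\<exists>b\<in>B. X = N #> b)"
    and subquotient_mult: "a \<in> B \<Longrightarrow> b \<in> B \<Longrightarrow>
      (N #> a) \<otimes>\<^bsub>G\<lparr>carrier := B\<rparr> Mod N\<^esub> (N #> b) = N #> (a \<otimes> b)"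
    and subquotient_one: "b \<in> B \<Longrightarrow> N #> b = \<one>\<^bsub>G\<lparr>carrier := B\<rparr> Mod N\<^esub> \<longleftrightarrow> b \<in> N"
    and subquotient_pow: "b \<in> B \<Longrightarrow> (N #> b) [^]\<^bsub>G\<lparr>carrier := B\<rparr> Mod N\<^esub> (n::nat) = N #> (b [^] n)"
    and subquotient_inv: "b \<in> B \<Longrightarrow> inv\<^bsub>G\<lparr>carrier := B\<rparr> Mod N\<^esub> (N #> b) = N #> (inv b)"
proof -
  interpret N: normal N G by fact
  interpret B: subgroup B G by fact
  let ?Q = "G\<lparr>carrier := B\<rparr> Mod N"
  have "N \<lhd> G\<lparr>carrier := B\<rparr>" by (rule normal_restrict_supergroup[OF B N NB])
  then show Q: "group ?Q" by (rule normal.factorgroup_is_group)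
  interpret Q: group ?Q by (rule Q)
  show car: "X \<in> carrier ?Q \<longleftrightarrow> (\<exists>b\<in>B. X = N #> b)" for X by (auto simp: carrier_FactGroup)
  show mult: "(N #> a) \<otimes>\<^bsub>?Q\<^esub> (N #> b) = N #> (a \<otimes> b)" if "a \<in> B" "b \<in> B" for a b
    using N.rcos_sum[of a b] that by simp
  show one: "N #> b = \<one>\<^bsub>?Q\<^esub> \<longleftrightarrow> b \<in> N" if "b \<in> B" for b
    using that coset_join1[OF _ _ N.subgroup_axioms, of b] coset_join2[OF _ N.subgroup_axioms, of b]
    by auto
  have one': "N #> \<one> = \<one>\<^bsub>?Q\<^esub>" using one[OF B.one_closed] by simp
  show "(N #> b) [^]\<^bsub>?Q\<^esub> n = N #> (b [^] n)" if b: "b \<in> B" for b and n :: nat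
  proof (induction n)
    case 0
    then show ?case using one' by simp
  next
    case (Suc n)
    have "b [^] n \<in> B" by (induction n) (use b in auto)
    then show ?case using Suc mult[of "b [^] n" b] b by simp
  qed
  show "inv\<^bsub>?Q\<^esub> (N #> b) = N #> (inv b)" if b: "b \<in> B" for b
    using mult[of "inv b" b] b one' car by (intro Q.inv_equality) auto
qed

lemma subquotient_comm_group_iff:
  assumes N: "N \<lhd> G" and B: "subgroup B G" and NB: "N \<subseteq> B"
  shows "comm_group (G\<lparr>carrier := B\<rparr> Mod N) \<longleftrightarrow> (\<forall>a\<in>B. \<forall>b\<in>B. a \<otimes> b \<otimes> inv a \<otimes> inv b \<in> N)"
proof -
  interpret N: normal N G by fact
  interpret B: subgroup B G by fact
  let ?Q = "G\<lparr>carrier := B\<rparr> Mod N"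
  interpret Q: group ?Q by (rule subquotient_group[OF assms])
  note mult = subquotient_mult[OF assms] and one = subquotient_one[OF assms]
    and inv = subquotient_inv[OF assms] and car = subquotient_carrier[OF assms]
  have comm_iff: "a \<otimes> b \<otimes> inv a \<otimes> inv b \<in> N \<longleftrightarrow> (N #> a) \<otimes>\<^bsub>?Q\<^esub> (N #> b) = (N #> b) \<otimes>\<^bsub>?Q\<^esub> (N #> a)"
    if a: "a \<in> B" and b: "b \<in> B" for a b
  proof -
    have Q: "N #> a \<in> carrier ?Q" "N #> b \<in> carrier ?Q" using car a b by auto
    have "a \<otimes> b \<otimes> inv a \<otimes> inv b = (a \<otimes> b) \<otimes> inv (b \<otimes> a)" using a b by (simp add: word_simps)
    then have "a \<otimes> b \<otimes> inv a \<otimes> inv b \<in> N \<longleftrightarrow>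
        N #> ((a \<otimes> b) \<otimes> inv (b \<otimes> a)) = \<one>\<^bsub>?Q\<^esub>"
      using one[of "(a \<otimes> b) \<otimes> inv (b \<otimes> a)"] a b by simp
    also have "N #> ((a \<otimes> b) \<otimes> inv (b \<otimes> a)) = (N #> (a \<otimes> b)) \<otimes>\<^bsub>?Q\<^esub> inv\<^bsub>?Q\<^esub> (N #> (b \<otimes> a))"
      using mult[of "a \<otimes> b" "inv (b \<otimes> a)"] inv[of "b \<otimes> a"] a b by simp
    also have "\<dots> = \<one>\<^bsub>?Q\<^esub> \<longleftrightarrow> N #> (a \<otimes> b) = N #> (b \<otimes> a)"
    proof -
      have "N #> (a \<otimes> b) \<in> carrier ?Q" "N #> (b \<otimes> a) \<in> carrier ?Q" using car a b by auto
      then show ?thesis by (metis Q.inv_closed Q.inv_equality Q.inv_inv Q.r_inv)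
    qed
    finally show ?thesis using mult a b by simp
  qed
  show ?thesis
  proof
    assume "comm_group ?Q"
    then interpret Q: comm_group ?Q .
    show "\<forall>a\<in>B. \<forall>b\<in>B. a \<otimes> b \<otimes> inv a \<otimes> inv b \<in> N"
    proof (intro ballI)
      fix a b assume ab: "a \<in> B" "b \<in> B"
      then have "N #> a \<in> carrier ?Q" "N #> b \<in> carrier ?Q" using car by auto
      then show "a \<otimes> b \<otimes> inv a \<otimes> inv b \<in> N" unfolding comm_iff[OF ab] by (rule Q.m_comm)
    qed
  next
    assume *: "\<forall>a\<in>B. \<forall>b\<in>B. a \<otimes> b \<otimes> inv a \<otimes> inv b \<in> N"
    show "comm_group ?Q"
    proof (rule Q.group_comm_groupI)
      fix X Y assume "X \<in> carrier ?Q" "Y \<in> carrier ?Q"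
      then obtain a b where ab: "a \<in> B" "b \<in> B" "X = N #> a" "Y = N #> b" unfolding car by blast
      then have "a \<otimes> b \<otimes> inv a \<otimes> inv b \<in> N" using * by blast
      then show "X \<otimes>\<^bsub>?Q\<^esub> Y = Y \<otimes>\<^bsub>?Q\<^esub> X" unfolding ab(3,4) comm_iff[OF ab(1,2)] .
    qed
  qed
qed

end

section \<open>Locally compact sections\<close>

text \<open>The distance of a continuous character from \<open>1\<close> is a totally bounded pseudonorm, because the unit circle is compact.\<close>

lemma (in abelian_section) unimodular_separates:
  fixes \<psi> :: "'a \<Rightarrow> complex"
  assumes mult: "\<And>x y. x \<in> B \<Longrightarrow> y \<in> B \<Longrightarrow> \<psi> (x \<otimes> y) = \<psi> x * \<psi> y"
    and norm: "\<And>x. x \<in> B \<Longrightarrow> norm (\<psi> x) = 1" and N1: "\<And>n. n \<in> N \<Longrightarrow> \<psi> n = 1"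
    and cont: "small_near_one G T B (\<lambda>x. norm (\<psi> x - 1))"
    and b: "b \<in> B" "\<And>r. r \<in> tb_norms \<Longrightarrow> r b = 0"
  shows "\<psi> b = 1"
proof -
  let ?s = "\<lambda>x. norm (\<psi> x - 1)"
  have one: "\<psi> \<one> = 1" using N1 N.one_closed by blast
  have dist: "?s (inv x \<otimes> y) = norm (\<psi> y - \<psi> x)" if xy: "x \<in> B" "y \<in> B" for x y
  proof -
    have "\<psi> y = \<psi> x * \<psi> (inv x \<otimes> y)"
      using mult[of x "inv x \<otimes> y"] xy by (simp add: inv_mult_cancel_left)
    then have "\<psi> y - \<psi> x = \<psi> x * (\<psi> (inv x \<otimes> y) - 1)" by (simp add: right_diff_distrib)
    then show ?thesis using norm[OF xy(1)] by (simp add: norm_mult)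
  qed
  have "pseudonorm G B ?s"
    unfolding pseudonorm_def
  proof (intro conjI ballI)
    fix x y assume xy: "x \<in> B" "y \<in> B"
    show "0 \<le> ?s x" by simp
    show "?s (inv x) = ?s x" using dist[OF xy(1) B.one_closed] xy(1) one by (simp add: norm_minus_commute)
    have eq: "\<psi> (x \<otimes> y) - 1 = \<psi> x * (\<psi> y - 1) + (\<psi> x - 1)" by (simp add: mult[OF xy] algebra_simps)
    show "?s (x \<otimes> y) \<le> ?s x + ?s y"
      unfolding eq using norm_triangle_ineq[of "\<psi> x * (\<psi> y - 1)" "\<psi> x - 1"] norm[OF xy(1)] by (simp add: norm_mult)
  qed (simp add: one)
  moreover have "totally_bounded_norm G B ?s"
  proof (rule totally_boundedI)
    fix e :: real assume e: "e > 0"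
    have "compact (sphere (0::complex) 1)" by simp
    then obtain K where K: "finite K" "sphere (0::complex) 1 \<subseteq> (\<Union>k\<in>K. ball k (e / 2))"
      using compact_eq_totally_bounded[of "sphere (0::complex) 1"] e by (meson half_gt_zero)
    have "\<forall>x\<in>B. \<exists>k. k \<in> K \<and> dist k (\<psi> x) < e / 2"
    proof
      fix x assume "x \<in> B"
      then have "\<psi> x \<in> sphere 0 1" using norm by simp
      then have "\<psi> x \<in> (\<Union>k\<in>K. ball k (e / 2))" using K(2) by blast
      then show "\<exists>k. k \<in> K \<and> dist k (\<psi> x) < e / 2" by auto
    qed
    from bchoice[OF this] obtain \<phi> where "\<forall>x\<in>B. \<phi> x \<in> K \<and> dist (\<phi> x) (\<psi> x) < e / 2" ..
    then have \<phi>: "\<phi> x \<in> K" "dist (\<phi> x) (\<psi> x) < e / 2" if "x \<in> B" for x using that by auto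
    have "finite (\<phi> ` B)" by (rule finite_subset[OF _ K(1)]) (use \<phi> in auto)
    moreover have "?s (inv x \<otimes> y) < e" if xy: "x \<in> B" "y \<in> B" "\<phi> x = \<phi> y" for x y
    proof -
      have "dist (\<psi> y) (\<psi> x) < e"
        using dist_triangle_half_r[OF \<phi>(2)[OF xy(2)] \<phi>(2)[OF xy(1), unfolded xy(3)]] .
      then show ?thesis unfolding dist[OF xy(1,2)] dist_norm .
    qed
    ultimately show "\<exists>\<phi> :: 'a \<Rightarrow> complex. finite (\<phi> ` B) \<and>
        (\<forall>x\<in>B. \<forall>y\<in>B. \<phi> x = \<phi> y \<longrightarrow> ?s (inv x \<otimes> y) < e)" by blast
  qed
  moreover have "?s x \<le> 2" if "x \<in> B" for x
    using norm_triangle_ineq4[of "\<psi> x" 1] norm[OF that] by simp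
  moreover have "?s n = 0" if "n \<in> N" for n using N1[OF that] by simp
  ultimately obtain r where r: "r \<in> tb_norms" "\<And>b. b \<in> B \<Longrightarrow> ?s b \<le> r b"
    by (rule invariant_hull[OF _ cont, of 2]) blast+
  then show ?thesis using b(2)[OF r(1)] r(2)[OF b(1)] by simp
qed

lemma (in topological_group) locally_compact_norm:
  assumes bal: "balanced_group G T" and lc: "locally_compact_space T"
  obtains q where "q \<in> norms G T (carrier G)" "compactin T {x \<in> carrier G. q x \<le> 1/2}"
proof -
  obtain U K where U: "openin T U" "compactin T K" "\<one> \<in> U" "U \<subseteq> K"
    using lc unfolding locally_compact_space_def by (metis one_closed topspace_eq)
  obtain q where q: "q \<in> norms G T (carrier G)" "\<And>x. q x < 1 \<Longrightarrow> x \<in> U"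
    using balanced_norm[OF bal U(1,3)] by blast
  have "{x \<in> carrier G. q x \<le> 1/2} \<subseteq> K"
  proof
    fix x assume "x \<in> {x \<in> carrier G. q x \<le> 1/2}"
    then have "q x < 1" by simp
    then show "x \<in> K" using q(2) U(4) by blast
  qed
  moreover have "carrier G \<lhd> G" by (simp add: normal_inv_iff subgroup_self)
  then have "closedin T {x \<in> carrier G. q x \<le> 1/2}"
    using closedin_norm_le[OF _ _ q(1), of "1/2"] closedin_topspace[of T] unfolding topspace_eq by blast
  ultimately have "compactin T {x \<in> carrier G. q x \<le> 1/2}"
    using closed_compactin[OF U(2)] by blast
  with q(1) show thesis by (rule that)
qed

text \<open>The discrete abelian group \<open>B/H\<close> has enough characters, and all of them are continuous.\<close>

lemma (in abelian_section) precompact_open_subgroup: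
  assumes H: "H \<lhd> G" "closedin T H" "N \<subseteq> H" "H \<subseteq> B"
    and q: "q \<in> norms G T B" "c > 0" "\<And>b. b \<in> B \<Longrightarrow> q b < c \<Longrightarrow> b \<in> H"
  shows "precompact_modulo G T H"
proof -
  interpret H: abelian_section G T H B
  proof (intro abelian_section.intro topological_group_axioms abelian_section_axioms.intro
      balanced hTG H B precompact)
    show "a \<otimes> b \<otimes> inv a \<otimes> inv b \<in> H" if "a \<in> B" "b \<in> B" for a b
      using commutator[OF that] H(3) by blast
  qed
  let ?Q = "G\<lparr>carrier := B\<rparr> Mod H"
  note sub = H(1) B.subgroup_axioms H(4)
  have "comm_group ?Q"
    unfolding subquotient_comm_group_iff[OF sub] using H.commutator by blast
  then interpret Q: comm_group ?Q .
  show ?thesis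
  proof (rule H.precompact_if_separated)
    fix b assume b: "b \<in> B" and zero: "\<And>r. r \<in> H.tb_norms \<Longrightarrow> r b = 0"
    show "b \<in> H"
    proof (rule ccontr)
      assume "b \<notin> H"
      then have b1: "H #> b \<in> carrier ?Q" "H #> b \<noteq> \<one>\<^bsub>?Q\<^esub>"
        using subquotient_carrier[OF sub] subquotient_one[OF sub b] b by auto
      obtain \<psi> :: "'a set \<Rightarrow> complex" where \<psi>:
        "\<And>x y. x \<in> carrier ?Q \<Longrightarrow> y \<in> carrier ?Q \<Longrightarrow> \<psi> (x \<otimes>\<^bsub>?Q\<^esub> y) = \<psi> x * \<psi> y"
        "\<And>x. x \<in> carrier ?Q \<Longrightarrow> norm (\<psi> x) = 1" "\<psi> (H #> b) \<noteq> 1"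
        by (rule Q.character_separates[OF b1]) blast
      have car: "H #> x \<in> carrier ?Q" if "x \<in> B" for x using subquotient_carrier[OF sub] that by blast
      have one: "\<psi> (H #> n) = 1" if n: "n \<in> H" for n
      proof -
        have "H #> n = \<one>\<^bsub>?Q\<^esub>" using subquotient_one[OF sub, of n] n H(4) by blast
        moreover have "\<psi> \<one>\<^bsub>?Q\<^esub> * \<psi> \<one>\<^bsub>?Q\<^esub> = \<psi> \<one>\<^bsub>?Q\<^esub>" 
          using \<psi>(1)[OF Q.one_closed Q.one_closed] unfolding Q.r_one[OF Q.one_closed] by (rule sym)
        moreover have "\<psi> \<one>\<^bsub>?Q\<^esub> \<noteq> 0" using \<psi>(2)[OF Q.one_closed] by auto
        ultimately show ?thesis by simp
      qed
      have "\<psi> (H #> b) = 1"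
      proof (rule H.unimodular_separates[where \<psi> = "\<lambda>x. \<psi> (H #> x)" and b = b])
        show "r b = 0" if "r \<in> H.tb_norms" for r by (rule zero[OF that])
        show "\<psi> (H #> (x \<otimes> y)) = \<psi> (H #> x) * \<psi> (H #> y)" if "x \<in> B" "y \<in> B" for x y
          using \<psi>(1)[OF car car] that by (simp only: subquotient_mult[OF sub that, symmetric])
        show "small_near_one G T B (\<lambda>x. norm (\<psi> (H #> x) - 1))"
          unfolding small_near_one_def
        proof (intro allI impI)
          fix e :: real assume e: "e > 0"
          obtain U where U: "openin T U" "\<one> \<in> U" "\<forall>x\<in>U \<inter> B. q x < c"
            using normsD(3)[OF q(1)] q(2) unfolding small_near_one_def by blast
          have "norm (\<psi> (H #> x) - 1) < e" if "x \<in> U \<inter> B" for x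
          proof -
            have "x \<in> H" using U(3) that q(3) by blast
            then show ?thesis using one e by simp
          qed
          then show "\<exists>U. openin T U \<and> \<one> \<in> U \<and> (\<forall>x\<in>U \<inter> B. norm (\<psi> (H #> x) - 1) < e)"
            using U(1,2) by blast
        qed
      qed (use \<psi>(2) car one b in auto)
      then show False using \<psi>(3) by simp
    qed
  qed
qed

primrec set_powers :: "('a, 'm) monoid_scheme \<Rightarrow> 'a set \<Rightarrow> nat \<Rightarrow> 'a set" where
  "set_powers G C 0 = {\<one>\<^bsub>G\<^esub>}"
| "set_powers G C (Suc n) = (\<lambda>(w, c). w \<otimes>\<^bsub>G\<^esub> c) ` (set_powers G C n \<times> C)"

context group
begin

lemma set_powers_Suc: "w \<in> set_powers G C (Suc n) \<longleftrightarrow> (\<exists>v\<in>set_powers G C n. \<exists>c\<in>C. w = v \<otimes> c)"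
  by auto

lemma set_powers_subset:
  assumes "subgroup B G" "C \<subseteq> B"
  shows "set_powers G C n \<subseteq> B"
proof -
  interpret B: subgroup B G by fact
  show ?thesis using assms(2) by (induction n) auto
qed

lemma set_powers_mult:
  assumes C: "C \<subseteq> carrier G" and v: "v \<in> set_powers G C m"
  shows "w \<in> set_powers G C n \<Longrightarrow> v \<otimes> w \<in> set_powers G C (m + n)"
proof (induction n arbitrary: w)
  case 0
  have "v \<in> carrier G" using v set_powers_subset[OF subgroup_self C] by blast
  then show ?case using 0 v by simp
next
  case (Suc n)
  then obtain w' c where w: "w' \<in> set_powers G C n" "c \<in> C" "w = w' \<otimes> c"
    unfolding set_powers_Suc by blast
  have "v \<in> carrier G" "w' \<in> carrier G" "c \<in> carrier G"
    using v w(1,2) set_powers_subset[OF subgroup_self C] C by blast+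
  then have "v \<otimes> w = (v \<otimes> w') \<otimes> c" unfolding w(3) by (simp add: m_assoc)
  then show ?case unfolding add_Suc_right set_powers_Suc using Suc.IH[OF w(1)] w(2) by blast
qed

lemma set_powers_mono:
  assumes C: "C \<subseteq> carrier G" "\<one> \<in> C" and "m \<le> n"
  shows "set_powers G C m \<subseteq> set_powers G C n"
  using assms(3)
proof (induction rule: dec_induct)
  case (step n)
  have "w \<in> set_powers G C (Suc n)" if w: "w \<in> set_powers G C n" for w
  proof -
    have "w \<in> carrier G" using w set_powers_subset[OF subgroup_self C(1)] by blast
    then have "w = w \<otimes> \<one>" by simp
    then show ?thesis unfolding set_powers_Suc using w C(2) by blast
  qed
  then show ?case using step by blast
qed simp

lemma set_powers_conj:
  assumes C: "C \<subseteq> carrier G" "\<And>x c. x \<in> carrier G \<Longrightarrow> c \<in> C \<Longrightarrow> x \<otimes> c \<otimes> inv x \<in> C"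
    and x: "x \<in> carrier G"
  shows "w \<in> set_powers G C n \<Longrightarrow> x \<otimes> w \<otimes> inv x \<in> set_powers G C n"
proof (induction n arbitrary: w)
  case 0
  then show ?case using x by simp
next
  case (Suc n)
  then obtain w' c where w: "w' \<in> set_powers G C n" "c \<in> C" "w = w' \<otimes> c"
    unfolding set_powers_Suc by blast
  have "w' \<in> carrier G" "c \<in> carrier G"
    using w(1,2) set_powers_subset[OF subgroup_self C(1)] C(1) by blast+
  then have "x \<otimes> w \<otimes> inv x = (x \<otimes> w' \<otimes> inv x) \<otimes> (x \<otimes> c \<otimes> inv x)"
    unfolding w(3) using x by (simp add: word_simps)
  then show ?case unfolding set_powers_Suc using Suc.IH[OF w(1)] C(2)[OF x w(2)] by blast
qed

end

lemma (in topological_group) compactin_set_powers: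
  assumes C: "compactin T C"
  shows "compactin T (set_powers G C n)"
proof (induction n)
  case 0
  then show ?case by (simp add: topspace_eq)
next
  case (Suc n)
  then have "compactin (prod_topology T T) (set_powers G C n \<times> C)"
    using C by (simp add: compactin_Times)
  then show ?case
    unfolding set_powers.simps by (rule image_compactin[OF _ continuous_mult])
qed

text \<open>A finite net of the compact set \<open>K\<close> refines a finite net modulo \<open>K N\<close>.\<close>

lemma (in topological_group) precompact_modulo_compact_extension:
  assumes pc: "precompact_modulo G T (K <#> N)" and K: "compactin T K" and N: "N \<lhd> G"
  shows "precompact_modulo G T N"
  unfolding precompact_modulo_def
proof (intro ballI allI impI)
  interpret N: normal N G by fact
  fix q and e :: real assume q: "q \<in> norms G T (carrier G)" and "e > 0"
  then have e2: "e / 2 > 0" by simp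
  note qn = normsD[OF q]
  have Kc: "K \<subseteq> carrier G" using compactin_subset_topspace[OF K] topspace_eq by simp
  obtain F where F: "finite F" "F \<subseteq> carrier G"
    "\<forall>x\<in>carrier G. \<exists>f\<in>F. \<exists>n\<in>K <#> N. q (inv f \<otimes> x \<otimes> n) < e / 2"
    using pc[unfolded precompact_modulo_def, rule_format, OF q e2] by blast
  obtain U where U: "openin T U" "\<one> \<in> U" "\<forall>x\<in>U \<inter> carrier G. q x < e / 2"
    using qn(3) e2 unfolding small_near_one_def by blast
  obtain E where E: "finite E" "E \<subseteq> K" "\<And>x. x \<in> K \<Longrightarrow> \<exists>f\<in>E. inv f \<otimes> x \<in> U"
    by (rule compactin_net[OF K U(1,2)]) (rule that)
  show "\<exists>F. finite F \<and> F \<subseteq> carrier G \<and> (\<forall>x\<in>carrier G. \<exists>f\<in>F. \<exists>n\<in>N. q (inv f \<otimes> x \<otimes> n) < e)"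
  proof (intro exI[of _ "(\<lambda>(f, g). f \<otimes> inv g) ` (F \<times> E)"] conjI ballI)
    show "finite ((\<lambda>(f, g). f \<otimes> inv g) ` (F \<times> E))" using F(1) E(1) by simp
    have "g \<in> carrier G" if "g \<in> E" for g using that E(2) Kc by blast
    then show "(\<lambda>(f, g). f \<otimes> inv g) ` (F \<times> E) \<subseteq> carrier G" using F(2) by auto
    fix x assume x: "x \<in> carrier G"
    obtain f h where f: "f \<in> F" "h \<in> K <#> N" "q (inv f \<otimes> x \<otimes> h) < e / 2" using F(3) x by blast
    obtain k n where k: "k \<in> K" "n \<in> N" "h = k \<otimes> n" using f(2) by (auto simp: set_mult_def)
    obtain g where g: "g \<in> E" "inv g \<otimes> k \<in> U" using E(3)[OF k(1)] by blast
    have cl: "f \<in> carrier G" "k \<in> carrier G" "n \<in> carrier G" "g \<in> carrier G"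
      using f(1) g(1) k F(2) E(2) Kc N.subset by auto
    define m where "m = k \<otimes> n \<otimes> inv k"
    have m: "m \<in> N" unfolding m_def by (rule N.inv_op_closed2[OF cl(2) k(2)])
    have mc: "m \<in> carrier G" using m N.subset by blast
    let ?u = "inv f \<otimes> x \<otimes> h" and ?v = "inv g \<otimes> k"
    have eq: "inv (f \<otimes> inv g) \<otimes> x \<otimes> m = (g \<otimes> ?u \<otimes> inv g) \<otimes> (g \<otimes> inv ?v \<otimes> inv g)"
      using cl x by (simp add: k(3) m_def word_simps)
    have "q (g \<otimes> ?u \<otimes> inv g) = q ?u"
      using cl x k by (intro conj_invariantD[OF qn(2)]) auto
    moreover have "q (inv ?v) = q ?v" using cl by (intro pseudonormD(3)[OF qn(1)]) simp
    moreover have "q ?v < e / 2" using U(3) g(2) cl by simp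
    moreover have "q ((g \<otimes> ?u \<otimes> inv g) \<otimes> (g \<otimes> inv ?v \<otimes> inv g)) \<le> q (g \<otimes> ?u \<otimes> inv g) + q (g \<otimes> inv ?v \<otimes> inv g)"
      using cl x k by (intro pseudonormD(4)[OF qn(1)]) auto
    moreover have "q (g \<otimes> inv ?v \<otimes> inv g) = q (inv ?v)"
      using cl by (intro conj_invariantD[OF qn(2)]) auto
    ultimately have "q (inv (f \<otimes> inv g) \<otimes> x \<otimes> m) < e" unfolding eq using f(3) by linarith
    moreover have "f \<otimes> inv g \<in> (\<lambda>(f, g). f \<otimes> inv g) ` (F \<times> E)" using f(1) g(1) by auto
    ultimately show "\<exists>f\<in>(\<lambda>(f, g). f \<otimes> inv g) ` (F \<times> E). \<exists>n\<in>N. q (inv f \<otimes> x \<otimes> n) < e"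
      using m by blast
  qed
qed

lemma (in group) conj_pow:
  "x \<in> carrier G \<Longrightarrow> b \<in> carrier G \<Longrightarrow> (x \<otimes> b \<otimes> inv x) [^] (n::nat) = x \<otimes> b [^] n \<otimes> inv x"
proof (induction n)
  case (Suc n)
  then show ?case by (simp add: word_simps)
qed simp

lemma (in group) norm_pow_le:
  assumes r: "pseudonorm G B r" "subgroup B G" and b: "b \<in> B"
  shows "b [^] (n::nat) \<in> B \<and> r (b [^] n) \<le> real n * r b"
proof (induction n)
  case 0
  then show ?case using pseudonormD(2)[OF r(1)] subgroup.one_closed[OF r(2)] by simp
next
  case (Suc n)
  then have "r (b [^] n \<otimes> b) \<le> r (b [^] n) + r b" using b by (intro pseudonormD(4)[OF r(1)]) auto
  moreover have "b [^] n \<otimes> b \<in> B" using Suc b subgroup.m_closed[OF r(2)] by blast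
  ultimately show ?case using Suc by (simp add: algebra_simps)
qed

lemma cis_near_one: "e > 0 \<Longrightarrow> \<exists>d>0. \<forall>t. \<bar>t\<bar> < d \<longrightarrow> norm (cis t - 1) < e"
proof -
  assume "e > 0"
  have "isCont cis 0" unfolding cis_conv_exp by (intro continuous_intros)
  then have "\<exists>d>0. \<forall>x'. dist x' 0 < d \<longrightarrow> dist (cis x') (cis 0) < e"
    using \<open>e > 0\<close> unfolding continuous_at_eps_delta by (simp add: dist_norm)
  then show ?thesis by (simp add: dist_norm)
qed

text \<open>Let \<open>l\<close> be the word length on \<open>B/N\<close> for the generating set \<open>C\<close>, and \<open>p\<close> its growth
rate on \<open>B\<close>, an invariant continuous pseudonorm.  By Hahn--Banach, characters separate \<open>B\<close>
modulo the kernel of \<open>p\<close>, so \<open>p\<close> is totally bounded and, being homogeneous, zero.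
Compactness gives a finite set \<open>F\<close> with \<open>C C \<subseteq> F C\<close>.  Hence a word of length \<open>n + 1\<close>
in \<open>C\<close> equals, modulo \<open>N\<close>, a product of \<open>n\<close> elements of \<open>F\<close> and one of \<open>C\<close>, whose
length is only about \<open>n/2\<close> because \<open>p\<close> vanishes on \<open>F\<close>.  So long words can be shortened,
the length is bounded, and \<open>B\<close> is the product of a compact set and \<open>N\<close>.\<close>

lemma (in abelian_section) precompact_if_compactly_generated:
  assumes q: "q \<in> norms G T B"
    and C: "C = {b \<in> B. q b \<le> 1/2}" "compactin T C"
    and gen: "B = (\<Union>n. set_powers G C n) <#> N"
  shows "precompact_modulo G T N"
proof -
  note Bc = B.subset[THEN subsetD] and qn = normsD[OF q]
  let ?Q = "G\<lparr>carrier := B\<rparr> Mod N"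
  note sub = N(1) B.subgroup_axioms NB
  note car = subquotient_carrier[OF sub] and mult = subquotient_mult[OF sub]
    and one = subquotient_one[OF sub] and pow = subquotient_pow[OF sub] and inv = subquotient_inv[OF sub]
  have "comm_group ?Q"
    unfolding subquotient_comm_group_iff[OF sub] using commutator by blast
  then interpret Q: comm_group ?Q .
  have \<pi>: "N #> b \<in> carrier ?Q" if "b \<in> B" for b using car that by blast
  have \<pi>1: "N #> \<one> = \<one>\<^bsub>?Q\<^esub>" using one[OF B.one_closed] N.one_closed by blast
  let ?W = "set_powers G C"
  have CB: "C \<subseteq> B" using C(1) by blast
  have Cc: "C \<subseteq> carrier G" using CB B.subset by blast
  have C1: "\<one> \<in> C" unfolding C(1) using pseudonormD(2)[OF qn(1)] by simp
  have Cinv: "inv c \<in> C" if "c \<in> C" for c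
    using that pseudonormD(3)[OF qn(1), of c] unfolding C(1) by simp
  have Cconj: "x \<otimes> c \<otimes> inv x \<in> C" if "x \<in> carrier G" "c \<in> C" for x c
    using that conj_invariantD[OF qn(2), of x c] B.inv_op_closed2[of x c] unfolding C(1) by simp
  have WB: "w \<in> B" if "w \<in> ?W n" for w n
    using that set_powers_subset[OF B.subgroup_axioms CB] by blast
  define l where "l X = (LEAST n. \<exists>w\<in>?W n. X = N #> w)" for X
  have l_le: "l (N #> w) \<le> n" if "w \<in> ?W n" for w n
    unfolding l_def by (rule Least_le) (use that in blast)
  have l_ex: "\<exists>w\<in>?W (l X). X = N #> w" if X: "X \<in> carrier ?Q" for X
  proof -
    obtain b where b: "b \<in> B" "X = N #> b" using X car by blast
    obtain w n m where w: "w \<in> ?W n" "m \<in> N" "b = w \<otimes> m"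
      using b(1) unfolding gen set_mult_def by blast
    have mB: "m \<in> B" using w(2) NB by blast
    have "X = (N #> w) \<otimes>\<^bsub>?Q\<^esub> (N #> m)" using mult[OF WB[OF w(1)] mB] b(2) w(3) by simp
    also have "N #> m = \<one>\<^bsub>?Q\<^esub>" using one[OF mB] w(2) by blast
    finally have "X = N #> w" using Q.r_one[OF \<pi>[OF WB[OF w(1)]]] by simp
    then have "\<exists>n. \<exists>w\<in>?W n. X = N #> w" using w(1) by blast
    then show ?thesis unfolding l_def by (rule LeastI_ex)
  qed
  have l_mult: "l (X \<otimes>\<^bsub>?Q\<^esub> Y) \<le> l X + l Y" if XY: "X \<in> carrier ?Q" "Y \<in> carrier ?Q" for X Y
  proof -
    obtain v w where v: "v \<in> ?W (l X)" "X = N #> v" and w: "w \<in> ?W (l Y)" "Y = N #> w"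
      using l_ex[OF XY(1)] l_ex[OF XY(2)] by blast
    have "X \<otimes>\<^bsub>?Q\<^esub> Y = N #> (v \<otimes> w)"
      using mult[OF WB[OF v(1)] WB[OF w(1)]] v(2) w(2) by simp
    then show ?thesis using l_le[OF set_powers_mult[OF Cc v(1) w(1)]] by simp
  qed
  have l_one: "l \<one>\<^bsub>?Q\<^esub> = 0" using l_le[of \<one> 0] \<pi>1 by simp
  have l_inv: "l (inv\<^bsub>?Q\<^esub> X) \<le> l X" if X: "X \<in> carrier ?Q" for X
  proof -
    have "\<exists>v\<in>?W n. inv\<^bsub>?Q\<^esub> (N #> w) = N #> v" if "w \<in> ?W n" for w n
      using that
    proof (induction n arbitrary: w)
      case 0
      then have w: "w = \<one>" by simp
      have "inv\<^bsub>?Q\<^esub> (N #> w) = N #> \<one>" unfolding w \<pi>1 by (rule Q.inv_one)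
      then show ?case by (intro bexI) simp_all
    next
      case (Suc n)
      then obtain w' c where w: "w' \<in> ?W n" "c \<in> C" "w = w' \<otimes> c" unfolding set_powers_Suc by blast
      obtain v where v: "v \<in> ?W n" "inv\<^bsub>?Q\<^esub> (N #> w') = N #> v" using Suc.IH[OF w(1)] by blast
      have cB: "c \<in> B" "inv c \<in> B" using w(2) CB by auto
      have "inv\<^bsub>?Q\<^esub> (N #> w) = inv\<^bsub>?Q\<^esub> ((N #> w') \<otimes>\<^bsub>?Q\<^esub> (N #> c))"
        using mult[OF WB[OF w(1)] cB(1)] w(3) by simp
      also have "\<dots> = inv\<^bsub>?Q\<^esub> (N #> w') \<otimes>\<^bsub>?Q\<^esub> inv\<^bsub>?Q\<^esub> (N #> c)"
        by (rule Q.inv_mult[OF \<pi>[OF WB[OF w(1)]] \<pi>[OF cB(1)]])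
      also have "\<dots> = N #> (v \<otimes> inv c)"
        unfolding v(2) inv[OF cB(1)] by (rule mult[OF WB[OF v(1)] cB(2)])
      finally have eq: "inv\<^bsub>?Q\<^esub> (N #> w) = N #> (v \<otimes> inv c)" .
      have "v \<otimes> inv c \<in> ?W (Suc n)" unfolding set_powers_Suc using v(1) Cinv[OF w(2)] by blast
      then show ?case using eq by (rule bexI[rotated])
    qed
    moreover obtain w where "w \<in> ?W (l X)" "X = N #> w" using l_ex[OF X] by blast
    ultimately obtain v where "v \<in> ?W (l X)" "inv\<^bsub>?Q\<^esub> X = N #> v" by blast
    then show ?thesis using l_le by metis
  qed
  have l_conj: "l (N #> (x \<otimes> b \<otimes> inv x)) \<le> l (N #> b)" if x: "x \<in> carrier G" and b: "b \<in> B" for x b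
  proof -
    obtain w where w: "w \<in> ?W (l (N #> b))" "N #> b = N #> w" using l_ex[OF \<pi>[OF b]] by blast
    have wB: "w \<in> B" by (rule WB[OF w(1)])
    have "b \<in> N #> w" using rcos_self[OF Bc[OF b] N.subgroup_axioms] w(2) by simp
    then obtain m where m: "m \<in> N" "b = m \<otimes> w" unfolding r_coset_def by blast
    have mc: "m \<in> carrier G" using m(1) N.subset by blast
    have mN: "x \<otimes> m \<otimes> inv x \<in> N" by (rule N.inv_op_closed2[OF x m(1)])
    have mB: "x \<otimes> m \<otimes> inv x \<in> B" using mN NB by blast
    have wx: "x \<otimes> w \<otimes> inv x \<in> ?W (l (N #> b))" by (rule set_powers_conj[OF Cc Cconj x w(1)])
    have "x \<otimes> b \<otimes> inv x = (x \<otimes> m \<otimes> inv x) \<otimes> (x \<otimes> w \<otimes> inv x)"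
      using x mc Bc[OF wB] by (simp add: m(2) word_simps)
    then have "N #> (x \<otimes> b \<otimes> inv x) = (N #> (x \<otimes> m \<otimes> inv x)) \<otimes>\<^bsub>?Q\<^esub> (N #> (x \<otimes> w \<otimes> inv x))"
      using mult[OF mB WB[OF wx]] by simp
    also have "N #> (x \<otimes> m \<otimes> inv x) = \<one>\<^bsub>?Q\<^esub>" using one[OF mB] mN by blast
    finally have "N #> (x \<otimes> b \<otimes> inv x) = N #> (x \<otimes> w \<otimes> inv x)"
      using Q.l_one[OF \<pi>[OF WB[OF wx]]] by simp
    then show ?thesis using l_le[OF wx] by simp
  qed
  have slin: "Q.sublinear (Q.growth l)" by (rule Q.sublinear_growth[OF l_mult l_one])
  define p where "p b = Q.growth l (N #> b)" for b
  have p_nonneg: "0 \<le> p b" for b unfolding p_def by (rule Q.growth_nonneg)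
  have p_pow: "p (b [^] n) = real n * p b" if b: "b \<in> B" for b and n :: nat
    using Q.sublinearD(2)[OF slin \<pi>[OF b], of n] pow[OF b, of n] by (simp add: p_def)
  have p_N: "p n = 0" if n: "n \<in> N" for n
  proof -
    have "N #> n = \<one>\<^bsub>?Q\<^esub>" using one[of n] n NB by blast
    then show ?thesis using Q.sublinear_one[OF slin] by (simp only: p_def)
  qed
  have p_inv: "p (inv b) = p b" if b: "b \<in> B" for b
  proof -
    have le: "p (inv a) \<le> p a" if a: "a \<in> B" for a
      unfolding p_def
    proof (rule Q.growth_greatest)
      fix n :: nat assume n: "n > 0"
      have aQ: "N #> a \<in> carrier ?Q" by (rule \<pi>[OF a])
      have "Q.growth l (N #> inv a) \<le> real (l ((N #> inv a) [^]\<^bsub>?Q\<^esub> n)) / real n"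
        by (rule Q.growth_le[OF n])
      also have "(N #> inv a) [^]\<^bsub>?Q\<^esub> n = inv\<^bsub>?Q\<^esub> ((N #> a) [^]\<^bsub>?Q\<^esub> n)"
        unfolding inv[OF a, symmetric] by (rule Q.nat_pow_inv[OF aQ])
      also have "real (l (inv\<^bsub>?Q\<^esub> ((N #> a) [^]\<^bsub>?Q\<^esub> n))) / real n \<le> real (l ((N #> a) [^]\<^bsub>?Q\<^esub> n)) / real n"
        by (intro divide_right_mono of_nat_mono l_inv Q.nat_pow_closed aQ) simp
      finally show "Q.growth l (N #> inv a) \<le> real (l ((N #> a) [^]\<^bsub>?Q\<^esub> n)) / real n" .
    qed
    show ?thesis using le[OF b] le[of "inv b"] b Bc[OF b] by simp
  qed
  have "pseudonorm G B p"
    unfolding pseudonorm_def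
  proof (intro conjI ballI p_nonneg p_inv)
    show "p \<one> = 0" by (rule p_N[OF N.one_closed])
    show "p (x \<otimes> y) \<le> p x + p y" if "x \<in> B" "y \<in> B" for x y
      using Q.sublinearD(1)[OF slin \<pi>[OF that(1)] \<pi>[OF that(2)]] unfolding mult[OF that] p_def .
  qed
  moreover have "conj_invariant G B p"
  proof -
    have le: "p (x \<otimes> b \<otimes> inv x) \<le> p b" if x: "x \<in> carrier G" and b: "b \<in> B" for x b
      unfolding p_def
    proof (rule Q.growth_greatest)
      fix n :: nat assume n: "n > 0"
      have xb: "x \<otimes> b \<otimes> inv x \<in> B" by (rule B.inv_op_closed2[OF x b])
      have bn: "b [^] n \<in> B" using norm_pow_le[OF qn(1) B.subgroup_axioms b] by blast
      have "Q.growth l (N #> (x \<otimes> b \<otimes> inv x)) \<le> real (l ((N #> (x \<otimes> b \<otimes> inv x)) [^]\<^bsub>?Q\<^esub> n)) / real n"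
        by (rule Q.growth_le[OF n])
      also have "(N #> (x \<otimes> b \<otimes> inv x)) [^]\<^bsub>?Q\<^esub> n = N #> (x \<otimes> b [^] n \<otimes> inv x)"
        unfolding pow[OF xb] conj_pow[OF x Bc[OF b]] ..
      also have "real (l (N #> (x \<otimes> b [^] n \<otimes> inv x))) / real n \<le> real (l (N #> (b [^] n))) / real n"
        by (intro divide_right_mono of_nat_mono l_conj x bn) simp
      finally show "Q.growth l (N #> (x \<otimes> b \<otimes> inv x)) \<le> real (l ((N #> b) [^]\<^bsub>?Q\<^esub> n)) / real n"
        unfolding pow[OF b] .
    qed
    show ?thesis
      unfolding conj_invariant_def
    proof (intro ballI antisym le)
      fix x b assume x: "x \<in> carrier G" and b: "b \<in> B"
      have "inv x \<otimes> (x \<otimes> b \<otimes> inv x) \<otimes> inv (inv x) = b" using x Bc[OF b] by (simp add: word_simps)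
      then show "p b \<le> p (x \<otimes> b \<otimes> inv x)"
        using le[of "inv x" "x \<otimes> b \<otimes> inv x"] x B.inv_op_closed2[OF x b] by simp
    qed
  qed
  moreover have "small_near_one G T B p"
    unfolding small_near_one_def
  proof (intro allI impI)
    fix e :: real assume "e > 0"
    then obtain k where k: "1 / real (Suc k) < e" using nat_approx_posE by blast
    have pos: "1 / (2 * real (Suc k)) > 0" by simp
    obtain U where U: "openin T U" "\<one> \<in> U" "\<forall>x\<in>U \<inter> B. q x < 1 / (2 * real (Suc k))"
      using qn(3) pos unfolding small_near_one_def by blast
    have "p b < e" if b: "b \<in> U \<inter> B" for b
    proof -
      have bB: "b \<in> B" using b by blast
      have bk: "b [^] Suc k \<in> B" "q (b [^] Suc k) \<le> real (Suc k) * q b"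
        using norm_pow_le[OF qn(1) B.subgroup_axioms bB, of "Suc k"] by blast+
      have "q b < 1 / (2 * real (Suc k))" using U(3) b by blast
      then have "real (Suc k) * q b \<le> real (Suc k) * (1 / (2 * real (Suc k)))"
        by (intro mult_left_mono) auto
      then have "q (b [^] Suc k) \<le> 1 / 2" using bk(2) by (simp del: of_nat_Suc)
      then have bC: "b [^] Suc k \<in> C" using bk(1) unfolding C(1) by blast
      have "b [^] Suc k = \<one> \<otimes> b [^] Suc k" using Bc[OF bk(1)] by (simp del: nat_pow_Suc)
      then have "b [^] Suc k \<in> ?W (Suc 0)"
        unfolding set_powers_Suc using bC by (intro bexI[of _ \<one>] bexI[of _ "b [^] Suc k"]) simp_all
      then have "l (N #> (b [^] Suc k)) \<le> Suc 0" by (rule l_le)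
      then have "real (l (N #> (b [^] Suc k))) / real (Suc k) \<le> 1 / real (Suc k)"
        by (intro divide_right_mono) auto
      then have "p b \<le> 1 / real (Suc k)"
        using Q.growth_le[of "Suc k" l "N #> b"] unfolding pow[OF bB] p_def by linarith
      then show ?thesis using k by linarith
    qed
    then show "\<exists>U. openin T U \<and> \<one> \<in> U \<and> (\<forall>x\<in>U \<inter> B. p x < e)" using U(1,2) by blast
  qed
  ultimately have p: "p \<in> norms G T B" by (simp add: norms_def)
  have p_zero: "p b = 0" if b: "b \<in> B" for b
  proof -
    define M where "M = {b \<in> B. p b = 0}"
    have M: "M \<lhd> G" "closedin T M"
      unfolding M_def by (rule norm_kernel_normal[OF B(1) p], rule norm_kernel_closed[OF B p])
    have NM: "N \<subseteq> M" using p_N NB unfolding M_def by blast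
    have MB: "M \<subseteq> B" unfolding M_def by blast
    interpret M: abelian_section G T M B
    proof (intro abelian_section.intro topological_group_axioms abelian_section_axioms.intro
        balanced hTG M B MB precompact)
      show "a \<otimes> b \<otimes> inv a \<otimes> inv b \<in> M" if "a \<in> B" "b \<in> B" for a b
        using commutator[OF that] NM by blast
    qed
    have "totally_bounded_norm G B p"
    proof (rule M.norm_totally_bounded_if_kernel[OF _ p])
      fix a assume a: "a \<in> B" and zero: "\<And>r. r \<in> M.tb_norms \<Longrightarrow> r a = 0"
      show "a \<in> M"
      proof (rule ccontr)
        assume "a \<notin> M"
        then have pa: "p a > 0" using a p_nonneg[of a] unfolding M_def by simp
        obtain f where f: "\<And>X Y. X \<in> carrier ?Q \<Longrightarrow> Y \<in> carrier ?Q \<Longrightarrow> f (X \<otimes>\<^bsub>?Q\<^esub> Y) = f X + f Y"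
          "\<And>X. X \<in> carrier ?Q \<Longrightarrow> f X \<le> Q.growth l X" "f (N #> a) = Q.growth l (N #> a)"
          by (rule Q.Hahn_Banach[OF slin \<pi>[OF a]]) blast
        define h where "h b = f (N #> b)" for b
        have h_add: "h (x \<otimes> y) = h x + h y" if "x \<in> B" "y \<in> B" for x y
          using f(1)[OF \<pi>[OF that(1)] \<pi>[OF that(2)]] unfolding mult[OF that] h_def .
        have h_le: "h x \<le> p x" if "x \<in> B" for x
          using f(2)[OF \<pi>[OF that]] by (simp add: h_def p_def)
        have h_one: "h \<one> = 0" using h_add[OF B.one_closed B.one_closed] by simp
        have h_abs: "\<bar>h x\<bar> \<le> p x" if x: "x \<in> B" for x
        proof -
          have "h (inv x) + h x = 0" using h_add[of "inv x" x] x h_one by simp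
          then show ?thesis using h_le[OF x] h_le[of "inv x"] p_inv[OF x] x by simp
        qed
        have h_a: "h a = p a" using f(3) by (simp add: h_def p_def)
        \<comment> \<open>Scaled so that \<open>a\<close> is sent to \<open>cis pi = -1\<close>.\<close>
        define \<psi> where "\<psi> b = cis (pi * h b / p a)" for b
        have "\<psi> a = 1"
        proof (rule M.unimodular_separates[where \<psi> = \<psi> and b = a])
          show "\<psi> (x \<otimes> y) = \<psi> x * \<psi> y" if "x \<in> B" "y \<in> B" for x y
            unfolding \<psi>_def by (simp add: h_add[OF that] cis_mult distrib_left add_divide_distrib)
          show "norm (\<psi> x) = 1" for x by (simp add: \<psi>_def)
          show "\<psi> n = 1" if n: "n \<in> M" for n
          proof -
            have "\<bar>h n\<bar> \<le> 0" using h_abs[of n] n unfolding M_def by simp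
            then show ?thesis by (simp add: \<psi>_def)
          qed
          show "small_near_one G T B (\<lambda>x. norm (\<psi> x - 1))"
            unfolding small_near_one_def
          proof (intro allI impI)
            fix e :: real assume "e > 0"
            then obtain d where d: "d > 0" "\<forall>t. \<bar>t\<bar> < d \<longrightarrow> norm (cis t - 1) < e"
              using cis_near_one by blast
            have "d * p a / pi > 0" using d(1) pa by simp
            then obtain U where U: "openin T U" "\<one> \<in> U" "\<forall>x\<in>U \<inter> B. p x < d * p a / pi"
              using normsD(3)[OF p] unfolding small_near_one_def by blast
            have "norm (\<psi> x - 1) < e" if x: "x \<in> U \<inter> B" for x
            proof -
              have "\<bar>h x\<bar> < d * p a / pi" using U(3) x h_abs[of x] by force
              then have "\<bar>pi * h x / p a\<bar> < d" using pa by (simp add: abs_mult field_simps)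
              then show ?thesis unfolding \<psi>_def using d(2) by blast
            qed
            then show "\<exists>U. openin T U \<and> \<one> \<in> U \<and> (\<forall>x\<in>U \<inter> B. norm (\<psi> x - 1) < e)"
              using U(1,2) by blast
          qed
          show "a \<in> B" by (rule a)
          show "r a = 0" if "r \<in> M.tb_norms" for r by (rule zero[OF that])
        qed
        moreover have "\<psi> a = -1" using pa by (simp add: \<psi>_def h_a)
        ultimately show False by simp
      qed
    qed (simp add: M_def)
    then obtain F where F: "finite F" "F \<subseteq> B" "\<And>b. b \<in> B \<Longrightarrow> \<exists>f\<in>F. p (inv f \<otimes> b) < 1"
      by (rule totally_bounded_net[of _ _ _ 1]) auto
    have bound: "p x \<le> (\<Sum>f\<in>F. p f) + 1" if x: "x \<in> B" for x
    proof -
      obtain f where f: "f \<in> F" "p (inv f \<otimes> x) < 1" using F(3)[OF x] by blast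
      have "p x \<le> p f + p (inv f \<otimes> x)"
        using f(1) F(2) x by (intro norm_le_dist[OF normsD(1)[OF p] B.subgroup_axioms]) auto
      moreover have "p f \<le> (\<Sum>f\<in>F. p f)" using F(1) f(1) p_nonneg by (intro member_le_sum) auto
      ultimately show ?thesis using f(2) by linarith
    qed
    show "p b = 0"
    proof (rule ccontr)
      assume "p b \<noteq> 0"
      then have "p b > 0" using p_nonneg[of b] by simp
      then obtain n :: nat where n: "(\<Sum>f\<in>F. p f) + 1 < real n * p b"
        using reals_Archimedean3 by blast
      have "b [^] n \<in> B" using norm_pow_le[OF qn(1) B.subgroup_axioms b] by blast
      then show False using bound[of "b [^] n"] p_pow[OF b, of n] n by simp
    qed
  qed
  obtain U where U: "openin T U" "\<one> \<in> U" "\<forall>x\<in>U \<inter> B. q x < 1/2"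
    using qn(3) unfolding small_near_one_def by (meson half_gt_zero_iff zero_less_one)
  obtain F where F: "finite F" "F \<subseteq> ?W 2" "\<And>x. x \<in> ?W 2 \<Longrightarrow> \<exists>f\<in>F. inv f \<otimes> x \<in> U"
    by (rule compactin_net[OF compactin_set_powers[OF C(2)] U(1,2)]) (rule that)
  have FB: "f \<in> B" if "f \<in> F" for f using that F(2) WB by blast
  let ?F = "(\<lambda>f. N #> f) ` F"
  have "finite ?F" "?F \<subseteq> carrier ?Q" using F(1) FB \<pi> by auto
  moreover have "Q.growth l X = 0" if "X \<in> ?F" for X
    using that p_zero FB unfolding p_def by blast
  ultimately obtain M :: real where M: "\<forall>xs. set xs \<subseteq> ?F \<longrightarrow> real (l (Q.list_prod xs)) \<le> real (length xs) / 2 + M"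
    using Q.slow_growth_products[OF l_mult l_one, of ?F] by blast
  have factor: "\<exists>xs c. set xs \<subseteq> ?F \<and> length xs = n \<and> c \<in> C \<and> N #> w = Q.list_prod xs \<otimes>\<^bsub>?Q\<^esub> (N #> c)"
    if "w \<in> ?W (Suc n)" for w n
    using that
  proof (induction n arbitrary: w)
    case 0
    then obtain c where c: "c \<in> C" "w = \<one> \<otimes> c" unfolding set_powers_Suc by auto
    have "w = c" using c Cc by auto
    then show ?case using c(1) Q.l_one[OF \<pi>] CB by (intro exI[of _ "[]"] exI[of _ c]) (auto simp del: one_FactGroup mult_FactGroup)
  next
    case (Suc n)
    then obtain w' c' where w: "w' \<in> ?W (Suc n)" "c' \<in> C" "w = w' \<otimes> c'" unfolding set_powers_Suc[of w] by blast
    obtain xs c where xs: "set xs \<subseteq> ?F" "length xs = n" "c \<in> C" "N #> w' = Q.list_prod xs \<otimes>\<^bsub>?Q\<^esub> (N #> c)"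
      using Suc.IH[OF w(1)] by blast
    have cB: "c \<in> B" "c' \<in> B" using xs(3) w(2) CB by auto
    have "c \<otimes> c' \<in> ?W 2"
    proof -
      have "\<one> \<otimes> c \<in> ?W 1" using xs(3) by (auto simp: set_powers_Suc)
      then have "c \<in> ?W 1" using Bc[OF cB(1)] by simp
      then have "c \<otimes> c' \<in> ?W (Suc 1)" unfolding set_powers_Suc using w(2) by blast
      then show ?thesis by (simp only: numeral_2_eq_2 One_nat_def)
    qed
    then obtain f where f: "f \<in> F" "inv f \<otimes> (c \<otimes> c') \<in> U" using F(3) by blast
    define d where "d = inv f \<otimes> (c \<otimes> c')"
    have dB: "d \<in> B" using FB[OF f(1)] cB by (simp add: d_def)
    have dC: "d \<in> C" using U(3) f(2) dB unfolding C(1) d_def by (simp add: less_imp_le)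
    have fd: "c \<otimes> c' = f \<otimes> d"
      using Bc[OF FB[OF f(1)]] Bc[OF cB(1)] Bc[OF cB(2)] by (simp add: d_def inv_mult_cancel_left)
    have xsc: "Q.list_prod xs \<in> carrier ?Q" using xs(1) FB \<pi> by (intro Q.list_prod_closed) auto
    note el = xsc \<pi>[OF cB(1)] \<pi>[OF cB(2)] \<pi>[OF FB[OF f(1)]] \<pi>[OF dB]
    have "N #> w = (N #> w') \<otimes>\<^bsub>?Q\<^esub> (N #> c')" using mult[OF WB[OF w(1)] cB(2)] w(3) by simp
    also have "\<dots> = Q.list_prod xs \<otimes>\<^bsub>?Q\<^esub> ((N #> c) \<otimes>\<^bsub>?Q\<^esub> (N #> c'))"
      unfolding xs(4) by (rule Q.m_assoc[OF el(1-3)])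
    also have "(N #> c) \<otimes>\<^bsub>?Q\<^esub> (N #> c') = (N #> f) \<otimes>\<^bsub>?Q\<^esub> (N #> d)"
      unfolding mult[OF cB] mult[OF FB[OF f(1)] dB] fd ..
    also have "Q.list_prod xs \<otimes>\<^bsub>?Q\<^esub> ((N #> f) \<otimes>\<^bsub>?Q\<^esub> (N #> d)) = ((N #> f) \<otimes>\<^bsub>?Q\<^esub> Q.list_prod xs) \<otimes>\<^bsub>?Q\<^esub> (N #> d)"
      using el by (simp only: Q.m_assoc[symmetric] Q.m_comm[of "Q.list_prod xs" "N #> f"] Q.m_closed)
    finally have "N #> w = Q.list_prod ((N #> f) # xs) \<otimes>\<^bsub>?Q\<^esub> (N #> d)"
      by (simp only: Q.list_prod_simps)
    then show ?case using xs(1,2) f(1) dC by (intro exI[of _ "(N #> f) # xs"] exI[of _ d]) auto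
  qed
  have slow: "real (l (N #> w)) \<le> real n / 2 + M + 1" if w: "w \<in> ?W (Suc n)" for w n
  proof -
    obtain xs c where xs: "set xs \<subseteq> ?F" "length xs = n" "c \<in> C" "N #> w = Q.list_prod xs \<otimes>\<^bsub>?Q\<^esub> (N #> c)"
      using factor[OF w] by blast
    have "\<one> \<otimes> c = c" using xs(3) Cc by auto
    moreover have "\<one> \<otimes> c \<in> ?W 1" using xs(3) by (auto simp: set_powers_Suc)
    ultimately have "l (N #> c) \<le> 1" using l_le[of c 1] by (simp only:)
    moreover have "l (N #> w) \<le> l (Q.list_prod xs) + l (N #> c)"
      unfolding xs(4) using xs(1,3) FB \<pi> CB by (intro l_mult Q.list_prod_closed) auto
    ultimately have "real (l (N #> w)) \<le> real (l (Q.list_prod xs)) + 1" by linarith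
    then show ?thesis using M[rule_format, OF xs(1)] xs(2) by simp
  qed
  \<comment> \<open>For \<open>n \<ge> n0\<close> the bound \<open>n/2 + M + 1\<close> is at most \<open>n\<close>.\<close>
  obtain n0 :: nat where n0: "2 * M + 2 \<le> real n0" using real_arch_simple by blast
  have bounded: "l (N #> w) \<le> n0" if "w \<in> ?W k" for w k
    using that
  proof (induction k arbitrary: w rule: less_induct)
    case (less k)
    show ?case
    proof (cases "k \<le> n0")
      case True
      then show ?thesis using l_le[OF less.prems] by simp
    next
      case False
      then obtain n where k: "k = Suc n" "n0 \<le> n" by (metis not_less_eq_eq old.nat.exhaust zero_le)
      have "real (l (N #> w)) \<le> real n / 2 + M + 1" using less.prems unfolding k(1) by (rule slow)
      also have "\<dots> \<le> real n" using n0 k(2) by (simp add: field_simps)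
      finally have "l (N #> w) < k" using k(1) by simp
      moreover obtain w' where "w' \<in> ?W (l (N #> w))" "N #> w = N #> w'"
        using l_ex[OF \<pi>[OF WB[OF less.prems]]] by blast
      ultimately show ?thesis using less.IH by metis
    qed
  qed
  have "B \<subseteq> ?W n0 <#> N"
  proof
    fix b assume b: "b \<in> B"
    obtain w where w: "w \<in> ?W (l (N #> b))" "N #> b = N #> w" using l_ex[OF \<pi>[OF b]] by blast
    have wB: "w \<in> B" by (rule WB[OF w(1)])
    have "l (N #> b) \<le> n0" unfolding w(2) by (rule bounded[OF w(1)])
    then have w0: "w \<in> ?W n0" using w(1) set_powers_mono[OF Cc C1] by blast
    have "b \<in> N #> w" using rcos_self[OF Bc[OF b] N.subgroup_axioms] w(2) by simp
    then have "b \<in> w <# N" using N.coset_eq Bc[OF wB] by blast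
    then show "b \<in> ?W n0 <#> N" using w0 unfolding l_coset_def set_mult_def by blast
  qed
  moreover have "?W n0 <#> N \<subseteq> B" using WB NB unfolding set_mult_def by auto
  ultimately have "?W n0 <#> N = B" by blast
  then show ?thesis
    using precompact precompact_modulo_compact_extension[OF _ compactin_set_powers[OF C(2)] N(1)] by metis
qed

text \<open>The subgroup \<open>H\<close> generated by \<open>N\<close> and a compact invariant neighbourhood of the unit in \<open>B\<close> is open in \<open>B\<close>, so that \<open>precompact_open_subgroup\<close> leads from \<open>B\<close> to \<open>H\<close> and \<open>precompact_if_compactly_generated\<close> from \<open>H\<close> to \<open>N\<close>.\<close>

lemma (in abelian_section) precompact_if_locally_compact:
  assumes lc: "locally_compact_space T"
  shows "precompact_modulo G T N"
proof -
  obtain q where q: "q \<in> norms G T (carrier G)" "compactin T {x \<in> carrier G. q x \<le> 1/2}"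
    by (rule locally_compact_norm[OF balanced lc])
  note Bc = B.subset[THEN subsetD]
  have qB: "q \<in> norms G T B" by (rule norms_subset[OF q(1) B.subset])
  note qn = normsD[OF qB]
  define C where "C = {b \<in> B. q b \<le> 1/2}"
  have CB: "C \<subseteq> B" by (auto simp: C_def)
  have Cc: "C \<subseteq> carrier G" using CB B.subset by blast
  have comp: "compactin T C"
    unfolding C_def
    by (rule closed_compactin[OF q(2) _ closedin_norm_le[OF B qB]]) (use B.subset in blast)
  have Cconj: "x \<otimes> c \<otimes> inv x \<in> C" if "x \<in> carrier G" "c \<in> C" for x c
    using that conj_invariantD[OF qn(2), of x c] B.inv_op_closed2[of x c] by (simp add: C_def)
  let ?W = "set_powers G C"
  have WB: "w \<in> B" if "w \<in> ?W n" for w n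
    using that set_powers_subset[OF B.subgroup_axioms CB] by blast
  define H where "H = (\<Union>n. ?W n) <#> N"
  have H_iff: "h \<in> H \<longleftrightarrow> (\<exists>n. \<exists>w\<in>?W n. \<exists>m\<in>N. h = w \<otimes> m)" for h
    unfolding H_def set_mult_def by blast
  have HB: "H \<subseteq> B" unfolding subset_iff H_iff using WB NB by blast
  have mult: "g \<otimes> h \<in> H" if gh: "g \<in> H" "h \<in> H" for g h
  proof -
    obtain n w m n' w' m' where w: "w \<in> ?W n" "m \<in> N" "g = w \<otimes> m"
      and w': "w' \<in> ?W n'" "m' \<in> N" "h = w' \<otimes> m'" using gh unfolding H_iff by blast
    have cl: "w \<in> carrier G" "w' \<in> carrier G" "m \<in> carrier G" "m' \<in> carrier G"
      using Bc WB w(1) w'(1) w(2) w'(2) N.subset by blast+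
    have "g \<otimes> h = (w \<otimes> w') \<otimes> ((inv w' \<otimes> m \<otimes> w') \<otimes> m')"
      unfolding w(3) w'(3) using cl by (simp add: word_simps)
    moreover have "(inv w' \<otimes> m \<otimes> w') \<otimes> m' \<in> N"
      using N.inv_op_closed1[OF cl(2) w(2)] w'(2) by blast
    ultimately show ?thesis unfolding H_iff using set_powers_mult[OF Cc w(1) w'(1)] by blast
  qed
  have W0: "\<one> \<in> ?W 0" by simp
  have NH: "N \<subseteq> H"
  proof
    fix m assume m: "m \<in> N"
    then have "m = \<one> \<otimes> m" using N.subset by auto
    then show "m \<in> H" unfolding H_iff using W0 m by blast
  qed
  have CH: "C \<subseteq> H"
  proof
    fix c assume c: "c \<in> C"
    then have cc: "c \<in> carrier G" using Cc by blast
    have "\<one> \<otimes> c \<in> ?W (Suc 0)" unfolding set_powers_Suc using c W0 by blast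
    moreover have "c = (\<one> \<otimes> c) \<otimes> \<one>" using cc by simp
    ultimately show "c \<in> H" unfolding H_iff using N.one_closed by blast
  qed
  have "inv w \<in> H" if "w \<in> ?W n" for w n
    using that
  proof (induction n arbitrary: w)
    case 0
    then show ?case using NH N.one_closed by auto
  next
    case (Suc n)
    then obtain v c where v: "v \<in> ?W n" "c \<in> C" "w = v \<otimes> c" unfolding set_powers_Suc by blast
    have cl: "v \<in> carrier G" "c \<in> carrier G" using Bc[OF WB[OF v(1)]] v(2) Cc by auto
    have "inv c \<in> C" using v(2) pseudonormD(3)[OF qn(1), of c] by (simp add: C_def)
    then have "inv c \<otimes> inv v \<in> H" using mult CH Suc.IH[OF v(1)] by blast
    then show ?case unfolding v(3) using cl by (simp add: inv_mult_group)
  qed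
  then have inv: "inv h \<in> H" if h: "h \<in> H" for h
  proof -
    obtain n w m where w: "w \<in> ?W n" "m \<in> N" "h = w \<otimes> m" using h unfolding H_iff by blast
    have "w \<in> carrier G" "m \<in> carrier G" using Bc WB w(1) w(2) N.subset by blast+
    then have "inv h = inv m \<otimes> inv w" unfolding w(3) by (simp add: inv_mult_group)
    then show ?thesis using mult[of "inv m" "inv w"] \<open>\<And>w n. w \<in> ?W n \<Longrightarrow> inv w \<in> H\<close>[OF w(1)] NH w(2) by auto
  qed
  have H: "H \<lhd> G"
    unfolding normal_inv_iff
  proof (intro conjI ballI)
    show "subgroup H G"
    proof
      show "H \<subseteq> carrier G" using HB B.subset by blast
      show "\<one> \<in> H" using NH N.one_closed by blast
    qed (use mult inv in auto)
    fix x h assume x: "x \<in> carrier G" and "h \<in> H"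
    then obtain n w m where w: "w \<in> ?W n" "m \<in> N" "h = w \<otimes> m" unfolding H_iff by blast
    have "w \<in> carrier G" "m \<in> carrier G" using Bc WB w(1) w(2) N.subset by blast+
    then have "x \<otimes> h \<otimes> inv x = (x \<otimes> w \<otimes> inv x) \<otimes> (x \<otimes> m \<otimes> inv x)"
      unfolding w(3) using x by (simp add: word_simps)
    then show "x \<otimes> h \<otimes> inv x \<in> H"
      unfolding H_iff using set_powers_conj[OF Cc Cconj x w(1)] N.inv_op_closed2[OF x w(2)] by blast
  qed
  interpret H: normal H G by (rule H)
  have open_H: "b \<in> H" if "b \<in> B" "q b < 1/2" for b using that CH by (auto simp: C_def)
  have H_closed: "closedin T H"
  proof -
    have "T closure_of H \<subseteq> H"
    proof
      fix x assume x: "x \<in> T closure_of H"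
      have xB: "x \<in> B" using x closure_of_minimal[OF HB B(2)] by blast
      have half: "(1/2::real) > 0" by simp
      obtain U where U: "openin T U" "\<one> \<in> U" "\<forall>x\<in>U \<inter> B. q x < 1/2"
        using qn(3) half unfolding small_near_one_def by blast
      obtain h where h: "h \<in> H" "inv h \<otimes> x \<in> U" by (rule closure_near[OF x H.subset U(1,2)])
      have hB: "h \<in> B" using h(1) HB by blast
      have "inv h \<otimes> x \<in> B" using hB xB by simp
      then have "inv h \<otimes> x \<in> H" using open_H U(3) h(2) by blast
      then have "h \<otimes> (inv h \<otimes> x) \<in> H" by (rule H.m_closed[OF h(1)])
      then show "x \<in> H" using Bc[OF hB] Bc[OF xB] by (simp add: inv_mult_cancel_left)
    qed
    moreover have "H \<subseteq> topspace T" using H.subset topspace_eq by simp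
    ultimately show ?thesis using closure_of_subset_eq by blast
  qed
  have pcH: "precompact_modulo G T H"
    by (rule precompact_open_subgroup[OF H H_closed NH HB qB, of "1/2"]) (simp, rule open_H)
  interpret NH: abelian_section G T N H
  proof (intro abelian_section.intro topological_group_axioms abelian_section_axioms.intro
      balanced hTG N H H_closed NH pcH)
    show "a \<otimes> b \<otimes> inv a \<otimes> inv b \<in> N" if "a \<in> H" "b \<in> H" for a b
      using commutator that HB by blast
  qed
  have "C = {b \<in> H. q b \<le> 1/2}" using CH HB by (auto simp: C_def)
  then show ?thesis
    by (rule NH.precompact_if_compactly_generated[OF norms_subset[OF q(1) H.subset] _ comp]) (rule H_def)
qed

section \<open>Quotient topological groups\<close>

text \<open>The saturation of an open set is the union of its translates by \<open>N\<close>.\<close>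

lemma (in topological_group) openin_cosets:
  assumes N: "N \<lhd> G" and U: "openin T U"
  shows "openin (quotient_topology T (\<lambda>x. N #> x)) ((\<lambda>x. N #> x) ` U)"
proof -
  interpret N: normal N G by fact
  have Uc: "U \<subseteq> carrier G" by (rule openin_carrier[OF U])
  have eq: "{x \<in> topspace T. N #> x \<in> (\<lambda>x. N #> x) ` U} = (\<Union>n\<in>N. {x \<in> topspace T. inv n \<otimes> x \<in> U})"
  proof (intro equalityI subsetI)
    fix x assume "x \<in> {x \<in> topspace T. N #> x \<in> (\<lambda>x. N #> x) ` U}"
    then obtain u where x: "x \<in> carrier G" and u: "u \<in> U" "N #> x = N #> u" by (auto simp: topspace_eq)
    have "x \<in> N #> u" using rcos_self[OF x N.subgroup_axioms] u(2) by simp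
    then obtain n where n: "n \<in> N" "x = n \<otimes> u" unfolding r_coset_def by blast
    have "inv n \<otimes> x = u" using n u(1) Uc N.subset by (auto simp: n(2) inv_mult_cancel_left)
    then show "x \<in> (\<Union>n\<in>N. {x \<in> topspace T. inv n \<otimes> x \<in> U})" using n(1) u(1) x topspace_eq by auto
  next
    fix x assume "x \<in> (\<Union>n\<in>N. {x \<in> topspace T. inv n \<otimes> x \<in> U})"
    then obtain n where n: "n \<in> N" "x \<in> carrier G" "inv n \<otimes> x \<in> U" by (auto simp: topspace_eq)
    have "N #> (inv n \<otimes> x) = (N #> inv n) #> x"
      using n N.subset by (intro coset_mult_assoc[symmetric]) auto
    also have "N #> inv n = N" using n(1) by (intro N.rcos_const) (auto simp: is_group)
    finally have "N #> x = N #> (inv n \<otimes> x)" by simp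
    then show "x \<in> {x \<in> topspace T. N #> x \<in> (\<lambda>x. N #> x) ` U}" using n topspace_eq by auto
  qed
  have "openin T {x \<in> topspace T. inv n \<otimes> x \<in> U}" if n: "n \<in> N" for n
  proof (rule openin_continuous_map_preimage[OF _ U])
    show "continuous_map T T (\<lambda>x. inv n \<otimes> x)"
      using n N.subset by (intro continuous_group_intros) auto
  qed
  then have "openin T {x \<in> topspace T. N #> x \<in> (\<lambda>x. N #> x) ` U}"
    unfolding eq by (intro openin_Union) blast
  then show ?thesis
    unfolding openin_quotient_topology using Uc topspace_eq by auto
qed

lemma (in topological_group) quotient_topological_group:
  assumes N: "N \<lhd> G" "closedin T N"
  shows "topological_group (G Mod N) (quotient_topology T (\<lambda>x. N #> x))"
proof -
  interpret N: normal N G by fact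
  interpret Q: group "G Mod N" by (rule N.factorgroup_is_group)
  let ?q = "\<lambda>x. N #> x" and ?TQ = "quotient_topology T (\<lambda>x. N #> x)"
  have top: "topspace ?TQ = carrier (G Mod N)"
    by (simp add: topspace_quotient_topology topspace_eq carrier_FactGroup)
  have car: "X \<in> topspace ?TQ \<longleftrightarrow> (\<exists>x\<in>carrier G. X = N #> x)" for X
    unfolding top by (auto simp: carrier_FactGroup)
  have mult: "(N #> x) \<otimes>\<^bsub>G Mod N\<^esub> (N #> y) = N #> (x \<otimes> y)" if "x \<in> carrier G" "y \<in> carrier G" for x y
    using N.rcos_sum[OF that] by simp
  have qcont: "continuous_map T ?TQ ?q"
    by (rule quotient_imp_continuous_map[OF quotient_map_quotient_topology])
  note open_q = openin_cosets[OF N(1)]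
  have pair: "\<exists>A B. openin T A \<and> openin T B \<and> x \<in> A \<and> y \<in> B \<and> A \<times> B \<subseteq> {p \<in> topspace (prod_topology T T). f p \<in> W}"
    if f: "continuous_map (prod_topology T T) Z f" "openin Z W" and x: "x \<in> carrier G" "y \<in> carrier G" "f (x, y) \<in> W"
    for x y W and Z :: "'c topology" and f
  proof -
    have "openin (prod_topology T T) {p \<in> topspace (prod_topology T T). f p \<in> W}"
      by (rule openin_continuous_map_preimage[OF f])
    moreover have "(x, y) \<in> {p \<in> topspace (prod_topology T T). f p \<in> W}" using x by (simp add: topspace_eq)
    ultimately show ?thesis by (rule openin_prod_topology_alt[THEN iffD1, rule_format])
  qed
  have "continuous_map (prod_topology ?TQ ?TQ) ?TQ (\<lambda>(X, Y). X \<otimes>\<^bsub>G Mod N\<^esub> Y)"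
    unfolding continuous_map_def
  proof (intro conjI allI impI)
    show "(\<lambda>(X, Y). X \<otimes>\<^bsub>G Mod N\<^esub> Y) \<in> topspace (prod_topology ?TQ ?TQ) \<rightarrow> topspace ?TQ"
      unfolding topspace_prod_topology top using Q.m_closed by (auto simp del: mult_FactGroup)
    fix W assume W: "openin ?TQ W"
    show "openin (prod_topology ?TQ ?TQ)
        {p \<in> topspace (prod_topology ?TQ ?TQ). (case p of (X, Y) \<Rightarrow> X \<otimes>\<^bsub>G Mod N\<^esub> Y) \<in> W}"
      unfolding openin_prod_topology_alt
    proof (intro allI impI)
      fix X Y assume XY: "(X, Y) \<in> {p \<in> topspace (prod_topology ?TQ ?TQ). (case p of (X, Y) \<Rightarrow> X \<otimes>\<^bsub>G Mod N\<^esub> Y) \<in> W}"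
      then have "X \<in> topspace ?TQ" "Y \<in> topspace ?TQ" "X \<otimes>\<^bsub>G Mod N\<^esub> Y \<in> W" by simp_all
      then obtain x y where x: "x \<in> carrier G" "X = N #> x" and y: "y \<in> carrier G" "Y = N #> y"
        and W': "N #> (x \<otimes> y) \<in> W"
        unfolding car using mult by metis
      have "continuous_map (prod_topology T T) ?TQ (?q \<circ> (\<lambda>(x, y). x \<otimes> y))"
        by (rule continuous_map_compose[OF continuous_mult qcont])
      from pair[OF this W x(1) y(1)] W' obtain A B where AB: "openin T A" "openin T B" "x \<in> A" "y \<in> B"
        "A \<times> B \<subseteq> {p \<in> topspace (prod_topology T T). (?q \<circ> (\<lambda>(x, y). x \<otimes> y)) p \<in> W}" by auto
      have "?q ` A \<times> ?q ` B \<subseteq> {p \<in> topspace (prod_topology ?TQ ?TQ). (case p of (X, Y) \<Rightarrow> X \<otimes>\<^bsub>G Mod N\<^esub> Y) \<in> W}"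
      proof clarify
        fix a b assume ab: "a \<in> A" "b \<in> B"
        have c: "a \<in> carrier G" "b \<in> carrier G" using ab openin_carrier[OF AB(1)] openin_carrier[OF AB(2)] by auto
        have "N #> (a \<otimes> b) \<in> W" using subsetD[OF AB(5), of "(a, b)"] ab by simp
        then show "(N #> a, N #> b) \<in> topspace (prod_topology ?TQ ?TQ) \<and> (N #> a) \<otimes>\<^bsub>G Mod N\<^esub> (N #> b) \<in> W"
          unfolding mult[OF c] topspace_prod_topology using car c by auto
      qed
      then show "\<exists>U V. openin ?TQ U \<and> openin ?TQ V \<and> X \<in> U \<and> Y \<in> V \<and> U \<times> V \<subseteq>
          {p \<in> topspace (prod_topology ?TQ ?TQ). (case p of (X, Y) \<Rightarrow> X \<otimes>\<^bsub>G Mod N\<^esub> Y) \<in> W}"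
        using open_q[OF AB(1)] open_q[OF AB(2)] AB(3,4) x(2) y(2)
        by (intro exI[of _ "?q ` A"] exI[of _ "?q ` B"] conjI) auto
    qed
  qed
  moreover have "continuous_map ?TQ ?TQ (\<lambda>X. inv\<^bsub>G Mod N\<^esub> X)"
    unfolding continuous_map_def
  proof (intro conjI allI impI)
    show "(\<lambda>X. inv\<^bsub>G Mod N\<^esub> X) \<in> topspace ?TQ \<rightarrow> topspace ?TQ" unfolding top by auto
    fix W assume W: "openin ?TQ W"
    have inv: "inv\<^bsub>G Mod N\<^esub> (N #> x) = N #> inv x" if "x \<in> carrier G" for x
      using that N.inv_FactGroup N.rcos_inv by (auto simp: carrier_FactGroup)
    have "{x \<in> topspace T. N #> x \<in> {X \<in> topspace ?TQ. inv\<^bsub>G Mod N\<^esub> X \<in> W}} = {x \<in> topspace T. (?q \<circ> (\<lambda>x. inv x)) x \<in> W}"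
      using inv car by (auto simp: topspace_eq)
    moreover have "openin T {x \<in> topspace T. (?q \<circ> (\<lambda>x. inv x)) x \<in> W}"
      by (rule openin_continuous_map_preimage[OF continuous_map_compose[OF continuous_inv qcont] W])
    ultimately show "openin ?TQ {X \<in> topspace ?TQ. inv\<^bsub>G Mod N\<^esub> X \<in> W}"
      unfolding openin_quotient_topology by (auto simp: topspace_quotient_topology)
  qed
  moreover have "Hausdorff_space ?TQ"
    unfolding Hausdorff_space_def
  proof (intro allI impI)
    fix X Y assume "X \<in> topspace ?TQ \<and> Y \<in> topspace ?TQ \<and> X \<noteq> Y"
    then obtain x y where x: "x \<in> carrier G" "X = N #> x" and y: "y \<in> carrier G" "Y = N #> y"
      and ne: "N #> x \<noteq> N #> y"
      unfolding car by blast
    have same: "N #> a = N #> b \<longleftrightarrow> a \<otimes> inv b \<in> N" if "a \<in> carrier G" "b \<in> carrier G" for a b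
      using N.rcos_module[OF is_group that(2,1)] rcos_self[OF that(1) N.subgroup_axioms]
        repr_independence[OF _ that(2) N.subgroup_axioms, of a] by auto
    have div: "continuous_map (prod_topology T T) T (\<lambda>p. fst p \<otimes> inv (snd p))"
      by (intro continuous_group_intros continuous_map_fst continuous_map_snd)
    have co: "openin T (topspace T - N)" using N(2) by blast
    have "fst (x, y) \<otimes> inv (snd (x, y)) \<in> topspace T - N"
      using same[OF x(1) y(1)] ne x y topspace_eq by simp
    from pair[OF div co x(1) y(1) this]
    obtain A B where AB: "openin T A" "openin T B" "x \<in> A" "y \<in> B"
      "A \<times> B \<subseteq> {p \<in> topspace (prod_topology T T). fst p \<otimes> inv (snd p) \<in> topspace T - N}"
      by (elim exE conjE)
    have "disjnt (?q ` A) (?q ` B)"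
      unfolding disjnt_iff
    proof (intro allI notI)
      fix Z assume "Z \<in> ?q ` A \<and> Z \<in> ?q ` B"
      then obtain a b where ab: "a \<in> A" "b \<in> B" "N #> a = N #> b" by auto
      have "a \<in> carrier G" "b \<in> carrier G" using ab openin_carrier[OF AB(1)] openin_carrier[OF AB(2)] by auto
      then have "a \<otimes> inv b \<in> N" using same ab(3) by blast
      then show False using subsetD[OF AB(5), of "(a, b)"] ab by simp
    qed
    then show "\<exists>U V. openin ?TQ U \<and> openin ?TQ V \<and> X \<in> U \<and> Y \<in> V \<and> disjnt U V"
      using open_q[OF AB(1)] open_q[OF AB(2)] AB(3,4) x(2) y(2) by blast
  qed
  ultimately show ?thesis using top by unfold_locales auto
qed

lemma (in topological_group) compact_quotient_MAP:
  assumes comp: "compact_space T" and N: "N \<lhd> G" "closedin T N"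
  shows "MAP_group (G Mod N) (quotient_topology T (\<lambda>x. N #> x))"
proof -
  let ?TQ = "quotient_topology T (\<lambda>x. N #> x)"
  have Q: "topological_group (G Mod N) ?TQ" by (rule quotient_topological_group[OF N])
  interpret Q: topological_group "G Mod N" ?TQ by (rule Q)
  have "compactin ?TQ ((\<lambda>x. N #> x) ` topspace T)"
    using comp quotient_imp_continuous_map[OF quotient_map_quotient_topology]
    by (intro image_compactin[of T]) (auto simp: compact_space_def)
  then have "compact_space ?TQ" by (simp add: compact_space_def topspace_quotient_topology)
  moreover have "(\<lambda>x. x) \<in> continuous_hom (G Mod N) ?TQ (G Mod N) ?TQ"
    by (auto simp: continuous_hom_def hom_def)
  ultimately show ?thesis
    by (intro MAP_group_any_type[OF Q.is_group Q.topspace_eq Q]) auto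
qed

section \<open>The closed derived series\<close>

context topological_group
begin

lemma closed_derived_series_normal: "closed_derived_series G T n \<lhd> G"
proof (induction n)
  case 0
  then show ?case by (simp add: normal_inv_iff subgroup_self)
next
  case (Suc n)
  then show ?case by (simp add: normal_closure_of derived_is_normal)
qed

lemma closed_derived_series_closed: "closedin T (closed_derived_series G T n)"
  by (cases n) (simp_all add: topspace_eq[symmetric] del: topspace_eq)

lemma closed_derived_series_Suc:
  "closed_derived_series G T (Suc n) \<subseteq> closed_derived_series G T n"
  unfolding closed_derived_series.simps
  using derived_incl[OF order_refl normal_imp_subgroup[OF closed_derived_series_normal]] closed_derived_series_closed
  by (rule closure_of_minimal)

lemma closed_derived_series_commutator:
  assumes "a \<in> closed_derived_series G T n" "b \<in> closed_derived_series G T n"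
  shows "a \<otimes> b \<otimes> inv a \<otimes> inv b \<in> closed_derived_series G T (Suc n)"
proof -
  have sub: "closed_derived_series G T n \<subseteq> carrier G"
    using subgroup.subset[OF normal_imp_subgroup[OF closed_derived_series_normal]] .
  have "a \<otimes> b \<otimes> inv a \<otimes> inv b \<in> derived G (closed_derived_series G T n)"
    unfolding derived_def using assms by (intro generate.incl) blast
  moreover have "derived G (closed_derived_series G T n) \<subseteq> topspace T"
    using derived_in_carrier[OF sub] topspace_eq by simp
  ultimately show ?thesis using closure_of_subset[of _ T] by auto
qed

text \<open>The closed derived series, read backwards; the identity embeds each of its compact quotients into a compact group.\<close>

lemma compact_imp_MAP_solvable:
  assumes comp: "compact_space T" and solv: "solvable_topological_group G T"
  shows "MAP_solvable G T"
proof -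
  obtain m where m: "closed_derived_series G T m = {\<one>}"
    using solv unfolding solvable_topological_group_def by blast
  let ?D = "closed_derived_series G T"
  show ?thesis
    unfolding MAP_solvable_def
  proof (intro exI[of _ m] exI[of _ "\<lambda>k. ?D (m - k)"] conjI allI impI)
    show "?D (m - 0) = {\<one>}" using m by simp
    show "?D (m - m) = carrier G" by simp
    show "?D (m - n) \<lhd> G" "closedin T (?D (m - n))" for n
      by (rule closed_derived_series_normal, rule closed_derived_series_closed)
    fix n assume "n < m"
    then have S: "m - n = Suc (m - Suc n)" by simp
    let ?A = "?D (m - Suc n)" and ?N = "?D (m - n)"
    have A: "?A \<lhd> G" "closedin T ?A" and N: "?N \<lhd> G" "closedin T ?N"
      by (rule closed_derived_series_normal closed_derived_series_closed)+
    note As = normal_imp_subgroup[OF A(1)]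
    show NA: "?N \<subseteq> ?A" unfolding S by (rule closed_derived_series_Suc)
    show "comm_group (G\<lparr>carrier := ?A\<rparr> Mod ?N)"
      unfolding subquotient_comm_group_iff[OF N(1) As NA]
      unfolding S by (intro ballI closed_derived_series_commutator)
    interpret A: topological_group "G\<lparr>carrier := ?A\<rparr>" "subtopology T ?A"
      by (rule topological_subgroup[OF As])
    have "compact_space (subtopology T ?A)"
      using closedin_compact_space[OF comp A(2)] by (rule compact_space_subtopology)
    moreover have "?N \<lhd> G\<lparr>carrier := ?A\<rparr>" by (rule normal_restrict_supergroup[OF As N(1) NA])
    moreover have "closedin (subtopology T ?A) ?N"
      using N(2) NA by (simp add: closedin_closed_subtopology A(2))
    ultimately have "MAP_group (G\<lparr>carrier := ?A\<rparr> Mod ?N)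
        (quotient_topology (subtopology T ?A) (\<lambda>x. ?N #>\<^bsub>G\<lparr>carrier := ?A\<rparr>\<^esub> x))"
      by (rule A.compact_quotient_MAP)
    then show "MAP_group (G\<lparr>carrier := ?A\<rparr> Mod ?N) (quotient_topology (subtopology T ?A) (\<lambda>x. ?N #> x))"
      by simp
  qed
qed

lemma precompact_modulo_carrier: "precompact_modulo G T (carrier G)"
  unfolding precompact_modulo_def
proof (intro ballI allI impI)
  fix q and e :: real assume q: "q \<in> norms G T (carrier G)" and e: "e > 0"
  have "\<exists>f\<in>{\<one>}. \<exists>n\<in>carrier G. q (inv f \<otimes> x \<otimes> n) < e" if "x \<in> carrier G" for x
    using that e pseudonormD(2)[OF normsD(1)[OF q]] by (auto intro!: bexI[of _ "inv x"])
  then show "\<exists>F. finite F \<and> F \<subseteq> carrier G \<and> (\<forall>x\<in>carrier G. \<exists>f\<in>F. \<exists>n\<in>carrier G. q (inv f \<otimes> x \<otimes> n) < e)"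
    by (intro exI[of _ "{\<one>}"]) auto
qed

lemma locally_compact_hTG_closed_imp_compact:
  assumes bal: "balanced_group G T" and h: "hTG_closed G T"
    and lc: "locally_compact_space T" and solv: "solvable_topological_group G T"
  shows "compact_space T"
proof -
  let ?D = "closed_derived_series G T"
  have "precompact_modulo G T (?D n)" for n
  proof (induction n)
    case 0
    then show ?case using precompact_modulo_carrier by simp
  next
    case (Suc n)
    have "abelian_section G T (?D (Suc n)) (?D n)"
      by (intro abelian_section.intro topological_group_axioms abelian_section_axioms.intro bal h
          closed_derived_series_normal closed_derived_series_closed closed_derived_series_Suc
          closed_derived_series_commutator Suc)
    then show ?case by (rule abelian_section.precompact_if_locally_compact[OF _ lc])
  qed
  moreover obtain m where "?D m = {\<one>}" using solv unfolding solvable_topological_group_def by blast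
  ultimately have "precompact_modulo G T {\<one>}" by metis
  then show ?thesis by (rule precompact_imp_compact[OF bal h])
qed

lemma MAP_solvable_hTG_closed_imp_compact:
  assumes bal: "balanced_group G T" and h: "hTG_closed G T" and MAP: "MAP_solvable G T"
  shows "compact_space T"
proof -
  obtain m and X :: "nat \<Rightarrow> 'a set" where X: "X 0 = {\<one>}" "X m = carrier G"
    "\<And>n. n \<le> m \<Longrightarrow> X n \<lhd> G" "\<And>n. n \<le> m \<Longrightarrow> closedin T (X n)"
    "\<And>n. n < m \<Longrightarrow> X n \<subseteq> X (Suc n)"
    "\<And>n. n < m \<Longrightarrow> comm_group (G\<lparr>carrier := X (Suc n)\<rparr> Mod X n)"
    "\<And>n. n < m \<Longrightarrow> MAP_group (G\<lparr>carrier := X (Suc n)\<rparr> Mod X n)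
        (quotient_topology (subtopology T (X (Suc n))) (\<lambda>x. X n #> x))"
    using MAP unfolding MAP_solvable_def by auto
  have "precompact_modulo G T (X n)" if "n \<le> m" for n
    using that
  proof (induction rule: inc_induct)
    case base
    then show ?case using precompact_modulo_carrier X(2) by simp
  next
    case (step n)
    have n: "n \<le> m" "Suc n \<le> m" using step.hyps by auto
    have "\<forall>a\<in>X (Suc n). \<forall>b\<in>X (Suc n). a \<otimes> b \<otimes> inv a \<otimes> inv b \<in> X n"
      using X(6)[OF step.hyps(2)]
      unfolding subquotient_comm_group_iff[OF X(3)[OF n(1)] normal_imp_subgroup[OF X(3)[OF n(2)]] X(5)[OF step.hyps(2)]] .
    then have "abelian_section G T (X n) (X (Suc n))"
      by (intro abelian_section.intro topological_group_axioms abelian_section_axioms.intro bal h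
          X(3,4) n X(5)[OF step.hyps(2)] step.IH) blast
    then show ?case by (rule abelian_section.precompact_if_MAP[OF _ X(7)[OF step.hyps(2)]])
  qed
  from this[of 0] have "precompact_modulo G T {\<one>}" by (simp add: X(1))
  then show ?thesis by (rule precompact_imp_compact[OF bal h])
qed

end

theorem theorem1p14:
  fixes G :: "('a, 'm) monoid_scheme" and T :: "'a topology"
  assumes "topological_group G T"
    and "solvable_topological_group G T"
  shows "(compact_space T \<longleftrightarrow>
            balanced_group G T \<and> locally_compact_space T \<and> hTG_closed G T) \<and>
         (compact_space T \<longleftrightarrow>
            balanced_group G T \<and> MAP_solvable G T \<and> hTG_closed G T)"
proof -
  interpret topological_group G T by fact
  have "balanced_group G T \<and> locally_compact_space T \<and> hTG_closed G T \<and> MAP_solvable G T"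
    if "compact_space T"
    using that compact_imp_balanced compact_imp_hTG_closed compact_imp_MAP_solvable[OF _ assms(2)]
      compact_imp_locally_compact_space by blast
  then show ?thesis
    using locally_compact_hTG_closed_imp_compact[OF _ _ _ assms(2)] MAP_solvable_hTG_closed_imp_compact
    by blast
qed

end
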